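(* There is a unique continuous, strictly increasing function $A:(-1,0]\to(0,\alpha_*]$ such that, for all $a>0$ and $b\in\mathbb{R}$, $$F_{a,b}\text{ is a Bernstein function}\iff -1<b\le 0\ \text{ and }\ 0<a\le A(b).$$ It satisfies $$A(0)=\alpha_*,\qquad \lim_{b\downarrow -1}A(b)=0,$$ and for $-1<b<0$, $$\alpha_*(1+b)<A(b)<\min\{\alpha_*,U(b)\}.$$ For fixed $b\in(-1,0]$, the density $D_{a,-b}(t)$ is strictly positive at every $t\ge 0$ whenever $0<a<A(b)$. At $a=A(b)$ the density $D_{a,-b}$ is nonnegative on $[0,\infty)$ and has a nonempty finite set of zeros in $(0,\infty)$.
   Context: A function $g\in C^\infty(0,\infty)$ is completely monotone if $(-1)^n g^{(n)}\ge 0$ on $(0,\infty)$ for every integer $n\ge 0$. A nonnegative smooth function $f$ on $(0,\infty)$ is a Bernstein function if $f'$ is completely monotone. For $a>0$, $b\in\mathbb{R}$, $x>0$: $F_{a,b}(x)=\left(1+\frac{a}{x}\right)^{x+b}$. For $\alpha>0$, $y>0$: $h_\alpha(y)=\left(1+\frac1y\right)^{\alpha y}$, and $\alpha_*=\sup\{\alpha>0: h_\alpha\text{ is a Bernstein function}\}$ (a finite positive number). $U(b)=\min\{K_0+b,\ 2(1+b)+2\sqrt{1+b}\}$ for $-1<b\le0$, where $K_0=\dfrac{30\log 3-28}{(3\log 3-2)^2}$ ($<3$). For $a>0$, $0\le c<1$, $a+c<3$, put $$w_{a,c}(s)=\frac1\pi\left(\frac{s}{1-s}\right)^{as+c}\sin\bigl(\pi(as+c)\bigr)\quad(0<s<1),$$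 $$q_1=\frac a2+c,\qquad q_2=\frac a3+\frac c2+\frac12\left(\frac a2+c\right)^2,$$ $$D_{a,c}(t)=q_1+(q_1-q_2)t+e^{-a}\int_0^1 w_{a,c}(s)\bigl[e^{(1-s)t}-1-(1-s)t\bigr]\,ds .$$ The "density" attached to $(a,b)$ with $c=-b$ is $\Phi_{a,c}(t)=e^{a-t}D_{a,c}(t)$; it has the same sign and the same zeros as $D_{a,c}(t)$. (Every pair $(a,b)$ for which $F_{a,b}$ is Bernstein satisfies $a-b<K_0<3$, so the density is defined for it.) *)

theory Defs
  imports "HOL-Analysis.Analysis"
begin

text \<open>
  Functions on \<open>(0, \<infinity>)\<close> are represented by total functions on the reals; their values
  outside \<open>(0, \<infinity>)\<close> are irrelevant below, since iterated derivatives at a point \<open>x > 0\<close>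
  depend only on the function near \<open>x\<close>.
\<close>

definition smooth_pos :: "(real \<Rightarrow> real) \<Rightarrow> bool" where
  "smooth_pos g \<longleftrightarrow> (\<forall>n. \<forall>x>0. ((deriv ^^ n) g) field_differentiable (at x))"

definition completely_monotone :: "(real \<Rightarrow> real) \<Rightarrow> bool" where
  "completely_monotone g \<longleftrightarrow>
     smooth_pos g \<and> (\<forall>n. \<forall>x>0. (-1) ^ n * (deriv ^^ n) g x \<ge> 0)"

definition bernstein_function :: "(real \<Rightarrow> real) \<Rightarrow> bool" where
  "bernstein_function f \<longleftrightarrow>
     smooth_pos f \<and> (\<forall>x>0. f x \<ge> 0) \<and> completely_monotone (deriv f)"

definition F :: "real \<Rightarrow> real \<Rightarrow> real \<Rightarrow> real" where
  "F a b x = (1 + a / x) powr (x + b)"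

definition h :: "real \<Rightarrow> real \<Rightarrow> real" where
  "h \<alpha> y = (1 + 1 / y) powr (\<alpha> * y)"

definition alpha_star :: real where
  "alpha_star = Sup {\<alpha>. \<alpha> > 0 \<and> bernstein_function (h \<alpha>)}"

definition K0 :: real where
  "K0 = (30 * ln 3 - 28) / (3 * ln 3 - 2)\<^sup>2"

definition U :: "real \<Rightarrow> real" where
  "U b = min (K0 + b) (2 * (1 + b) + 2 * sqrt (1 + b))"

definition w :: "real \<Rightarrow> real \<Rightarrow> real \<Rightarrow> real" where
  "w a c s = 1 / pi * (s / (1 - s)) powr (a * s + c) * sin (pi * (a * s + c))"

definition q1 :: "real \<Rightarrow> real \<Rightarrow> real" where
  "q1 a c = a / 2 + c"

definition q2 :: "real \<Rightarrow> real \<Rightarrow> real" where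
  "q2 a c = a / 3 + c / 2 + 1 / 2 * (a / 2 + c)\<^sup>2"

text \<open>
  The integrand is absolutely integrable on \<open>(0, 1)\<close> when \<open>a > 0\<close>, \<open>0 \<le> c < 1\<close> and \<open>a + c < 3\<close>:
  near \<open>s = 1\<close> it is \<open>O((1 - s) powr (2 - (a + c)))\<close>. Only such parameters are meaningful.
\<close>

definition D :: "real \<Rightarrow> real \<Rightarrow> real \<Rightarrow> real" where
  "D a c t = q1 a c + (q1 a c - q2 a c) * t
     + exp (- a) * (LINT s:{0<..<1}|lborel. w a c s * (exp ((1 - s) * t) - 1 - (1 - s) * t))"

text \<open>
  A function with domain \<open>(-1, 0]\<close> is taken to be extensional (undefined outside the domain),
  so that uniqueness of such a function is literally uniqueness of an object.
\<close>

definition is_threshold :: "(real \<Rightarrow> real) \<Rightarrow> bool" where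
  "is_threshold A \<longleftrightarrow>
     A \<in> {-1<..0} \<rightarrow>\<^sub>E {0<..alpha_star} \<and>
     continuous_on {-1<..0} A \<and>
     strict_mono_on {-1<..0} A \<and>
     (\<forall>a>0. \<forall>b. bernstein_function (F a b) \<longleftrightarrow> (-1 < b \<and> b \<le> 0) \<and> (0 < a \<and> a \<le> A b))"

end

theory Submission
  imports Defs "HOL-Complex_Analysis.Complex_Analysis" "HOL-Real_Asymp.Real_Asymp"
begin

text \<open>
  Write \<open>c = -b\<close> and substitute \<open>x = a y\<close>. The function to study becomes \<open>f y = (1 + 1/y) powr (a y - c)\<close>,
  and \<open>f y = e\<^sup>a (1 - \<Sum>n. d n z ^ (n + 1))\<close> with \<open>z = 1 / (1 + y)\<close>, where the coefficients \<open>d n = dens a c n\<close>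
  come from the logarithm of \<open>f\<close>, whose derivative in \<open>z\<close> has the coefficients \<open>- (c + a / (n + 2))\<close>, linear in \<open>(a, c)\<close>.
  Read as a Laplace transform, this says that the derivative of \<open>f\<close> has the density
  \<open>t e\<^sup>-\<^sup>t \<Sum>n. d n t ^ n / n!\<close> up to a constant, so that \<open>f\<close> is a Bernstein function iff the entire function
  \<open>Dser a c t = \<Sum>n. d n t ^ n / n!\<close> is nonnegative on \<open>[0, \<infinity>)\<close> (\<open>bernstein_F_iff_Dser\<close>).
  A contour integral identifies \<open>d n\<close>, for \<open>n \<ge> 2\<close>, with the moments of the weight \<open>w a c\<close>
  (\<open>dens_integral\<close>), and hence \<open>Dser\<close> with \<open>D\<close> (\<open>D_eq_Dser\<close>). The same moments show that \<open>Dser\<close> is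
  positive for large arguments, locally uniformly in the parameters (\<open>local_tail_positive\<close>), so that
  only a compact range of \<open>t\<close> matters.

  The order structure comes from a maximum-principle argument. Since the logarithm of \<open>f\<close> is linear in the
  parameters, the densities satisfy a convolution semigroup law, which yields the directional derivatives
  (\<open>dirder\<close>) of \<open>Dser\<close> with respect to \<open>(a, c)\<close>. At a zero \<open>t0\<close> of a nonnegative density the Volterra equation
  \<open>t D = v - v * D\<close> turns \<open>v (t0 - u) D u / v t0\<close> into a probability weight on \<open>[0, t0]\<close>, and any kernel whose quotient by \<open>v\<close>
  decreases then has average larger than its value at \<open>t0\<close> (\<open>chebyshev_touching\<close>). In the directions that
  decrease both parameters this shows that every zero lifts off; hence the set of pairs with nonnegative
  density is closed downwards, with strict positivity at smaller pairs (\<open>down_closed\<close>). Consequently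
  \<open>Acrit c\<close>, the supremum of all \<open>a\<close> with nonnegative density, is attained, strictly decreasing
  and continuous, and the density at \<open>Acrit c\<close> has a zero, since otherwise positivity would persist.

  The upper bound \<open>U\<close> follows from positivity and log-convexity of the first three derivatives of \<open>f\<close>
  (\<open>log_derivative_conditions\<close>) evaluated at suitable points. The lower bound \<open>alpha_star (1 + b) < A b\<close>
  says that the graph of \<open>Acrit\<close> lies above its chord. With \<open>alpha_star < 2.31\<close>, certified by a
  partial sum, the chord for \<open>c \<ge> 0.026\<close> is covered by explicit nonnegative densities and downward closure
  (\<open>Acrit_ge_chord_away_from_0\<close>). For smaller \<open>c\<close> the parameters move along the chord itself: there
  the direction raises \<open>c\<close> while lowering \<open>a\<close>, and the Volterra equation together with its derivative reduces the
  lifting of zeros to an elementary monotonicity property of an explicit kernel on the interval that can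
  contain zeros (\<open>dirder_star\<close>, \<open>star_kernel_ratio\<close>, \<open>touching_location\<close>).
\<close>

section \<open>Exponential generating functions\<close>

definition geom_bounded :: "(nat \<Rightarrow> real) \<Rightarrow> bool" where
  "geom_bounded s \<longleftrightarrow> (\<exists>C K. \<forall>n. \<bar>s n\<bar> \<le> C * K ^ n)"

definition borel_series :: "(nat \<Rightarrow> real) \<Rightarrow> real \<Rightarrow> real" where
  "borel_series s t = (\<Sum>n. s n * t ^ n / fact n)"

lemma geom_boundedE:
  assumes "geom_bounded s"
  obtains C K where "C \<ge> 0" "K \<ge> 1" "\<And>n. \<bar>s n\<bar> \<le> C * K ^ n"
proof -
  obtain C K where CK: "\<And>n. \<bar>s n\<bar> \<le> C * K ^ n"
    using assms unfolding geom_bounded_def by blast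
  have "\<bar>s n\<bar> \<le> \<bar>C\<bar> * max 1 \<bar>K\<bar> ^ n" for n
  proof -
    have "\<bar>s n\<bar> \<le> \<bar>C * K ^ n\<bar>" using CK[of n] by linarith
    also have "\<dots> = \<bar>C\<bar> * \<bar>K\<bar> ^ n" by (simp add: abs_mult power_abs)
    also have "\<dots> \<le> \<bar>C\<bar> * max 1 \<bar>K\<bar> ^ n"
      by (intro mult_left_mono power_mono) auto
    finally show ?thesis .
  qed
  then show ?thesis using that[of "\<bar>C\<bar>" "max 1 \<bar>K\<bar>"] by simp
qed

lemma geom_bounded_Suc: "geom_bounded s \<Longrightarrow> geom_bounded (\<lambda>n. s (Suc n))"
  unfolding geom_bounded_def by (metis mult.assoc power_Suc)

lemma summable_exp_majorant: "summable (\<lambda>n. C * K ^ n * t ^ n / fact n :: real)"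
proof -
  have "summable (\<lambda>n. C * ((K * t) ^ n /\<^sub>R fact n))"
    by (intro summable_mult summable_exp_generic)
  then show ?thesis by (simp add: power_mult_distrib field_simps)
qed

lemma summable_abs_borel:
  assumes "geom_bounded s" shows "summable (\<lambda>n. \<bar>s n * t ^ n / fact n\<bar>)"
proof -
  obtain C K where CK: "C \<ge> 0" "K \<ge> 1" "\<And>n. \<bar>s n\<bar> \<le> C * K ^ n"
    using geom_boundedE[OF assms] by blast
  show ?thesis
  proof (rule summable_comparison_test'[OF summable_exp_majorant[of C K "\<bar>t\<bar>"]])
    fix n :: nat
    show "norm \<bar>s n * t ^ n / fact n\<bar> \<le> C * K ^ n * \<bar>t\<bar> ^ n / fact n"
      using CK(3)[of n] by (auto simp: abs_mult power_abs intro!: divide_right_mono mult_right_mono)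
  qed
qed

lemma summable_borel:
  assumes "geom_bounded s" shows "summable (\<lambda>n. s n * t ^ n / fact n)"
  using summable_abs_borel[OF assms, of t] by (rule summable_rabs_cancel)

lemma borel_series_sums:
  "geom_bounded s \<Longrightarrow> (\<lambda>n. s n * t ^ n / fact n) sums borel_series s t"
  unfolding borel_series_def by (intro summable_sums summable_borel)

lemma borel_series_0: "borel_series s 0 = s 0"
proof -
  have "(\<lambda>n. s n * 0 ^ n / fact n) sums (s 0 * 0 ^ 0 / fact 0)"
    using powser_sums_zero[of "\<lambda>n. s n / fact n"] by simp
  then show ?thesis unfolding borel_series_def by (simp add: sums_unique[symmetric])
qed

lemma DERIV_borel_series:
  assumes "geom_bounded s"
  shows "(borel_series s has_real_derivative borel_series (\<lambda>n. s (Suc n)) t) (at t)"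
proof -
  have sm: "summable (\<lambda>n. (s n / fact n) * y ^ n)" for y
    using summable_borel[OF assms, of y] by (simp add: field_simps)
  have "((\<lambda>x. \<Sum>n. (s n / fact n) * x ^ n) has_real_derivative
      (\<Sum>n. diffs (\<lambda>n. s n / fact n) n * t ^ n)) (at t)"
    by (rule termdiffs_strong_converges_everywhere[OF sm])
  moreover have "diffs (\<lambda>n. s n / fact n) = (\<lambda>n. s (Suc n) / fact n)"
    by (simp add: diffs_def fun_eq_iff fact_Suc del: of_nat_Suc)
  ultimately show ?thesis
    unfolding borel_series_def by (simp add: field_simps cong: suminf_cong)
qed

lemma continuous_on_borel_series: "geom_bounded s \<Longrightarrow> continuous_on A (borel_series s)"
  by (meson DERIV_borel_series DERIV_continuous continuous_at_imp_continuous_on)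

lemma borel_series_diff:
  assumes "geom_bounded r" "geom_bounded s"
  shows "borel_series (\<lambda>n. r n - s n) t = borel_series r t - borel_series s t"
proof -
  have "(\<lambda>n. r n * t ^ n / fact n - s n * t ^ n / fact n) sums (borel_series r t - borel_series s t)"
    by (intro sums_diff borel_series_sums assms)
  then show ?thesis unfolding borel_series_def
    by (simp add: sums_iff left_diff_distrib diff_divide_distrib)
qed

lemma borel_series_cmult:
  assumes "geom_bounded s"
  shows "borel_series (\<lambda>n. k * s n) t = k * borel_series s t"
proof -
  have "(\<lambda>n. k * (s n * t ^ n / fact n)) sums (k * borel_series s t)"
    by (intro sums_mult borel_series_sums assms)
  then show ?thesis unfolding borel_series_def
    by (simp add: sums_iff mult.assoc)
qed

lemma abs_borel_series_le:
  assumes "geom_bounded s" "\<And>n. \<bar>s n\<bar> \<le> B" "t \<ge> 0"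
  shows "\<bar>borel_series s t\<bar> \<le> B * exp t"
proof -
  have "(\<lambda>n. B * (t ^ n /\<^sub>R fact n)) sums (B * exp t)"
    by (intro sums_mult exp_converges)
  then have e: "(\<lambda>n. B * t ^ n / fact n) sums (B * exp t)" by (simp add: field_simps)
  have "\<bar>borel_series s t\<bar> \<le> (\<Sum>n. \<bar>s n * t ^ n / fact n\<bar>)"
    unfolding borel_series_def by (rule summable_rabs[OF summable_abs_borel[OF assms(1)]])
  also have "\<dots> \<le> (\<Sum>n. B * t ^ n / fact n)"
  proof (rule suminf_le)
    show "\<bar>s n * t ^ n / fact n\<bar> \<le> B * t ^ n / fact n" for n
      using assms(2)[of n] assms(3)
      by (auto simp: abs_mult intro!: divide_right_mono mult_right_mono)
  qed (use summable_abs_borel[OF assms(1)] e sums_summable in auto)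
  also have "\<dots> = B * exp t" using e by (simp add: sums_iff)
  finally show ?thesis .
qed

text \<open>
  The Beta integral at integer arguments; it is what makes convolution of the monomials \<open>t ^ n / n!\<close>
  a pure index shift.
\<close>

lemma beta_has_integral:
  assumes "t \<ge> 0"
  shows "((\<lambda>u. (t - u) ^ i * u ^ j) has_integral
            (fact i * fact j / fact (i + j + 1) * t ^ (i + j + 1))) {0..t::real}"
proof (induction i arbitrary: j)
  case 0
  have "((\<lambda>u. u ^ j) has_integral (t ^ (j + 1) / (j + 1) - 0 ^ (j + 1) / (j + 1))) {0..t}"
  proof (rule fundamental_theorem_of_calculus[OF assms])
    fix u :: real
    have "((\<lambda>u. u ^ (j + 1) / real (j + 1)) has_real_derivative u ^ j) (at u within {0..t})"
      using DERIV_cdivide[OF DERIV_subset[OF DERIV_pow[of "Suc j" u] subset_UNIV], of "real (Suc j)" "{0..t}"]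
      by (simp del: of_nat_Suc)
    then show "((\<lambda>u. u ^ (j + 1) / (j + 1)) has_vector_derivative u ^ j) (at u within {0..t})"
      by (simp add: has_real_derivative_iff_has_vector_derivative)
  qed
  then show ?case by (simp add: field_simps del: of_nat_Suc)
next
  case (Suc i)
  let ?P = "\<lambda>u. (t - u) ^ Suc i * u ^ Suc j / real (Suc j)"
  let ?p = "\<lambda>u. (t - u) ^ Suc i * u ^ j - real (Suc i) / real (Suc j) * ((t - u) ^ i * u ^ Suc j)"
  have d: "(?P has_real_derivative ?p u) (at u within {0..t})" for u
    by (rule derivative_eq_intros refl | simp)+ (simp add: field_simps)
  have "(?p has_integral (?P t - ?P 0)) {0..t}"
    by (rule fundamental_theorem_of_calculus[OF assms])
       (use d in \<open>simp add: has_real_derivative_iff_has_vector_derivative\<close>)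
  then have 1: "(?p has_integral 0) {0..t}" by simp
  have 2: "((\<lambda>u. real (Suc i) / real (Suc j) * ((t - u) ^ i * u ^ Suc j)) has_integral
      real (Suc i) / real (Suc j) * (fact i * fact (Suc j) / fact (i + Suc j + 1) * t ^ (i + Suc j + 1))) {0..t}"
    by (rule has_integral_mult_right[OF Suc.IH[of "Suc j"]])
  have "((\<lambda>u. (t - u) ^ Suc i * u ^ j) has_integral
      real (Suc i) / real (Suc j) * (fact i * fact (Suc j) / fact (i + Suc j + 1) * t ^ (i + Suc j + 1))) {0..t}"
    using has_integral_add[OF 1 2] by simp
  moreover have "real (Suc i) / real (Suc j) * (fact i * fact (Suc j) / fact (i + Suc j + 1) * t ^ (i + Suc j + 1))
     = fact (Suc i) * fact j / fact (Suc i + j + 1) * t ^ (Suc i + j + 1)"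
    by (simp del: of_nat_Suc add: fact_Suc[of i] fact_Suc[of j])
  ultimately show ?case by (simp only:)
qed

text \<open>
  The Cauchy product delayed by one index. The delay is the factor \<open>1 / (i + j + 1)!\<close> of the Beta integral:
  convolving two exponential generating functions over \<open>[0, t]\<close> yields exactly this operation on coefficients.
\<close>

definition seq_conv :: "(nat \<Rightarrow> real) \<Rightarrow> (nat \<Rightarrow> real) \<Rightarrow> nat \<Rightarrow> real" where
  "seq_conv r s n = (\<Sum>i<n. r (n - 1 - i) * s i)"

lemma seq_conv_0 [simp]: "seq_conv r s 0 = 0"
  by (simp add: seq_conv_def)

lemma seq_conv_Suc: "seq_conv r s (Suc n) = (\<Sum>i\<le>n. r i * s (n - i))"
  unfolding seq_conv_def lessThan_Suc_atMost
  by (subst sum.nat_diff_reindex[symmetric, of _ "Suc n", unfolded lessThan_Suc_atMost])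
     (auto intro!: sum.cong)

text \<open>
  The double series of the two factors is dominated by a product of exponential series, so it may be
  integrated termwise and rearranged by antidiagonals; each term is a Beta integral.
\<close>

lemma conv_has_integral:
  assumes r: "geom_bounded r" and s: "geom_bounded s" and t: "t \<ge> 0"
  shows "((\<lambda>u. borel_series r (t - u) * borel_series s u) has_integral
            borel_series (seq_conv r s) t) {0..t}"
    and "summable (\<lambda>n. seq_conv r s n * t ^ n / fact n)"
proof -
  obtain C1 K1 where CK1: "C1 \<ge> 0" "K1 \<ge> 1" "\<And>n. \<bar>r n\<bar> \<le> C1 * K1 ^ n"
    using geom_boundedE[OF r] by blast
  obtain C2 K2 where CK2: "C2 \<ge> 0" "K2 \<ge> 1" "\<And>n. \<bar>s n\<bar> \<le> C2 * K2 ^ n"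
    using geom_boundedE[OF s] by blast
  define K where "K = max K1 K2"
  have rb: "\<bar>r n\<bar> \<le> C1 * K ^ n" for n
    by (rule order_trans[OF CK1(3)]) (use CK1 CK2 in \<open>auto simp: K_def intro!: mult_left_mono power_mono\<close>)
  have sb: "\<bar>s n\<bar> \<le> C2 * K ^ n" for n
    by (rule order_trans[OF CK2(3)]) (use CK1 CK2 in \<open>auto simp: K_def intro!: mult_left_mono power_mono\<close>)
  define c where "c n u = (\<Sum>i\<le>n. (r i * (t - u) ^ i / fact i) * (s (n - i) * u ^ (n - i) / fact (n - i)))" for n u
  have cs: "(\<lambda>n. c n u) sums (borel_series r (t - u) * borel_series s u)" for u
    unfolding c_def borel_series_def
    by (rule Cauchy_product_sums) (use summable_abs_borel r s in auto)
  define M where "M n = C1 * C2 * K ^ n * t ^ n / fact n" for n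
  have cM: "norm (c n u) \<le> M n" if u: "u \<in> {0..t}" for n u
  proof -
    have "norm (c n u) \<le> (\<Sum>i\<le>n. norm ((r i * (t - u) ^ i / fact i) * (s (n - i) * u ^ (n - i) / fact (n - i))))"
      unfolding c_def by (rule norm_sum)
    also have "\<dots> \<le> (\<Sum>i\<le>n. (C1 * K ^ i * (t - u) ^ i / fact i) * (C2 * K ^ (n - i) * u ^ (n - i) / fact (n - i)))"
    proof (rule sum_mono)
      fix i
      have A: "norm (r i * (t - u) ^ i / fact i) \<le> C1 * K ^ i * (t - u) ^ i / fact i"
        using u rb[of i] by (auto simp: abs_mult intro!: divide_right_mono mult_right_mono)
      have B: "norm (s (n - i) * u ^ (n - i) / fact (n - i)) \<le> C2 * K ^ (n - i) * u ^ (n - i) / fact (n - i)"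
        using u sb[of "n - i"] by (auto simp: abs_mult intro!: divide_right_mono mult_right_mono)
      show "norm ((r i * (t - u) ^ i / fact i) * (s (n - i) * u ^ (n - i) / fact (n - i)))
        \<le> (C1 * K ^ i * (t - u) ^ i / fact i) * (C2 * K ^ (n - i) * u ^ (n - i) / fact (n - i))"
        unfolding norm_mult by (rule mult_mono[OF A B order_trans[OF norm_ge_zero A] norm_ge_zero])
    qed
    also have "\<dots> = (\<Sum>i\<le>n. C1 * C2 * K ^ n / fact n * (of_nat (n choose i) * (t - u) ^ i * u ^ (n - i)))"
    proof (rule sum.cong[OF refl])
      fix i assume i: "i \<in> {..n}"
      have k: "K ^ n = K ^ i * K ^ (n - i)" using i by (simp flip: power_add)
      have b: "real (n choose i) / fact n = 1 / (fact i * fact (n - i))"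
        using i by (simp add: binomial_fact)
      show "(C1 * K ^ i * (t - u) ^ i / fact i) * (C2 * K ^ (n - i) * u ^ (n - i) / fact (n - i))
        = C1 * C2 * K ^ n / fact n * (of_nat (n choose i) * (t - u) ^ i * u ^ (n - i))"
      proof -
        have "C1 * C2 * K ^ n / fact n * (of_nat (n choose i) * (t - u) ^ i * u ^ (n - i))
          = C1 * C2 * K ^ n * (real (n choose i) / fact n) * (t - u) ^ i * u ^ (n - i)" by simp
        also have "\<dots> = (C1 * K ^ i * (t - u) ^ i / fact i) * (C2 * K ^ (n - i) * u ^ (n - i) / fact (n - i))"
          unfolding b k by simp
        finally show ?thesis by simp
      qed
    qed
    also have "\<dots> = C1 * C2 * K ^ n / fact n * ((t - u) + u) ^ n"
      by (simp only: binomial_ring sum_distrib_left)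
    also have "\<dots> = M n" by (simp add: M_def)
    finally show ?thesis .
  qed
  have Msum: "summable M" unfolding M_def by (rule summable_exp_majorant)
  have ul: "uniform_limit (cbox 0 t) (\<lambda>n u. \<Sum>i<n. c i u) (\<lambda>u. \<Sum>i. c i u) sequentially"
    by (rule Weierstrass_m_test[OF _ Msum]) (use cM in auto)
  have lim: "(\<lambda>u. \<Sum>i. c i u) = (\<lambda>u. borel_series r (t - u) * borel_series s u)"
    using cs by (auto simp: sums_iff)
  have ci: "(c n has_integral (seq_conv r s (Suc n) * t ^ Suc n / fact (Suc n))) {0..t}" for n
  proof -
    have "(c n has_integral (\<Sum>i\<le>n. (r i * s (n - i) / (fact i * fact (n - i))) *
              (fact i * fact (n - i) / fact (i + (n - i) + 1) * t ^ (i + (n - i) + 1)))) {0..t}"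
      unfolding c_def
    proof (rule has_integral_sum)
      fix i
      have "((\<lambda>u. (r i * s (n - i) / (fact i * fact (n - i))) * ((t - u) ^ i * u ^ (n - i))) has_integral
        (r i * s (n - i) / (fact i * fact (n - i))) *
              (fact i * fact (n - i) / fact (i + (n - i) + 1) * t ^ (i + (n - i) + 1))) {0..t}"
        by (rule has_integral_mult_right[OF beta_has_integral[OF t]])
      then show "((\<lambda>u. (r i * (t - u) ^ i / fact i) * (s (n - i) * u ^ (n - i) / fact (n - i))) has_integral
        (r i * s (n - i) / (fact i * fact (n - i))) *
              (fact i * fact (n - i) / fact (i + (n - i) + 1) * t ^ (i + (n - i) + 1))) {0..t}"
        by (simp add: mult_ac)
    qed simp
    also have "(\<Sum>i\<le>n. (r i * s (n - i) / (fact i * fact (n - i))) *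
              (fact i * fact (n - i) / fact (i + (n - i) + 1) * t ^ (i + (n - i) + 1)))
        = (\<Sum>i\<le>n. r i * s (n - i) * (t ^ Suc n / fact (Suc n)))"
      by (intro sum.cong) auto
    finally show ?thesis
      by (simp add: seq_conv_Suc sum_distrib_right sum_divide_distrib)
  qed
  obtain I J where IJ: "\<And>n. ((\<lambda>u. \<Sum>i<n. c i u) has_integral I n) (cbox 0 t)"
    "((\<lambda>u. \<Sum>i. c i u) has_integral J) (cbox 0 t)" "I \<longlonglongrightarrow> J"
  proof (rule uniform_limit_integral_cbox[OF ul])
    show "continuous_on (cbox 0 t) (\<lambda>u. \<Sum>i<n. c i u)" for n
      unfolding c_def by (intro continuous_intros) auto
  qed (use trivial_limit_sequentially in auto)
  have I: "I n = (\<Sum>i<n. seq_conv r s (Suc i) * t ^ Suc i / fact (Suc i))" for n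
    using has_integral_unique[OF IJ(1)[of n, unfolded cbox_interval] has_integral_sum[OF _ ci]] by simp
  have "(\<lambda>i. seq_conv r s (Suc i) * t ^ Suc i / fact (Suc i)) sums J"
    using IJ(3) unfolding I sums_def .
  then have *: "(\<lambda>i. seq_conv r s i * t ^ i / fact i) sums J"
    using sums_Suc_iff[of "\<lambda>i. seq_conv r s i * t ^ i / fact i" J] by simp
  then show "summable (\<lambda>n. seq_conv r s n * t ^ n / fact n)" by (rule sums_summable)
  show "((\<lambda>u. borel_series r (t - u) * borel_series s u) has_integral
            borel_series (seq_conv r s) t) {0..t}"
    using IJ(2) * unfolding lim borel_series_def by (simp add: sums_iff)
qed

section \<open>Coefficients of the density\<close>

text \<open>
  The coefficients of the negative logarithm of the normalised function:
  \<open>- ln (f y / e\<^sup>a) = \<Sum>n. mom a c n z ^ (n + 1) / (n + 1)\<close> for \<open>z = 1 / (1 + y)\<close>. They are linear in \<open>(a, c)\<close>,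
  which is the source of the semigroup law below.
\<close>

definition mom :: "real \<Rightarrow> real \<Rightarrow> nat \<Rightarrow> real" where
  "mom a c n = c + a / (real n + 2)"

text \<open>
  Exponentiating the series above: \<open>E = 1 - \<Sum>n. dens a c n z ^ (n + 1)\<close> solves \<open>E' = - M E\<close> for the generating
  function \<open>M\<close> of \<open>mom\<close>, and this is the resulting recursion.
\<close>

fun dens :: "real \<Rightarrow> real \<Rightarrow> nat \<Rightarrow> real" where
  "dens a c n = (mom a c n - (\<Sum>j<n. mom a c (n - 1 - j) * dens a c j)) / (real n + 1)"

declare dens.simps [simp del]

lemma dens_rec: "(real n + 1) * dens a c n = mom a c n - seq_conv (mom a c) (dens a c) n"
  unfolding seq_conv_def by (subst dens.simps) (simp add: field_simps)

text \<open>
  The same recursion with all signs positive and \<open>mom\<close> replaced by its bound \<open>M\<close>, i.e. the coefficients of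
  \<open>(1 - z) powr (- M)\<close> after the constant term.
\<close>

fun majorant :: "real \<Rightarrow> nat \<Rightarrow> real" where
  "majorant M 0 = M"
| "majorant M (Suc n) = majorant M n * (real n + 1 + M) / (real n + 2)"

text \<open>
  The convolution recursion of the majorant, recovered from its two-term form.
\<close>

lemma majorant_sum: "(real n + 1) * majorant M n = M * (1 + (\<Sum>j<n. majorant M j))"
proof (induction n)
  case (Suc n)
  have "(real (Suc n) + 1) * majorant M (Suc n) = (real n + 1) * majorant M n + M * majorant M n"
    by (simp add: field_simps)
  then show ?case using Suc by (simp add: algebra_simps)
qed simp

lemma majorant_nonneg: "M \<ge> 0 \<Longrightarrow> majorant M n \<ge> 0"
  by (induction n) auto

lemma abs_dens_le_majorant:
  assumes "\<And>n. \<bar>mom a c n\<bar> \<le> M"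
  shows "\<bar>dens a c n\<bar> \<le> majorant M n"
proof (induction n rule: less_induct)
  case (less n)
  have "\<bar>(real n + 1) * dens a c n\<bar> \<le> \<bar>mom a c n\<bar> + (\<Sum>i<n. \<bar>mom a c (n - 1 - i) * dens a c i\<bar>)"
    unfolding dens_rec seq_conv_def
    by (rule order_trans[OF abs_triangle_ineq4]) (simp add: sum_abs)
  also have "\<dots> \<le> M + (\<Sum>i<n. M * majorant M i)"
    unfolding abs_mult using assms less by (intro add_mono sum_mono mult_mono) (auto intro: order_trans[OF abs_ge_zero])
  also have "\<dots> = (real n + 1) * majorant M n"
    using majorant_sum[of n M] by (simp add: sum_distrib_left distrib_left)
  finally show ?case by (simp add: abs_mult)
qed

lemma abs_mom_le: "\<bar>mom a c n\<bar> \<le> \<bar>a\<bar> / 2 + \<bar>c\<bar>"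
proof -
  have "\<bar>mom a c n\<bar> \<le> \<bar>c\<bar> + \<bar>a\<bar> / (real n + 2)"
    unfolding mom_def by (rule order_trans[OF abs_triangle_ineq]) simp
  moreover have "\<bar>a\<bar> / (real n + 2) \<le> \<bar>a\<bar> / 2" by (intro divide_left_mono) auto
  ultimately show ?thesis by linarith
qed

lemma majorant_le_geom: "M \<ge> 0 \<Longrightarrow> majorant M n \<le> M * (1 + M) ^ n"
proof (induction n)
  case (Suc n)
  have "majorant M (Suc n) = majorant M n * ((real n + 1 + M) / (real n + 2))" by simp
  also have "\<dots> \<le> (M * (1 + M) ^ n) * (1 + M)"
    using Suc majorant_nonneg by (intro mult_mono) (auto simp: field_simps)
  finally show ?case by (simp add: mult_ac)
qed simp

lemma majorant_le_self: "0 \<le> M \<Longrightarrow> M \<le> 1 \<Longrightarrow> majorant M n \<le> M"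
proof (induction n)
  case (Suc n)
  have "majorant M (Suc n) = majorant M n * ((real n + 1 + M) / (real n + 2))" by simp
  also have "\<dots> \<le> M * 1"
    using Suc majorant_nonneg by (intro mult_mono) (auto simp: field_simps)
  finally show ?case by simp
qed simp

lemma abs_dens_le: "\<bar>dens a c n\<bar> \<le> majorant (\<bar>a\<bar> / 2 + \<bar>c\<bar>) n"
  by (rule abs_dens_le_majorant[OF abs_mom_le])

lemma geom_bounded_dens: "geom_bounded (dens a c)"
  unfolding geom_bounded_def
  using order_trans[OF abs_dens_le majorant_le_geom] by (metis abs_ge_zero add_nonneg_nonneg divide_nonneg_nonneg zero_le_numeral)

lemma geom_bounded_mom: "geom_bounded (mom a c)"
  unfolding geom_bounded_def
  by (rule exI[of _ "\<bar>a\<bar> / 2 + \<bar>c\<bar>"], rule exI[of _ 1]) (use abs_mom_le in auto)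

lemma abs_dens_le_small:
  assumes "\<bar>a\<bar> / 2 + \<bar>c\<bar> \<le> 1" shows "\<bar>dens a c n\<bar> \<le> \<bar>a\<bar> / 2 + \<bar>c\<bar>"
  using order_trans[OF abs_dens_le majorant_le_self] assms by simp

text \<open>
  To first order in the parameters the recursion reads \<open>(n + 1) dens = mom\<close>; the convolution term is quadratic.
\<close>

lemma abs_dens_minus_linear_le:
  assumes "\<bar>a\<bar> / 2 + \<bar>c\<bar> \<le> 1"
  shows "\<bar>dens a c n - mom a c n / (real n + 1)\<bar> \<le> (\<bar>a\<bar> / 2 + \<bar>c\<bar>)\<^sup>2"
proof -
  let ?M = "\<bar>a\<bar> / 2 + \<bar>c\<bar>"
  have "dens a c n - mom a c n / (real n + 1) = - seq_conv (mom a c) (dens a c) n / (real n + 1)"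
  proof -
    have "dens a c n = (mom a c n - seq_conv (mom a c) (dens a c) n) / (real n + 1)"
      using dens_rec[of n a c] by (simp add: eq_divide_eq mult.commute)
    then show ?thesis by (simp add: diff_divide_distrib)
  qed
  then have "\<bar>dens a c n - mom a c n / (real n + 1)\<bar> = \<bar>seq_conv (mom a c) (dens a c) n\<bar> / (real n + 1)"
    by simp
  also have "\<bar>seq_conv (mom a c) (dens a c) n\<bar> \<le> (\<Sum>i<n. ?M * ?M)"
    unfolding seq_conv_def
    by (rule order_trans[OF sum_abs])
       (unfold abs_mult, intro sum_mono mult_mono abs_mom_le abs_dens_le_small assms, auto)
  then have "\<bar>seq_conv (mom a c) (dens a c) n\<bar> / (real n + 1) \<le> (\<Sum>i<n. ?M * ?M) / (real n + 1)"
    by (intro divide_right_mono) auto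
  also have "\<dots> = (real n / (real n + 1)) * ?M\<^sup>2" by (simp add: power2_eq_square)
  also have "\<dots> \<le> 1 * ?M\<^sup>2" by (intro mult_right_mono) (auto simp: field_simps)
  finally show ?thesis by simp
qed

section \<open>The ordinary generating function\<close>

lemma summable_ratio_tendsto:
  fixes u :: "nat \<Rightarrow> real"
  assumes u: "\<And>n. u (Suc n) = \<rho> n * u n" and lim: "\<rho> \<longlonglongrightarrow> r" and r: "\<bar>r\<bar> < 1"
  shows "summable u"
proof -
  obtain q where q: "\<bar>r\<bar> < q" "q < 1" using r dense by blast
  have "(\<lambda>n. \<bar>\<rho> n\<bar>) \<longlonglongrightarrow> \<bar>r\<bar>" using lim by (rule tendsto_rabs)
  then have "eventually (\<lambda>n. \<bar>\<rho> n\<bar> < q) sequentially" using q(1) by (rule order_tendstoD)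
  then obtain N where N: "\<And>n. n \<ge> N \<Longrightarrow> \<bar>\<rho> n\<bar> < q" unfolding eventually_sequentially by blast
  show ?thesis
  proof (rule summable_ratio_test[OF q(2)])
    fix n assume "n \<ge> N"
    then show "norm (u (Suc n)) \<le> q * norm (u n)"
      using N[of n] by (auto simp: u abs_mult intro!: mult_right_mono)
  qed
qed

text \<open>
  Consecutive terms have quotient tending to \<open>r\<close>, since all polynomial factors have quotient tending to 1.
\<close>

lemma summable_majorant_fact:
  assumes "M \<ge> 0" "0 \<le> r" "r < 1"
  shows "summable (\<lambda>n. majorant M n * (fact (n + m) / fact n) * r ^ n)"
proof (rule summable_ratio_tendsto)
  let ?rho = "\<lambda>n. (real n + 1 + M) / (real n + 2) * ((real n + real m + 1) / (real n + 1)) * r"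
  show "majorant M (Suc n) * (fact (Suc n + m) / fact (Suc n)) * r ^ Suc n
      = ?rho n * (majorant M n * (fact (n + m) / fact n) * r ^ n)" for n
  proof -
    have "fact (Suc n + m) / fact (Suc n) = (real n + real m + 1) / (real n + 1) * (fact (n + m) / fact n :: real)"
      by (simp add: add_ac)
    then show ?thesis by (simp only: majorant.simps power_Suc) (simp add: mult_ac)
  qed
  show "?rho \<longlonglongrightarrow> r" by real_asymp
  show "\<bar>r\<bar> < 1" using assms by simp
qed

lemma summable_dens_fact:
  assumes "0 \<le> r" "r < 1"
  shows "summable (\<lambda>n. \<bar>dens a c n\<bar> * (fact (n + m) / fact n) * r ^ n)"
proof (rule summable_comparison_test'[OF summable_majorant_fact[of "\<bar>a\<bar> / 2 + \<bar>c\<bar>" r m]])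
  show "norm (\<bar>dens a c n\<bar> * (fact (n + m) / fact n) * r ^ n) \<le> majorant (\<bar>a\<bar> / 2 + \<bar>c\<bar>) n * (fact (n + m) / fact n) * r ^ n" for n
    using abs_dens_le[of a c n] assms(1) by (auto simp: abs_mult intro!: mult_right_mono divide_right_mono)
qed (use assms in auto)

lemma summable_dens_power:
  assumes "norm (z :: complex) < 1"
  shows "summable (\<lambda>n. norm (of_real (dens a c n) * z ^ n))"
  using summable_dens_fact[of "norm z" a c 0] assms by (simp add: norm_mult norm_power)

lemma summable_mom_power:
  assumes "norm (z :: complex) < 1"
  shows "summable (\<lambda>n. norm (of_real (mom a c n) * z ^ n))"
proof (rule summable_comparison_test'[of "\<lambda>n. (\<bar>a\<bar> / 2 + \<bar>c\<bar>) * norm z ^ n"])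
  show "norm (norm (of_real (mom a c n) * z ^ n)) \<le> (\<bar>a\<bar> / 2 + \<bar>c\<bar>) * norm z ^ n" for n
    using abs_mom_le[of a c n] by (auto simp: norm_mult norm_power intro!: mult_right_mono)
qed (use assms in \<open>auto intro!: summable_mult summable_geometric\<close>)

text \<open>
  The series \<open>E\<close>, with its constant term, and below minus its logarithm \<open>g\<close>; complex because the expansion is
  later used at complex points near infinity.
\<close>

definition ecoef :: "real \<Rightarrow> real \<Rightarrow> nat \<Rightarrow> complex" where
  "ecoef a c n = (case n of 0 \<Rightarrow> 1 | Suc k \<Rightarrow> - of_real (dens a c k))"

definition gcoef :: "real \<Rightarrow> real \<Rightarrow> nat \<Rightarrow> complex" where
  "gcoef a c n = (case n of 0 \<Rightarrow> 0 | Suc k \<Rightarrow> of_real (mom a c k / (real k + 1)))"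

lemma summable_ecoef:
  assumes "norm (z :: complex) < 1" shows "summable (\<lambda>n. norm (ecoef a c n * z ^ n))"
proof -
  have "summable (\<lambda>n. norm (ecoef a c (Suc n) * z ^ Suc n))"
    using summable_mult[OF summable_dens_power[OF assms, of a c], of "norm z"]
    by (simp add: ecoef_def norm_mult mult_ac)
  then show ?thesis using summable_Suc_iff[of "\<lambda>n. norm (ecoef a c n * z ^ n)"] by simp
qed

lemma summable_gcoef:
  assumes "norm (z :: complex) < 1" shows "summable (\<lambda>n. norm (gcoef a c n * z ^ n))"
proof -
  have "summable (\<lambda>n. norm (gcoef a c (Suc n) * z ^ Suc n))"
  proof (rule summable_comparison_test'[OF summable_mult[OF summable_mom_power[OF assms, of a c], of "norm z"]])
    fix n :: nat
    have "norm (gcoef a c (Suc n)) \<le> \<bar>mom a c n\<bar>"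
    proof -
      have "norm (gcoef a c (Suc n)) = \<bar>mom a c n\<bar> / (real n + 1)"
        unfolding gcoef_def nat.case norm_of_real by simp
      also have "\<dots> \<le> \<bar>mom a c n\<bar>" by (simp add: divide_le_eq mult_le_cancel_left1)
      finally show ?thesis .
    qed
    then show "norm (norm (gcoef a c (Suc n) * z ^ Suc n)) \<le> norm z * norm (of_real (mom a c n) * z ^ n)"
      by (simp add: norm_mult norm_power mult_left_mono mult_right_mono mult.left_commute)
  qed
  then show ?thesis using summable_Suc_iff[of "\<lambda>n. norm (gcoef a c n * z ^ n)"] by simp
qed

text \<open>
  The recursion of \<open>dens\<close> as a Cauchy product: \<open>E' = - M E\<close> on the level of coefficients.
\<close>

lemma sum_mom_ecoef:
  "(\<Sum>i\<le>n. of_real (mom a c i) * ecoef a c (n - i)) = of_real ((real n + 1) * dens a c n)"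
proof -
  have "(\<Sum>i\<le>n. of_real (mom a c i) * ecoef a c (n - i))
      = of_real (mom a c n) + (\<Sum>i<n. of_real (mom a c i) * ecoef a c (n - i))"
    by (simp add: ecoef_def lessThan_Suc_atMost[symmetric])
  also have "(\<Sum>i<n. of_real (mom a c i) * ecoef a c (n - i)) = - of_real (\<Sum>i<n. mom a c i * dens a c (n - 1 - i))"
  proof -
    have "ecoef a c (n - i) = - of_real (dens a c (n - 1 - i))" if i: "i < n" for i
    proof -
      obtain k where k: "n - i = Suc k" using i by (cases "n - i") auto
      then have k': "n - 1 - i = k" by linarith
      show ?thesis unfolding k k' by (simp add: ecoef_def)
    qed
    then have "(\<Sum>i<n. of_real (mom a c i) * ecoef a c (n - i)) = (\<Sum>i<n. of_real (mom a c i) * - of_real (dens a c (n - 1 - i)))"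
      by (intro sum.cong) auto
    then show ?thesis by (simp add: sum_negf)
  qed
  also have "(\<Sum>i<n. mom a c i * dens a c (n - 1 - i)) = seq_conv (mom a c) (dens a c) n"
  proof -
    have "(\<Sum>i<n. mom a c i * dens a c (n - 1 - i)) = (\<Sum>i<n. mom a c (n - Suc i) * dens a c (n - 1 - (n - Suc i)))"
      by (rule sum.nat_diff_reindex[symmetric])
    also have "\<dots> = seq_conv (mom a c) (dens a c) n"
      unfolding seq_conv_def by (rule sum.cong) auto
    finally show ?thesis .
  qed
  finally show ?thesis by (simp only: dens_rec of_real_diff) simp
qed

text \<open>
  \<open>E e\<^sup>g\<close> has derivative zero on the unit disc because \<open>E' = - g' E\<close>, and it equals 1 at the origin.
\<close>

lemma egf_eq_exp:
  assumes z: "norm (z :: complex) < 1"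
  shows "(\<Sum>n. ecoef a c n * z ^ n) = exp (- (\<Sum>n. gcoef a c n * z ^ n))"
proof -
  define E where "E z = (\<Sum>n. ecoef a c n * z ^ n)" for z
  define G where "G z = (\<Sum>n. gcoef a c n * z ^ n)" for z
  define G' where "G' z = (\<Sum>n. of_real (mom a c n) * z ^ n :: complex)" for z
  have dG: "(G has_field_derivative G' w) (at w)" if "norm w < 1" for w
  proof -
    have "((\<lambda>z. \<Sum>n. gcoef a c n * z ^ n) has_field_derivative (\<Sum>n. diffs (gcoef a c) n * w ^ n)) (at w)"
      by (rule termdiffs_strong'[where K = 1]) (use that summable_norm_cancel[OF summable_gcoef] in auto)
    moreover have "diffs (gcoef a c) n = of_real (mom a c n)" for n
    proof -
      have "complex_of_real (real n + 1) \<noteq> 0" unfolding of_real_eq_0_iff by linarith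
      then show ?thesis by (simp add: diffs_def gcoef_def add.commute)
    qed
    ultimately show ?thesis unfolding G_def G'_def by simp
  qed
  have dE: "(E has_field_derivative - (G' w * E w)) (at w)" if w: "norm w < 1" for w
  proof -
    have "((\<lambda>z. \<Sum>n. ecoef a c n * z ^ n) has_field_derivative (\<Sum>n. diffs (ecoef a c) n * w ^ n)) (at w)"
      by (rule termdiffs_strong'[where K = 1]) (use w summable_norm_cancel[OF summable_ecoef] in auto)
    moreover have "(\<lambda>n. diffs (ecoef a c) n * w ^ n) sums - (G' w * E w)"
    proof -
      have "(\<lambda>n. \<Sum>i\<le>n. (of_real (mom a c i) * w ^ i) * (ecoef a c (n - i) * w ^ (n - i))) sums (G' w * E w)"
        unfolding G'_def E_def by (rule Cauchy_product_sums[OF summable_mom_power[OF w] summable_ecoef[OF w]])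
      moreover have "(\<Sum>i\<le>n. (of_real (mom a c i) * w ^ i) * (ecoef a c (n - i) * w ^ (n - i)))
          = - (diffs (ecoef a c) n * w ^ n)" for n
      proof -
        have "(\<Sum>i\<le>n. (of_real (mom a c i) * w ^ i) * (ecoef a c (n - i) * w ^ (n - i)))
          = (\<Sum>i\<le>n. (of_real (mom a c i) * ecoef a c (n - i)) * w ^ n)"
          by (intro sum.cong) (auto simp: power_add[symmetric])
        also have "\<dots> = of_real ((real n + 1) * dens a c n) * w ^ n"
          unfolding sum_distrib_right[symmetric] sum_mom_ecoef ..
        finally show ?thesis by (simp add: diffs_def ecoef_def add.commute)
      qed
      ultimately have "(\<lambda>n. - (diffs (ecoef a c) n * w ^ n)) sums (G' w * E w)" by (simp only:)
      then show ?thesis using sums_minus by fastforce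
    qed
    ultimately show ?thesis unfolding E_def by (simp only: sums_iff)
  qed
  have "\<exists>k. \<forall>w\<in>ball 0 1. E w * exp (G w) = k"
  proof (rule has_field_derivative_zero_constant)
    fix w :: complex assume "w \<in> ball 0 1"
    then have w: "norm w < 1" by simp
    show "((\<lambda>w. E w * exp (G w)) has_field_derivative 0) (at w within ball 0 1)"
      by (rule has_field_derivative_at_within)
         (rule derivative_eq_intros dE[OF w] dG[OF w] refl | simp add: algebra_simps)+
  qed simp
  then obtain k where k: "\<And>w. norm w < 1 \<Longrightarrow> E w * exp (G w) = k" by auto
  have "E 0 = 1" "G 0 = 0"
    unfolding E_def G_def using powser_sums_zero[of "ecoef a c"] powser_sums_zero[of "gcoef a c"]
    by (auto simp: sums_iff ecoef_def gcoef_def)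
  then have "k = 1" using k[of 0] by simp
  then have "E z * exp (G z) = 1" using k z by simp
  then have "exp (G z) * E z = 1" by (simp only: mult.commute)
  then have "inverse (exp (G z)) = E z" by (rule inverse_unique)
  then show ?thesis unfolding E_def[symmetric] G_def[symmetric] exp_minus by (rule sym)
qed

text \<open>
  The logarithm of the generating function is elementary: the series with coefficients \<open>1 / (n + 1)\<close> and
  \<open>1 / (n + 2)\<close> are logarithms.
\<close>

lemma gcoef_series:
  assumes z: "norm (z :: complex) < 1" "z \<noteq> 0"
  shows "(\<Sum>n. gcoef a c n * z ^ n) = of_real a - (of_real (a + c) - of_real a / z) * Ln (1 - z)"
proof -
  have L: "(\<lambda>n. (-1) ^ Suc n / of_nat n * (- z) ^ n) sums ln (1 + (- z))"
    by (rule Ln_series) (use z in simp)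
  have eq: "(-1) ^ Suc n / of_nat n * (- z) ^ n = - (z ^ n / of_nat n)" for n
  proof -
    have "(- z) ^ n = (-1) ^ n * z ^ n" by (rule power_minus)
    moreover have "(-1) ^ Suc n * (-1) ^ n = (-1 :: complex)" by (simp flip: power_mult_distrib)
    ultimately show ?thesis by (simp add: field_simps)
  qed
  have L1: "(\<lambda>n. z ^ n / of_nat n) sums (- Ln (1 - z))"
    using sums_minus[OF L] unfolding eq by simp
  have L2: "(\<lambda>n. z ^ Suc n / of_nat (Suc n)) sums (- Ln (1 - z))"
    using L1 sums_Suc_iff[of "\<lambda>n. z ^ n / of_nat n" "- Ln (1 - z)"] by simp
  have L3: "(\<lambda>n. z ^ n / of_nat (Suc n)) sums (- Ln (1 - z) / z)"
    using sums_divide[OF L2, of z] z(2) by simp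
  have L4: "(\<lambda>n. z ^ Suc n / of_nat (Suc (Suc n))) sums (- Ln (1 - z) / z - 1)"
    using L3 sums_Suc_iff[of "\<lambda>n. z ^ n / of_nat (Suc n)" "- Ln (1 - z) / z - 1"] by simp
  have "(\<lambda>n. of_real (a + c) * (z ^ Suc n / of_nat (Suc n)) - of_real a * (z ^ Suc n / of_nat (Suc (Suc n))))
     sums (of_real (a + c) * (- Ln (1 - z)) - of_real a * (- Ln (1 - z) / z - 1))"
    by (intro sums_diff sums_mult L2 L4)
  moreover have "of_real (a + c) * (z ^ Suc n / of_nat (Suc n)) - of_real a * (z ^ Suc n / of_nat (Suc (Suc n)))
      = gcoef a c (Suc n) * z ^ Suc n" for n
  proof -
    have r: "mom a c n / (real n + 1) = (a + c) / real (Suc n) - a / real (Suc (Suc n))"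
      by (simp add: mom_def field_simps)
    have "gcoef a c (Suc n) = of_real ((a + c) / real (Suc n) - a / real (Suc (Suc n)))"
      unfolding gcoef_def by (simp only: nat.case r)
    then have g: "gcoef a c (Suc n) = of_real (a + c) / of_nat (Suc n) - of_real a / of_nat (Suc (Suc n))"
      by (simp only: of_real_diff of_real_divide of_real_of_nat_eq)
    show ?thesis unfolding g by (simp add: left_diff_distrib del: of_nat_Suc power_Suc of_real_add)
  qed
  ultimately have "(\<lambda>n. gcoef a c (Suc n) * z ^ Suc n)
     sums (of_real (a + c) * (- Ln (1 - z)) - of_real a * (- Ln (1 - z) / z - 1))" by simp
  then have "(\<lambda>n. gcoef a c n * z ^ n)
     sums (of_real (a + c) * (- Ln (1 - z)) - of_real a * (- Ln (1 - z) / z - 1))"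
    using sums_Suc_iff[of "\<lambda>n. gcoef a c n * z ^ n"] by (simp add: gcoef_def)
  then show ?thesis by (simp add: sums_iff algebra_simps)
qed

lemma egf_closed_form:
  assumes z: "norm (z :: complex) < 1" "z \<noteq> 0"
  shows "(\<lambda>n. ecoef a c n * z ^ n) sums exp ((of_real (a + c) - of_real a / z) * Ln (1 - z) - of_real a)"
proof -
  have "exp ((of_real (a + c) - of_real a / z) * Ln (1 - z) - of_real a) = (\<Sum>n. ecoef a c n * z ^ n)"
    unfolding egf_eq_exp[OF z(1)] gcoef_series[OF z] by simp
  then show ?thesis
    using summable_sums[OF summable_norm_cancel[OF summable_ecoef[OF z(1)]]] by simp
qed

text \<open>
  The series \<open>\<Sum>n. dens a c n z ^ n\<close> and, up to powers of \<open>z\<close>, its derivatives. For \<open>z = s / (x + s)\<close> these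
  sums are the derivatives in \<open>x\<close>, and they are also the moments \<open>\<integral> t ^ m e\<^sup>-\<^sup>t Dser (z t) dt\<close>.
\<close>

definition psum :: "real \<Rightarrow> real \<Rightarrow> nat \<Rightarrow> real \<Rightarrow> real" where
  "psum a c m z = (\<Sum>n. dens a c n * (fact (n + m) / fact n) * z ^ n)"

lemma summable_psum:
  assumes "\<bar>z\<bar> < 1" shows "summable (\<lambda>n. dens a c n * (fact (n + m) / fact n) * z ^ n)"
proof (rule summable_rabs_cancel)
  show "summable (\<lambda>n. \<bar>dens a c n * (fact (n + m) / fact n) * z ^ n\<bar>)"
    using summable_dens_fact[of "\<bar>z\<bar>" a c m] assms by (simp add: abs_mult power_abs)
qed

text \<open>
  The closed form of the generating function at \<open>z = 1 / (1 + y)\<close>, where \<open>1 - z = y / (1 + y)\<close>.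
\<close>

lemma scaled_powr_eq:
  assumes "y > 0"
  shows "(1 + 1 / y) powr (a * y - c) = exp a * (1 - psum a c 0 (1 / (1 + y)) * (1 / (1 + y)))"
proof -
  define z where "z = 1 / (1 + y)"
  have z: "0 < z" "z < 1" using assms by (auto simp: z_def)
  have "(\<lambda>n. ecoef a c n * of_real z ^ n) sums exp ((of_real (a + c) - of_real a / of_real z) * Ln (1 - of_real z) - of_real a)"
    by (rule egf_closed_form) (use z in auto)
  also have "exp ((of_real (a + c) - of_real a / of_real z) * Ln (1 - of_real z) - of_real a)
      = complex_of_real (exp ((a + c - a / z) * ln (1 - z) - a))"
  proof -
    have "Ln (complex_of_real (1 - z)) = of_real (ln (1 - z))"
      by (rule Ln_of_real) (use z in simp)
    then have "Ln (1 - complex_of_real z) = of_real (ln (1 - z))" by simp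
    then show ?thesis by (simp add: exp_of_real[symmetric])
  qed
  finally have "(\<lambda>n. Re (ecoef a c n * of_real z ^ n)) sums Re (of_real (exp ((a + c - a / z) * ln (1 - z) - a)))"
    by (rule sums_Re)
  then have "(\<lambda>n. Re (ecoef a c n * of_real z ^ n)) sums exp ((a + c - a / z) * ln (1 - z) - a)"
    by (simp only: Re_complex_of_real)
  then have "(\<lambda>n. Re (ecoef a c (Suc n) * of_real z ^ Suc n)) sums (exp ((a + c - a / z) * ln (1 - z) - a) - 1)"
    using sums_Suc_iff[of "\<lambda>n. Re (ecoef a c n * of_real z ^ n)" "exp ((a + c - a / z) * ln (1 - z) - a) - 1"]
    by (simp add: ecoef_def)
  then have 1: "(\<lambda>n. - (dens a c n * z ^ n * z)) sums (exp ((a + c - a / z) * ln (1 - z) - a) - 1)"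
    by (simp add: ecoef_def mult_ac flip: of_real_power of_real_mult)
  have "(\<lambda>n. dens a c n * z ^ n) sums psum a c 0 z"
    using summable_sums[OF summable_psum[of z a c 0]] z unfolding psum_def by simp
  then have "(\<lambda>n. - (dens a c n * z ^ n * z)) sums (- (psum a c 0 z * z))"
    by (intro sums_minus sums_mult2)
  then have e: "exp ((a + c - a / z) * ln (1 - z) - a) = 1 - psum a c 0 z * z"
    using 1 sums_unique2 by fastforce
  have l: "ln (1 - z) = - ln (1 + 1 / y)"
  proof -
    have "1 - z = inverse (1 + 1 / y)" using assms by (simp add: z_def field_simps)
    then show ?thesis using assms by (simp add: ln_inverse)
  qed
  have ex: "(a + c - a / z) * ln (1 - z) - a = (a * y - c) * ln (1 + 1 / y) - a"
    unfolding l using assms by (simp add: z_def field_simps)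
  have "(1 + 1 / y) powr (a * y - c) = exp ((a * y - c) * ln (1 + 1 / y))"
    using assms by (simp add: powr_def add_pos_pos less_imp_neq[symmetric])
  also have "\<dots> = exp a * exp ((a * y - c) * ln (1 + 1 / y) - a)" by (simp flip: exp_add)
  also have "\<dots> = exp a * (1 - psum a c 0 z * z)" using e ex by simp
  finally show ?thesis unfolding z_def .
qed

lemma DERIV_psum:
  assumes "\<bar>z\<bar> < 1"
  shows "((\<lambda>z. z ^ Suc m * psum a c m z) has_real_derivative z ^ m * psum a c (Suc m) z) (at z)"
proof -
  let ?f = "\<lambda>m n. dens a c n * (fact (n + m) / fact n)"
  have 1: "((\<lambda>z. \<Sum>n. ?f m n * z ^ n) has_real_derivative (\<Sum>n. diffs (?f m) n * z ^ n)) (at z)"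
    by (rule termdiffs_strong'[where K = 1]) (use assms summable_psum in auto)
  have 2: "z * (\<Sum>n. diffs (?f m) n * z ^ n) + real (Suc m) * psum a c m z = psum a c (Suc m) z"
  proof -
    have "summable (\<lambda>n. diffs (?f m) n * z ^ n)"
      by (rule termdiff_converges[where K = 1]) (use assms summable_psum in auto)
    then have "(\<lambda>n. real n * ?f m n * z ^ (n - Suc 0)) sums (\<Sum>n. diffs (?f m) n * z ^ n)"
      using diffs_equiv[of "?f m" z] by simp
    then have s1: "(\<lambda>n. z * (real n * ?f m n * z ^ (n - Suc 0))) sums (z * (\<Sum>n. diffs (?f m) n * z ^ n))"
      by (rule sums_mult)
    have s2: "(\<lambda>n. real (Suc m) * (?f m n * z ^ n)) sums (real (Suc m) * psum a c m z)"
      unfolding psum_def by (intro sums_mult summable_sums summable_psum assms)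
    have "z * (real n * ?f m n * z ^ (n - Suc 0)) + real (Suc m) * (?f m n * z ^ n) = ?f (Suc m) n * z ^ n" for n
      by (cases n) (auto simp: algebra_simps add_divide_distrib)
    then have "(\<lambda>n. ?f (Suc m) n * z ^ n) sums (z * (\<Sum>n. diffs (?f m) n * z ^ n) + real (Suc m) * psum a c m z)"
      using sums_add[OF s1 s2] by simp
    then show ?thesis unfolding psum_def by (simp add: sums_iff)
  qed
  have "((\<lambda>z. z ^ Suc m * psum a c m z) has_real_derivative
      (real (Suc m) * z ^ m * psum a c m z + z ^ Suc m * (\<Sum>n. diffs (?f m) n * z ^ n))) (at z)"
    unfolding psum_def
    by (rule derivative_eq_intros 1 refl | simp)+
  moreover have "real (Suc m) * z ^ m * psum a c m z + z ^ Suc m * (\<Sum>n. diffs (?f m) n * z ^ n) = z ^ m * psum a c (Suc m) z"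
    unfolding 2[symmetric] by (simp add: algebra_simps)
  ultimately show ?thesis by simp
qed

section \<open>Bernstein functions and nonnegativity of the density\<close>

text \<open>
  The total function \<open>deriv\<close> only sees germs, so a tower of derivatives on the open half-line determines the iterates there.
\<close>

lemma iterated_deriv:
  assumes f: "\<And>x. x > 0 \<Longrightarrow> f x = G 0 x"
    and G: "\<And>n x. x > 0 \<Longrightarrow> (G n has_real_derivative G (Suc n) x) (at x)"
  shows "x > 0 \<Longrightarrow> (deriv ^^ n) f x = G n x"
    and "smooth_pos f"
proof -
  have d: "(g has_real_derivative G (Suc n) x) (at x)" if "x > 0" "\<And>x. x > 0 \<Longrightarrow> g x = G n x" for g n x
    by (rule has_field_derivative_transform_within_open[OF G[OF that(1), of n] open_greaterThan[of 0]])
       (use that in auto)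
  have *: "\<forall>x>0. (deriv ^^ n) f x = G n x" for n
  proof (induction n)
    case (Suc n)
    show ?case
    proof (intro allI impI)
      fix x :: real assume x: "x > 0"
      have "((deriv ^^ n) f has_real_derivative G (Suc n) x) (at x)"
        by (rule d[OF x]) (use Suc in auto)
      then show "(deriv ^^ Suc n) f x = G (Suc n) x" by (simp add: DERIV_imp_deriv)
    qed
  qed (use f in simp)
  then show "x > 0 \<Longrightarrow> (deriv ^^ n) f x = G n x" by blast
  show "smooth_pos f"
    unfolding smooth_pos_def field_differentiable_def using d * by blast
qed

text \<open>
  The derivatives in \<open>x\<close> of \<open>f (x / s)\<close>. The scale \<open>s\<close> covers both families at once: \<open>s = a\<close> gives \<open>F a (-c)\<close> and
  \<open>s = 1\<close> gives \<open>h a\<close>.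
\<close>

definition gder :: "real \<Rightarrow> real \<Rightarrow> real \<Rightarrow> nat \<Rightarrow> real \<Rightarrow> real" where
  "gder s a c n x = (case n of 0 \<Rightarrow> exp a * (1 - s / (x + s) * psum a c 0 (s / (x + s)))
     | Suc m \<Rightarrow> exp a * ((-1) ^ m / s ^ Suc m) * ((s / (x + s)) ^ Suc (Suc m) * psum a c (Suc m) (s / (x + s))))"

lemma DERIV_gder:
  assumes s: "s > 0" and x: "x > 0"
  shows "(gder s a c n has_real_derivative gder s a c (Suc n) x) (at x)"
proof -
  define z where "z x = s / (x + s)" for x
  have z: "\<bar>z x\<bar> < 1" using s x by (simp add: z_def)
  have dz: "(z has_real_derivative - (z x)\<^sup>2 / s) (at x)"
  proof -
    have "((\<lambda>x. s / (x + s)) has_real_derivative - s / (x + s)\<^sup>2) (at x)"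
      using s x by (auto intro!: derivative_eq_intros simp: power2_eq_square)
    moreover have "- s / (x + s)\<^sup>2 = - (z x)\<^sup>2 / s"
      using s x by (simp add: z_def power_divide power2_eq_square)
    ultimately show ?thesis unfolding z_def by simp
  qed
  have dp: "((\<lambda>x. (z x) ^ Suc m * psum a c m (z x)) has_real_derivative
      ((z x) ^ m * psum a c (Suc m) (z x)) * (- (z x)\<^sup>2 / s)) (at x)" for m
    using DERIV_chain2[OF DERIV_psum[OF z] dz] by simp
  show ?thesis
  proof (cases n)
    case 0
    have "((\<lambda>x. exp a * (1 - (z x) ^ Suc 0 * psum a c 0 (z x))) has_real_derivative
      exp a * (0 - ((z x) ^ 0 * psum a c (Suc 0) (z x)) * (- (z x)\<^sup>2 / s))) (at x)"
      by (intro DERIV_cmult DERIV_diff DERIV_const dp)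
    moreover have "gder s a c n = (\<lambda>x. exp a * (1 - (z x) ^ Suc 0 * psum a c 0 (z x)))"
      by (simp add: gder_def 0 fun_eq_iff z_def)
    moreover have "exp a * (0 - ((z x) ^ 0 * psum a c (Suc 0) (z x)) * (- (z x)\<^sup>2 / s)) = gder s a c (Suc n) x"
      by (simp add: gder_def 0 z_def power2_eq_square)
    ultimately show ?thesis by simp
  next
    case (Suc m)
    have "((\<lambda>x. exp a * ((-1) ^ m / s ^ Suc m) * ((z x) ^ Suc (Suc m) * psum a c (Suc m) (z x))) has_real_derivative
      exp a * ((-1) ^ m / s ^ Suc m) * (((z x) ^ Suc m * psum a c (Suc (Suc m)) (z x)) * (- (z x)\<^sup>2 / s))) (at x)"
      by (intro DERIV_cmult dp)
    moreover have "gder s a c n = (\<lambda>x. exp a * ((-1) ^ m / s ^ Suc m) * ((z x) ^ Suc (Suc m) * psum a c (Suc m) (z x)))"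
      by (simp add: gder_def Suc fun_eq_iff z_def)
    moreover have "exp a * ((-1) ^ m / s ^ Suc m) * (((z x) ^ Suc m * psum a c (Suc (Suc m)) (z x)) * (- (z x)\<^sup>2 / s)) = gder s a c (Suc n) x"
      by (simp add: gder_def Suc z_def[symmetric] power2_eq_square mult_ac)
    ultimately show ?thesis by simp
  qed
qed

text \<open>
  By \<open>gder\<close> the signs required of the derivatives are exactly the signs of \<open>psum a c (Suc m)\<close>.
\<close>

lemma bernstein_iff_psum:
  assumes s: "s > 0" and f: "\<And>x. x > 0 \<Longrightarrow> f x = gder s a c 0 x" and nn: "\<And>x. x > 0 \<Longrightarrow> f x \<ge> 0"
  shows "bernstein_function f \<longleftrightarrow> (\<forall>m z. 0 < z \<and> z < 1 \<longrightarrow> psum a c (Suc m) z \<ge> 0)"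
proof -
  have it: "(deriv ^^ n) f x = gder s a c n x" if "x > 0" for n x
    using iterated_deriv(1)[of f "gder s a c", OF f DERIV_gder[OF s] that] by blast
  have sm: "smooth_pos f" using iterated_deriv(2)[of f "gder s a c", OF f DERIV_gder[OF s]] by blast
  have df: "deriv f x = gder s a c (Suc 0) x" if "x > 0" for x using it[OF that, of "Suc 0"] by simp
  have it': "(deriv ^^ n) (deriv f) x = gder s a c (Suc n) x" if "x > 0" for n x
    using iterated_deriv(1)[of "deriv f" "\<lambda>n. gder s a c (Suc n)", OF df DERIV_gder[OF s] that] by blast
  have sm': "smooth_pos (deriv f)"
    using iterated_deriv(2)[of "deriv f" "\<lambda>n. gder s a c (Suc n)", OF df DERIV_gder[OF s]] by blast
  have sgn: "(-1) ^ n * gder s a c (Suc n) x \<ge> 0 \<longleftrightarrow> psum a c (Suc n) (s / (x + s)) \<ge> 0" if "x > 0" for n x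
  proof -
    have "(-1) ^ n * gder s a c (Suc n) x = ((-1) ^ n * (-1) ^ n) * (exp a / s ^ Suc n * (s / (x + s)) ^ Suc (Suc n)) * psum a c (Suc n) (s / (x + s))"
      by (simp add: gder_def)
    also have "(-1) ^ n * (-1) ^ n = (1 :: real)" by (simp flip: power_mult_distrib)
    finally have e: "(-1) ^ n * gder s a c (Suc n) x = (exp a / s ^ Suc n * (s / (x + s)) ^ Suc (Suc n)) * psum a c (Suc n) (s / (x + s))"
      by simp
    define K where "K = exp a / s ^ Suc n * (s / (x + s)) ^ Suc (Suc n)"
    have "K > 0" unfolding K_def
      by (intro mult_pos_pos divide_pos_pos zero_less_power) (use s that in auto)
    then show ?thesis unfolding e K_def[symmetric] by (simp add: zero_le_mult_iff)
  qed
  have range: "(\<forall>x>0. P (s / (x + s))) \<longleftrightarrow> (\<forall>z. 0 < z \<and> z < 1 \<longrightarrow> P z)" for P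
  proof
    assume P: "\<forall>x>0. P (s / (x + s))"
    show "\<forall>z. 0 < z \<and> z < 1 \<longrightarrow> P z"
    proof (intro allI impI)
      fix z :: real assume z: "0 < z \<and> z < 1"
      have "s / z - s > 0" using z s by (simp add: less_divide_eq)
      then have "P (s / ((s / z - s) + s))" using P by blast
      then show "P z" using z s by simp
    qed
  next
    assume "\<forall>z. 0 < z \<and> z < 1 \<longrightarrow> P z"
    then show "\<forall>x>0. P (s / (x + s))" using s by auto
  qed
  have "bernstein_function f \<longleftrightarrow> (\<forall>n. \<forall>x>0. psum a c (Suc n) (s / (x + s)) \<ge> 0)"
    unfolding bernstein_function_def completely_monotone_def using sm sm' nn it' sgn by auto
  then show ?thesis using range[of "\<lambda>z. psum a c (Suc _) z \<ge> 0"] by (auto simp: range)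
qed

lemma bernstein_F_iff_psum:
  assumes "a > 0"
  shows "bernstein_function (F a b) \<longleftrightarrow> (\<forall>m z. 0 < z \<and> z < 1 \<longrightarrow> psum a (- b) (Suc m) z \<ge> 0)"
proof (rule bernstein_iff_psum[OF assms])
  fix x :: real assume x: "x > 0"
  have "F a b x = (1 + 1 / (x / a)) powr (a * (x / a) - (- b))"
    unfolding F_def using assms by simp
  also have "\<dots> = exp a * (1 - psum a (- b) 0 (1 / (1 + x / a)) * (1 / (1 + x / a)))"
    by (rule scaled_powr_eq) (use assms x in simp)
  also have "1 / (1 + x / a) = a / (x + a)" using assms x by (simp add: field_simps)
  finally show "F a b x = gder a a (- b) 0 x" by (simp add: gder_def mult.commute)
  show "F a b x \<ge> 0" unfolding F_def by simp
qed

lemma bernstein_h_iff_psum: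
  "bernstein_function (h a) \<longleftrightarrow> (\<forall>m z. 0 < z \<and> z < 1 \<longrightarrow> psum a 0 (Suc m) z \<ge> 0)"
proof (rule bernstein_iff_psum[of 1])
  fix x :: real assume x: "x > 0"
  show "h a x = gder 1 a 0 0 x"
    using scaled_powr_eq[OF x, of a 0] by (simp add: h_def gder_def add.commute)
  show "h a x \<ge> 0" unfolding h_def by simp
qed simp

definition Dser :: "real \<Rightarrow> real \<Rightarrow> real \<Rightarrow> real" where
  "Dser a c t = borel_series (dens a c) t"

lemma continuous_on_Dser: "continuous_on A (Dser a c)"
  unfolding Dser_def[abs_def] by (rule continuous_on_borel_series[OF geom_bounded_dens])

text \<open>
  The Post-Widder inversion of the Laplace transform, done on coefficients: with \<open>z = t / (t + m)\<close> the quotient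
  \<open>(n + m)! / (n! m!) z ^ n\<close> tends to \<open>t ^ n / n!\<close>.
\<close>

lemma psum_tendsto_Dser:
  assumes t: "t > 0"
  shows "(\<lambda>m. psum a c (Suc m) (t / (t + real (Suc m))) / fact (Suc m)) \<longlonglongrightarrow> Dser a c t"
proof -
  obtain M :: nat where M: "real M > t" using reals_Archimedean2 by blast
  define B where "B n m = (fact (n + m) / (fact n * fact m)) * (t / (t + real m)) ^ n" for n m
  have BSuc: "B (Suc n) m = B n m * ((real n + 1 + real m) / (real n + 1) * (t / (t + real m)))" for n m
    unfolding B_def by (simp add: add_ac mult_ac)
  have lim: "(\<lambda>m. B n m) \<longlonglongrightarrow> t ^ n / fact n" for n
  proof (induction n)
    case (Suc n)
    have "(\<lambda>m. (real n + 1 + real m) / (real n + 1) * (t / (t + real m))) \<longlonglongrightarrow> inverse (real n + 1) * t"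
      using t by real_asymp
    then have "(\<lambda>m. (real n + 1 + real m) / (real n + 1) * (t / (t + real m))) \<longlonglongrightarrow> t / (real n + 1)"
      by (simp add: divide_inverse mult.commute)
    then have "(\<lambda>m. B (Suc n) m) \<longlonglongrightarrow> t ^ n / fact n * (t / (real n + 1))"
      unfolding BSuc by (intro tendsto_mult Suc)
    then show ?case by (simp add: field_simps)
  qed (simp add: B_def)
  \<comment> \<open>the factors increase when \<open>m\<close> decreases to a fixed \<open>M > t\<close>, which gives a summable dominating sequence\<close>
  define B0 where "B0 n = (fact (n + M) / (fact n * fact M)) * (t / real M) ^ n" for n
  have bound: "0 \<le> B n m \<and> B n m \<le> B0 n" if m: "m \<ge> M" for n m
  proof (induction n)
    case 0
    show ?case by (simp add: B_def B0_def)
  next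
    case (Suc n)
    have M0: "M > 0" "m > 0" using M t m by (auto intro: Suc_leI)
    have s: "B0 (Suc n) = B0 n * ((real n + 1 + real M) / (real n + 1) * (t / real M))"
      unfolding B0_def by (simp add: add_ac mult_ac)
    have "(real n + 1 + real m) / (real n + 1) * (t / (t + real m)) \<le> (real n + 1 + real m) / (real n + 1) * (t / real m)"
      using t M0 by (intro mult_left_mono divide_left_mono) auto
    also have "\<dots> = t / real m + t / (real n + 1)" using M0 by (simp add: field_simps)
    also have "\<dots> \<le> t / real M + t / (real n + 1)" using t M0 m by (intro add_right_mono divide_left_mono) auto
    also have "\<dots> = (real n + 1 + real M) / (real n + 1) * (t / real M)" using M0 by (simp add: field_simps)
    finally have *: "(real n + 1 + real m) / (real n + 1) * (t / (t + real m)) \<le> (real n + 1 + real M) / (real n + 1) * (t / real M)" .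
    have p: "0 \<le> (real n + 1 + real m) / (real n + 1) * (t / (t + real m))" using t by simp
    have "0 \<le> B0 n" using Suc by linarith
    then show ?case unfolding BSuc s
      using mult_nonneg_nonneg[OF conjunct1[OF Suc] p] mult_mono[OF conjunct2[OF Suc] * _ p] by blast
  qed
  have M0: "M > 0" using M t by (cases M) auto
  have sum: "summable (\<lambda>n. \<bar>dens a c n\<bar> * B0 n)"
    using summable_mult[OF summable_dens_fact[of "t / real M" a c M], of "1 / fact M"] M t M0
    by (simp add: B0_def field_simps)
  have "((\<lambda>m. \<Sum>n. dens a c n * B n m) \<longlongrightarrow> (\<Sum>n. dens a c n * (t ^ n / fact n))) sequentially"
  proof (rule tannerys_theorem[OF _ _ sum, THEN conjunct2, THEN conjunct2])
    show "((\<lambda>m. dens a c n * B n m) \<longlongrightarrow> dens a c n * (t ^ n / fact n)) sequentially" for n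
      by (intro tendsto_intros lim)
    show "\<forall>\<^sub>F (n, m) in at_top \<times>\<^sub>F sequentially. norm (dens a c n * B n m) \<le> \<bar>dens a c n\<bar> * B0 n"
    proof -
      have "\<forall>\<^sub>F x in sequentially \<times>\<^sub>F sequentially. snd x \<ge> M"
        using eventually_prod2[OF sequentially_bot, of "\<lambda>m. m \<ge> M" sequentially] by (simp add: case_prod_unfold eventually_ge_at_top)
      then show ?thesis
      proof (rule eventually_mono)
        fix x :: "nat \<times> nat" assume "snd x \<ge> M"
        then show "case x of (n, m) \<Rightarrow> norm (dens a c n * B n m) \<le> \<bar>dens a c n\<bar> * B0 n"
          using bound[of "snd x" "fst x"] by (auto simp: abs_mult split: prod.split intro!: mult_left_mono)
      qed
    qed
  qed simp
  then have "(\<lambda>m. \<Sum>n. dens a c n * B n m) \<longlonglongrightarrow> Dser a c t"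
    by (simp add: Dser_def borel_series_def)
  moreover have "(\<Sum>n. dens a c n * B n m) = psum a c m (t / (t + real m)) / fact m" if "m > 0" for m
  proof -
    have "summable (\<lambda>n. dens a c n * (fact (n + m) / fact n) * (t / (t + real m)) ^ n)"
      by (rule summable_psum) (use t that in auto)
    from suminf_divide[OF this, of "fact m"] show ?thesis unfolding psum_def B_def by (simp add: field_simps)
  qed
  ultimately have "(\<lambda>m. \<Sum>n. dens a c n * B n (Suc m)) \<longlonglongrightarrow> Dser a c t"
    by (intro LIMSEQ_Suc)
  then show ?thesis using \<open>\<And>m. m > 0 \<Longrightarrow> _ m\<close> by simp
qed

text \<open>
  At \<open>t > 0\<close> this is the inversion formula; at \<open>t = 0\<close> it follows by continuity.
\<close>

lemma Dser_nonneg_of_psum: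
  assumes "\<forall>m z. 0 < z \<and> z < 1 \<longrightarrow> psum a c (Suc m) z \<ge> 0" and "t \<ge> 0"
  shows "Dser a c t \<ge> 0"
proof -
  have pos: "Dser a c t \<ge> 0" if t: "t > 0" for t
  proof (rule LIMSEQ_le_const[OF psum_tendsto_Dser[OF t]])
    show "\<exists>N. \<forall>m\<ge>N. 0 \<le> psum a c (Suc m) (t / (t + real (Suc m))) / fact (Suc m)"
      using assms(1) t by (auto intro!: exI[of _ 0] divide_nonneg_nonneg)
  qed
  show ?thesis
  proof (cases "t = 0")
    case True
    have "isCont (Dser a c) 0" using continuous_on_Dser[of UNIV a c] by (simp add: continuous_on_eq_continuous_at)
    then have "(Dser a c \<longlongrightarrow> Dser a c 0) (at_right 0)"
      unfolding isCont_def by (rule tendsto_within_subset) simp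
    moreover have "\<forall>\<^sub>F t in at_right 0. 0 \<le> Dser a c t"
      using eventually_at_right_less[of 0] pos by (auto elim!: eventually_mono)
    ultimately show ?thesis unfolding True by (intro tendsto_lowerbound[of "Dser a c" _ "at_right 0"]) auto
  qed (use pos assms in auto)
qed

lemma gamma_moment:
  "set_integrable lborel {0<..} (\<lambda>t::real. t ^ k * exp (- t))"
  "(LINT t:{0<..}|lborel. t ^ k * exp (- t)) = (fact k :: real)"
proof -
  have hk: "((\<lambda>t. t powr (real (Suc k) - 1) / exp t) has_integral Gamma (real (Suc k))) {0..}"
    by (rule Gamma_integral_real) simp
  have "((\<lambda>t::real. t ^ k * exp (- t)) has_integral fact k) {0<..}"
  proof -
    have "((\<lambda>t. t powr (real (Suc k) - 1) / exp t) has_integral Gamma (real (Suc k))) {0<..}"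
      using hk by (subst has_integral_spike_set_eq[of _ "{0..}"]) (auto intro: negligible_subset[of "{0}"])
    then have "((\<lambda>t::real. t ^ k * exp (- t)) has_integral Gamma (real (Suc k))) {0<..}"
      by (rule has_integral_eq[rotated]) (auto simp: powr_realpow exp_minus divide_inverse)
    then show ?thesis using Gamma_fact[of k, where ?'a = real] by (simp add: add.commute)
  qed
  moreover from this have "(\<lambda>t::real. t ^ k * exp (- t)) absolutely_integrable_on {0<..}"
    by (intro nonnegative_absolutely_integrable_1) (auto simp: integrable_on_def)
  ultimately have 1: "set_integrable lebesgue {0<..} (\<lambda>t::real. t ^ k * exp (- t))" "integral {0<..} (\<lambda>t::real. t ^ k * exp (- t)) = fact k"
    by (auto simp: integral_unique)
  then show i: "set_integrable lborel {0<..} (\<lambda>t::real. t ^ k * exp (- t))"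
    unfolding set_integrable_def by (subst (asm) integrable_completion) auto
  show "(LINT t:{0<..}|lborel. t ^ k * exp (- t)) = (fact k :: real)"
    using set_borel_integral_eq_integral(2)[OF i] 1(2) by simp
qed

text \<open>
  Termwise integration of the exponential generating function against \<open>t ^ m e\<^sup>-\<^sup>t\<close>. With the inversion formula it
  shows that nonnegativity of \<open>Dser\<close> and of all the \<open>psum\<close> are equivalent, a case of Bernstein's theorem for which no
  representing measure has to be constructed.
\<close>

lemma laplace_Dser:
  assumes z: "0 < z" "z < 1"
  shows "set_integrable lborel {0<..} (\<lambda>t. t ^ m * exp (- t) * Dser a c (z * t))"
    and "(LINT t:{0<..}|lborel. t ^ m * exp (- t) * Dser a c (z * t)) = psum a c m z"
proof -
  define f where "f n t = indicator {0<..} t *\<^sub>R (dens a c n * z ^ n / fact n * (t ^ (n + m) * exp (- t)))" for n and t :: real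
  have int: "integrable lborel (f n)" for n
    unfolding f_def using set_integrable_mult_right[OF gamma_moment(1)[of "n + m"], of "dens a c n * z ^ n / fact n"]
    by (simp add: set_integrable_def)
  have nint: "(LINT t|lborel. norm (f n t)) = \<bar>dens a c n\<bar> * (fact (n + m) / fact n) * z ^ n" for n
  proof -
    have "(LINT t|lborel. norm (f n t)) = (LINT t:{0<..}|lborel. (\<bar>dens a c n\<bar> * z ^ n / fact n) * (t ^ (n + m) * exp (- t)))"
      unfolding set_lebesgue_integral_def
      by (rule Bochner_Integration.integral_cong) (use z in \<open>auto simp: f_def abs_mult indicator_def\<close>)
    also have "\<dots> = (\<bar>dens a c n\<bar> * z ^ n / fact n) * fact (n + m)"
      by (simp only: set_integral_mult_right gamma_moment(2))
    finally show ?thesis by simp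
  qed
  have fint: "(LINT t|lborel. f n t) = dens a c n * (fact (n + m) / fact n) * z ^ n" for n
  proof -
    have "(LINT t|lborel. f n t) = (LINT t:{0<..}|lborel. (dens a c n * z ^ n / fact n) * (t ^ (n + m) * exp (- t)))"
      unfolding set_lebesgue_integral_def f_def by simp
    also have "\<dots> = (dens a c n * z ^ n / fact n) * fact (n + m)"
      by (simp only: set_integral_mult_right gamma_moment(2))
    finally show ?thesis by simp
  qed
  have fs: "(\<lambda>n. f n t) sums (indicator {0<..} t *\<^sub>R (t ^ m * exp (- t) * Dser a c (z * t)))" for t
  proof -
    have "(\<lambda>n. indicator {0<..} t * (t ^ m * exp (- t)) * (dens a c n * (z * t) ^ n / fact n))
      sums (indicator {0<..} t * (t ^ m * exp (- t)) * Dser a c (z * t))"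
      unfolding Dser_def by (intro sums_mult borel_series_sums geom_bounded_dens)
    then show ?thesis unfolding f_def by (simp add: power_add power_mult_distrib mult_ac)
  qed
  have sm1: "AE t in lborel. summable (\<lambda>n. norm (f n t))"
  proof (rule AE_I2)
    fix t
    have "summable (\<lambda>n. indicator {0<..} t * (\<bar>t\<bar> ^ m * exp (- t)) * \<bar>dens a c n * (z * t) ^ n / fact n\<bar>)"
      by (intro summable_mult summable_abs_borel geom_bounded_dens)
    then show "summable (\<lambda>n. norm (f n t))"
      unfolding f_def using z by (simp add: abs_mult power_abs power_add power_mult_distrib mult_ac)
  qed
  have sm2: "summable (\<lambda>n. LINT t|lborel. norm (f n t))"
    unfolding nint by (rule summable_dens_fact) (use z in auto)
  have eq: "(\<lambda>t. \<Sum>n. f n t) = (\<lambda>t. indicator {0<..} t *\<^sub>R (t ^ m * exp (- t) * Dser a c (z * t)))"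
    using fs by (auto simp: sums_iff)
  show "set_integrable lborel {0<..} (\<lambda>t. t ^ m * exp (- t) * Dser a c (z * t))"
    using integrable_suminf[OF int sm1 sm2] unfolding eq set_integrable_def .
  show "(LINT t:{0<..}|lborel. t ^ m * exp (- t) * Dser a c (z * t)) = psum a c m z"
    using sums_integral[OF int sm1 sm2] unfolding eq fint set_lebesgue_integral_def psum_def
    by (simp add: sums_iff)
qed

lemma psum_nonneg:
  assumes D: "\<And>t. t \<ge> 0 \<Longrightarrow> Dser a c t \<ge> 0" and z: "0 < z" "z < 1"
  shows "psum a c m z \<ge> 0"
  unfolding laplace_Dser(2)[OF z, symmetric] set_lebesgue_integral_def
  by (rule integral_nonneg_AE) (use D z in \<open>auto simp: indicator_def\<close>)

text \<open>
  Cauchy-Schwarz for moments: integrating \<open>t (t - l)\<^sup>2\<close> against the density gives a quadratic polynomial in \<open>l\<close> without sign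
  change.
\<close>

lemma psum_log_convex:
  assumes D: "\<And>t. t \<ge> 0 \<Longrightarrow> Dser a c t \<ge> 0" and z: "0 < z" "z < 1"
  shows "(psum a c 2 z)\<^sup>2 \<le> psum a c 1 z * psum a c 3 z"
proof -
  have q: "psum a c 3 z - 2 * l * psum a c 2 z + l\<^sup>2 * psum a c 1 z \<ge> 0" for l
  proof -
    let ?f = "\<lambda>m t. t ^ m * exp (- t) * Dser a c (z * t)"
    define g where "g m t = ?f m t" for m t
    have gi: "set_integrable lborel {0<..} (g m)" and gv: "(LINT t:{0<..}|lborel. g m t) = psum a c m z" for m
      unfolding g_def[abs_def] using laplace_Dser[OF z] by auto
    have "(LINT t:{0<..}|lborel. g 3 t - (2 * l) * g 2 t + l\<^sup>2 * g 1 t) = psum a c 3 z - (2 * l) * psum a c 2 z + l\<^sup>2 * psum a c 1 z"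
      by (subst set_integral_add(2) | intro set_integral_diff(1) set_integrable_mult_right gi
         | subst set_integral_diff(2) | simp only: set_integral_mult_right gv)+
    then have "(LINT t:{0<..}|lborel. ?f 3 t - 2 * l * ?f 2 t + l\<^sup>2 * ?f 1 t) = psum a c 3 z - 2 * l * psum a c 2 z + l\<^sup>2 * psum a c 1 z"
      unfolding g_def .
    moreover have "(LINT t:{0<..}|lborel. ?f 3 t - 2 * l * ?f 2 t + l\<^sup>2 * ?f 1 t) \<ge> 0"
      unfolding set_lebesgue_integral_def
    proof (rule integral_nonneg_AE, rule AE_I2)
      fix t :: real
      have e: "?f 3 t - 2 * l * ?f 2 t + l\<^sup>2 * ?f 1 t = t * (t - l)\<^sup>2 * (exp (- t) * Dser a c (z * t))"
        by (simp add: power2_eq_square power3_eq_cube algebra_simps)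
      show "0 \<le> indicator {0<..} t *\<^sub>R (?f 3 t - 2 * l * ?f 2 t + l\<^sup>2 * ?f 1 t)"
        unfolding e using D[of "z * t"] z by (auto simp: indicator_def)
    qed
    ultimately show ?thesis by simp
  qed
  have p1: "psum a c 1 z \<ge> 0" by (rule psum_nonneg[OF D z])
  show ?thesis
  proof (cases "psum a c 1 z = 0")
    case False
    with p1 have p: "psum a c 1 z > 0" by simp
    have "psum a c 1 z * (psum a c 3 z - 2 * (psum a c 2 z / psum a c 1 z) * psum a c 2 z + (psum a c 2 z / psum a c 1 z)\<^sup>2 * psum a c 1 z) \<ge> 0"
      using q[of "psum a c 2 z / psum a c 1 z"] p by simp
    then show ?thesis using p by (simp add: field_simps power2_eq_square)
  next
    case True
    have "psum a c 2 z = 0"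
    proof (rule ccontr)
      assume n: "psum a c 2 z \<noteq> 0"
      show False using q[of "(psum a c 3 z + 1) / (2 * psum a c 2 z)"] n True by (simp add: field_simps)
    qed
    then show ?thesis using True by simp
  qed
qed

theorem bernstein_F_iff_Dser:
  assumes "a > 0" shows "bernstein_function (F a b) \<longleftrightarrow> (\<forall>t\<ge>0. Dser a (- b) t \<ge> 0)"
  using bernstein_F_iff_psum[OF assms, of b] Dser_nonneg_of_psum[of a "- b"] psum_nonneg[of a "- b"] by blast

theorem bernstein_h_iff_Dser:
  "bernstein_function (h a) \<longleftrightarrow> (\<forall>t\<ge>0. Dser a 0 t \<ge> 0)"
  using bernstein_h_iff_psum[of a] Dser_nonneg_of_psum[of a 0] psum_nonneg[of a 0] by blast

section \<open>The coefficients as moments of the weight\<close>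

text \<open>
  The coefficients are read off from a contour integral of \<open>u ^ n\<close> times the function \<open>Fu\<close> below over the boundary of
  a half disc in the upper half plane: the arc sees the Laurent expansion at infinity, the diameter sees the
  jump of the logarithms on \<open>(0, 1)\<close>, which is where the weight \<open>w\<close> lives.
\<close>

definition uhp :: "complex set" where "uhp = {u. Im u \<ge> 0}"

text \<open>
  The branch of the logarithm cut along the negative imaginary axis, hence holomorphic up to the boundary of the
  upper half plane except at 0.
\<close>

definition clog :: "complex \<Rightarrow> complex" where
  "clog u = Ln (- \<i> * u) + \<i> * of_real (pi / 2)"

lemma minus_ii_times_notin: "u \<in> uhp \<Longrightarrow> u \<noteq> 0 \<Longrightarrow> - \<i> * u \<notin> \<real>\<^sub>\<le>\<^sub>0"
  by (auto simp: uhp_def complex_nonpos_Reals_iff complex_eq_iff)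

lemma Re_clog: "u \<noteq> 0 \<Longrightarrow> Re (clog u) = ln (norm u)"
  by (simp add: clog_def Re_Ln norm_mult)

lemma abs_Im_clog_le: "\<bar>Im (clog u)\<bar> \<le> 2 * pi" if "u \<noteq> 0"
proof -
  have "- \<i> * u \<noteq> 0" using that by simp
  from mpi_less_Im_Ln[OF this] Im_Ln_le_pi[OF this] pi_gt_zero show ?thesis
    unfolding clog_def by (simp add: abs_le_iff)
qed

lemma clog_of_real_pos: "x > 0 \<Longrightarrow> clog (of_real x) = of_real (ln x)"
proof -
  assume x: "x > 0"
  have "Ln (of_real x * (- \<i>)) = of_real (ln x) + Ln (- \<i>)"
    using Ln_times_of_real[of x "- \<i>"] x by (simp add: Ln_of_real)
  then show ?thesis by (simp add: clog_def mult.commute Ln_minus_ii)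
qed

lemma clog_of_real_neg: "x < 0 \<Longrightarrow> clog (of_real x) = of_real (ln (- x)) + \<i> * of_real pi"
proof -
  assume x: "x < 0"
  have "Ln (of_real (- x) * \<i>) = of_real (ln (- x)) + Ln \<i>"
    using Ln_times_of_real[of "- x" \<i>] x Ln_of_real[of "- x"] by simp
  then show ?thesis by (simp add: clog_def mult.commute)
qed

lemma DERIV_clog:
  assumes "u \<in> uhp" "u \<noteq> 0"
  shows "(clog has_field_derivative inverse (- \<i> * u) * (- \<i>)) (at u)"
proof -
  have "((\<lambda>u. - \<i> * u) has_field_derivative - \<i>) (at u)"
    by (rule DERIV_cmult_Id)
  from DERIV_chain2[OF has_field_derivative_Ln[OF minus_ii_times_notin[OF assms]] this]
  have "((\<lambda>u. Ln (- \<i> * u)) has_field_derivative inverse (- \<i> * u) * (- \<i>)) (at u)" .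
  from DERIV_add[OF this DERIV_const[of "\<i> * of_real (pi / 2)"]] show ?thesis
    unfolding clog_def[abs_def] by simp
qed

text \<open>
  The generating function in the variable \<open>u = 1 / z\<close>, so that \<open>f y\<close> appears at \<open>u = 1 + y\<close>.
\<close>

definition Fu :: "real \<Rightarrow> real \<Rightarrow> complex \<Rightarrow> complex" where
  "Fu a c u = exp ((of_real a * (u - 1) - of_real c) * (clog u - clog (u - 1)))"

lemma Fu_differentiable:
  assumes "u \<in> uhp" "u \<noteq> 0" "u \<noteq> 1" shows "Fu a c field_differentiable at u"
proof -
  have u1: "u - 1 \<in> uhp" "u - 1 \<noteq> 0" using assms by (auto simp: uhp_def)
  define d0 d1 where "d0 = inverse (- \<i> * u) * (- \<i>)" and "d1 = inverse (- \<i> * (u - 1)) * (- \<i>)"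
  have 0: "(clog has_field_derivative d0) (at u)" unfolding d0_def by (rule DERIV_clog[OF assms(1,2)])
  have "((\<lambda>u. u - 1) has_field_derivative 1) (at u)" by (auto intro!: derivative_eq_intros)
  from DERIV_chain2[OF DERIV_clog[OF u1] this]
  have 1: "((\<lambda>u. clog (u - 1)) has_field_derivative d1) (at u)" by (simp add: d1_def)
  have "((\<lambda>u. (of_real a * (u - 1) - of_real c) * (clog u - clog (u - 1))) has_field_derivative
     of_real a * (clog u - clog (u - 1)) + (d0 - d1) * (of_real a * (u - 1) - of_real c)) (at u)"
    by (rule derivative_eq_intros 0 1 refl | simp)+
  from DERIV_chain2[OF DERIV_exp this] show ?thesis
    unfolding Fu_def[abs_def] field_differentiable_def by blast
qed

lemma abs_x_ln_le:
  fixes v :: real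
  shows "v > 0 \<Longrightarrow> v \<le> 3 \<Longrightarrow> \<bar>v * ln v\<bar> \<le> 6" "v > 0 \<Longrightarrow> v \<le> 1 \<Longrightarrow> \<bar>v * ln v\<bar> \<le> 1"
proof -
  have lo: "v * ln v \<ge> v - 1" if "v > 0" for v :: real
  proof -
    have "ln (1 / v) \<le> 1 / v - 1" using that by (intro ln_le_minus_one) simp
    then have "- ln v \<le> 1 / v - 1" using that by (simp add: ln_div)
    then have "v * (- ln v) \<le> v * (1 / v - 1)" using that by (intro mult_left_mono) auto
    then show ?thesis using that by (simp add: algebra_simps)
  qed
  have up: "v * ln v \<le> v * (v - 1)" if "v > 0" for v :: real
    using that ln_le_minus_one[of v] by (intro mult_left_mono) auto
  { assume v: "v > 0" "v \<le> 3"
    have "v * (v - 1) \<le> 3 * 2"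
    proof (cases "v \<ge> 1")
      case False
      then have "v * (v - 1) \<le> 0" using v by (intro mult_nonneg_nonpos) auto
      then show ?thesis by linarith
    qed (use v in \<open>intro mult_mono, auto\<close>)
    then show "\<bar>v * ln v\<bar> \<le> 6" using lo[OF v(1)] up[OF v(1)] v by linarith }
  { assume v: "v > 0" "v \<le> 1"
    have "v * (v - 1) \<le> 0" using v by (intro mult_nonneg_nonpos) auto
    then show "\<bar>v * ln v\<bar> \<le> 1" using lo[OF v(1)] up[OF v(1)] v by linarith }
qed

text \<open>
  Near 0 the factor \<open>a (u - 1) - c\<close> tends to \<open>- (a + c)\<close>, which gives the power of \<open>norm u\<close>. Near 1 it tends to
  \<open>- c \<le> 0\<close> while the second logarithm enters with a minus sign, so the function stays bounded there.
\<close>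

lemma norm_Fu_le:
  assumes a: "a > 0" and c: "0 \<le> c" and u: "u \<in> uhp" "u \<noteq> 0" "u \<noteq> 1" "norm u \<le> 2"
  shows "norm (Fu a c u) \<le> exp (9 * a + 3 * c + 8 * pi * a) * norm u powr (- (a + c))"
proof -
  define x where "x = Re u"
  define y where "y = Im u"
  define v where "v = norm (u - 1)"
  define \<theta> where "\<theta> = Im (clog u) - Im (clog (u - 1))"
  have v: "v > 0" "v \<le> 3" using u norm_triangle_ineq4[of u 1] by (auto simp: v_def)
  have nu: "norm u > 0" using u by simp
  have xb: "\<bar>x\<bar> \<le> norm u" "\<bar>y\<bar> \<le> 2" "\<bar>x - 1\<bar> \<le> v"
    using abs_Re_le_cmod[of u] abs_Im_le_cmod[of u] abs_Re_le_cmod[of "u - 1"] u(4) by (auto simp: x_def y_def v_def)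
  have th: "\<bar>\<theta>\<bar> \<le> 4 * pi" unfolding \<theta>_def
    using abs_Im_clog_le[of u] abs_Im_clog_le[of "u - 1"] u by auto
  have "Re ((of_real a * (u - 1) - of_real c) * (clog u - clog (u - 1)))
     = (a * (x - 1) - c) * (ln (norm u) - ln v) - a * y * \<theta>"
    using u by (simp add: Re_clog x_def y_def v_def \<theta>_def)
  also have "\<dots> = - (a + c) * ln (norm u) + a * (x * ln (norm u)) - a * ((x - 1) * ln v) + c * ln v - a * y * \<theta>"
    by (simp add: algebra_simps)
  also have "\<dots> \<le> - (a + c) * ln (norm u) + a * 2 + a * 6 + c * 3 + 8 * pi * a"
  proof -
    have 1: "x * ln (norm u) \<le> 2"
    proof (cases "norm u \<le> 1")
      case True
      have "x * ln (norm u) \<le> \<bar>x\<bar> * \<bar>ln (norm u)\<bar>" by (metis abs_ge_self abs_mult)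
      also have "\<dots> \<le> norm u * \<bar>ln (norm u)\<bar>" using xb by (intro mult_right_mono) auto
      also have "\<dots> = \<bar>norm u * ln (norm u)\<bar>" by (simp add: abs_mult)
      also have "\<dots> \<le> 1" using abs_x_ln_le(2)[OF nu True] .
      finally show ?thesis by simp
    next
      case False
      have "ln (norm u) \<le> 1" "ln (norm u) \<ge> 0" using ln_le_minus_one[OF nu] u(4) False by auto
      then have "x * ln (norm u) \<le> 2 * ln (norm u)" using xb u(4) by (intro mult_right_mono) auto
      then show ?thesis using \<open>ln (norm u) \<le> 1\<close> by linarith
    qed
    have 2: "- ((x - 1) * ln v) \<le> 6"
    proof -
      have "- ((x - 1) * ln v) \<le> \<bar>x - 1\<bar> * \<bar>ln v\<bar>" by (metis abs_ge_minus_self abs_mult)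
      also have "\<dots> \<le> v * \<bar>ln v\<bar>" using xb by (intro mult_right_mono) auto
      also have "\<dots> = \<bar>v * ln v\<bar>" using v by (simp add: abs_mult)
      finally show ?thesis using abs_x_ln_le(1)[OF v] by linarith
    qed
    have 3: "ln v \<le> 3" using ln_le_minus_one[OF v(1)] v by linarith
    have 4: "- (y * \<theta>) \<le> 8 * pi"
    proof -
      have "- (y * \<theta>) \<le> \<bar>y\<bar> * \<bar>\<theta>\<bar>" by (metis abs_ge_minus_self abs_mult)
      also have "\<dots> \<le> 2 * (4 * pi)" using xb th by (intro mult_mono) auto
      finally show ?thesis by simp
    qed
    have a0: "0 \<le> a" using a by simp
    have "a * (x * ln (norm u)) \<le> a * 2" "a * (- ((x - 1) * ln v)) \<le> a * 6" "c * ln v \<le> c * 3" "a * (- (y * \<theta>)) \<le> a * (8 * pi)"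
      by (rule mult_left_mono[OF 1 a0] mult_left_mono[OF 2 a0] mult_left_mono[OF 3 c] mult_left_mono[OF 4 a0])+
    then show ?thesis by (simp add: algebra_simps)
  qed
  also have "\<dots> \<le> - (a + c) * ln (norm u) + (9 * a + 3 * c + 8 * pi * a)" using a by simp
  finally have "norm (Fu a c u) \<le> exp (- (a + c) * ln (norm u) + (9 * a + 3 * c + 8 * pi * a))"
    unfolding Fu_def norm_exp_eq_Re by simp
  also have "\<dots> = exp (9 * a + 3 * c + 8 * pi * a) * norm u powr (- (a + c))"
    using nu by (simp add: powr_def exp_add[symmetric] add.commute)
  finally show ?thesis .
qed

lemma Fu_series:
  assumes u: "u \<in> uhp" "norm u > 1"
  shows "(\<lambda>n. ecoef a c n * (1 / u) ^ n) sums (Fu a c u / of_real (exp a))"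
proof -
  have u0: "u \<noteq> 0" using u by auto
  define z where "z = 1 / u"
  have z: "norm z < 1" "z \<noteq> 0" using u u0 by (auto simp: z_def norm_divide)
  have z1: "1 - z \<noteq> 0" using z by auto
  have ReLn: "\<bar>Im (Ln (1 - z))\<bar> < pi / 2"
  proof (rule Re_Ln_pos_lt_imp)
    show "0 < Re (1 - z)" using z complex_Re_le_cmod[of z] by simp
  qed
  have w0: "- \<i> * u \<noteq> 0" using u0 by simp
  have Re0: "Re (- \<i> * u) \<ge> 0" using u by (simp add: uhp_def)
  have ImLn: "\<bar>Im (Ln (- \<i> * u))\<bar> \<le> pi / 2"
    using Re_Ln_pos_le[OF w0] Re0 by blast
  have "Ln ((- \<i> * u) * (1 - z)) = Ln (- \<i> * u) + Ln (1 - z)"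
    by (rule Ln_times_simple) (use w0 z1 ReLn ImLn in auto)
  moreover have "(- \<i> * u) * (1 - z) = - \<i> * (u - 1)" using u0 by (simp add: z_def algebra_simps)
  ultimately have L: "Ln (- \<i> * (u - 1)) = Ln (- \<i> * u) + Ln (1 - z)" by (simp only:)
  have "clog u - clog (u - 1) = - Ln (1 - z)" unfolding clog_def L by (simp add: algebra_simps)
  moreover have "(of_real a * (u - 1) - of_real c) * (- Ln (1 - z)) = (of_real (a + c) - of_real a / z) * Ln (1 - z)"
    by (simp add: z_def algebra_simps)
  ultimately have "Fu a c u = exp ((of_real (a + c) - of_real a / z) * Ln (1 - z))"
    unfolding Fu_def by (simp only:)
  then have e: "Fu a c u / of_real (exp a) = exp ((of_real (a + c) - of_real a / z) * Ln (1 - z) - of_real a)"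
    by (simp add: exp_diff exp_of_real[symmetric])
  show ?thesis unfolding e using egf_closed_form[OF z, of a c] unfolding z_def .
qed

text \<open>
  A bounded factor, tending to 1, with simple zeros at the branch points 0 and 1. It makes the integrand continuous on the
  closed half disc, so Cauchy's theorem applies with two exceptional points; the factor is removed by dominated
  convergence.
\<close>

definition damp :: "nat \<Rightarrow> complex \<Rightarrow> complex" where
  "damp k u = u / (u + \<i> / of_nat (Suc k)) * ((u - 1) / (u - 1 + \<i> / of_nat (Suc k)))"

lemma norm_add_ii:
  assumes "u \<in> uhp" "e > 0"
  shows "norm u \<le> norm (u + \<i> * of_real e)" "e \<le> norm (u + \<i> * of_real e)"
proof -
  show "norm u \<le> norm (u + \<i> * of_real e)"
    unfolding cmod_def using assms by (auto simp: uhp_def intro!: real_sqrt_le_mono power_mono)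
  have "e \<le> Im (u + \<i> * of_real e)" using assms by (simp add: uhp_def)
  then show "e \<le> norm (u + \<i> * of_real e)" using abs_Im_le_cmod[of "u + \<i> * of_real e"] by linarith
qed

lemma ii_div_nat: "\<i> / of_nat (Suc k) = \<i> * of_real (1 / real (Suc k))"
  by (simp add: divide_inverse)

lemma norm_frac_le:
  assumes "u \<in> uhp"
  shows "norm (u / (u + \<i> / of_nat (Suc k))) \<le> 1" "norm (u / (u + \<i> / of_nat (Suc k))) \<le> real (Suc k) * norm u"
    "u + \<i> / of_nat (Suc k) \<noteq> 0"
proof -
  have p: "1 / real (Suc k) > 0" by simp
  note n = norm_add_ii[OF assms p, folded ii_div_nat]
  have pos: "norm (u + \<i> / of_nat (Suc k)) > 0" using n(2) p by linarith
  then show "u + \<i> / of_nat (Suc k) \<noteq> 0" by auto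
  show "norm (u / (u + \<i> / of_nat (Suc k))) \<le> 1" using n(1) pos by (simp add: norm_divide divide_le_eq)
  have "norm u / norm (u + \<i> / of_nat (Suc k)) \<le> norm u / (1 / real (Suc k))"
    using n(2) pos p by (intro divide_left_mono mult_pos_pos) auto
  then show "norm (u / (u + \<i> / of_nat (Suc k))) \<le> real (Suc k) * norm u" by (simp add: norm_divide mult.commute)
qed

lemma damp_bounds:
  assumes "u \<in> uhp"
  shows "norm (damp k u) \<le> 1" "norm (damp k u) \<le> real (Suc k) * norm u" "norm (damp k u) \<le> real (Suc k) * norm (u - 1)"
proof -
  have u1: "u - 1 \<in> uhp" using assms by (simp add: uhp_def)
  note a = norm_frac_le[OF assms, of k] and b = norm_frac_le[OF u1, of k]
  have e: "norm (damp k u) = norm (u / (u + \<i> / of_nat (Suc k))) * norm ((u - 1) / (u - 1 + \<i> / of_nat (Suc k)))"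
    by (simp only: damp_def norm_mult)
  show "norm (damp k u) \<le> 1" unfolding e using mult_mono[OF a(1) b(1)] by simp
  show "norm (damp k u) \<le> real (Suc k) * norm u" unfolding e using mult_mono[OF a(2) b(1)] by simp
  show "norm (damp k u) \<le> real (Suc k) * norm (u - 1)" unfolding e using mult_mono[OF a(1) b(2)] by simp
qed

lemma damp_tendsto:
  assumes "u \<noteq> 0" "u \<noteq> 1" shows "(\<lambda>k. damp k u) \<longlonglongrightarrow> 1"
proof -
  have "(\<lambda>k. \<i> * of_real (inverse (real (Suc k)))) \<longlonglongrightarrow> \<i> * of_real 0"
    by (intro tendsto_intros LIMSEQ_inverse_real_of_nat)
  then have l: "(\<lambda>k. \<i> / of_nat (Suc k)) \<longlonglongrightarrow> 0"
    by (simp add: divide_inverse del: of_nat_Suc)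
  have "(\<lambda>k. u / (u + \<i> / of_nat (Suc k)) * ((u - 1) / (u - 1 + \<i> / of_nat (Suc k)))) \<longlonglongrightarrow> u / (u + 0) * ((u - 1) / (u - 1 + 0))"
    by (intro tendsto_intros l) (use assms in auto)
  then show ?thesis unfolding damp_def using assms by simp
qed

lemma damp_differentiable:
  assumes "u \<in> uhp" shows "damp k field_differentiable at u"
proof -
  have u1: "u - 1 \<in> uhp" using assms by (simp add: uhp_def)
  show ?thesis unfolding damp_def[abs_def]
    by (intro field_differentiable_mult field_differentiable_divide field_differentiable_add field_differentiable_diff
        field_differentiable_const field_differentiable_ident norm_frac_le(3) assms u1)
qed

definition halfdisc :: "complex set" where "halfdisc = uhp \<inter> cball 0 2"

lemma convex_halfdisc: "convex halfdisc"
proof -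
  have "uhp = {u. \<i> \<bullet> u \<ge> 0}" by (auto simp: uhp_def inner_complex_def)
  then have "convex uhp" using convex_halfspace_ge[of 0 \<i>] by simp
  then show ?thesis unfolding halfdisc_def by (intro convex_Int convex_cball)
qed

definition growth_const :: "real \<Rightarrow> real \<Rightarrow> nat \<Rightarrow> real" where
  "growth_const a c n = exp (9 * a + 3 * c + 8 * pi * a) * 2 ^ (n - 2)"

definition Gk :: "real \<Rightarrow> real \<Rightarrow> nat \<Rightarrow> nat \<Rightarrow> complex \<Rightarrow> complex" where
  "Gk a c n k u = Fu a c u * u ^ n * damp k u"

text \<open>
  The integrand without the damping factor, set to 0 at the two branch points so that it is the pointwise limit everywhere.
\<close>

definition Glim :: "real \<Rightarrow> real \<Rightarrow> nat \<Rightarrow> complex \<Rightarrow> complex" where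
  "Glim a c n u = (if u = 0 \<or> u = 1 then 0 else Fu a c u * u ^ n)"

definition upper_arc :: "real \<Rightarrow> complex" where "upper_arc = part_circlepath 0 2 0 pi"

lemma upper_arc_props:
  "valid_path upper_arc" "path_image upper_arc \<subseteq> halfdisc" "\<And>u. u \<in> path_image upper_arc \<Longrightarrow> norm u = 2"
  "pathstart upper_arc = 2" "pathfinish upper_arc = -2"
proof -
  show "valid_path upper_arc" unfolding upper_arc_def by simp
  have im: "path_image upper_arc = (\<lambda>t. 0 + 2 * exp (\<i> * of_real t)) ` {0..pi}"
    unfolding upper_arc_def using path_image_part_circlepath[of 0 pi 0 2] pi_ge_zero by (auto simp: image_def)
  show n2: "\<And>u. u \<in> path_image upper_arc \<Longrightarrow> norm u = 2" unfolding im by (auto simp: norm_mult)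
  show "path_image upper_arc \<subseteq> halfdisc"
  proof
    fix u assume u: "u \<in> path_image upper_arc"
    then obtain t where t: "t \<in> {0..pi}" "u = 2 * exp (\<i> * of_real t)" unfolding im by auto
    have "Im u = 2 * sin t" unfolding t(2) by (simp add: Im_exp)
    then have "Im u \<ge> 0" using t(1) by (simp add: sin_ge_zero)
    then show "u \<in> halfdisc" using n2[OF u] by (simp add: halfdisc_def uhp_def)
  qed
  show "pathstart upper_arc = 2" "pathfinish upper_arc = -2" unfolding upper_arc_def by (auto simp: exp_pi_i)
qed

context
  fixes a c :: real and n :: nat
  assumes a: "a > 0" and c: "0 \<le> c" and ac: "a + c < 3" and n: "n \<ge> 2"
begin

lemma growth_const_pos: "growth_const a c n > 0" by (simp add: growth_const_def)

lemma norm_Fu_pow_le: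
  assumes u: "u \<in> halfdisc" "u \<noteq> 0" "u \<noteq> 1"
  shows "norm (Fu a c u * u ^ n) \<le> growth_const a c n * norm u powr (2 - (a + c))"
proof -
  have u': "u \<in> uhp" "norm u \<le> 2" "norm u > 0" using u by (auto simp: halfdisc_def)
  have "norm (Fu a c u * u ^ n) = norm (Fu a c u) * norm u ^ n" by (simp add: norm_mult norm_power)
  also have "norm u ^ n = norm u ^ (n - 2) * norm u ^ 2" by (metis n le_add_diff_inverse2 power_add)
  also have "norm (Fu a c u) * (norm u ^ (n - 2) * norm u ^ 2)
      \<le> (exp (9 * a + 3 * c + 8 * pi * a) * norm u powr (- (a + c))) * (2 ^ (n - 2) * norm u ^ 2)"
    using norm_Fu_le[OF a c u'(1) u(2,3) u'(2)] u' by (intro mult_mono power_mono) auto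
  also have "\<dots> = growth_const a c n * (norm u powr (- (a + c)) * norm u ^ 2)" by (simp add: growth_const_def)
  also have "norm u powr (- (a + c)) * norm u ^ 2 = norm u powr (2 - (a + c))"
  proof -
    have "norm u powr (- (a + c)) * norm u powr 2 = norm u powr (- (a + c) + 2)" by (rule powr_add[symmetric])
    moreover have "norm u powr 2 = norm u ^ 2" using u'(3) by simp
    moreover have "- (a + c) + 2 = 2 - (a + c)" by simp
    ultimately show ?thesis by (simp only:)
  qed
  finally show ?thesis .
qed

lemma Gk_zero: "Gk a c n k 0 = 0" "Gk a c n k 1 = 0"
  by (auto simp: Gk_def damp_def)

lemma norm_Gk_le:
  assumes u: "u \<in> halfdisc"
  shows "norm (Gk a c n k u) \<le> growth_const a c n * norm u powr (2 - (a + c))"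
proof (cases "u = 0 \<or> u = 1")
  case True then show ?thesis using Gk_zero growth_const_pos by auto
next
  case False
  have "norm (Gk a c n k u) = norm (Fu a c u * u ^ n) * norm (damp k u)" unfolding Gk_def norm_mult ..
  also have "\<dots> \<le> (growth_const a c n * norm u powr (2 - (a + c))) * 1"
    using norm_Fu_pow_le[OF u] damp_bounds(1)[of u k] u False growth_const_pos
    by (intro mult_mono) (auto simp: halfdisc_def)
  finally show ?thesis by simp
qed

lemma Gk_differentiable:
  assumes "u \<in> halfdisc" "u \<noteq> 0" "u \<noteq> 1" shows "Gk a c n k field_differentiable at u"
  unfolding Gk_def[abs_def] using assms
  by (intro field_differentiable_mult field_differentiable_power field_differentiable_ident Fu_differentiable damp_differentiable)
     (auto simp: halfdisc_def)

lemma continuous_on_Gk: "continuous_on halfdisc (Gk a c n k)"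
  unfolding continuous_on_eq_continuous_within
proof
  fix u assume u: "u \<in> halfdisc"
  consider "u = 0" | "u = 1" | "u \<noteq> 0" "u \<noteq> 1" by blast
  then show "continuous (at u within halfdisc) (Gk a c n k)"
  proof cases
    case 3
    then show ?thesis
      using field_differentiable_imp_continuous_at[OF Gk_differentiable[OF u]] continuous_at_imp_continuous_within by blast
  next
    case 1
    have "(Gk a c n k \<longlongrightarrow> 0) (at 0 within halfdisc)"
    proof (rule Lim_null_comparison)
      show "\<forall>\<^sub>F u in at 0 within halfdisc. norm (Gk a c n k u) \<le> growth_const a c n * real (Suc k) * norm u powr (3 - (a + c))"
        unfolding eventually_at_filter
      proof (rule always_eventually, intro allI impI)
        fix u :: complex assume u: "u \<noteq> 0" "u \<in> halfdisc"
        show "norm (Gk a c n k u) \<le> growth_const a c n * real (Suc k) * norm u powr (3 - (a + c))"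
        proof (cases "u = 1")
          case True then show ?thesis using Gk_zero growth_const_pos by auto
        next
          case False
          have "norm (Gk a c n k u) = norm (Fu a c u * u ^ n) * norm (damp k u)" unfolding Gk_def norm_mult ..
          also have "\<dots> \<le> (growth_const a c n * norm u powr (2 - (a + c))) * (real (Suc k) * norm u)"
            using norm_Fu_pow_le[OF u(2) u(1) False] damp_bounds(2)[of u k] u growth_const_pos
            by (intro mult_mono) (auto simp: halfdisc_def)
          also have "\<dots> = growth_const a c n * real (Suc k) * (norm u powr (2 - (a + c)) * norm u)" by simp
          also have "norm u powr (2 - (a + c)) * norm u = norm u powr (3 - (a + c))"
            using powr_add[of "norm u" "2 - (a + c)" 1] u by (simp add: algebra_simps)
          finally show ?thesis .
        qed
      qed
      have "((\<lambda>u::complex. norm u powr (3 - (a + c))) \<longlongrightarrow> 0) (at 0 within halfdisc)"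
      proof (rule tendsto_zero_powrI[where b = "3 - (a + c)"])
        show "((\<lambda>u::complex. norm u) \<longlongrightarrow> 0) (at 0 within halfdisc)"
          by (rule tendsto_norm_zero) (rule tendsto_ident_at)
      qed (use ac in auto)
      then show "((\<lambda>u. growth_const a c n * real (Suc k) * norm u powr (3 - (a + c))) \<longlongrightarrow> 0) (at 0 within halfdisc)"
        by (rule tendsto_mult_right_zero)
    qed
    then show ?thesis unfolding 1 continuous_within Gk_zero .
  next
    case 2
    have "(Gk a c n k \<longlongrightarrow> 0) (at 1 within halfdisc)"
    proof (rule Lim_null_comparison)
      show "\<forall>\<^sub>F u in at 1 within halfdisc. norm (Gk a c n k u) \<le> (growth_const a c n * norm u powr (2 - (a + c))) * (real (Suc k) * norm (u - 1))"
        unfolding eventually_at_filter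
      proof (rule always_eventually, intro allI impI)
        fix u :: complex assume u: "u \<noteq> 1" "u \<in> halfdisc"
        show "norm (Gk a c n k u) \<le> (growth_const a c n * norm u powr (2 - (a + c))) * (real (Suc k) * norm (u - 1))"
        proof (cases "u = 0")
          case True then show ?thesis using Gk_zero by auto
        next
          case False
          have "norm (Gk a c n k u) = norm (Fu a c u * u ^ n) * norm (damp k u)" unfolding Gk_def norm_mult ..
          also have "\<dots> \<le> (growth_const a c n * norm u powr (2 - (a + c))) * (real (Suc k) * norm (u - 1))"
            using norm_Fu_pow_le[OF u(2) False u(1)] damp_bounds(3)[of u k] u growth_const_pos
            by (intro mult_mono) (auto simp: halfdisc_def)
          finally show ?thesis .
        qed
      qed
      have "((\<lambda>u::complex. (growth_const a c n * norm u powr (2 - (a + c))) * (real (Suc k) * norm (u - 1))) \<longlongrightarrow>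
          (growth_const a c n * norm (1::complex) powr (2 - (a + c))) * (real (Suc k) * norm (1 - 1 :: complex))) (at 1 within halfdisc)"
        by (intro tendsto_intros) auto
      then show "((\<lambda>u::complex. (growth_const a c n * norm u powr (2 - (a + c))) * (real (Suc k) * norm (u - 1))) \<longlongrightarrow> 0) (at 1 within halfdisc)"
        by simp
    qed
    then show ?thesis unfolding 2 continuous_within Gk_zero .
  qed
qed

text \<open>
  Cauchy's theorem on the convex half disc, with the exceptional points 0 and 1 on the boundary.
\<close>

lemma Gk_contour:
  "integral {-2..2} (\<lambda>x. Gk a c n k (of_real x)) + contour_integral upper_arc (Gk a c n k) = 0"
  "Gk a c n k contour_integrable_on upper_arc" "(\<lambda>x. Gk a c n k (of_real x)) integrable_on {-2..2}"
proof -
  have line: "path_image (linepath (-2) (2::complex)) \<subseteq> halfdisc"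
  proof -
    have "(-2::complex) \<in> halfdisc" "(2::complex) \<in> halfdisc" by (auto simp: halfdisc_def uhp_def)
    then show ?thesis using convex_halfdisc by (simp add: closed_segment_subset)
  qed
  have "(Gk a c n k has_contour_integral 0) (linepath (-2) 2 +++ upper_arc)"
  proof (rule Cauchy_theorem_convex[OF continuous_on_Gk convex_halfdisc, of "{0, 1}"])
    show "Gk a c n k field_differentiable at u" if "u \<in> interior halfdisc - {0, 1}" for u
      using that interior_subset Gk_differentiable by blast
    show "valid_path (linepath (-2) 2 +++ upper_arc)" by (rule valid_path_join) (use upper_arc_props in auto)
    show "path_image (linepath (-2) 2 +++ upper_arc) \<subseteq> halfdisc"
      using upper_arc_props line by (intro order_trans[OF path_image_join_subset]) auto
  qed (use upper_arc_props in auto)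
  moreover have l: "Gk a c n k contour_integrable_on linepath (-2) 2"
    by (rule contour_integrable_continuous_linepath) (use continuous_on_subset[OF continuous_on_Gk line] in simp)
  moreover show ar: "Gk a c n k contour_integrable_on upper_arc"
    unfolding upper_arc_def by (rule contour_integrable_continuous_part_circlepath)
      (use continuous_on_subset[OF continuous_on_Gk upper_arc_props(2)] in \<open>simp add: upper_arc_def\<close>)
  ultimately have "contour_integral (linepath (-2) 2) (Gk a c n k) + contour_integral upper_arc (Gk a c n k) = 0"
    using contour_integral_join[OF l ar _ upper_arc_props(1)] by (simp add: contour_integral_unique)
  moreover have "contour_integral (linepath (-2) 2) (Gk a c n k) = integral {-2..2} (\<lambda>x. Gk a c n k (of_real x))"
    by (subst contour_integral_linepath_Reals_eq) auto
  ultimately show "integral {-2..2} (\<lambda>x. Gk a c n k (of_real x)) + contour_integral upper_arc (Gk a c n k) = 0" by simp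
  have "continuous_on {-2..2} (\<lambda>x. Gk a c n k (of_real x))"
    by (rule continuous_on_compose2[OF continuous_on_Gk]) (auto intro!: continuous_intros simp: halfdisc_def uhp_def)
  then show "(\<lambda>x. Gk a c n k (of_real x)) integrable_on {-2..2}" by (rule integrable_continuous_real)
qed

lemma Gk_tendsto: "(\<lambda>k. Gk a c n k u) \<longlonglongrightarrow> Glim a c n u"
proof (cases "u = 0 \<or> u = 1")
  case True then show ?thesis using Gk_zero by (auto simp: Glim_def)
next
  case False
  then have "(\<lambda>k. Fu a c u * u ^ n * damp k u) \<longlonglongrightarrow> Fu a c u * u ^ n * 1"
    by (intro tendsto_mult tendsto_const damp_tendsto) auto
  then show ?thesis using False by (simp add: Gk_def Glim_def)
qed

lemma abs_powr_integrable: "(\<lambda>x. growth_const a c n * \<bar>x\<bar> powr (2 - (a + c))) integrable_on {-2..2::real}"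
proof -
  have 1: "((\<lambda>x. x powr (2 - (a + c))) has_integral (2 powr (2 - (a + c) + 1) / (2 - (a + c) + 1))) {0..2}"
    by (rule has_integral_powr_from_0) (use ac in auto)
  then have 2: "(\<lambda>x. \<bar>x\<bar> powr (2 - (a + c))) integrable_on {0..2}"
    by (metis (no_types, lifting) abs_of_nonneg atLeastAtMost_iff has_integral_eq has_integral_integrable)
  then have 3: "(\<lambda>x. \<bar>x\<bar> powr (2 - (a + c))) integrable_on {-2..0}"
    using Henstock_Kurzweil_Integration.integrable_reflect_real[where f = "\<lambda>x. \<bar>x\<bar> powr (2 - (a + c))" and a = 0 and b = 2] by simp
  have "(\<lambda>x. \<bar>x\<bar> powr (2 - (a + c))) integrable_on {-2..2}"
    by (rule Henstock_Kurzweil_Integration.integrable_combine[OF _ _ 3 2]) auto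
  then show ?thesis by (rule integrable_on_mult_right)
qed

lemma Glim_line:
  "(\<lambda>x. Glim a c n (of_real x)) integrable_on {-2..2}"
  "(\<lambda>k. integral {-2..2} (\<lambda>x. Gk a c n k (of_real x))) \<longlonglongrightarrow> integral {-2..2} (\<lambda>x. Glim a c n (of_real x))"
proof -
  have le: "norm (Gk a c n k (of_real x)) \<le> growth_const a c n * \<bar>x\<bar> powr (2 - (a + c))" if "x \<in> {-2..2}" for k x
    using norm_Gk_le[of "of_real x" k] that by (auto simp: halfdisc_def uhp_def)
  note dc = dominated_convergence[OF Gk_contour(3) abs_powr_integrable le Gk_tendsto]
  show "(\<lambda>x. Glim a c n (of_real x)) integrable_on {-2..2}" by (rule dc(1))
  show "(\<lambda>k. integral {-2..2} (\<lambda>x. Gk a c n k (of_real x))) \<longlonglongrightarrow> integral {-2..2} (\<lambda>x. Glim a c n (of_real x))" by (rule dc(2))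
qed

lemma Glim_arc: "(\<lambda>k. contour_integral upper_arc (Gk a c n k)) \<longlonglongrightarrow> contour_integral upper_arc (Glim a c n)"
proof -
  have e: "contour_integral upper_arc f = integral {0..pi} (\<lambda>t. f (0 + of_real 2 * cis t) * of_real 2 * \<i> * cis t)" for f
    unfolding upper_arc_def using contour_integral_part_circlepath_eq[of 0 pi 0 2 f] by simp
  have mem: "0 + of_real 2 * cis t \<in> halfdisc" if "t \<in> {0..pi}" for t
    using that by (auto simp: halfdisc_def uhp_def norm_mult sin_ge_zero)
  have "(\<lambda>k. integral {0..pi} (\<lambda>t. Gk a c n k (0 + of_real 2 * cis t) * of_real 2 * \<i> * cis t)) \<longlonglongrightarrow>
     integral {0..pi} (\<lambda>t. Glim a c n (0 + of_real 2 * cis t) * of_real 2 * \<i> * cis t)"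
  proof (rule dominated_convergence(2)[where h = "\<lambda>t. 2 * (growth_const a c n * 2 powr (2 - (a + c)))"])
    fix k
    have "continuous_on {0..pi} (\<lambda>t. Gk a c n k (0 + of_real 2 * cis t))"
      by (rule continuous_on_compose2[OF continuous_on_Gk]) (use mem in \<open>auto intro!: continuous_intros\<close>)
    then show "(\<lambda>t. Gk a c n k (0 + of_real 2 * cis t) * of_real 2 * \<i> * cis t) integrable_on {0..pi}"
      by (intro integrable_continuous_real continuous_intros)
    fix t assume t: "t \<in> {0..pi}"
    have "norm (Gk a c n k (0 + of_real 2 * cis t) * of_real 2 * \<i> * cis t) = 2 * norm (Gk a c n k (0 + of_real 2 * cis t))"
      by (simp add: norm_mult)
    also have "\<dots> \<le> 2 * (growth_const a c n * norm (0 + of_real 2 * cis t) powr (2 - (a + c)))"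
      by (intro mult_left_mono norm_Gk_le mem t) auto
    finally show "norm (Gk a c n k (0 + of_real 2 * cis t) * of_real 2 * \<i> * cis t) \<le> 2 * (growth_const a c n * 2 powr (2 - (a + c)))"
      by (simp add: norm_mult)
  next
    fix t
    show "(\<lambda>k. Gk a c n k (0 + of_real 2 * cis t) * of_real 2 * \<i> * cis t) \<longlonglongrightarrow> Glim a c n (0 + of_real 2 * cis t) * of_real 2 * \<i> * cis t"
      by (intro tendsto_intros Gk_tendsto)
  qed auto
  then show ?thesis unfolding e .
qed

lemma Glim_contour: "integral {-2..2} (\<lambda>x. Glim a c n (of_real x)) + contour_integral upper_arc (Glim a c n) = 0"
proof -
  have "(\<lambda>k. integral {-2..2} (\<lambda>x. Gk a c n k (of_real x)) + contour_integral upper_arc (Gk a c n k)) \<longlonglongrightarrow>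
    integral {-2..2} (\<lambda>x. Glim a c n (of_real x)) + contour_integral upper_arc (Glim a c n)"
    by (intro tendsto_add Glim_line Glim_arc)
  then show ?thesis unfolding Gk_contour(1) by (simp add: LIMSEQ_const_iff)
qed

end

definition rcoef :: "real \<Rightarrow> real \<Rightarrow> nat \<Rightarrow> nat \<Rightarrow> complex" where
  "rcoef a c n j = (if j = 0 then 0 else ecoef a c (n + 1 + j) / of_nat j)"

lemma summable_ecoef_shift:
  assumes "norm z < 1" shows "summable (\<lambda>j. ecoef a c (j + m) * z ^ j)"
proof (cases "z = 0")
  case True
  then show ?thesis using summable_finite[of "{0}" "\<lambda>j. ecoef a c (j + m) * z ^ j"] by (auto simp: power_0_left)
next
  case False
  have "summable (\<lambda>j. ecoef a c (j + m) * z ^ (j + m))"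
    using summable_ignore_initial_segment[OF summable_norm_cancel[OF summable_ecoef[OF assms, of a c]], of m] .
  then have "summable (\<lambda>j. inverse (z ^ m) * (ecoef a c (j + m) * z ^ (j + m)))" by (rule summable_mult)
  moreover have "inverse (z ^ m) * (ecoef a c (j + m) * z ^ (j + m)) = ecoef a c (j + m) * z ^ j" for j
    using False by (simp add: power_add)
  ultimately show ?thesis by simp
qed

lemma norm_rcoef_le: "norm (rcoef a c n j) \<le> norm (ecoef a c (j + (n + 1)))"
  by (auto simp: rcoef_def norm_divide divide_le_eq mult_le_cancel_left1 add_ac)

lemma summable_rcoef:
  assumes "norm z < 1" shows "summable (\<lambda>j. rcoef a c n j * z ^ j)"
proof (rule summable_comparison_test)
  have "norm (of_real (norm z) :: complex) < 1" using assms by simp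
  from summable_ecoef[OF this, of a c] have "summable (\<lambda>j. norm (ecoef a c j) * norm z ^ j)"
    by (simp add: norm_mult norm_power)
  then have s: "summable (\<lambda>j. norm (ecoef a c (j + (n + 1))) * norm z ^ (j + (n + 1)))"
    by (rule summable_ignore_initial_segment)
  show "summable (\<lambda>j. norm (ecoef a c (j + (n + 1))) * norm z ^ j)"
  proof (cases "z = 0")
    case True
    then show ?thesis using summable_finite[of "{0}" "\<lambda>j. norm (ecoef a c (j + (n + 1))) * norm z ^ j"] by (auto simp: power_0_left)
  next
    case False
    have e: "inverse (norm z ^ (n + 1)) * (norm (ecoef a c (j + (n + 1))) * norm z ^ (j + (n + 1)))
        = norm (ecoef a c (j + (n + 1))) * norm z ^ j" for j
    proof -
      define K where "K = norm z ^ (n + 1)"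
      have K: "K \<noteq> 0" using False by (simp add: K_def)
      show ?thesis unfolding power_add[of "norm z" j "n + 1"] K_def[symmetric] using K by simp
    qed
    show ?thesis using summable_mult[OF s, of "inverse (norm z ^ (n + 1))"] unfolding e .
  qed
  show "\<exists>N. \<forall>j\<ge>N. norm (rcoef a c n j * z ^ j) \<le> norm (ecoef a c (j + (n + 1))) * norm z ^ j"
    using norm_rcoef_le by (auto simp: norm_mult norm_power intro!: mult_right_mono)
qed

text \<open>
  At \<open>1 / u\<close>, this is minus a primitive in \<open>u\<close> of the part \<open>\<Sum>j. ecoef a c (n + 2 + j) u ^ (- 2 - j)\<close> of the Laurent expansion.
\<close>

definition Rser :: "real \<Rightarrow> real \<Rightarrow> nat \<Rightarrow> complex \<Rightarrow> complex" where
  "Rser a c n z = (\<Sum>j. rcoef a c n j * z ^ j)"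

definition rser :: "real \<Rightarrow> real \<Rightarrow> nat \<Rightarrow> complex \<Rightarrow> complex" where
  "rser a c n z = (\<Sum>j. ecoef a c (j + (n + 2)) * z ^ j)"

lemma DERIV_Rser:
  assumes "norm z < 1" shows "(Rser a c n has_field_derivative rser a c n z) (at z)"
proof -
  have "((\<lambda>z. \<Sum>j. rcoef a c n j * z ^ j) has_field_derivative (\<Sum>j. diffs (rcoef a c n) j * z ^ j)) (at z)"
    by (rule termdiffs_strong'[where K = 1]) (use assms summable_rcoef in auto)
  moreover have "diffs (rcoef a c n) j = ecoef a c (j + (n + 2))" for j
    by (simp add: diffs_def rcoef_def add_ac del: of_nat_Suc)
  ultimately show ?thesis unfolding Rser_def[abs_def] rser_def by simp
qed

lemma Im_Rser_real:
  assumes "\<bar>x\<bar> < 1" shows "Im (Rser a c n (of_real x)) = 0"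
proof -
  have s: "(\<lambda>j. rcoef a c n j * of_real x ^ j) sums Rser a c n (of_real x)"
    unfolding Rser_def by (intro summable_sums summable_rcoef) (use assms in simp)
  have z: "Im (rcoef a c n j * of_real x ^ j) = 0" for j
  proof -
    have "Im (ecoef a c m) = 0" for m by (cases m) (auto simp: ecoef_def)
    then have "Im (rcoef a c n j) = 0" by (simp add: rcoef_def Im_divide_of_nat)
    then show ?thesis by (simp flip: of_real_power)
  qed
  have "(\<lambda>j. 0) sums Im (Rser a c n (of_real x))" using sums_Im[OF s] unfolding z .
  then show ?thesis by (simp add: sums_iff)
qed

text \<open>
  A primitive of the integrand over \<open>e\<^sup>a\<close> except for the residue term \<open>ecoef a c (n + 1) / u\<close>.
\<close>

definition Qprim :: "real \<Rightarrow> real \<Rightarrow> nat \<Rightarrow> complex \<Rightarrow> complex" where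
  "Qprim a c n u = (\<Sum>k\<le>n. ecoef a c k * (u ^ (n - k + 1) / of_nat (n - k + 1))) - Rser a c n (1 / u)"

lemma DERIV_Qprim:
  assumes "norm u > 1"
  shows "(Qprim a c n has_field_derivative ((\<Sum>k\<le>n. ecoef a c k * u ^ (n - k)) + rser a c n (1 / u) / u\<^sup>2)) (at u)"
proof -
  have "norm u > 0" using assms by linarith
  then have u: "u \<noteq> 0" "norm (1 / u) < 1" using assms by (auto simp: norm_divide)
  have p: "((\<lambda>u. u ^ (n - k + 1) / of_nat (n - k + 1)) has_field_derivative u ^ (n - k)) (at u)" for k
  proof -
    have "((\<lambda>u. u ^ Suc (n - k)) has_field_derivative of_nat (Suc (n - k)) * u ^ (n - k)) (at u)"
      by (auto intro!: derivative_eq_intros simp del: of_nat_Suc power_Suc)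
    from DERIV_cdivide[OF this, of "of_nat (Suc (n - k))"] show ?thesis
      by (simp del: of_nat_Suc power_Suc)
  qed
  have i: "((\<lambda>u. 1 / u) has_field_derivative - (1 / u\<^sup>2)) (at u)"
    using u by (auto intro!: derivative_eq_intros simp: power2_eq_square)
  have r: "((\<lambda>u. Rser a c n (1 / u)) has_field_derivative rser a c n (1 / u) * - (1 / u\<^sup>2)) (at u)"
    by (rule DERIV_chain2[OF DERIV_Rser[OF u(2)] i])
  have "(Qprim a c n has_field_derivative ((\<Sum>k\<le>n. ecoef a c k * u ^ (n - k)) - rser a c n (1 / u) * - (1 / u\<^sup>2))) (at u)"
    unfolding Qprim_def[abs_def] by (intro DERIV_diff DERIV_sum DERIV_cmult p r)
  then show ?thesis by simp
qed

lemma Fu_pow_decomp: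
  assumes u: "u \<in> uhp" "norm u > 1"
  shows "Fu a c u * u ^ n = of_real (exp a) * ((\<Sum>k\<le>n. ecoef a c k * u ^ (n - k)) + rser a c n (1 / u) / u\<^sup>2
           + ecoef a c (n + 1) / u)"
proof -
  have "norm u > 0" using u by linarith
  then have u0: "u \<noteq> 0" and z: "norm (1 / u) < 1" using u by (auto simp: norm_divide)
  have s: "(\<lambda>k. ecoef a c k * (1 / u) ^ k) sums (Fu a c u / of_real (exp a))" by (rule Fu_series[OF u])
  have "(\<lambda>k. ecoef a c (k + (n + 2)) * (1 / u) ^ (k + (n + 2))) sums (rser a c n (1 / u) * (1 / u) ^ (n + 2))"
  proof -
    have "(\<lambda>j. ecoef a c (j + (n + 2)) * (1 / u) ^ j * (1 / u) ^ (n + 2)) sums (rser a c n (1 / u) * (1 / u) ^ (n + 2))"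
      unfolding rser_def by (intro sums_mult2 summable_sums summable_ecoef_shift z)
    then show ?thesis by (simp only: power_add mult.assoc)
  qed
  then have "(\<lambda>k. ecoef a c k * (1 / u) ^ k) sums (rser a c n (1 / u) * (1 / u) ^ (n + 2) + (\<Sum>k<n + 2. ecoef a c k * (1 / u) ^ k))"
    by (subst (asm) sums_iff_shift)
  then have "Fu a c u / of_real (exp a) = rser a c n (1 / u) * (1 / u) ^ (n + 2) + (\<Sum>k<n + 2. ecoef a c k * (1 / u) ^ k)"
    using s sums_unique2 by blast
  then have "Fu a c u = of_real (exp a) * (rser a c n (1 / u) * (1 / u) ^ (n + 2) + (\<Sum>k<n + 2. ecoef a c k * (1 / u) ^ k))"
    by (simp add: field_simps)
  then have "Fu a c u * u ^ n = of_real (exp a) * (rser a c n (1 / u) * ((1 / u) ^ (n + 2) * u ^ n) + (\<Sum>k<n + 2. ecoef a c k * ((1 / u) ^ k * u ^ n)))"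
    by (simp only: distrib_right sum_distrib_right mult.assoc)
  also have "(1 / u) ^ (n + 2) * u ^ n = 1 / u\<^sup>2"
    using u0 by (simp add: power_add power_one_over power2_eq_square field_simps)
  also have "(\<Sum>k<n + 2. ecoef a c k * ((1 / u) ^ k * u ^ n)) = (\<Sum>k\<le>n. ecoef a c k * u ^ (n - k)) + ecoef a c (n + 1) / u"
  proof -
    have "(1 / u) ^ k * u ^ n = u ^ (n - k)" if "k \<le> n" for k
      using that u0 by (simp add: power_diff power_one_over field_simps)
    then have "(\<Sum>k\<le>n. ecoef a c k * ((1 / u) ^ k * u ^ n)) = (\<Sum>k\<le>n. ecoef a c k * u ^ (n - k))" by simp
    moreover have "(1 / u) ^ (n + 1) * u ^ n = 1 / u" using u0 by (simp add: power_one_over field_simps)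
    moreover have "{..<n + 2} = insert (n + 1) {..n}" by auto
    ultimately show ?thesis by (simp del: power_Suc)
  qed
  finally show ?thesis by (simp add: algebra_simps)
qed

text \<open>
  The residue term contributes half a turn, \<open>\<i> pi\<close>, and the primitive contributes its end values.
\<close>

lemma arc_value:
  "contour_integral upper_arc (Glim a c n) = of_real (exp a) * (Qprim a c n (-2) - Qprim a c n 2 + ecoef a c (n + 1) * \<i> * of_real pi)"
proof -
  have 1: "((\<lambda>u. (\<Sum>k\<le>n. ecoef a c k * u ^ (n - k)) + rser a c n (1 / u) / u\<^sup>2) has_contour_integral (Qprim a c n (-2) - Qprim a c n 2)) upper_arc"
  proof -
    have "((\<lambda>u. (\<Sum>k\<le>n. ecoef a c k * u ^ (n - k)) + rser a c n (1 / u) / u\<^sup>2) has_contour_integral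
        (Qprim a c n (pathfinish upper_arc) - Qprim a c n (pathstart upper_arc))) upper_arc"
    proof (rule contour_integral_primitive)
      show "(Qprim a c n has_field_derivative ((\<Sum>k\<le>n. ecoef a c k * u ^ (n - k)) + rser a c n (1 / u) / u\<^sup>2)) (at u within {u. norm u > 1})"
        if "u \<in> {u. norm u > 1}" for u
        by (rule has_field_derivative_at_within[OF DERIV_Qprim]) (use that in simp)
      show "path_image upper_arc \<subseteq> {u. norm u > 1}" using upper_arc_props(3) by auto
    qed (rule upper_arc_props)
    then show ?thesis by (simp only: upper_arc_props)
  qed
  have 2: "((\<lambda>u. ecoef a c (n + 1) / u) has_contour_integral (ecoef a c (n + 1) * \<i> * of_real pi)) upper_arc"
  proof -
    have "((\<lambda>t::real. ecoef a c (n + 1) * \<i>) has_integral (pi - 0) *\<^sub>R (ecoef a c (n + 1) * \<i>)) {0..pi}"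
      using has_integral_const_real[of "ecoef a c (n + 1) * \<i>" 0 pi] by simp
    then have "((\<lambda>t. ecoef a c (n + 1) / (0 + of_real 2 * cis t) * of_real 2 * \<i> * cis t) has_integral ecoef a c (n + 1) * \<i> * of_real pi) {0..pi}"
      by (simp add: scaleR_conv_of_real mult_ac)
    then show ?thesis unfolding upper_arc_def by (subst has_contour_integral_part_circlepath_iff) auto
  qed
  have "((\<lambda>u. of_real (exp a) * (((\<Sum>k\<le>n. ecoef a c k * u ^ (n - k)) + rser a c n (1 / u) / u\<^sup>2) + ecoef a c (n + 1) / u))
     has_contour_integral (of_real (exp a) * ((Qprim a c n (-2) - Qprim a c n 2) + ecoef a c (n + 1) * \<i> * of_real pi))) upper_arc"
    by (intro has_contour_integral_lmul has_contour_integral_add 1 2)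
  then have "(Glim a c n has_contour_integral (of_real (exp a) * ((Qprim a c n (-2) - Qprim a c n 2) + ecoef a c (n + 1) * \<i> * of_real pi))) upper_arc"
  proof (rule has_contour_integral_eq)
    fix u assume u: "u \<in> path_image upper_arc"
    then have "norm u = 2" "u \<in> uhp" using upper_arc_props by (auto simp: halfdisc_def)
    then have n: "u \<in> uhp" "norm u > 1" "u \<noteq> 0" "u \<noteq> 1" by auto
    show "of_real (exp a) * (((\<Sum>k\<le>n. ecoef a c k * u ^ (n - k)) + rser a c n (1 / u) / u\<^sup>2) + ecoef a c (n + 1) / u) = Glim a c n u"
      unfolding Glim_def using n Fu_pow_decomp[OF n(1,2), of a c n] by simp
  qed
  then show ?thesis by (rule contour_integral_unique)
qed

lemma Im_Qprim_real:
  assumes "\<bar>x\<bar> > 1" shows "Im (Qprim a c n (of_real x)) = 0"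
proof -
  have e: "Im (ecoef a c m) = 0" for m by (cases m) (auto simp: ecoef_def)
  have "Im (of_real x ^ (n - k + 1) / of_nat (n - k + 1)) = 0" for k
    by (simp add: Im_divide_of_nat del: of_nat_Suc of_nat_add power_Suc flip: of_real_power)
  then have "Im (\<Sum>k\<le>n. ecoef a c k * (of_real x ^ (n - k + 1) / of_nat (n - k + 1))) = 0"
    by (simp add: e del: of_nat_Suc of_nat_add power_Suc)
  moreover have "Im (Rser a c n (of_real (1 / x))) = 0" by (rule Im_Rser_real) (use assms in \<open>simp add: divide_less_eq\<close>)
  ultimately show ?thesis unfolding Qprim_def by simp
qed

text \<open>
  All coefficients are real, so the end values of the primitive are real and only the residue term survives in the
  imaginary part.
\<close>

lemma Im_arc_value: "Im (contour_integral upper_arc (Glim a c n)) = - (exp a * dens a c n * pi)"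
proof -
  have q: "Im (Qprim a c n (-2)) = 0" "Im (Qprim a c n 2) = 0"
    using Im_Qprim_real[of "-2" a c n] Im_Qprim_real[of 2 a c n] by auto
  have e: "ecoef a c (n + 1) * \<i> * of_real pi = \<i> * of_real (- (dens a c n * pi))" by (simp add: ecoef_def)
  show ?thesis by (simp add: arc_value q ecoef_def)
qed

text \<open>
  Outside \<open>[0, 1]\<close> the two logarithms have equal imaginary parts and the integrand is real; on \<open>(0, 1)\<close> they
  differ by \<open>pi\<close>, which produces the sine in \<open>w\<close>.
\<close>

lemma Im_Glim_line:
  assumes "x \<noteq> 0" "x \<noteq> 1"
  shows "Im (Glim a c n (of_real x)) = (if x \<in> {0<..<1} then pi * (w a c (1 - x) * x ^ n) else 0)"
proof -
  have G: "Glim a c n (of_real x) = Fu a c (of_real x) * of_real (x ^ n)" using assms by (simp add: Glim_def)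
  have c1: "clog (of_real x - 1) = clog (of_real (x - 1))" by simp
  consider "x < 0" | "x > 1" | "0 < x" "x < 1" using assms by linarith
  then show ?thesis
  proof cases
    case 1
    have "Fu a c (of_real x) = of_real (exp ((a * (x - 1) - c) * (ln (- x) - ln (- (x - 1)))))"
      unfolding Fu_def c1 clog_of_real_neg[OF 1] using clog_of_real_neg[of "x - 1"] 1
      by (simp add: exp_of_real[symmetric])
    then show ?thesis unfolding G using 1 by (simp only: of_real_mult[symmetric] Im_complex_of_real) simp
  next
    case 2
    have "Fu a c (of_real x) = of_real (exp ((a * (x - 1) - c) * (ln x - ln (x - 1))))"
      unfolding Fu_def c1 using clog_of_real_pos[of x] clog_of_real_pos[of "x - 1"] 2
      by (simp add: exp_of_real[symmetric])
    then show ?thesis unfolding G using 2 by (simp only: of_real_mult[symmetric] Im_complex_of_real) simp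
  next
    case 3
    define e where "e = a * (1 - x) + c"
    have l: "clog (of_real x) - clog (of_real x - 1) = - (of_real (ln ((1 - x) / x)) + \<i> * of_real pi)"
      unfolding c1 using clog_of_real_pos[of x] clog_of_real_neg[of "x - 1"] 3 by (simp add: ln_div)
    have e2: "of_real a * (of_real x - 1) - of_real c = - complex_of_real e" by (simp add: e_def algebra_simps)
    have "Fu a c (of_real x) = exp (of_real (e * ln ((1 - x) / x)) + \<i> * of_real (pi * e))"
      unfolding Fu_def l e2 by (simp add: algebra_simps)
    also have "\<dots> = of_real (exp (e * ln ((1 - x) / x))) * cis (pi * e)"
      by (simp only: exp_add exp_of_real cis_conv_exp)
    finally have "Im (Fu a c (of_real x)) = exp (e * ln ((1 - x) / x)) * sin (pi * e)" by simp
    also have "exp (e * ln ((1 - x) / x)) = ((1 - x) / (1 - (1 - x))) powr e" using 3 by (simp add: powr_def)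
    finally have "Im (Fu a c (of_real x)) = pi * w a c (1 - x)" by (simp add: w_def e_def)
    then show ?thesis unfolding G using 3 by simp
  qed
qed

text \<open>
  The imaginary part of the contour identity. The condition \<open>a + c < 3\<close> makes \<open>x ^ n\<close> with \<open>n \<ge> 2\<close> integrable
  against the singularity of the weight.
\<close>

lemma dens_has_integral:
  assumes ac: "a > 0" "0 \<le> c" "a + c < 3" "n \<ge> 2"
  shows "((\<lambda>x. w a c (1 - x) * x ^ n) has_integral (exp a * dens a c n)) {0<..<1}"
proof -
  have i: "(\<lambda>x. Glim a c n (of_real x)) integrable_on {-2..2}" using Glim_line(1)[OF ac] .
  have "Im (integral {-2..2} (\<lambda>x. Glim a c n (of_real x))) = exp a * dens a c n * pi"
    using arg_cong[OF Glim_contour[OF ac], of Im] Im_arc_value[of a c n] by simp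
  moreover have "((\<lambda>x. Im (Glim a c n (of_real x))) has_integral Im (integral {-2..2} (\<lambda>x. Glim a c n (of_real x)))) {-2..2}"
    using has_integral_linear[OF integrable_integral[OF i] bounded_linear_Im] by (simp add: o_def)
  ultimately have "((\<lambda>x. Im (Glim a c n (of_real x))) has_integral (exp a * dens a c n * pi)) {-2..2}" by simp
  then have "((\<lambda>x. if x \<in> {0<..<1} then pi * (w a c (1 - x) * x ^ n) else 0) has_integral (exp a * dens a c n * pi)) {-2..2}"
    by (rule has_integral_spike[of "{0, 1}", rotated 2]) (use Im_Glim_line in auto)
  then have "((\<lambda>x. pi * (w a c (1 - x) * x ^ n)) has_integral (exp a * dens a c n * pi)) {0<..<1}"
    by (subst (asm) has_integral_restrict) auto
  from has_integral_mult_right[OF this, of "1 / pi"] show ?thesis by simp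
qed

lemma abs_w_le:
  assumes "a > 0" "0 \<le> c" "0 < s" "s < 1"
  shows "\<bar>w a c s\<bar> \<le> (1 - s) powr (- (a + c))"
proof -
  have e: "0 \<le> a * s + c" "a * s + c \<le> a + c" using assms by (auto simp: mult_le_cancel_left1)
  have "\<bar>w a c s\<bar> = 1 / pi * (s / (1 - s)) powr (a * s + c) * \<bar>sin (pi * (a * s + c))\<bar>"
    by (simp add: w_def abs_mult)
  also have "\<dots> \<le> 1 * (s / (1 - s)) powr (a * s + c) * 1"
    using pi_gt3 by (intro mult_mono) (auto simp: divide_le_eq)
  also have "\<dots> = s powr (a * s + c) * (1 - s) powr (- (a * s + c))"
  proof -
    define e where "e = a * s + c"
    have "(s / (1 - s)) powr e = s powr e / (1 - s) powr e" using assms by (simp add: powr_divide)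
    then show ?thesis unfolding e_def[symmetric] powr_minus by (simp add: divide_inverse)
  qed
  also have "\<dots> \<le> 1 * (1 - s) powr (- (a + c))"
  proof (intro mult_mono)
    show "s powr (a * s + c) \<le> 1" using assms e by (intro powr_le1) auto
    show "(1 - s) powr (- (a * s + c)) \<le> (1 - s) powr (- (a + c))" using assms e by (intro powr_mono') auto
  qed auto
  finally show ?thesis by simp
qed

theorem dens_integral:
  assumes ac: "a > 0" "0 \<le> c" "a + c < 3" "n \<ge> 2"
  shows "set_integrable lborel {0<..<1} (\<lambda>s. w a c s * (1 - s) ^ n)"
    and "(LINT s:{0<..<1}|lborel. w a c s * (1 - s) ^ n) = exp a * dens a c n"
proof -
  let ?g = "\<lambda>x. w a c (1 - x) * x ^ n"
  have hi: "(?g has_integral (exp a * dens a c n)) {0<..<1}" by (rule dens_has_integral[OF ac])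
  have dom: "(\<lambda>x::real. x powr (2 - (a + c))) integrable_on {0<..<1}"
  proof -
    have "((\<lambda>x. x powr (2 - (a + c))) has_integral (1 powr (2 - (a + c) + 1) / (2 - (a + c) + 1))) {0..1}"
      by (rule has_integral_powr_from_0) (use ac in auto)
    then show ?thesis by (meson has_integral_Icc_iff_Ioo has_integral_integrable)
  qed
  have le: "norm (?g x) \<le> x powr (2 - (a + c))" if x: "x \<in> {0<..<1}" for x
  proof -
    have "norm (?g x) = \<bar>w a c (1 - x)\<bar> * x ^ n" using x by (simp add: abs_mult)
    also have "\<dots> \<le> x powr (- (a + c)) * x ^ 2"
      using abs_w_le[OF ac(1,2), of "1 - x"] x ac(4) by (intro mult_mono power_decreasing) auto
    also have "x ^ 2 = x powr 2" using x by simp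
    also have "x powr (- (a + c)) * x powr 2 = x powr (2 - (a + c))"
      using powr_add[of x "- (a + c)" 2] by (simp add: algebra_simps)
    finally show ?thesis .
  qed
  have "?g absolutely_integrable_on {0<..<1}"
    by (rule absolutely_integrable_integrable_bound[OF le _ dom]) (use hi in \<open>auto simp: integrable_on_def\<close>)
  moreover have "(\<lambda>x. indicator {0<..<1} x *\<^sub>R ?g x) \<in> borel_measurable borel"
    unfolding w_def by measurable
  ultimately have li: "set_integrable lborel {0<..<1} ?g"
    unfolding set_integrable_def by (subst (asm) integrable_completion) auto
  have lv: "(LINT x:{0<..<1}|lborel. ?g x) = exp a * dens a c n"
    using set_borel_integral_eq_integral(2)[OF li] hi by (simp add: integral_unique)
  have ind: "indicator {0<..<1} (1 + (-1) * s) = (indicator {0<..<1} s :: real)" for s :: real by (auto simp: indicator_def)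
  show "set_integrable lborel {0<..<1} (\<lambda>s. w a c s * (1 - s) ^ n)"
    using lborel_integrable_real_affine[OF li[unfolded set_integrable_def], of "-1" 1]
    unfolding set_integrable_def ind by simp
  show "(LINT s:{0<..<1}|lborel. w a c s * (1 - s) ^ n) = exp a * dens a c n"
    using lborel_integral_real_affine[of "-1" "\<lambda>x. indicator {0<..<1} x *\<^sub>R ?g x" 1] lv
    unfolding set_lebesgue_integral_def ind by simp
qed

lemma dens_0: "dens a c 0 = q1 a c"
  by (subst dens.simps) (simp add: mom_def q1_def)

lemma dens_1: "dens a c 1 = q1 a c - q2 a c"
  by (subst dens.simps) (simp add: mom_def dens_0 q1_def q2_def power2_eq_square field_simps)

text \<open>
  Expanding the exponential in \<open>D\<close> leaves the moments of order at least 2, which are the coefficients; the two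
  remaining terms of \<open>D\<close> are \<open>dens_0\<close> and \<open>dens_1\<close>.
\<close>

theorem D_eq_Dser:
  assumes ac: "a > 0" "0 \<le> c" "a + c < 3"
  shows "D a c t = Dser a c t"
proof -
  define f where "f n s = indicator {0<..<1} s *\<^sub>R (t ^ (n + 2) / fact (n + 2) * (w a c s * (1 - s) ^ (n + 2)))" for n s
  note di = dens_integral[OF ac le_add2]
  have int: "integrable lborel (f n)" for n
    unfolding f_def using set_integrable_mult_right[OF di(1)[of n], of "t ^ (n + 2) / fact (n + 2)"]
    by (simp add: set_integrable_def)
  have fint: "(LINT s|lborel. f n s) = t ^ (n + 2) / fact (n + 2) * (exp a * dens a c (n + 2))" for n
  proof -
    have "(LINT s|lborel. f n s) = (LINT s:{0<..<1}|lborel. t ^ (n + 2) / fact (n + 2) * (w a c s * (1 - s) ^ (n + 2)))"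
      unfolding set_lebesgue_integral_def f_def ..
    also have "\<dots> = t ^ (n + 2) / fact (n + 2) * (exp a * dens a c (n + 2))"
      by (simp only: set_integral_mult_right di(2))
    finally show ?thesis .
  qed
  define K where "K = (LINT s|lborel. norm (f 0 s))"
  have es: "(\<lambda>n. x ^ (n + 2) / fact (n + 2)) sums (exp x - 1 - x)" for x :: real
  proof -
    have "(\<lambda>n. x ^ n / fact n) sums exp x" using exp_converges[of x] by (simp add: divide_inverse mult.commute)
    from sums_split_initial_segment[OF this, of 2] show ?thesis by (simp add: numeral_2_eq_2 algebra_simps)
  qed
  have fs: "(\<lambda>n. f n s) sums (indicator {0<..<1} s *\<^sub>R (w a c s * (exp ((1 - s) * t) - 1 - (1 - s) * t)))" for s
  proof -
    have "(\<lambda>n. (indicator {0<..<1} s * w a c s) * (((1 - s) * t) ^ (n + 2) / fact (n + 2))) sums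
      ((indicator {0<..<1} s * w a c s) * (exp ((1 - s) * t) - 1 - (1 - s) * t))"
      by (intro sums_mult es)
    moreover have "(indicator {0<..<1} s * w a c s) * (((1 - s) * t) ^ (n + 2) / fact (n + 2)) = f n s" for n
      by (simp only: f_def power_mult_distrib real_scaleR_def) simp
    ultimately show ?thesis by (simp add: mult.assoc)
  qed
  have sm1: "AE s in lborel. summable (\<lambda>n. norm (f n s))"
  proof (rule AE_I2)
    fix s
    have "summable (\<lambda>n. \<bar>indicator {0<..<1} s * w a c s\<bar> * (\<bar>(1 - s) * t\<bar> ^ (n + 2) / fact (n + 2)))"
      using es[of "\<bar>(1 - s) * t\<bar>"] by (intro summable_mult) (rule sums_summable)
    moreover have "\<bar>indicator {0<..<1} s * w a c s\<bar> * (\<bar>(1 - s) * t\<bar> ^ (n + 2) / fact (n + 2)) = norm (f n s)" for n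
      by (simp only: f_def power_mult_distrib real_scaleR_def real_norm_def abs_mult abs_divide power_abs abs_of_nonneg[OF fact_ge_zero]) simp
    ultimately show "summable (\<lambda>n. norm (f n s))" by simp
  qed
  have sm2: "summable (\<lambda>n. LINT s|lborel. norm (f n s))"
  proof (rule summable_comparison_test')
    define J where "J = (LINT s:{0<..<1}|lborel. \<bar>w a c s * (1 - s) ^ 2\<bar>)"
    have Ji: "set_integrable lborel {0<..<1} (\<lambda>s. \<bar>w a c s * (1 - s) ^ 2\<bar>)"
      using set_integrable_abs[OF di(1)[of 0]] by (simp add: power2_eq_square)
    show "summable (\<lambda>n. \<bar>t\<bar> ^ (n + 2) / fact (n + 2) * J)"
      using es[of "\<bar>t\<bar>"] by (intro summable_mult2) (rule sums_summable)
    fix n :: nat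
    have "(LINT s|lborel. norm (f n s)) \<le> (LINT s:{0<..<1}|lborel. \<bar>t\<bar> ^ (n + 2) / fact (n + 2) * \<bar>w a c s * (1 - s) ^ 2\<bar>)"
      unfolding set_lebesgue_integral_def
    proof (rule integral_mono)
      show "integrable lborel (\<lambda>s. norm (f n s))" using int by simp
      show "integrable lborel (\<lambda>s. indicator {0<..<1} s *\<^sub>R (\<bar>t\<bar> ^ (n + 2) / fact (n + 2) * \<bar>w a c s * (1 - s) ^ 2\<bar>))"
        using set_integrable_mult_right[OF Ji, of "\<bar>t\<bar> ^ (n + 2) / fact (n + 2)"] by (simp add: set_integrable_def)
      fix s :: real
      show "norm (f n s) \<le> indicator {0<..<1} s *\<^sub>R (\<bar>t\<bar> ^ (n + 2) / fact (n + 2) * \<bar>w a c s * (1 - s) ^ 2\<bar>)"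
      proof (cases "s \<in> {0<..<1}")
        case True
        have "(1 - s) ^ (n + 2) \<le> (1 - s) ^ 2" using True by (intro power_decreasing) auto
        then have "\<bar>w a c s * (1 - s) ^ (n + 2)\<bar> \<le> \<bar>w a c s * (1 - s) ^ 2\<bar>"
          using True by (auto simp: abs_mult intro!: mult_left_mono)
        then have "\<bar>t ^ (n + 2) / fact (n + 2)\<bar> * \<bar>w a c s * (1 - s) ^ (n + 2)\<bar> \<le> \<bar>t ^ (n + 2) / fact (n + 2)\<bar> * \<bar>w a c s * (1 - s) ^ 2\<bar>"
          by (intro mult_left_mono) auto
        moreover have "norm (f n s) = \<bar>t ^ (n + 2) / fact (n + 2)\<bar> * \<bar>w a c s * (1 - s) ^ (n + 2)\<bar>"
          using True by (simp add: f_def abs_mult)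
        moreover have "\<bar>t ^ (n + 2) / fact (n + 2)\<bar> = \<bar>t\<bar> ^ (n + 2) / fact (n + 2)" by (simp add: power_abs abs_mult)
        ultimately show ?thesis using True by simp
      qed (simp add: f_def)
    qed
    also have "\<dots> = \<bar>t\<bar> ^ (n + 2) / fact (n + 2) * J" by (simp only: set_integral_mult_right J_def)
    finally show "norm (LINT s|lborel. norm (f n s)) \<le> \<bar>t\<bar> ^ (n + 2) / fact (n + 2) * J" by simp
  qed
  have eq: "(\<lambda>s. \<Sum>n. f n s) = (\<lambda>s. indicator {0<..<1} s *\<^sub>R (w a c s * (exp ((1 - s) * t) - 1 - (1 - s) * t)))"
    using fs by (auto simp: sums_iff)
  have "(\<lambda>n. t ^ (n + 2) / fact (n + 2) * (exp a * dens a c (n + 2))) sums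
      (LINT s:{0<..<1}|lborel. w a c s * (exp ((1 - s) * t) - 1 - (1 - s) * t))"
    using sums_integral[OF int sm1 sm2] unfolding fint eq set_lebesgue_integral_def .
  from sums_mult[OF this, of "exp (- a)"]
  have "(\<lambda>n. dens a c (n + 2) * t ^ (n + 2) / fact (n + 2)) sums
      (exp (- a) * (LINT s:{0<..<1}|lborel. w a c s * (exp ((1 - s) * t) - 1 - (1 - s) * t)))"
    by (simp add: exp_minus field_simps del: power_Suc fact_Suc power_add)
  moreover have "(\<lambda>n. dens a c (n + 2) * t ^ (n + 2) / fact (n + 2)) sums (Dser a c t - (\<Sum>i<2. dens a c i * t ^ i / fact i))"
    unfolding Dser_def by (rule sums_split_initial_segment[OF borel_series_sums[OF geom_bounded_dens]])
  ultimately have "exp (- a) * (LINT s:{0<..<1}|lborel. w a c s * (exp ((1 - s) * t) - 1 - (1 - s) * t))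
     = Dser a c t - (\<Sum>i<2. dens a c i * t ^ i / fact i)" by (rule sums_unique2)
  then show ?thesis unfolding D_def using dens_0[of a c] dens_1[of a c] by (simp add: numeral_2_eq_2)
qed

section \<open>Semigroup law and Volterra equation\<close>

text \<open>
  The formal power series \<open>E\<close>. Formally \<open>E = exp (- g)\<close> with \<open>g\<close> linear in \<open>(a, c)\<close>, so adding parameters multiplies
  series; uniqueness for the linear differential equation proves this without exponentials of power series.
\<close>

definition efps :: "real \<Rightarrow> real \<Rightarrow> real fps" where
  "efps a c = Abs_fps (\<lambda>n. case n of 0 \<Rightarrow> 1 | Suc k \<Rightarrow> - dens a c k)"

lemma efps_nth [simp]: "efps a c $ 0 = 1" "efps a c $ Suc k = - dens a c k"
  by (auto simp: efps_def)

lemma efps_deriv: "fps_deriv (efps a c) = - (Abs_fps (mom a c) * efps a c)"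
proof (rule fps_ext)
  fix n
  have "(Abs_fps (mom a c) * efps a c) $ n = (\<Sum>i\<le>n. mom a c i * efps a c $ (n - i))"
    by (simp add: fps_mult_nth atLeast0AtMost)
  also have "\<dots> = mom a c n + (\<Sum>i<n. mom a c i * efps a c $ (n - i))"
    by (simp add: lessThan_Suc_atMost[symmetric])
  also have "(\<Sum>i<n. mom a c i * efps a c $ (n - i)) = (\<Sum>i<n. mom a c (n - Suc i) * efps a c $ (n - (n - Suc i)))"
    by (rule sum.nat_diff_reindex[symmetric])
  also have "\<dots> = (\<Sum>i<n. - (mom a c (n - 1 - i) * dens a c i))"
  proof (rule sum.cong[OF refl])
    fix i assume "i \<in> {..<n}"
    then have "n - (n - Suc i) = Suc i" by auto
    then show "mom a c (n - Suc i) * efps a c $ (n - (n - Suc i)) = - (mom a c (n - 1 - i) * dens a c i)" by simp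
  qed
  also have "mom a c n + \<dots> = (real n + 1) * dens a c n"
    unfolding dens_rec seq_conv_def by (simp add: sum_negf)
  finally show "fps_deriv (efps a c) $ n = (- (Abs_fps (mom a c) * efps a c)) $ n"
    by (simp add: algebra_simps)
qed

lemma linear_fps_ode_unique:
  fixes E E' M :: "real fps"
  assumes "fps_deriv E = - (M * E)" "fps_deriv E' = - (M * E')" "E $ 0 = E' $ 0"
  shows "E = E'"
proof (rule fps_ext)
  fix n
  have rec: "X $ Suc n = - (\<Sum>i=0..n. M $ i * X $ (n - i)) / (real n + 1)" if "fps_deriv X = - (M * X)" for X n
  proof -
    have "(real n + 1) * X $ Suc n = - (\<Sum>i=0..n. M $ i * X $ (n - i))"
      using arg_cong[OF that, of "\<lambda>f. f $ n"] by (simp add: fps_mult_nth add.commute)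
    then show ?thesis by (simp add: field_simps)
  qed
  show "E $ n = E' $ n"
  proof (induction n rule: less_induct)
    case (less n)
    show ?case
    proof (cases n)
      case (Suc k)
      have "(\<Sum>i=0..k. M $ i * E $ (k - i)) = (\<Sum>i=0..k. M $ i * E' $ (k - i))"
        using less Suc by (intro sum.cong) auto
      then show ?thesis unfolding Suc rec[OF assms(1)] rec[OF assms(2)] by simp
    qed (use assms in simp)
  qed
qed

lemma efps_mult: "efps (a + a') (c + c') = efps a' c' * efps a c"
proof (rule linear_fps_ode_unique[where M = "Abs_fps (mom a' c') + Abs_fps (mom a c)"])
  have "Abs_fps (mom (a + a') (c + c')) = Abs_fps (mom a' c') + Abs_fps (mom a c)"
    by (rule fps_ext) (simp add: mom_def add_divide_distrib)
  then show "fps_deriv (efps (a + a') (c + c')) = - ((Abs_fps (mom a' c') + Abs_fps (mom a c)) * efps (a + a') (c + c'))"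
    by (simp add: efps_deriv)
  show "fps_deriv (efps a' c' * efps a c) = - ((Abs_fps (mom a' c') + Abs_fps (mom a c)) * (efps a' c' * efps a c))"
    by (simp add: efps_deriv algebra_simps)
qed simp

lemma dens_add: "dens (a + a') (c + c') n = dens a c n + dens a' c' n - seq_conv (dens a' c') (dens a c) n"
proof -
  have "efps (a + a') (c + c') $ Suc n = (\<Sum>i=0..Suc n. efps a' c' $ i * efps a c $ (Suc n - i))"
    unfolding efps_mult fps_mult_nth ..
  also have "\<dots> = efps a c $ Suc n + (\<Sum>i=1..Suc n. efps a' c' $ i * efps a c $ (Suc n - i))"
    by (simp add: sum.atLeast_Suc_atMost)
  also have "(\<Sum>i=1..Suc n. efps a' c' $ i * efps a c $ (Suc n - i)) = efps a' c' $ Suc n + (\<Sum>i=1..n. efps a' c' $ i * efps a c $ (Suc n - i))"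
    by simp
  also have "(\<Sum>i=1..n. efps a' c' $ i * efps a c $ (Suc n - i)) = (\<Sum>i<n. dens a' c' i * dens a c (n - 1 - i))"
  proof (rule sum.reindex_bij_witness[where i = Suc and j = "\<lambda>i. i - 1"])
    fix i assume i: "i \<in> {1..n}"
    then obtain k where k: "i = Suc k" by (cases i) auto
    have "Suc n - i = Suc (n - 1 - k)" using i k by auto
    then show "dens a' c' (i - 1) * dens a c (n - 1 - (i - 1)) = efps a' c' $ i * efps a c $ (Suc n - i)"
      unfolding k by simp
  qed auto
  also have "\<dots> = (\<Sum>i<n. dens a' c' (n - Suc i) * dens a c (n - 1 - (n - Suc i)))"
    by (rule sum.nat_diff_reindex[symmetric])
  also have "\<dots> = seq_conv (dens a' c') (dens a c) n"
    unfolding seq_conv_def by (rule sum.cong) auto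
  finally show ?thesis by simp
qed

lemma Dser_0: "Dser a c 0 = a / 2 + c"
  unfolding Dser_def borel_series_0 dens_0 q1_def ..

lemma Dser_sums: "(\<lambda>n. dens a c n * t ^ n / fact n) sums Dser a c t"
  unfolding Dser_def by (rule borel_series_sums[OF geom_bounded_dens])

lemma conv_sums:
  assumes "geom_bounded r" "geom_bounded s" "t \<ge> 0"
  shows "(\<lambda>n. seq_conv r s n * t ^ n / fact n) sums integral {0..t} (\<lambda>u. borel_series r (t - u) * borel_series s u)"
    "(\<lambda>u. borel_series r (t - u) * borel_series s u) integrable_on {0..t}"
  using conv_has_integral[OF assms] summable_sums[OF conv_has_integral(2)[OF assms]]
  by (auto simp: integral_unique borel_series_def integrable_on_def)

text \<open>
  The product of two series \<open>E\<close> in terms of densities: \<open>1 - E\<close> is additive up to a convolution.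
\<close>

lemma Dser_add:
  assumes "t \<ge> 0"
  shows "Dser (a + a') (c + c') t = Dser a c t + Dser a' c' t - integral {0..t} (\<lambda>u. Dser a' c' (t - u) * Dser a c u)"
proof -
  have "(\<lambda>n. dens a c n * t ^ n / fact n + dens a' c' n * t ^ n / fact n - seq_conv (dens a' c') (dens a c) n * t ^ n / fact n)
     sums (Dser a c t + Dser a' c' t - integral {0..t} (\<lambda>u. Dser a' c' (t - u) * Dser a c u))"
    unfolding Dser_def by (intro sums_diff sums_add borel_series_sums geom_bounded_dens conv_sums assms)
  moreover have "dens a c n * t ^ n / fact n + dens a' c' n * t ^ n / fact n - seq_conv (dens a' c') (dens a c) n * t ^ n / fact n
     = dens (a + a') (c + c') n * t ^ n / fact n" for n
    unfolding dens_add by (simp add: algebra_simps add_divide_distrib diff_divide_distrib)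
  ultimately show ?thesis using Dser_sums[of "a + a'" "c + c'" t] sums_unique2 by fastforce
qed

text \<open>
  The exponential generating function of \<open>mom\<close> delayed by one index; the delay produces the factor \<open>t\<close> in the Volterra
  equation.
\<close>

definition vker :: "real \<Rightarrow> real \<Rightarrow> real \<Rightarrow> real" where
  "vker a c t = borel_series (\<lambda>n. case n of 0 \<Rightarrow> 0 | Suc k \<Rightarrow> mom a c k) t"

lemma geom_bounded_vker: "geom_bounded (\<lambda>n. case n of 0 \<Rightarrow> 0 | Suc k \<Rightarrow> mom a c k)"
  unfolding geom_bounded_def
proof (intro exI allI)
  show "\<bar>case n of 0 \<Rightarrow> 0 | Suc k \<Rightarrow> mom a c k\<bar> \<le> (\<bar>a\<bar> / 2 + \<bar>c\<bar>) * 1 ^ n" for n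
    using abs_mom_le[of a c] by (auto split: nat.split)
qed

text \<open>
  The differential equation \<open>E' = - M E\<close> seen on the side of exponential generating functions, where differentiation
  of \<open>E\<close> becomes multiplication by \<open>t\<close>.
\<close>

lemma volterra:
  assumes "t \<ge> 0"
  shows "t * Dser a c t = vker a c t - integral {0..t} (\<lambda>u. vker a c (t - u) * Dser a c u)"
proof -
  let ?s = "\<lambda>n. case n of 0 \<Rightarrow> 0 | Suc k \<Rightarrow> mom a c k"
  have sc: "seq_conv ?s (dens a c) (Suc n) = seq_conv (mom a c) (dens a c) n" for n
  proof -
    have "seq_conv ?s (dens a c) (Suc n) = (\<Sum>i<n. ?s (n - i) * dens a c i)" by (simp add: seq_conv_def)
    also have "\<dots> = (\<Sum>i<n. mom a c (n - 1 - i) * dens a c i)"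
    proof (rule sum.cong[OF refl])
      fix i assume "i \<in> {..<n}"
      then have "n - i = Suc (n - 1 - i)" by auto
      then show "?s (n - i) * dens a c i = mom a c (n - 1 - i) * dens a c i" by simp
    qed
    finally show ?thesis by (simp add: seq_conv_def)
  qed
  have "(\<lambda>n. ?s n * t ^ n / fact n - seq_conv ?s (dens a c) n * t ^ n / fact n) sums
    (vker a c t - integral {0..t} (\<lambda>u. vker a c (t - u) * Dser a c u))"
    unfolding Dser_def vker_def by (intro sums_diff borel_series_sums geom_bounded_dens geom_bounded_vker conv_sums assms)
  then have "(\<lambda>n. ?s (Suc n) * t ^ Suc n / fact (Suc n) - seq_conv ?s (dens a c) (Suc n) * t ^ Suc n / fact (Suc n)) sums
    (vker a c t - integral {0..t} (\<lambda>u. vker a c (t - u) * Dser a c u))"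
    by (subst sums_Suc_iff) simp
  moreover have "?s (Suc n) * t ^ Suc n / fact (Suc n) - seq_conv ?s (dens a c) (Suc n) * t ^ Suc n / fact (Suc n) = t * (dens a c n * t ^ n / fact n)" for n
  proof -
    have "?s (Suc n) * t ^ Suc n / fact (Suc n) - seq_conv ?s (dens a c) (Suc n) * t ^ Suc n / fact (Suc n)
      = (mom a c n - seq_conv (mom a c) (dens a c) n) * t ^ Suc n / fact (Suc n)"
      unfolding sc by (simp add: diff_divide_distrib left_diff_distrib del: fact_Suc power_Suc)
    also have "\<dots> = ((real n + 1) * dens a c n) * t ^ Suc n / fact (Suc n)" by (simp only: dens_rec)
    also have "\<dots> = t * (dens a c n * t ^ n / fact n)"
    proof -
      have f: "fact (Suc n) = (real n + 1) * (fact n :: real)" by simp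
      have nz: "real n + 1 \<noteq> 0" by linarith
      have "((real n + 1) * dens a c n) * t ^ Suc n / fact (Suc n) = ((real n + 1) * (dens a c n * (t * t ^ n))) / ((real n + 1) * fact n)"
        unfolding f power_Suc by (simp only: mult.assoc)
      also have "\<dots> = (dens a c n * (t * t ^ n)) / fact n" by (rule nonzero_mult_divide_mult_cancel_left[OF nz])
      finally show ?thesis by (simp add: mult_ac)
    qed
    finally show ?thesis .
  qed
  ultimately have "(\<lambda>n. t * (dens a c n * t ^ n / fact n)) sums (vker a c t - integral {0..t} (\<lambda>u. vker a c (t - u) * Dser a c u))"
    by (simp only:)
  moreover have "(\<lambda>n. t * (dens a c n * t ^ n / fact n)) sums (t * Dser a c t)" by (intro sums_mult Dser_sums)
  ultimately show ?thesis using sums_unique2 by blast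
qed

definition dDser :: "real \<Rightarrow> real \<Rightarrow> real \<Rightarrow> real" where
  "dDser a c t = borel_series (\<lambda>n. dens a c (Suc n)) t"

lemma DERIV_Dser: "(Dser a c has_real_derivative dDser a c t) (at t)"
  unfolding Dser_def[abs_def] dDser_def by (rule DERIV_borel_series[OF geom_bounded_dens])

definition vker' :: "real \<Rightarrow> real \<Rightarrow> real \<Rightarrow> real" where
  "vker' a c t = borel_series (mom a c) t"

text \<open>
  The derivative of the preceding equation; the boundary term vanishes since the kernel starts at 0.
\<close>

lemma volterra':
  assumes "t \<ge> 0"
  shows "Dser a c t + t * dDser a c t = vker' a c t - integral {0..t} (\<lambda>u. vker' a c (t - u) * Dser a c u)"
proof -
  have "(\<lambda>n. mom a c n * t ^ n / fact n - seq_conv (mom a c) (dens a c) n * t ^ n / fact n) sums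
    (vker' a c t - integral {0..t} (\<lambda>u. vker' a c (t - u) * Dser a c u))"
    unfolding Dser_def vker'_def by (intro sums_diff borel_series_sums geom_bounded_dens geom_bounded_mom conv_sums assms)
  moreover have "mom a c n * t ^ n / fact n - seq_conv (mom a c) (dens a c) n * t ^ n / fact n = dens a c n * t ^ n / fact n + real n * (dens a c n * t ^ n / fact n)" for n
  proof -
    have "mom a c n * t ^ n / fact n - seq_conv (mom a c) (dens a c) n * t ^ n / fact n = ((real n + 1) * dens a c n) * t ^ n / fact n"
      unfolding dens_rec by (simp add: diff_divide_distrib left_diff_distrib)
    then show ?thesis by (simp add: algebra_simps add_divide_distrib)
  qed
  moreover have "(\<lambda>n. real n * (dens a c n * t ^ n / fact n)) sums (t * dDser a c t)"
  proof -
    have "(\<lambda>n. t * (dens a c (Suc n) * t ^ n / fact n)) sums (t * dDser a c t)"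
      unfolding dDser_def by (intro sums_mult borel_series_sums geom_bounded_Suc geom_bounded_dens)
    moreover have "t * (dens a c (Suc n) * t ^ n / fact n) = real (Suc n) * (dens a c (Suc n) * t ^ Suc n / fact (Suc n))" for n
      by (simp del: of_nat_Suc)
    ultimately have "(\<lambda>n. real (Suc n) * (dens a c (Suc n) * t ^ Suc n / fact (Suc n))) sums (t * dDser a c t)" by (simp only:)
    then show ?thesis by (subst (asm) sums_Suc_iff) simp
  qed
  ultimately show ?thesis using sums_add[OF Dser_sums[of a c t], of "\<lambda>n. real n * (dens a c n * t ^ n / fact n)" "t * dDser a c t"] sums_unique2 by fastforce
qed

lemma partial_fraction_step:
  fixes N K P :: real
  assumes "N \<ge> 0" "K > 0"
  shows "P / ((N + 1) * K) - P / ((N + 2) * ((N + 1) * K)) = P / ((N + 2) * K)"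
proof -
  have "N + 1 \<noteq> 0" "N + 2 \<noteq> 0" "K \<noteq> 0" using assms by auto
  then show ?thesis by (simp add: divide_simps) (simp add: algebra_simps)
qed

lemma vker'_closed: "t * vker' a c t = c * t * exp t + a * (exp t - (exp t - 1) / t)" if "t \<noteq> 0"
proof -
  have e: "(\<lambda>n. t ^ n / fact n) sums exp t" using exp_converges[of t] by (simp add: divide_inverse mult.commute)
  have e1: "(\<lambda>n. t ^ Suc n / fact (Suc n)) sums (exp t - 1)" using e by (subst sums_Suc_iff) simp
  then have e2: "(\<lambda>n. t ^ n / fact (Suc n)) sums ((exp t - 1) / t)"
    using sums_divide[OF e1, of t] that by (simp del: fact_Suc)
  have e3: "(\<lambda>n. t ^ Suc n / fact (Suc (Suc n))) sums ((exp t - 1) / t - 1)" using e2 by (subst sums_Suc_iff) simp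
  have "(\<lambda>n. c * t * (t ^ n / fact n) + a * (t ^ Suc n / fact (Suc n) - t ^ Suc n / fact (Suc (Suc n)))) sums
     (c * t * exp t + a * ((exp t - 1) - ((exp t - 1) / t - 1)))"
    by (intro sums_add sums_mult sums_diff e e1 e3)
  moreover have "c * t * (t ^ n / fact n) + a * (t ^ Suc n / fact (Suc n) - t ^ Suc n / fact (Suc (Suc n))) = t * (mom a c n * t ^ n / fact n)" for n
  proof -
    have f: "fact (Suc n) = (real n + 1) * (fact n :: real)" "fact (Suc (Suc n)) = (real n + 2) * ((real n + 1) * (fact n :: real))"
      by (simp_all add: algebra_simps)
    have "t ^ Suc n / fact (Suc n) - t ^ Suc n / fact (Suc (Suc n)) = t ^ Suc n / ((real n + 2) * fact n)"
      unfolding f by (rule partial_fraction_step) auto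
    then show ?thesis by (simp add: mom_def distrib_right add_divide_distrib distrib_left mult_ac del: fact_Suc)
  qed
  ultimately have "(\<lambda>n. t * (mom a c n * t ^ n / fact n)) sums (c * t * exp t + a * ((exp t - 1) - ((exp t - 1) / t - 1)))" by (simp only:)
  moreover have "(\<lambda>n. t * (mom a c n * t ^ n / fact n)) sums (t * vker' a c t)"
    unfolding vker'_def by (intro sums_mult borel_series_sums geom_bounded_mom)
  ultimately have "t * vker' a c t = c * t * exp t + a * ((exp t - 1) - ((exp t - 1) / t - 1))" using sums_unique2 by blast
  then show ?thesis by (simp add: algebra_simps)
qed

lemma vker_closed: "vker a c t = c * (exp t - 1) + a * ((exp t - 1) / t - 1)" if "t \<noteq> 0"
proof -
  have e: "(\<lambda>n. t ^ n / fact n) sums exp t" using exp_converges[of t] by (simp add: divide_inverse mult.commute)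
  have e1: "(\<lambda>n. t ^ Suc n / fact (Suc n)) sums (exp t - 1)" using e by (subst sums_Suc_iff) simp
  then have e2: "(\<lambda>n. t ^ n / fact (Suc n)) sums ((exp t - 1) / t)"
    using sums_divide[OF e1, of t] that by (simp del: fact_Suc)
  have e3: "(\<lambda>n. t ^ Suc n / fact (Suc (Suc n))) sums ((exp t - 1) / t - 1)" using e2 by (subst sums_Suc_iff) simp
  have "(\<lambda>n. c * (t ^ Suc n / fact (Suc n)) + a * (t ^ Suc n / fact (Suc (Suc n)))) sums (c * (exp t - 1) + a * ((exp t - 1) / t - 1))"
    by (intro sums_add sums_mult e1 e3)
  moreover have "c * (t ^ Suc n / fact (Suc n)) + a * (t ^ Suc n / fact (Suc (Suc n))) = mom a c n * t ^ Suc n / fact (Suc n)" for n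
  proof -
    have f: "fact (Suc (Suc n)) = (real n + 2) * (fact (Suc n) :: real)" by simp
    show ?thesis unfolding f mom_def by (simp add: distrib_right add_divide_distrib del: fact_Suc power_Suc)
  qed
  ultimately have "(\<lambda>n. mom a c n * t ^ Suc n / fact (Suc n)) sums (c * (exp t - 1) + a * ((exp t - 1) / t - 1))" by (simp only:)
  then have "(\<lambda>n. (case n of 0 \<Rightarrow> 0 | Suc k \<Rightarrow> mom a c k) * t ^ n / fact n) sums (c * (exp t - 1) + a * ((exp t - 1) / t - 1))"
    using sums_Suc_iff[of "\<lambda>n. (case n of 0 \<Rightarrow> 0 | Suc k \<Rightarrow> mom a c k) * t ^ n / fact n" "c * (exp t - 1) + a * ((exp t - 1) / t - 1)"] by simp
  then show ?thesis unfolding vker_def borel_series_def by (simp add: sums_iff)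
qed

text \<open>
  The derivative of \<open>Dser\<close> at the trivial parameter pair \<open>(0, 0)\<close> in the direction \<open>(a, c)\<close>.
\<close>

definition lker :: "real \<Rightarrow> real \<Rightarrow> real \<Rightarrow> real" where
  "lker a c t = borel_series (\<lambda>n. mom a c n / (real n + 1)) t"

lemma geom_bounded_lker: "geom_bounded (\<lambda>n. mom a c n / (real n + 1))"
  unfolding geom_bounded_def
proof (intro exI allI)
  fix n
  have "\<bar>mom a c n / (real n + 1)\<bar> \<le> \<bar>mom a c n\<bar>" by (simp add: divide_le_eq mult_le_cancel_left1)
  then show "\<bar>mom a c n / (real n + 1)\<bar> \<le> (\<bar>a\<bar> / 2 + \<bar>c\<bar>) * 1 ^ n" using abs_mom_le[of a c n] by simp
qed

lemma vker_eq_lker: "vker a c t = t * lker a c t"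
proof -
  have "(\<lambda>n. t * (mom a c n / (real n + 1) * t ^ n / fact n)) sums (t * lker a c t)"
    unfolding lker_def by (intro sums_mult borel_series_sums geom_bounded_lker)
  moreover have "t * (mom a c n / (real n + 1) * t ^ n / fact n) = (case Suc n of 0 \<Rightarrow> 0 | Suc k \<Rightarrow> mom a c k) * t ^ Suc n / fact (Suc n)" for n
    by (simp add: field_simps)
  ultimately have "(\<lambda>n. (case Suc n of 0 \<Rightarrow> 0 | Suc k \<Rightarrow> mom a c k) * t ^ Suc n / fact (Suc n)) sums (t * lker a c t)" by (simp only:)
  then have "(\<lambda>n. (case n of 0 \<Rightarrow> 0 | Suc k \<Rightarrow> mom a c k) * t ^ n / fact n) sums (t * lker a c t)"
    by (subst (asm) sums_Suc_iff) simp
  then show ?thesis unfolding vker_def borel_series_def by (simp add: sums_iff)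
qed

lemma lker_scale: "lker (hh * a) (hh * c) t = hh * lker a c t"
proof -
  have "mom (hh * a) (hh * c) n / (real n + 1) = hh * (mom a c n / (real n + 1))" for n
    by (simp add: mom_def algebra_simps)
  then show ?thesis unfolding lker_def by (simp only: borel_series_cmult[OF geom_bounded_lker])
qed

lemma continuous_on_lker: "continuous_on A (lker a c)"
  unfolding lker_def[abs_def] by (rule continuous_on_borel_series[OF geom_bounded_lker])

lemma continuous_on_vker: "continuous_on A (vker a c)"
  unfolding vker_def[abs_def] by (rule continuous_on_borel_series[OF geom_bounded_vker])

section \<open>First-order dependence on the parameters\<close>

abbreviation pnorm :: "real \<Rightarrow> real \<Rightarrow> real" where "pnorm a c \<equiv> \<bar>a\<bar> / 2 + \<bar>c\<bar>"

lemma abs_Dser_le_small: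
  assumes "pnorm a c \<le> 1" "t \<ge> 0" shows "\<bar>Dser a c t\<bar> \<le> pnorm a c * exp t"
  unfolding Dser_def by (rule abs_borel_series_le[OF geom_bounded_dens abs_dens_le_small[OF assms(1)] assms(2)])

lemma abs_Dser_minus_lker_le:
  assumes "pnorm a c \<le> 1" "t \<ge> 0" shows "\<bar>Dser a c t - lker a c t\<bar> \<le> (pnorm a c)\<^sup>2 * exp t"
proof -
  have "Dser a c t - lker a c t = borel_series (\<lambda>n. dens a c n - mom a c n / (real n + 1)) t"
    unfolding Dser_def lker_def by (rule borel_series_diff[OF geom_bounded_dens geom_bounded_lker, symmetric])
  moreover have "geom_bounded (\<lambda>n. dens a c n - mom a c n / (real n + 1))"
    unfolding geom_bounded_def by (rule exI[of _ "(pnorm a c)\<^sup>2"], rule exI[of _ 1]) (use abs_dens_minus_linear_le[OF assms(1)] in simp)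
  ultimately show ?thesis using abs_borel_series_le[OF _ abs_dens_minus_linear_le[OF assms(1)] assms(2)] by simp
qed

text \<open>
  Controls the error terms of the expansion in the parameters, locally uniformly in \<open>t\<close> by \<open>Dbound_bounded\<close>.
\<close>

definition Dbound :: "real \<Rightarrow> real \<Rightarrow> real \<Rightarrow> real" where
  "Dbound a c t = exp t + integral {0..t} (\<lambda>u. exp (t - u) * \<bar>Dser a c u\<bar>)"

lemma conv_abs_le:
  assumes f: "continuous_on {0..t} f" and le: "\<And>r. 0 \<le> r \<Longrightarrow> r \<le> t \<Longrightarrow> \<bar>f r\<bar> \<le> B * exp r" and t: "t \<ge> 0"
  shows "\<bar>f t - integral {0..t} (\<lambda>u. f (t - u) * Dser a c u)\<bar> \<le> B * Dbound a c t"
proof -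
  have ft: "continuous_on {0..t} (\<lambda>u. f (t - u))"
    by (rule continuous_on_compose2[OF f]) (auto intro!: continuous_intros)
  have "norm (integral {0..t} (\<lambda>u. f (t - u) * Dser a c u)) \<le> integral {0..t} (\<lambda>u. B * (exp (t - u) * \<bar>Dser a c u\<bar>))"
  proof (rule integral_norm_bound_integral)
    show "(\<lambda>u. f (t - u) * Dser a c u) integrable_on {0..t}"
      by (intro integrable_continuous_real continuous_intros ft continuous_on_Dser)
    show "(\<lambda>u. B * (exp (t - u) * \<bar>Dser a c u\<bar>)) integrable_on {0..t}"
      by (intro integrable_continuous_real continuous_intros continuous_on_Dser)
    fix u assume "u \<in> {0..t}"
    then have "\<bar>f (t - u)\<bar> \<le> B * exp (t - u)" by (intro le) auto
    then show "norm (f (t - u) * Dser a c u) \<le> B * (exp (t - u) * \<bar>Dser a c u\<bar>)"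
      by (simp add: abs_mult mult.assoc[symmetric] mult_right_mono)
  qed
  also have "\<dots> = B * integral {0..t} (\<lambda>u. exp (t - u) * \<bar>Dser a c u\<bar>)" by simp
  finally have "\<bar>integral {0..t} (\<lambda>u. f (t - u) * Dser a c u)\<bar> \<le> B * integral {0..t} (\<lambda>u. exp (t - u) * \<bar>Dser a c u\<bar>)"
    by (simp only: real_norm_def)
  moreover have "\<bar>f t\<bar> \<le> B * exp t" by (rule le) (use t in auto)
  ultimately show ?thesis unfolding Dbound_def by (simp add: distrib_left)
qed

lemma Dser_add_diff_le:
  assumes "pnorm a' c' \<le> 1" "t \<ge> 0"
  shows "\<bar>Dser (a + a') (c + c') t - Dser a c t\<bar> \<le> pnorm a' c' * Dbound a c t"
proof -
  have "Dser (a + a') (c + c') t - Dser a c t = Dser a' c' t - integral {0..t} (\<lambda>u. Dser a' c' (t - u) * Dser a c u)"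
    using Dser_add[OF assms(2)] by simp
  then show ?thesis using conv_abs_le[OF continuous_on_Dser abs_Dser_le_small[OF assms(1)] assms(2)] by simp
qed

text \<open>
  The directional derivative of \<open>Dser\<close> at \<open>(a, c)\<close> in the direction \<open>(x, y)\<close>: by the semigroup law it is the
  infinitesimal direction \<open>lker x y\<close> corrected by a convolution.
\<close>

definition dirder :: "real \<Rightarrow> real \<Rightarrow> real \<Rightarrow> real \<Rightarrow> real \<Rightarrow> real" where
  "dirder a c x y t = lker x y t - integral {0..t} (\<lambda>u. lker x y (t - u) * Dser a c u)"

lemma pnorm_scale: "pnorm (hh * x) (hh * y) = \<bar>hh\<bar> * pnorm x y"
  by (simp add: abs_mult algebra_simps)

text \<open>
  The increment is a short semigroup step, which agrees with \<open>hh\<close> times \<open>lker\<close> up to second order.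
\<close>

lemma Dser_first_order:
  assumes "\<bar>hh\<bar> * pnorm x y \<le> 1" "t \<ge> 0"
  shows "\<bar>Dser (a + hh * x) (c + hh * y) t - Dser a c t - hh * dirder a c x y t\<bar> \<le> (hh * pnorm x y)\<^sup>2 * Dbound a c t"
proof -
  have s: "pnorm (hh * x) (hh * y) \<le> 1" using assms by (simp only: pnorm_scale)
  have i1: "(\<lambda>u. Dser (hh * x) (hh * y) (t - u) * Dser a c u) integrable_on {0..t}"
    by (intro integrable_continuous_real continuous_intros continuous_on_Dser continuous_on_compose2[OF continuous_on_Dser[of UNIV]]) auto
  have i2: "(\<lambda>u. hh * lker x y (t - u) * Dser a c u) integrable_on {0..t}"
    by (intro integrable_continuous_real continuous_intros continuous_on_Dser continuous_on_compose2[OF continuous_on_lker[of UNIV]]) auto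
  have "Dser (a + hh * x) (c + hh * y) t - Dser a c t - hh * dirder a c x y t
     = (Dser (hh * x) (hh * y) t - hh * lker x y t) - (integral {0..t} (\<lambda>u. Dser (hh * x) (hh * y) (t - u) * Dser a c u) - integral {0..t} (\<lambda>u. hh * lker x y (t - u) * Dser a c u))"
    unfolding Dser_add[OF assms(2)] dirder_def by (simp add: algebra_simps)
  also have "\<dots> = (Dser (hh * x) (hh * y) t - hh * lker x y t) - integral {0..t} (\<lambda>u. (Dser (hh * x) (hh * y) (t - u) - hh * lker x y (t - u)) * Dser a c u)"
    unfolding Henstock_Kurzweil_Integration.integral_diff[OF i1 i2, symmetric] by (simp add: left_diff_distrib)
  finally have e: "Dser (a + hh * x) (c + hh * y) t - Dser a c t - hh * dirder a c x y t = \<dots>" .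
  have "\<bar>(Dser (hh * x) (hh * y) t - hh * lker x y t) - integral {0..t} (\<lambda>u. (Dser (hh * x) (hh * y) (t - u) - hh * lker x y (t - u)) * Dser a c u)\<bar>
     \<le> (hh * pnorm x y)\<^sup>2 * Dbound a c t"
  proof (rule conv_abs_le[OF _ _ assms(2)])
    show "continuous_on {0..t} (\<lambda>r. Dser (hh * x) (hh * y) r - hh * lker x y r)"
      by (intro continuous_intros continuous_on_Dser continuous_on_lker)
    show "\<bar>Dser (hh * x) (hh * y) r - hh * lker x y r\<bar> \<le> (hh * pnorm x y)\<^sup>2 * exp r" if "0 \<le> r" for r
      using abs_Dser_minus_lker_le[OF s that] unfolding lker_scale pnorm_scale by (simp add: power_mult_distrib)
  qed
  then show ?thesis unfolding e .
qed

lemma Dbound_bounded: "\<exists>B. \<forall>t. 0 \<le> t \<and> t \<le> T \<longrightarrow> Dbound a c t \<le> B"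
proof -
  have e: "Dbound a c t = exp t * (1 + integral {0..t} (\<lambda>u. exp (- u) * \<bar>Dser a c u\<bar>))" for t
  proof -
    have "(\<lambda>u. exp (t - u) * \<bar>Dser a c u\<bar>) = (\<lambda>u. exp t * (exp (- u) * \<bar>Dser a c u\<bar>))"
      by (simp add: exp_diff exp_minus field_simps)
    then show ?thesis unfolding Dbound_def by (simp add: distrib_left)
  qed
  have i: "(\<lambda>u. exp (- u) * \<bar>Dser a c u\<bar>) integrable_on {0..T}" for T
    by (intro integrable_continuous_real continuous_intros continuous_on_Dser)
  have "Dbound a c t \<le> exp T * (1 + integral {0..T} (\<lambda>u. exp (- u) * \<bar>Dser a c u\<bar>))" if t: "0 \<le> t" "t \<le> T" for t
  proof -
    have "0 \<le> integral {0..t} (\<lambda>u. exp (- u) * \<bar>Dser a c u\<bar>)" by (rule integral_nonneg[OF i]) auto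
    moreover have "integral {0..t} (\<lambda>u. exp (- u) * \<bar>Dser a c u\<bar>) \<le> integral {0..T} (\<lambda>u. exp (- u) * \<bar>Dser a c u\<bar>)"
      by (rule integral_subset_le[OF _ i i]) (use t in auto)
    ultimately show ?thesis unfolding e using t by (intro mult_mono) auto
  qed
  then show ?thesis by blast
qed

lemma continuous_on_dirder: "continuous_on {0..T} (dirder a c x y)"
proof -
  have "dirder a c x y t = borel_series (\<lambda>n. mom x y n / (real n + 1)) t - borel_series (seq_conv (\<lambda>n. mom x y n / (real n + 1)) (dens a c)) t"
    if "t \<ge> 0" for t
    using conv_has_integral(1)[OF geom_bounded_lker geom_bounded_dens that, of x y a c]
    unfolding dirder_def lker_def Dser_def by (simp add: integral_unique)
  moreover have cs: "continuous_on A (borel_series (seq_conv (\<lambda>n. mom x y n / (real n + 1)) (dens a c)))" for A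
  proof (rule continuous_on_borel_series)
    obtain C K where CK: "C \<ge> 0" "K \<ge> 1" "\<And>n. \<bar>dens a c n\<bar> \<le> C * K ^ n" using geom_boundedE[OF geom_bounded_dens] by blast
    have "\<bar>seq_conv (\<lambda>n. mom x y n / (real n + 1)) (dens a c) n\<bar> \<le> (pnorm x y * C) * (2 * K) ^ n" for n
    proof -
      have "\<bar>seq_conv (\<lambda>n. mom x y n / (real n + 1)) (dens a c) n\<bar> \<le> (\<Sum>i<n. \<bar>mom x y (n - 1 - i) / (real (n - 1 - i) + 1)\<bar> * \<bar>dens a c i\<bar>)"
        unfolding seq_conv_def abs_mult[symmetric] by (rule sum_abs)
      also have "\<dots> \<le> (\<Sum>i<n. pnorm x y * (C * K ^ n))"
      proof (intro sum_mono mult_mono)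
        fix i assume i: "i \<in> {..<n}"
        have "\<bar>mom x y m / (real m + 1)\<bar> \<le> \<bar>mom x y m\<bar>" for m by (simp add: divide_le_eq mult_le_cancel_left1)
        then show "\<bar>mom x y (n - 1 - i) / (real (n - 1 - i) + 1)\<bar> \<le> pnorm x y" using abs_mom_le order_trans by blast
        have "K ^ i \<le> K ^ n" using i CK by (intro power_increasing) auto
        then show "\<bar>dens a c i\<bar> \<le> C * K ^ n" using CK(3)[of i] mult_left_mono[OF _ CK(1)] by fastforce
      qed auto
      also have "\<dots> = (pnorm x y * C) * (real n * K ^ n)" by simp
      also have "\<dots> \<le> (pnorm x y * C) * (2 ^ n * K ^ n)"
        using CK of_nat_less_two_power[of n, where 'a = real] by (intro mult_left_mono mult_right_mono) auto
      finally show ?thesis by (simp add: power_mult_distrib)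
    qed
    then show "geom_bounded (seq_conv (\<lambda>n. mom x y n / (real n + 1)) (dens a c))" unfolding geom_bounded_def by blast
  qed
  ultimately have "continuous_on {0..T} (dirder a c x y) \<longleftrightarrow> continuous_on {0..T} (\<lambda>t. borel_series (\<lambda>n. mom x y n / (real n + 1)) t - borel_series (seq_conv (\<lambda>n. mom x y n / (real n + 1)) (dens a c)) t)"
    by (intro continuous_on_cong) auto
  then show ?thesis using continuous_on_diff[OF continuous_on_borel_series[OF geom_bounded_lker] cs] by blast
qed

section \<open>Positivity for large arguments\<close>

definition admissible :: "real \<Rightarrow> real \<Rightarrow> bool" where
  "admissible a c \<longleftrightarrow> a > 0 \<and> 0 \<le> c \<and> c < 1 \<and> a + c < 3"

text \<open>
  The weight is positive for \<open>s\<close> small, and there \<open>(1 - s) ^ n\<close> is exponentially larger than on the remaining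
  interval, where the sign of the weight is unknown but its size is integrable.
\<close>

lemma dens_lower_bound:
  assumes adm: "a > 0" "0 \<le> c" "a + c \<le> \<sigma>" "\<sigma> < 3" "n \<ge> 2"
    and eta: "0 < \<eta>" "\<eta> \<le> 1 / 4" and sgn: "a * (2 * \<eta>) + c \<le> 1"
    and om: "\<omega> \<ge> 0" "\<And>s. \<eta> / 2 \<le> s \<Longrightarrow> s \<le> \<eta> \<Longrightarrow> \<omega> \<le> w a c s"
  shows "exp a * dens a c n \<ge> \<omega> * (1 - \<eta>) ^ n * (\<eta> / 2) - (1 - 2 * \<eta>) ^ (n - 2) / (3 - \<sigma>)"
proof -
  define I where "I = {1 - \<eta>..1 - \<eta> / 2}"
  have 1: "((\<lambda>x. w a c (1 - x) * x ^ n) has_integral (exp a * dens a c n)) {0<..<1}"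
    by (rule dens_has_integral) (use adm in auto)
  have "((\<lambda>x. \<omega> * (1 - \<eta>) ^ n) has_integral (measure lborel I *\<^sub>R (\<omega> * (1 - \<eta>) ^ n))) I"
    unfolding I_def by (rule has_integral_const_real)
  moreover have "measure lborel I = \<eta> / 2" unfolding I_def using eta by (simp add: content_real)
  ultimately have "((\<lambda>x. \<omega> * (1 - \<eta>) ^ n) has_integral (\<omega> * (1 - \<eta>) ^ n * (\<eta> / 2))) I" by (simp add: mult.commute)
  then have 2: "((\<lambda>x. if x \<in> I then \<omega> * (1 - \<eta>) ^ n else 0) has_integral (\<omega> * (1 - \<eta>) ^ n * (\<eta> / 2))) {0<..<1}"
    by (subst has_integral_restrict) (use eta in \<open>auto simp: I_def\<close>)
  have 3: "((\<lambda>x. x powr (2 - \<sigma>)) has_integral (1 / (3 - \<sigma>))) {0<..<1}"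
  proof -
    have "((\<lambda>x. x powr (2 - \<sigma>)) has_integral (1 powr (2 - \<sigma> + 1) / (2 - \<sigma> + 1))) {0..1}"
      by (rule has_integral_powr_from_0) (use adm in auto)
    then show ?thesis by (simp add: has_integral_Icc_iff_Ioo)
  qed
  have 4: "((\<lambda>x. (if x \<in> I then \<omega> * (1 - \<eta>) ^ n else 0) - (1 - 2 * \<eta>) ^ (n - 2) * x powr (2 - \<sigma>)) has_integral
     (\<omega> * (1 - \<eta>) ^ n * (\<eta> / 2) - (1 - 2 * \<eta>) ^ (n - 2) * (1 / (3 - \<sigma>)))) {0<..<1}"
    by (intro has_integral_diff has_integral_mult_right 2 3)
  have "(\<omega> * (1 - \<eta>) ^ n * (\<eta> / 2) - (1 - 2 * \<eta>) ^ (n - 2) * (1 / (3 - \<sigma>))) \<le> exp a * dens a c n"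
  proof (rule has_integral_le[OF 4 1])
    fix x :: real assume x: "x \<in> {0<..<1}"
    have ww: "w a c (1 - x) \<ge> 0" if "x \<ge> 1 - 2 * \<eta>"
    proof -
      have "a * (1 - x) \<le> a * (2 * \<eta>)" using that adm by (intro mult_left_mono) auto
      then have "a * (1 - x) + c \<le> 1" using sgn by linarith
      moreover have "0 \<le> a * (1 - x) + c" using adm x by (intro add_nonneg_nonneg mult_nonneg_nonneg) auto
      ultimately have "sin (pi * (a * (1 - x) + c)) \<ge> 0" by (intro sin_ge_zero) (auto simp: mult_le_cancel_left1)
      then show ?thesis unfolding w_def by (intro mult_nonneg_nonneg) auto
    qed
    show "(if x \<in> I then \<omega> * (1 - \<eta>) ^ n else 0) - (1 - 2 * \<eta>) ^ (n - 2) * x powr (2 - \<sigma>) \<le> w a c (1 - x) * x ^ n"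
    proof (cases "x \<ge> 1 - 2 * \<eta>")
      case True
      have p: "(1 - 2 * \<eta>) ^ (n - 2) * x powr (2 - \<sigma>) \<ge> 0" using eta by simp
      have "(if x \<in> I then \<omega> * (1 - \<eta>) ^ n else 0) \<le> w a c (1 - x) * x ^ n"
      proof (cases "x \<in> I")
        case xI: True
        then have "\<omega> * (1 - \<eta>) ^ n \<le> w a c (1 - x) * x ^ n"
          using om(2)[of "1 - x"] om(1) eta ww[OF True] by (intro mult_mono power_mono) (auto simp: I_def)
        then show ?thesis using xI by simp
      qed (use ww[OF True] x in auto)
      then show ?thesis using p by linarith
    next
      case False
      then have nI: "x \<notin> I" using eta by (auto simp: I_def)
      have "- (w a c (1 - x) * x ^ n) \<le> \<bar>w a c (1 - x)\<bar> * x ^ n" using x by (metis abs_ge_minus_self abs_mult abs_of_nonneg greaterThanLessThan_iff less_imp_le zero_le_power)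
      also have "\<dots> \<le> x powr (- \<sigma>) * x ^ n"
      proof (intro mult_right_mono)
        have "\<bar>w a c (1 - x)\<bar> \<le> x powr (- (a + c))" using abs_w_le[OF adm(1,2), of "1 - x"] x by simp
        also have "\<dots> \<le> x powr (- \<sigma>)" using x adm by (intro powr_mono') auto
        finally show "\<bar>w a c (1 - x)\<bar> \<le> x powr (- \<sigma>)" .
      qed (use x in auto)
      also have "x powr (- \<sigma>) * x ^ n = x powr (- \<sigma>) * (x ^ (n - 2) * x powr 2)"
      proof -
        have "x ^ n = x ^ (n - 2) * x ^ 2" by (metis adm(5) le_add_diff_inverse2 power_add)
        then show ?thesis using x by simp
      qed
      also have "x powr (- \<sigma>) * (x ^ (n - 2) * x powr 2) = x ^ (n - 2) * x powr (2 - \<sigma>)"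
        using powr_add[of x "- \<sigma>" 2] by (simp add: mult_ac)
      also have "\<dots> \<le> (1 - 2 * \<eta>) ^ (n - 2) * x powr (2 - \<sigma>)"
        using False x by (intro mult_right_mono power_mono) auto
      finally show ?thesis using nI by simp
    qed
  qed
  then show ?thesis by simp
qed

lemma sin_pi_lower:
  assumes "0 < x0" "x0 \<le> x1" "x1 < 1"
  shows "\<exists>k>0. \<forall>x. x0 \<le> x \<and> x \<le> x1 \<longrightarrow> k \<le> sin (pi * x)"
proof -
  have "\<exists>x\<in>{x0..x1}. \<forall>y\<in>{x0..x1}. sin (pi * x) \<le> sin (pi * y)"
    by (rule continuous_attains_inf) (use assms in \<open>auto intro!: continuous_intros\<close>)
  then obtain x where x: "x \<in> {x0..x1}" "\<And>y. y \<in> {x0..x1} \<Longrightarrow> sin (pi * x) \<le> sin (pi * y)" by blast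
  have "sin (pi * x) > 0" using x assms by (intro sin_gt_zero) auto
  then show ?thesis using x(2) by auto
qed

text \<open>
  Once the coefficients are nonnegative, truncation gives a lower bound.
\<close>

lemma Dser_ge_taylor:
  assumes pos: "\<And>n. n \<ge> N \<Longrightarrow> dens a c n \<ge> 0" and t: "t \<ge> 0"
  shows "Dser a c t \<ge> (\<Sum>n<N. dens a c n * t ^ n / fact n)"
proof -
  have "(\<Sum>n<N. dens a c n * t ^ n / fact n) \<le> (\<Sum>n. dens a c n * t ^ n / fact n)"
    by (rule sum_le_suminf) (use Dser_sums[of a c t] pos t in \<open>auto simp: sums_iff intro!: divide_nonneg_nonneg mult_nonneg_nonneg\<close>)
  then show ?thesis using Dser_sums[of a c t] by (simp add: sums_iff)
qed

text \<open>
  By \<open>dens_lower_bound\<close> all coefficients from some \<open>N\<close> on are positive, with \<open>N\<close> and a lower bound for the coefficient of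
  index \<open>N\<close> uniform near \<open>(a0, c0)\<close>. The term of degree \<open>N\<close> then dominates the terms of lower degree for large \<open>t\<close>.
\<close>

lemma local_tail_positive:
  assumes adm: "admissible a0 c0"
  shows "\<exists>e>0. \<exists>T. \<forall>a c t. admissible a c \<longrightarrow> \<bar>a - a0\<bar> < e \<longrightarrow> \<bar>c - c0\<bar> < e \<longrightarrow> t \<ge> T \<longrightarrow> Dser a c t > 0"
proof -
  have A0: "a0 > 0" "0 \<le> c0" "c0 < 1" "a0 + c0 < 3" using adm by (auto simp: admissible_def)
  define c1 where "c1 = (1 + c0) / 2"
  define \<sigma> where "\<sigma> = (3 + a0 + c0) / 2"
  define e where "e = min (a0 / 2) (min (c1 - c0) ((\<sigma> - a0 - c0) / 2))"
  have c1: "c0 < c1" "c1 < 1" "0 < c1" using A0 by (auto simp: c1_def)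
  have sg: "a0 + c0 < \<sigma>" "\<sigma> < 3" using A0 by (auto simp: \<sigma>_def)
  have e: "e > 0" "e \<le> a0 / 2" "e \<le> c1 - c0" "2 * e \<le> \<sigma> - a0 - c0"
  proof -
    have "e \<le> (\<sigma> - a0 - c0) / 2" unfolding e_def by (rule order_trans[OF min.cobounded2 min.cobounded2])
    then show "2 * e \<le> \<sigma> - a0 - c0" by (simp add: field_simps)
    show "e \<le> a0 / 2" unfolding e_def by (rule min.cobounded1)
    show "e \<le> c1 - c0" unfolding e_def by (rule order_trans[OF min.cobounded2 min.cobounded1])
    show "e > 0" using A0 c1 sg by (simp add: e_def)
  qed
  define \<eta> where "\<eta> = min (1 / 4) ((1 - c1) / 12)"
  have eta: "0 < \<eta>" "\<eta> \<le> 1 / 4" "\<eta> \<le> (1 - c1) / 12" using c1 by (auto simp: \<eta>_def)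
  obtain k where k: "k > 0" "\<And>x. a0 * \<eta> / 4 \<le> x \<Longrightarrow> x \<le> (1 + c1) / 2 \<Longrightarrow> k \<le> sin (pi * x)"
  proof -
    have "a0 * \<eta> \<le> 3 * ((1 - c1) / 12)" using A0 eta by (intro mult_mono) auto
    then have "a0 * \<eta> / 4 \<le> (1 + c1) / 2" using c1 by (simp add: field_simps)
    then show ?thesis using sin_pi_lower[of "a0 * \<eta> / 4" "(1 + c1) / 2"] A0 eta c1 that by auto
  qed
  \<comment> \<open>a lower bound of the weight on \<open>[\<eta> / 2, \<eta>]\<close>, uniform near the given parameters\<close>
  define \<omega> where "\<omega> = 1 / pi * (\<eta> / 2) * k"
  have om: "\<omega> > 0" using eta k by (simp add: \<omega>_def)
  \<comment> \<open>the rate at which the contribution of \<open>s \<ge> 2 \<eta>\<close> becomes negligible\<close>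
  define q where "q = (1 - 2 * \<eta>) / (1 - \<eta>)"
  have q: "0 \<le> q" "q < 1" using eta by (auto simp: q_def divide_less_eq)
  define low where "low n = \<omega> * (1 - \<eta>) ^ n * (\<eta> / 2) - (1 - 2 * \<eta>) ^ (n - 2) / (3 - \<sigma>)" for n
  have near: "low n \<le> exp a * dens a c n" if "admissible a c" "\<bar>a - a0\<bar> < e" "\<bar>c - c0\<bar> < e" "n \<ge> 2" for a c n
  proof -
    have ac: "a > 0" "0 \<le> c" "c < 1" "a + c < 3" using that by (auto simp: admissible_def)
    have a': "a0 / 2 \<le> a" "a \<le> 3" "c \<le> c1" "a + c \<le> \<sigma>" using that e ac by auto
    have sl: "a * s + c \<le> (1 + c1) / 2" if "0 \<le> s" "s \<le> 2 * \<eta>" for s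
    proof -
      have "a * s \<le> 3 * (2 * ((1 - c1) / 12))" using that eta ac a' by (intro mult_mono) auto
      then show ?thesis using a' by simp
    qed
    show ?thesis unfolding low_def
    proof (rule dens_lower_bound[OF ac(1,2) a'(4) sg(2) that(4) eta(1,2)])
      show "a * (2 * \<eta>) + c \<le> 1" using sl[of "2 * \<eta>"] eta c1 by auto
      show "0 \<le> \<omega>" using om by simp
      fix s assume s: "\<eta> / 2 \<le> s" "s \<le> \<eta>"
      have s1: "0 < s" "s \<le> 1 / 4" using s eta by auto
      have x: "a0 * \<eta> / 4 \<le> a * s + c"
      proof -
        have "a0 / 2 * (\<eta> / 2) \<le> a * s" using s a' eta A0 ac by (intro mult_mono) auto
        then show ?thesis using ac by simp
      qed
      have x2: "a * s + c \<le> (1 + c1) / 2" using sl[of s] s s1 eta by auto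
      have "s \<le> (s / (1 - s)) powr (a * s + c)"
      proof -
        have "s \<le> s / (1 - s)" using s1 by (simp add: le_divide_eq mult_le_cancel_left1)
        also have "\<dots> = (s / (1 - s)) powr 1" using s1 by simp
        also have "\<dots> \<le> (s / (1 - s)) powr (a * s + c)"
          using s1 x2 c1 by (intro powr_mono') (auto simp: divide_le_eq)
        finally show ?thesis .
      qed
      then have "\<eta> / 2 \<le> (s / (1 - s)) powr (a * s + c)" using s by linarith
      moreover have "k \<le> sin (pi * (a * s + c))" by (rule k(2)[OF x x2])
      ultimately show "\<omega> \<le> w a c s" unfolding \<omega>_def w_def using k eta by (intro mult_mono) auto
    qed
  qed
  have "\<exists>N\<ge>2. \<forall>n\<ge>N. low n > 0"
  proof -
    have "(\<lambda>n. q ^ n) \<longlonglongrightarrow> 0" using q by (intro LIMSEQ_power_zero) auto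
    moreover have K: "\<omega> * (\<eta> / 2) * (3 - \<sigma>) * (1 - 2 * \<eta>) ^ 2 > 0" using om eta sg by simp
    ultimately have "eventually (\<lambda>n. q ^ n < \<omega> * (\<eta> / 2) * (3 - \<sigma>) * (1 - 2 * \<eta>) ^ 2) sequentially"
      by (rule order_tendstoD(2))
    then obtain N where N: "\<And>n. n \<ge> N \<Longrightarrow> q ^ n < \<omega> * (\<eta> / 2) * (3 - \<sigma>) * (1 - 2 * \<eta>) ^ 2"
      unfolding eventually_sequentially by blast
    have "low n > 0" if n: "n \<ge> max N 2" for n
    proof -
      have p: "(1 - \<eta>) ^ n > 0" "(1 - 2 * \<eta>) ^ 2 > 0" using eta by auto
      have "(1 - 2 * \<eta>) ^ n < \<omega> * (\<eta> / 2) * (3 - \<sigma>) * (1 - 2 * \<eta>) ^ 2 * (1 - \<eta>) ^ n"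
        using N[of n] n p by (simp add: q_def power_divide divide_less_eq)
      moreover have "(1 - 2 * \<eta>) ^ n = (1 - 2 * \<eta>) ^ (n - 2) * (1 - 2 * \<eta>) ^ 2"
        using n by (metis le_add_diff_inverse2 max.bounded_iff power_add)
      ultimately have "(1 - 2 * \<eta>) ^ (n - 2) * (1 - 2 * \<eta>) ^ 2 < (\<omega> * (\<eta> / 2) * (3 - \<sigma>) * (1 - \<eta>) ^ n) * (1 - 2 * \<eta>) ^ 2"
        by (simp only: mult_ac)
      then have "(1 - 2 * \<eta>) ^ (n - 2) < \<omega> * (\<eta> / 2) * (3 - \<sigma>) * (1 - \<eta>) ^ n"
        using p(2) by (rule mult_right_less_imp_less[OF _ less_imp_le])
      then show ?thesis unfolding low_def using sg by (simp add: divide_less_eq mult_ac)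
    qed
    then show ?thesis by (intro exI[of _ "max N 2"]) auto
  qed
  then obtain N where N: "N \<ge> 2" "\<And>n. n \<ge> N \<Longrightarrow> low n > 0" by blast
  define \<delta> where "\<delta> = low N / exp 3"
  have del: "\<delta> > 0" using N by (simp add: \<delta>_def)
  define B where "B = (\<Sum>n<N. 3 * 4 ^ n :: real)"
  have B: "B \<ge> 0" unfolding B_def by (intro sum_nonneg) auto
  \<comment> \<open>beyond \<open>T\<close> the term of degree \<open>N\<close> beats the sum of the lower ones, which is at least \<open>- B t ^ (N - 1)\<close>\<close>
  define T where "T = max 1 (B * fact N / \<delta> + 1)"
  have "Dser a c t > 0" if hyp: "admissible a c" "\<bar>a - a0\<bar> < e" "\<bar>c - c0\<bar> < e" "t \<ge> T" for a c t
  proof -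
    have ac: "a > 0" "0 \<le> c" "c < 1" "a + c < 3" using hyp by (auto simp: admissible_def)
    have t: "t \<ge> 1" "t > B * fact N / \<delta>" using hyp(4) by (auto simp: T_def)
    have dpos: "dens a c n > 0" if "n \<ge> N" for n
    proof -
      have "0 < exp a * dens a c n" using near[OF hyp(1-3), of n] N that by fastforce
      then show ?thesis by (simp add: zero_less_mult_iff)
    qed
    have dN: "dens a c N \<ge> \<delta>"
    proof -
      have "low N \<le> exp a * dens a c N" by (rule near[OF hyp(1-3) N(1)])
      also have "\<dots> \<le> exp 3 * dens a c N" using ac dpos[of N] by (intro mult_right_mono) auto
      finally show ?thesis unfolding \<delta>_def by (simp add: divide_le_eq mult.commute)
    qed
    have low1: "- (3 * 4 ^ n * t ^ (N - 1)) \<le> dens a c n * t ^ n / fact n" if n: "n < N" for n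
    proof -
      have "\<bar>dens a c n\<bar> \<le> pnorm a c * (1 + pnorm a c) ^ n"
        using order_trans[OF abs_dens_le majorant_le_geom] by simp
      also have "\<dots> \<le> 3 * 4 ^ n" using ac by (intro mult_mono power_mono) auto
      finally have 1: "\<bar>dens a c n\<bar> \<le> 3 * 4 ^ n" .
      have "\<bar>dens a c n * t ^ n / fact n\<bar> = \<bar>dens a c n\<bar> * (t ^ n / fact n)" using t by (simp add: abs_mult)
      also have "\<dots> \<le> (3 * 4 ^ n) * t ^ (N - 1)"
      proof (intro mult_mono 1)
        have "t ^ n / fact n \<le> t ^ n" using t fact_ge_1[of n, where 'a = real] by (simp add: divide_le_eq mult_le_cancel_left1)
        also have "\<dots> \<le> t ^ (N - 1)" using t n by (intro power_increasing) auto
        finally show "t ^ n / fact n \<le> t ^ (N - 1)" .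
      qed (use t in auto)
      finally show ?thesis by linarith
    qed
    have "Dser a c t \<ge> (\<Sum>n<Suc N. dens a c n * t ^ n / fact n)"
      by (rule Dser_ge_taylor) (use dpos t in \<open>auto intro: less_imp_le\<close>)
    also have "(\<Sum>n<Suc N. dens a c n * t ^ n / fact n) = (\<Sum>n<N. dens a c n * t ^ n / fact n) + dens a c N * t ^ N / fact N" by simp
    finally have "Dser a c t \<ge> (\<Sum>n<N. dens a c n * t ^ n / fact n) + dens a c N * t ^ N / fact N" .
    moreover have "(\<Sum>n<N. dens a c n * t ^ n / fact n) \<ge> (\<Sum>n<N. - (3 * 4 ^ n * t ^ (N - 1)))"
      by (intro sum_mono low1) auto
    moreover have "(\<Sum>n<N. - (3 * 4 ^ n * t ^ (N - 1))) = - (B * t ^ (N - 1))" by (simp add: B_def sum_negf sum_distrib_right)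
    moreover have "B * t ^ (N - 1) < dens a c N * t ^ N / fact N"
    proof -
      have "B < \<delta> / fact N * t" using t(2) del by (simp add: divide_less_eq field_simps)
      also have "\<dots> \<le> dens a c N / fact N * t" using dN t by (intro mult_right_mono divide_right_mono) auto
      finally have "B * t ^ (N - 1) < dens a c N / fact N * t * t ^ (N - 1)" using t by (intro mult_strict_right_mono) auto
      also have "\<dots> = dens a c N * (t * t ^ (N - 1)) / fact N" by simp
      also have "t * t ^ (N - 1) = t ^ N" using N(1) by (cases N) auto
      finally show ?thesis .
    qed
    ultimately show ?thesis by linarith
  qed
  then show ?thesis using e(1) by blast
qed

section \<open>Zeros of a nonnegative density\<close>

lemma integral_continuous_pos:
  fixes f :: "real \<Rightarrow> real"
  assumes "continuous_on {a..b} f" "\<And>x. x \<in> {a..b} \<Longrightarrow> f x \<ge> 0" "x0 \<in> {a..b}" "f x0 > 0" "a < b"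
  shows "integral {a..b} f > 0"
proof -
  have i: "f integrable_on {a..b}" by (rule integrable_continuous_real[OF assms(1)])
  have "integral {a..b} f \<ge> 0" by (rule integral_nonneg[OF i assms(2)])
  moreover have "integral {a..b} f \<noteq> 0"
  proof
    assume "integral {a..b} f = 0"
    then have "(f has_integral 0) (cbox a b)" using i by (metis cbox_interval integrable_integral)
    then have "f x0 = 0"
      using has_integral_0_cbox_imp_0[of a b f x0] assms by (auto simp: box_real)
    then show False using assms(4) by simp
  qed
  ultimately show ?thesis by simp
qed

lemma vker_0: "vker a c 0 = 0"
  unfolding vker_def borel_series_0 by simp

text \<open>
  If \<open>D t0 = 0\<close>, the Volterra equation says that \<open>v (t0 - u) D u / v t0\<close> integrates to 1 over \<open>[0, t0]\<close>. Averaging the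
  quotient \<open>\<nu> / v\<close> against this weight compares it with its value at \<open>t0\<close>, the smallest value on the interval.
\<close>

lemma chebyshev_touching:
  assumes t0: "t0 > 0" and D: "\<And>u. 0 \<le> u \<Longrightarrow> u \<le> t0 \<Longrightarrow> Dser a c u \<ge> 0" "Dser a c 0 > 0" "Dser a c t0 = 0"
    and nu: "continuous_on {0..t0} \<nu>" and mu: "vker a c t0 > 0"
    and ratio: "\<And>r. 0 \<le> r \<Longrightarrow> r < t0 \<Longrightarrow> \<nu> t0 * vker a c r < \<nu> r * vker a c t0"
  shows "\<nu> t0 < integral {0..t0} (\<lambda>u. \<nu> (t0 - u) * Dser a c u)"
proof -
  let ?m = "vker a c"
  have nt: "continuous_on {0..t0} (\<lambda>u. \<nu> (t0 - u))"
    by (rule continuous_on_compose2[OF nu]) (auto intro!: continuous_intros)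
  have mt: "continuous_on {0..t0} (\<lambda>u. ?m (t0 - u))"
    by (rule continuous_on_compose2[OF continuous_on_vker[of UNIV]]) (auto intro!: continuous_intros)
  let ?g = "\<lambda>u. (\<nu> (t0 - u) * ?m t0 - \<nu> t0 * ?m (t0 - u)) * Dser a c u"
  have g: "continuous_on {0..t0} ?g"
    by (intro continuous_intros nt mt continuous_on_Dser)
  have nn: "?g u \<ge> 0" if u: "u \<in> {0..t0}" for u
  proof (cases "u = 0")
    case False
    then have "\<nu> t0 * ?m (t0 - u) < \<nu> (t0 - u) * ?m t0" using u by (intro ratio) auto
    then show ?thesis using D(1)[of u] u by auto
  qed simp
  have "\<exists>u\<in>{0..t0}. ?g u > 0"
  proof -
    have "isCont (Dser a c) 0" using DERIV_isCont[OF DERIV_Dser] .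
    then obtain d where d: "d > 0" "\<And>u. dist u 0 < d \<Longrightarrow> dist (Dser a c u) (Dser a c 0) < Dser a c 0"
      unfolding continuous_at_eps_delta using D(2) by blast
    define u where "u = min (d / 2) (t0 / 2)"
    have u: "0 < u" "u < t0" "u < d" using d(1) t0 by (auto simp: u_def)
    have "Dser a c u > 0" using d(2)[of u] u by (auto simp: dist_real_def)
    moreover have "\<nu> t0 * ?m (t0 - u) < \<nu> (t0 - u) * ?m t0" using u by (intro ratio) auto
    ultimately show ?thesis using u by (intro bexI[of _ u]) auto
  qed
  then obtain u where u: "u \<in> {0..t0}" "?g u > 0" by blast
  have pos: "integral {0..t0} ?g > 0" by (rule integral_continuous_pos[OF g nn u t0])
  have i1: "(\<lambda>u. \<nu> (t0 - u) * Dser a c u) integrable_on {0..t0}" "(\<lambda>u. ?m (t0 - u) * Dser a c u) integrable_on {0..t0}"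
    by (intro integrable_continuous_real continuous_intros nt mt continuous_on_Dser)+
  have "integral {0..t0} ?g = integral {0..t0} (\<lambda>u. ?m t0 * (\<nu> (t0 - u) * Dser a c u) - \<nu> t0 * (?m (t0 - u) * Dser a c u))"
    by (rule arg_cong[of _ _ "integral {0..t0}"]) (auto simp: algebra_simps)
  also have "\<dots> = ?m t0 * integral {0..t0} (\<lambda>u. \<nu> (t0 - u) * Dser a c u) - \<nu> t0 * integral {0..t0} (\<lambda>u. ?m (t0 - u) * Dser a c u)"
    using i1 by (subst Henstock_Kurzweil_Integration.integral_diff) (auto intro!: integrable_on_mult_right)
  also have "integral {0..t0} (\<lambda>u. ?m (t0 - u) * Dser a c u) = ?m t0"
    using volterra[of t0 a c] t0 D(3) by simp
  finally have "0 < ?m t0 * (integral {0..t0} (\<lambda>u. \<nu> (t0 - u) * Dser a c u) - \<nu> t0)"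
    using pos by (simp add: algebra_simps)
  then show ?thesis using mu by (simp add: zero_less_mult_iff)
qed

lemma exp_quot_mono:
  assumes "0 < r" "r < t" shows "r * (exp t - 1) > t * (exp r - 1 :: real)"
proof -
  have "(exp r - 1) / r < (exp t - 1) / t"
  proof (rule DERIV_pos_imp_increasing[OF assms(2)])
    fix x assume x: "r \<le> x" "x \<le> t"
    have "((\<lambda>x. (exp x - 1) / x) has_real_derivative (exp x * x - (exp x - 1) * 1) / (x * x)) (at x)"
      using x assms by (auto intro!: derivative_eq_intros)
    moreover have "(exp x * x - (exp x - 1) * 1) / (x * x) > 0"
    proof -
      have "1 - x < exp (- x)" using x assms exp_minus_greater[of x] by auto
      then have "exp x * (1 - x) < exp x * exp (- x)" by simp
      also have "\<dots> = 1" by (simp add: exp_minus)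
      finally show ?thesis using x assms by (intro divide_pos_pos mult_pos_pos) (auto simp: algebra_simps)
    qed
    ultimately show "\<exists>y. ((\<lambda>x. (exp x - 1) / x) has_real_derivative y) (at x) \<and> 0 < y" by blast
  qed
  then show ?thesis using assms by (simp add: field_simps)
qed

lemma r_exp_half_le: "r \<ge> 0 \<Longrightarrow> r * exp (r / 2) \<le> exp r - (1 :: real)"
proof -
  assume r: "r \<ge> 0"
  have "exp 0 - 1 - 0 * exp (0 / 2) \<le> exp r - 1 - r * exp (r / 2 :: real)"
  proof (rule DERIV_nonneg_imp_nondecreasing[OF r])
    fix x :: real assume x: "0 \<le> x"
    have "((\<lambda>x. exp x - 1 - x * exp (x / 2)) has_real_derivative (exp x - (exp (x / 2) + x * (exp (x / 2) * (1 / 2))))) (at x)"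
      by (auto intro!: derivative_eq_intros)
    moreover have "exp x - (exp (x / 2) + x * (exp (x / 2) * (1 / 2))) = exp (x / 2) * (exp (x / 2) - 1 - x / 2)"
    proof -
      have "exp x = exp (x / 2) * exp (x / 2)" by (simp flip: exp_add)
      then show ?thesis by (simp add: algebra_simps)
    qed
    moreover have "exp (x / 2) * (exp (x / 2) - 1 - x / 2) \<ge> 0"
    proof (rule mult_nonneg_nonneg)
      show "exp (x / 2) - 1 - x / 2 \<ge> 0" using exp_ge_add_one_self[of "x / 2"] by linarith
    qed simp
    ultimately show "\<exists>y. ((\<lambda>x. exp x - 1 - x * exp (x / 2)) has_real_derivative y) (at x) \<and> 0 \<le> y" by auto
  qed
  then show ?thesis by simp
qed

text \<open>
  The derivative of \<open>1 / t - 1 / (e\<^sup>t - 1)\<close> has the sign of \<open>t\<^sup>2 e\<^sup>t - (e\<^sup>t - 1)\<^sup>2\<close>, which is handled by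
  \<open>r_exp_half_le\<close>.
\<close>

lemma inverse_exp_diff_mono:
  assumes "0 < r" "r \<le> t" shows "1 / t - 1 / (exp t - 1) \<le> 1 / r - 1 / (exp r - 1 :: real)"
proof (rule DERIV_nonpos_imp_nonincreasing[OF assms(2)])
  fix x assume x: "r \<le> x"
  then have x0: "x > 0" using assms by simp
  have e1: "exp x - 1 > 0" using x0 by simp
  have "((\<lambda>x. 1 / x - 1 / (exp x - 1)) has_real_derivative (- 1 / x\<^sup>2 + exp x / (exp x - 1)\<^sup>2)) (at x)"
    using x0 e1 by (auto intro!: derivative_eq_intros simp: power2_eq_square)
  moreover have "- 1 / x\<^sup>2 + exp x / (exp x - 1)\<^sup>2 \<le> 0"
  proof -
    have "(x * exp (x / 2))\<^sup>2 \<le> (exp x - 1)\<^sup>2" using r_exp_half_le[of x] x0 by (intro power_mono) auto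
    moreover have "(x * exp (x / 2))\<^sup>2 = x\<^sup>2 * exp x" by (simp add: power_mult_distrib exp_double[symmetric])
    ultimately have "x\<^sup>2 * exp x \<le> (exp x - 1)\<^sup>2" by simp
    then have "exp x / (exp x - 1)\<^sup>2 \<le> 1 / x\<^sup>2" using x0 e1 by (simp add: field_simps)
    then show ?thesis by simp
  qed
  ultimately show "\<exists>y. ((\<lambda>x. 1 / x - 1 / (exp x - 1)) has_real_derivative y) (at x) \<and> y \<le> 0" by blast
qed

lemma lker_0: "lker x y 0 = x / 2 + y"
  unfolding lker_def borel_series_0 by (simp add: mom_def)

lemma vker_pos:
  assumes "a > 0" "c \<ge> 0" "t > 0" shows "vker a c t > 0"
proof -
  have "exp t - 1 > t" using exp_gt_one[of t] assms exp_ge_add_one_self[of t] exp_minus_greater[of "- t"] by simp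
  then have "(exp t - 1) / t - 1 > 0" using assms by (simp add: field_simps)
  then show ?thesis unfolding vker_closed[OF less_imp_neq[OF assms(3), symmetric]]
    using assms by (intro add_nonneg_pos mult_nonneg_nonneg mult_pos_pos) auto
qed

text \<open>
  In terms of \<open>t\<close> and \<open>e\<^sup>t\<close> both kernels are explicit; the two generators, \<open>(1, 0)\<close> and \<open>(0, 1)\<close>, of the cone of
  directions are compared with both parts of \<open>vker\<close> by the monotone quotients above.
\<close>

lemma lker_vker_ratio:
  assumes a: "a > 0" and c: "c \<ge> 0" and xy: "x \<ge> 0" "y \<ge> 0" "x + y > 0" and r: "0 \<le> r" "r < t"
  shows "lker x y t * vker a c r < lker x y r * vker a c t"
proof (cases "r = 0")
  case True
  have "lker x y 0 > 0" unfolding lker_0 using xy by (cases "x = 0") auto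
  then show ?thesis using vker_pos[OF a c, of t] r True by (simp add: vker_0)
next
  case False
  then have r0: "r > 0" "t > 0" using r by auto
  define A where "A s = exp s - (1 :: real)" for s
  define B where "B s = A s / s - 1" for s
  have Apos: "A s > 0" if "s > 0" for s using that by (simp add: A_def)
  have Bpos: "B s > 0" if "s > 0" for s
  proof -
    have "exp s - 1 > s" using that exp_minus_greater[of "- s"] by simp
    then show ?thesis using that by (simp add: A_def B_def field_simps)
  qed
  have v: "vker p q s = q * A s + p * B s" if "s > 0" for p q s
    using vker_closed[of s q p] vker_closed[of s] that by (simp add: A_def B_def)
  have l: "lker x y s = (y * A s + x * B s) / s" if "s > 0" for s
    using vker_eq_lker[of x y s] v[OF that] that by (simp add: field_simps)
  have inv: "1 / t < 1 / r" using r r0 by (simp add: frac_less2)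
  have k1: "A r * B t / r - A t * B r / t > 0"
  proof -
    have "A r * B t / r - A t * B r / t = (r * A t - t * A r) / (r * t)"
      using r0 by (simp add: B_def field_simps)
    also have "\<dots> > 0" using exp_quot_mono[OF r0(1) r(2)] r0 by (simp add: A_def)
    finally show ?thesis .
  qed
  have k2: "B r * A t / r - B t * A r / t \<ge> 0"
  proof -
    have "1 / t - 1 / A t \<le> 1 / r - 1 / A r" unfolding A_def by (rule inverse_exp_diff_mono) (use r r0 in auto)
    then have "(1 / t - 1 / A t) * (A r * A t) \<le> (1 / r - 1 / A r) * (A r * A t)"
      using Apos[OF r0(1)] Apos[OF r0(2)] by (intro mult_right_mono) auto
    moreover have "(1 / t - 1 / A t) * (A r * A t) = B t * A r"
      using Apos[OF r0(2)] r0 by (simp add: B_def field_simps)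
    moreover have "(1 / r - 1 / A r) * (A r * A t) = B r * A t"
      using Apos[OF r0(1)] r0 by (simp add: B_def field_simps)
    ultimately have "B t * A r \<le> B r * A t" by simp
    then have "B t * A r * (1 / t) \<le> B r * A t * (1 / r)"
      by (rule mult_mono) (use inv Apos[OF r0(2)] Bpos[OF r0(1)] r0 in auto)
    then show ?thesis by simp
  qed
  have "lker x y r * vker a c t - lker x y t * vker a c r
     = y * (c * (A r * A t) * (1 / r - 1 / t) + a * (A r * B t / r - A t * B r / t))
     + x * (a * (B r * B t) * (1 / r - 1 / t) + c * (B r * A t / r - B t * A r / t))"
    unfolding l[OF r0(1)] l[OF r0(2)] v[OF r0(1)] v[OF r0(2)] by (simp add: divide_inverse algebra_simps)
  moreover have "c * (A r * A t) * (1 / r - 1 / t) + a * (A r * B t / r - A t * B r / t) > 0"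
    using k1 a c inv Apos[OF r0(1)] Apos[OF r0(2)] by (intro add_nonneg_pos mult_nonneg_nonneg mult_pos_pos) auto
  moreover have "a * (B r * B t) * (1 / r - 1 / t) + c * (B r * A t / r - B t * A r / t) > 0"
    using k2 a c inv Bpos[OF r0(1)] Bpos[OF r0(2)] by (intro add_pos_nonneg mult_nonneg_nonneg mult_pos_pos) auto
  ultimately have "lker x y r * vker a c t - lker x y t * vker a c r > 0"
    using xy by (cases "y = 0") (auto intro!: add_pos_nonneg)
  then show ?thesis by simp
qed

text \<open>
  At a zero of a nonnegative density, lowering the parameters raises the value: \<open>chebyshev_touching\<close> with the kernel
  \<open>lker x y\<close>.
\<close>

lemma dirder_neg:
  assumes a: "a > 0" and c: "c \<ge> 0" and xy: "x \<ge> 0" "y \<ge> 0" "x + y > 0"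
    and t0: "t0 > 0" and D: "\<And>u. 0 \<le> u \<Longrightarrow> Dser a c u \<ge> 0" "Dser a c t0 = 0"
  shows "dirder a c (- x) (- y) t0 > 0"
proof -
  have neg: "lker (- x) (- y) s = - lker x y s" for s using lker_scale[of "-1" x y s] by simp
  have "lker x y t0 < integral {0..t0} (\<lambda>u. lker x y (t0 - u) * Dser a c u)"
  proof (rule chebyshev_touching[OF t0 D(1) _ D(2) continuous_on_lker vker_pos[OF a c t0]])
    show "0 < Dser a c 0" unfolding Dser_0 using a c by simp
  qed (use lker_vker_ratio[OF a c xy] in auto)
  then show ?thesis unfolding dirder_def neg by simp
qed

section \<open>Moving the parameters along segments\<close>

lemma Dser_param_continuous:
  assumes "(\<lambda>n. p n) \<longlonglongrightarrow> a" "(\<lambda>n. q n) \<longlonglongrightarrow> c" "\<And>n. 0 \<le> t n" "t \<longlonglongrightarrow> s"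
  shows "(\<lambda>n. Dser (p n) (q n) (t n)) \<longlonglongrightarrow> Dser a c s"
proof -
  obtain T where T: "\<And>n. t n \<le> T" using assms(4) Bseq_def[of t] convergent_imp_Bseq[OF convergentI[OF assms(4)]]
    by (metis Bseq_def abs_le_D1 real_norm_def)
  obtain B where B: "\<And>t. 0 \<le> t \<Longrightarrow> t \<le> T \<Longrightarrow> Dbound a c t \<le> B" using Dbound_bounded by blast
  have l: "(\<lambda>n. pnorm (p n - a) (q n - c)) \<longlonglongrightarrow> 0"
    using tendsto_add[OF tendsto_divide[OF tendsto_rabs[OF tendsto_diff[OF assms(1) tendsto_const[of a]]] tendsto_const[of 2]] tendsto_rabs[OF tendsto_diff[OF assms(2) tendsto_const[of c]]]]
    by simp
  then have ev: "\<forall>\<^sub>F n in sequentially. pnorm (p n - a) (q n - c) < 1" by (rule order_tendstoD) simp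
  have "(\<lambda>n. Dser (p n) (q n) (t n) - Dser a c (t n)) \<longlonglongrightarrow> 0"
  proof (rule Lim_null_comparison)
    show "\<forall>\<^sub>F n in sequentially. norm (Dser (p n) (q n) (t n) - Dser a c (t n)) \<le> pnorm (p n - a) (q n - c) * B"
    proof (rule eventually_mono[OF ev])
      fix n assume "pnorm (p n - a) (q n - c) < 1"
      then have "\<bar>Dser (a + (p n - a)) (c + (q n - c)) (t n) - Dser a c (t n)\<bar> \<le> pnorm (p n - a) (q n - c) * Dbound a c (t n)"
        using assms(3) by (intro Dser_add_diff_le) auto
      also have "\<dots> \<le> pnorm (p n - a) (q n - c) * B" using B[of "t n"] T assms(3) by (intro mult_left_mono) auto
      finally show "norm (Dser (p n) (q n) (t n) - Dser a c (t n)) \<le> pnorm (p n - a) (q n - c) * B" by simp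
    qed
    show "(\<lambda>n. pnorm (p n - a) (q n - c) * B) \<longlonglongrightarrow> 0" using tendsto_mult_right[OF l, of B] by (simp add: mult.commute tendsto_mult_left_zero l)
  qed
  moreover have "(\<lambda>n. Dser a c (t n)) \<longlonglongrightarrow> Dser a c s"
    using isCont_tendsto_compose[OF DERIV_isCont[OF DERIV_Dser] assms(4)] .
  ultimately show ?thesis using tendsto_add by fastforce
qed

lemma Dser_nonneg_closed:
  assumes "p \<longlonglongrightarrow> a" "q \<longlonglongrightarrow> c" "\<And>n. \<forall>t\<ge>0. Dser (p n) (q n) t \<ge> 0" "t \<ge> 0"
  shows "Dser a c t \<ge> 0"
proof (rule LIMSEQ_le_const)
  show "(\<lambda>n. Dser (p n) (q n) t) \<longlonglongrightarrow> Dser a c t"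
    by (rule Dser_param_continuous[OF assms(1,2)]) (use assms(4) in auto)
qed (use assms in auto)

text \<open>
  A compactness principle: the points where positivity fails cannot escape to infinity by \<open>local_tail_positive\<close>.
\<close>

lemma nonpos_sequence:
  assumes adm: "admissible a c" "\<And>n. admissible (p n) (q n)" and lim: "p \<longlonglongrightarrow> a" "q \<longlonglongrightarrow> c"
    and t: "\<And>n. 0 \<le> t n" "\<And>n. Dser (p n) (q n) (t n) \<le> 0"
  obtains s r where "strict_mono r" "(t \<circ> r) \<longlonglongrightarrow> s" "s \<ge> 0" "Dser a c s \<le> 0"
proof -
  obtain e T where eT: "e > 0" "\<And>a' c' t. admissible a' c' \<Longrightarrow> \<bar>a' - a\<bar> < e \<Longrightarrow> \<bar>c' - c\<bar> < e \<Longrightarrow> t \<ge> T \<Longrightarrow> Dser a' c' t > 0"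
    using local_tail_positive[OF adm(1)] by blast
  have "\<forall>\<^sub>F n in sequentially. \<bar>p n - a\<bar> < e \<and> \<bar>q n - c\<bar> < e"
    using tendstoD[OF lim(1) eT(1)] tendstoD[OF lim(2) eT(1)] by (auto simp: dist_real_def elim: eventually_elim2)
  then obtain N where N: "\<And>n. n \<ge> N \<Longrightarrow> \<bar>p n - a\<bar> < e \<and> \<bar>q n - c\<bar> < e" unfolding eventually_sequentially by blast
  have tb: "t n \<in> {0..T}" if "n \<ge> N" for n
    using eT(2)[OF adm(2)[of n], of "t n"] N[OF that] t[of n] by (cases "t n \<ge> T") auto
  have "compact {0..T}" by simp
  then obtain s r where sr: "s \<in> {0..T}" "strict_mono r" "((\<lambda>n. t (n + N)) \<circ> r) \<longlonglongrightarrow> s"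
    unfolding compact_def using tb by (metis le_add2)
  define r' where "r' n = r n + N" for n
  have r': "strict_mono r'" using sr(2) by (simp add: strict_mono_def r'_def)
  have tl: "(t \<circ> r') \<longlonglongrightarrow> s" using sr(3) by (simp add: o_def r'_def)
  have "(\<lambda>n. Dser (p (r' n)) (q (r' n)) (t (r' n))) \<longlonglongrightarrow> Dser a c s"
    using tl LIMSEQ_subseq_LIMSEQ[OF lim(1) r'] LIMSEQ_subseq_LIMSEQ[OF lim(2) r'] t(1)
    by (intro Dser_param_continuous) (auto simp: o_def)
  then have "Dser a c s \<le> 0" by (rule LIMSEQ_le_const2) (use t(2) in auto)
  then show ?thesis using that[OF r' tl] sr(1) by auto
qed

lemma positive_open:
  assumes adm: "admissible a c" and pos: "\<And>t. t \<ge> 0 \<Longrightarrow> Dser a c t > 0"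
  shows "\<exists>e>0. \<forall>a' c'. admissible a' c' \<longrightarrow> \<bar>a' - a\<bar> < e \<longrightarrow> \<bar>c' - c\<bar> < e \<longrightarrow> (\<forall>t\<ge>0. Dser a' c' t > 0)"
proof (rule ccontr)
  assume neg: "\<not> ?thesis"
  have "\<exists>a' c' t. admissible a' c' \<and> \<bar>a' - a\<bar> < 1 / real (Suc n) \<and> \<bar>c' - c\<bar> < 1 / real (Suc n) \<and> t \<ge> 0 \<and> Dser a' c' t \<le> 0" for n
    using neg by (meson not_less zero_less_divide_1_iff of_nat_0_less_iff zero_less_Suc)
  then obtain p q t where pq: "\<And>n. admissible (p n) (q n)" "\<And>n. \<bar>p n - a\<bar> < 1 / real (Suc n)" "\<And>n. \<bar>q n - c\<bar> < 1 / real (Suc n)"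
    "\<And>n. t n \<ge> 0" "\<And>n. Dser (p n) (q n) (t n) \<le> 0" by metis
  have lim: "X \<longlonglongrightarrow> L" if "\<And>n. \<bar>X n - L\<bar> < 1 / real (Suc n)" for X L
  proof -
    have "(\<lambda>n. X n - L) \<longlonglongrightarrow> 0"
      by (rule Lim_null_comparison[OF _ LIMSEQ_inverse_real_of_nat])
         (use that in \<open>auto simp: inverse_eq_divide less_imp_le intro!: always_eventually\<close>)
    then show ?thesis by (simp add: LIM_zero_iff)
  qed
  obtain s r where "s \<ge> 0" "Dser a c s \<le> 0"
    by (rule nonpos_sequence[OF adm pq(1) lim[OF pq(2)] lim[OF pq(3)] pq(4,5)])
  then show False using pos[of s] by simp
qed

text \<open>
  If positivity failed for arbitrarily small steps, the failure points would accumulate at a zero \<open>s\<close>; dividing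
  the first-order expansion by the step size would give \<open>dirder \<le> 0\<close> at \<open>s\<close>.
\<close>

lemma touching_forward:
  assumes adm: "admissible a c" and nn: "\<And>t. t \<ge> 0 \<Longrightarrow> Dser a c t \<ge> 0"
    and dd: "\<And>t. t > 0 \<Longrightarrow> Dser a c t = 0 \<Longrightarrow> dirder a c x y t > 0"
  shows "\<exists>d>0. \<forall>hh. 0 < hh \<and> hh < d \<and> admissible (a + hh * x) (c + hh * y) \<longrightarrow> (\<forall>t\<ge>0. Dser (a + hh * x) (c + hh * y) t > 0)"
proof (rule ccontr)
  assume neg: "\<not> ?thesis"
  have "\<exists>hh t. 0 < hh \<and> hh < 1 / real (Suc n) \<and> admissible (a + hh * x) (c + hh * y) \<and> t \<ge> 0 \<and> Dser (a + hh * x) (c + hh * y) t \<le> 0" for n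
    using neg by (meson not_less zero_less_divide_1_iff of_nat_0_less_iff zero_less_Suc)
  then obtain hh t where H: "\<And>n. 0 < hh n" "\<And>n. hh n < 1 / real (Suc n)" "\<And>n. admissible (a + hh n * x) (c + hh n * y)" "\<And>n. t n \<ge> 0"
    "\<And>n. Dser (a + hh n * x) (c + hh n * y) (t n) \<le> 0" by metis
  have h0: "hh \<longlonglongrightarrow> 0"
    by (rule Lim_null_comparison[OF _ LIMSEQ_inverse_real_of_nat])
       (use H(1,2) in \<open>auto simp: inverse_eq_divide less_imp_le abs_of_pos intro!: always_eventually\<close>)
  have l1: "(\<lambda>n. a + hh n * x) \<longlonglongrightarrow> a" using tendsto_add[OF tendsto_const[of a] tendsto_mult_right[OF h0, of x]] by simp
  have l2: "(\<lambda>n. c + hh n * y) \<longlonglongrightarrow> c" using tendsto_add[OF tendsto_const[of c] tendsto_mult_right[OF h0, of y]] by simp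
  obtain s r where sr: "strict_mono r" "(t \<circ> r) \<longlonglongrightarrow> s" "s \<ge> 0" "Dser a c s \<le> 0"
    by (rule nonpos_sequence[OF adm H(3) l1 l2 H(4,5)])
  have z: "Dser a c s = 0" using nn[OF sr(3)] sr(4) by simp
  have "s \<noteq> 0" using z Dser_0[of a c] adm by (auto simp: admissible_def)
  then have s: "s > 0" using sr(3) by simp
  have dpos: "dirder a c x y s > 0" by (rule dd[OF s z])
  obtain T where T: "\<And>n. t (r n) \<le> T"
    using convergent_imp_Bseq[OF convergentI[OF sr(2)]] by (metis Bseq_def abs_le_D1 comp_apply real_norm_def)
  obtain B where B: "\<And>t. 0 \<le> t \<Longrightarrow> t \<le> T \<Longrightarrow> Dbound a c t \<le> B" using Dbound_bounded by blast
  define P where "P = pnorm x y"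
  have hr: "(\<lambda>n. hh (r n)) \<longlonglongrightarrow> 0" using LIMSEQ_subseq_LIMSEQ[OF h0 sr(1)] by (simp add: o_def)
  have small: "\<forall>\<^sub>F n in sequentially. hh (r n) * P < 1"
  proof -
    have "(\<lambda>n. hh (r n) * P) \<longlonglongrightarrow> 0" using tendsto_mult_right[OF hr, of P] by simp
    then show ?thesis by (rule order_tendstoD) simp
  qed
  have "\<forall>\<^sub>F n in sequentially. dirder a c x y (t (r n)) \<le> hh (r n) * (P\<^sup>2 * B)"
  proof (rule eventually_mono[OF small])
    fix n assume n: "hh (r n) * P < 1"
    have "\<bar>Dser (a + hh (r n) * x) (c + hh (r n) * y) (t (r n)) - Dser a c (t (r n)) - hh (r n) * dirder a c x y (t (r n))\<bar> \<le> (hh (r n) * P)\<^sup>2 * Dbound a c (t (r n))"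
      unfolding P_def by (rule Dser_first_order) (use n H(1)[of "r n"] H(4) in \<open>auto simp: P_def\<close>)
    moreover have "(hh (r n) * P)\<^sup>2 * Dbound a c (t (r n)) \<le> (hh (r n) * P)\<^sup>2 * B"
      using B[of "t (r n)"] T H(4) by (intro mult_left_mono) auto
    moreover have "Dser (a + hh (r n) * x) (c + hh (r n) * y) (t (r n)) \<le> 0" "Dser a c (t (r n)) \<ge> 0"
      using H(5) nn H(4) by auto
    ultimately have "hh (r n) * dirder a c x y (t (r n)) \<le> (hh (r n) * P)\<^sup>2 * B" by linarith
    also have "\<dots> = hh (r n) * (hh (r n) * (P\<^sup>2 * B))" by (simp add: power2_eq_square)
    finally show "dirder a c x y (t (r n)) \<le> hh (r n) * (P\<^sup>2 * B)" using H(1)[of "r n"] by simp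
  qed
  moreover have "(\<lambda>n. hh (r n) * (P\<^sup>2 * B)) \<longlonglongrightarrow> 0" using tendsto_mult_right[OF hr, of "P\<^sup>2 * B"] by simp
  moreover have "(\<lambda>n. dirder a c x y (t (r n))) \<longlonglongrightarrow> dirder a c x y s"
  proof -
    have "continuous_on {0..T} (dirder a c x y)" by (rule continuous_on_dirder)
    moreover have "s \<in> {0..T}" using sr(3) LIMSEQ_le_const2[OF sr(2)] T by auto
    ultimately show ?thesis
      using sr(2) T H(4) unfolding continuous_on_sequentially comp_def by auto
  qed
  ultimately have "dirder a c x y s \<le> 0" by (intro tendsto_le[OF sequentially_bot, of "\<lambda>n. hh (r n) * (P\<^sup>2 * B)"]) auto
  then show False using dpos by simp
qed

text \<open>
  A positive derivative at a zero means that the density was negative just before.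
\<close>

lemma touching_backward:
  assumes t0: "t0 \<ge> 0" "Dser a c t0 = 0" "dirder a c x y t0 > 0"
  shows "\<exists>d>0. \<forall>hh. 0 < hh \<and> hh < d \<longrightarrow> Dser (a - hh * x) (c - hh * y) t0 < 0"
proof -
  define P where "P = pnorm x y"
  define M where "M = P\<^sup>2 * Dbound a c t0"
  define L where "L = dirder a c x y t0"
  define d where "d = min (1 / (P + 1)) (L / (\<bar>M\<bar> + 1))"
  have P: "P \<ge> 0" by (simp add: P_def)
  have d: "d > 0" using t0(3) P by (auto simp: d_def L_def)
  have "Dser (a - hh * x) (c - hh * y) t0 < 0" if hh: "0 < hh" "hh < d" for hh
  proof -
    have h1: "hh * (P + 1) < 1" "hh * (\<bar>M\<bar> + 1) < L"
      using hh P by (auto simp: d_def less_divide_eq)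
    have "\<bar>Dser (a + (- hh) * x) (c + (- hh) * y) t0 - Dser a c t0 - (- hh) * L\<bar> \<le> ((- hh) * P)\<^sup>2 * Dbound a c t0"
      unfolding P_def L_def by (rule Dser_first_order) (use h1 hh t0 in \<open>auto simp: P_def algebra_simps\<close>)
    then have "Dser (a - hh * x) (c - hh * y) t0 \<le> - hh * L + hh * (hh * M)" using t0(2) by (simp add: M_def power2_eq_square mult_ac)
    moreover have "hh * (hh * M) < hh * L"
    proof (intro mult_strict_left_mono)
      have "hh * M \<le> hh * (\<bar>M\<bar> + 1)" using hh by (intro mult_left_mono) auto
      then show "hh * M < L" using h1 by linarith
    qed (use hh in simp)
    ultimately show ?thesis by simp
  qed
  then show ?thesis using d by blast
qed

text \<open>
  A continuity argument along a segment of parameters. Let \<open>m\<close> be the largest time up to which the density is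
  nonnegative. By closedness it is nonnegative at \<open>m\<close>, by \<open>touching_forward\<close> it is positive right after \<open>m\<close>, so \<open>m\<close> is the
  end of the segment; a zero there would contradict nonnegativity before by \<open>touching_backward\<close>.
\<close>

theorem path_positive:
  assumes adm: "\<And>\<tau>. 0 \<le> \<tau> \<Longrightarrow> \<tau> \<le> 1 \<Longrightarrow> admissible (a + \<tau> * x) (c + \<tau> * y)"
    and nn: "\<And>t. t \<ge> 0 \<Longrightarrow> Dser a c t \<ge> 0"
    and dd: "\<And>\<tau> t. 0 \<le> \<tau> \<Longrightarrow> \<tau> \<le> 1 \<Longrightarrow> t > 0 \<Longrightarrow> (\<And>u. u \<ge> 0 \<Longrightarrow> Dser (a + \<tau> * x) (c + \<tau> * y) u \<ge> 0) \<Longrightarrow>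
        Dser (a + \<tau> * x) (c + \<tau> * y) t = 0 \<Longrightarrow> dirder (a + \<tau> * x) (c + \<tau> * y) x y t > 0"
    and tau: "0 < \<tau>" "\<tau> \<le> 1" and t: "t \<ge> 0"
  shows "Dser (a + \<tau> * x) (c + \<tau> * y) t > 0"
proof (rule ccontr)
  assume neg: "\<not> ?thesis"
  define G where "G \<tau> \<longleftrightarrow> (\<forall>t\<ge>0. Dser (a + \<tau> * x) (c + \<tau> * y) t \<ge> 0)" for \<tau>
  define S where "S = {\<tau>'. 0 \<le> \<tau>' \<and> \<tau>' \<le> \<tau> \<and> (\<forall>u. 0 \<le> u \<and> u \<le> \<tau>' \<longrightarrow> G u)}"
  have G0: "G 0" using nn by (simp add: G_def)
  have S0: "0 \<in> S" using G0 tau by (auto simp: S_def)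
  have bdd: "bdd_above S" by (rule bdd_aboveI[of _ \<tau>]) (auto simp: S_def)
  \<comment> \<open>the last time up to which nonnegativity is known\<close>
  define m where "m = Sup S"
  have m: "0 \<le> m" "m \<le> \<tau>" unfolding m_def using S0 bdd by (auto intro: cSup_upper cSup_least simp: S_def)
  have below: "G u" if u: "0 \<le> u" "u < m" for u
  proof -
    obtain v where "v \<in> S" "u < v" using less_cSupE[of u S] u S0 unfolding m_def by blast
    then show ?thesis using u by (auto simp: S_def)
  qed
  have Gm: "G m"
  proof (cases "m = 0")
    case False
    then have m0: "m > 0" using m by simp
    define u where "u n = m * (1 - 1 / real (Suc n))" for n
    have ul: "u \<longlonglongrightarrow> m"
    proof -
      have "(\<lambda>n. m * (1 - inverse (real (Suc n)))) \<longlonglongrightarrow> m * (1 - 0)"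
        by (intro tendsto_intros LIMSEQ_inverse_real_of_nat)
      then show ?thesis by (simp add: u_def[abs_def] inverse_eq_divide)
    qed
    have u: "0 \<le> u n" "u n < m" for n using m0 by (auto simp: u_def mult_less_cancel_left2)
    show ?thesis unfolding G_def
    proof (intro allI impI)
      fix t :: real assume t: "t \<ge> 0"
      show "Dser (a + m * x) (c + m * y) t \<ge> 0"
        by (rule Dser_nonneg_closed[of "\<lambda>n. a + u n * x" _ "\<lambda>n. c + u n * y"])
           (use below[OF u] t ul in \<open>auto simp: G_def intro!: tendsto_intros\<close>)
    qed
  qed (use G0 in simp)
  have m1: "m \<le> 1" using m tau by simp
  have fw: "\<exists>d>0. \<forall>hh. 0 < hh \<and> hh < d \<and> admissible ((a + m * x) + hh * x) ((c + m * y) + hh * y) \<longrightarrow> (\<forall>t\<ge>0. Dser ((a + m * x) + hh * x) ((c + m * y) + hh * y) t > 0)"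
    by (rule touching_forward[OF adm[OF m(1) m1]]) (use Gm dd[OF m(1) m1] in \<open>auto simp: G_def\<close>)
  show False
  proof (cases "m = \<tau>")
    case False
    then have mt: "m < \<tau>" using m by simp
    obtain d where d: "d > 0" "\<And>hh. 0 < hh \<Longrightarrow> hh < d \<Longrightarrow> admissible ((a + m * x) + hh * x) ((c + m * y) + hh * y) \<Longrightarrow> (\<forall>t\<ge>0. Dser ((a + m * x) + hh * x) ((c + m * y) + hh * y) t > 0)"
      using fw by blast
    define v where "v = min (d / 2) (\<tau> - m)"
    have v: "v > 0" "v < d" "m + v \<le> \<tau>" using d(1) mt by (auto simp: v_def)
    have "G u" if u: "0 \<le> u" "u \<le> m + v" for u
    proof -
      consider "u < m" | "u = m" | "u > m" by linarith
      then show ?thesis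
      proof cases
        case 3
        have e: "(a + m * x) + (u - m) * x = a + u * x" "(c + m * y) + (u - m) * y = c + u * y" by (auto simp: algebra_simps)
        have "admissible (a + u * x) (c + u * y)" using u v tau by (intro adm) auto
        then show ?thesis unfolding G_def using d(2)[of "u - m"] 3 u v unfolding e by (auto intro: less_imp_le)
      qed (use below u Gm in auto)
    qed
    then have "m + v \<in> S" using v m by (auto simp: S_def)
    then have "m + v \<le> m" unfolding m_def using bdd by (intro cSup_upper) auto
    then show False using v by simp
  next
    case True
    have z: "Dser (a + m * x) (c + m * y) t = 0" using neg Gm t unfolding True[symmetric] G_def by force
    have t1: "t \<noteq> 0"
    proof
      assume "t = 0"
      then have "(a + m * x) / 2 + (c + m * y) = 0" using z Dser_0[of "a + m * x" "c + m * y"] by simp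
      moreover have "(a + m * x) / 2 + (c + m * y) > 0"
        using adm[OF m(1) m1] by (intro add_pos_nonneg) (auto simp: admissible_def)
      ultimately show False by simp
    qed
    then have "dirder (a + m * x) (c + m * y) x y t > 0" using dd[OF m(1) m1 _ _ z] Gm t by (auto simp: G_def)
    then obtain d where d: "d > 0" "\<And>hh. 0 < hh \<Longrightarrow> hh < d \<Longrightarrow> Dser ((a + m * x) - hh * x) ((c + m * y) - hh * y) t < 0"
      using touching_backward[OF t z] by blast
    define v where "v = min (d / 2) (m / 2)"
    have v: "v > 0" "v < d" "v < m" using d(1) tau True by (auto simp: v_def)
    have e: "(a + m * x) - v * x = a + (m - v) * x" "(c + m * y) - v * y = c + (m - v) * y" by (auto simp: algebra_simps)
    have "G (m - v)" using v by (intro below) auto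
    then show False using d(2)[OF v(1,2)] t unfolding e G_def by force
  qed
qed

theorem down_closed:
  assumes adm: "admissible a c" and nn: "\<And>t. t \<ge> 0 \<Longrightarrow> Dser a c t \<ge> 0"
    and le: "0 < a'" "a' \<le> a" "0 \<le> c'" "c' \<le> c" "(a', c') \<noteq> (a, c)" and t: "t \<ge> 0"
  shows "Dser a' c' t > 0"
proof -
  have "Dser (a + 1 * (- (a - a'))) (c + 1 * (- (c - c'))) t > 0"
  proof (rule path_positive[OF _ nn _ _ _ t])
    fix \<tau> :: real assume tau: "0 \<le> \<tau>" "\<tau> \<le> 1"
    have b: "a' \<le> a + \<tau> * (- (a - a'))" "a + \<tau> * (- (a - a')) \<le> a" "c' \<le> c + \<tau> * (- (c - c'))" "c + \<tau> * (- (c - c')) \<le> c"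
    proof -
      have m1: "0 \<le> \<tau> * (a - a')" "\<tau> * (a - a') \<le> a - a'" and m2: "0 \<le> \<tau> * (c - c')" "\<tau> * (c - c') \<le> c - c'"
        using tau le by (auto intro: mult_left_le_one_le)
      have e: "\<tau> * (- (a - a')) = - (\<tau> * (a - a'))" "\<tau> * (- (c - c')) = - (\<tau> * (c - c'))" by (simp_all only: mult_minus_right)
      show "a' \<le> a + \<tau> * (- (a - a'))" "a + \<tau> * (- (a - a')) \<le> a" "c' \<le> c + \<tau> * (- (c - c'))" "c + \<tau> * (- (c - c')) \<le> c"
        unfolding e using m1 m2 by linarith+
    qed
    show "admissible (a + \<tau> * (- (a - a'))) (c + \<tau> * (- (c - c')))" using adm b le unfolding admissible_def by linarith
    show "dirder (a + \<tau> * (- (a - a'))) (c + \<tau> * (- (c - c'))) (- (a - a')) (- (c - c')) t > 0"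
      if "t > 0" "\<And>u. u \<ge> 0 \<Longrightarrow> Dser (a + \<tau> * (- (a - a'))) (c + \<tau> * (- (c - c'))) u \<ge> 0" "Dser (a + \<tau> * (- (a - a'))) (c + \<tau> * (- (c - c'))) t = 0" for t
    proof (rule dirder_neg[OF _ _ _ _ _ that])
      show "a - a' \<ge> 0" "c - c' \<ge> 0" "a - a' + (c - c') > 0" using le by auto
      show "0 < a + \<tau> * (- (a - a'))" "0 \<le> c + \<tau> * (- (c - c'))" using b le by linarith+
    qed
  qed auto
  then show ?thesis by simp
qed

section \<open>Necessary conditions from the logarithmic derivative\<close>

text \<open>
  The logarithm of \<open>1 + 1 / y\<close>, for positive \<open>y\<close>.
\<close>

abbreviation lnq :: "real \<Rightarrow> real" where "lnq y \<equiv> ln (y + 1) - ln y"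

text \<open>
  For a nonnegative density the first derivative of \<open>f\<close> is nonnegative, the second is nonpositive, and the first three
  satisfy the log-convexity inequality for moments. Dividing by powers of \<open>f\<close> these become conditions on
  \<open>p = f' / f\<close> and its derivatives; multiplied by \<open>Y = y (y + 1)\<close> only \<open>x = Y p\<close> is transcendental, and it enters
  through polynomial inequalities.
\<close>

lemma log_derivative_conditions:
  assumes nn: "\<And>t. t \<ge> 0 \<Longrightarrow> Dser a c t \<ge> 0" and y: "y > 0"
  defines "x \<equiv> a * (y * ((y + 1) * lnq y - 1)) + c"
    and "B \<equiv> (a + 2 * c) * y + c" and "C \<equiv> 3 * (a + 2 * c) * y\<^sup>2 + (a + 6 * c) * y + 2 * c"
  shows "0 \<le> x" "x\<^sup>2 \<le> B" "B * x\<^sup>2 - C * x + B\<^sup>2 \<le> 0"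
proof -
  define f where "f y = (1 + 1 / y) powr (a * y - c)" for y
  define p where "p y = a * lnq y - (a + c) / (y + 1) + c / y" for y
  define p1 where "p1 y = a / (y + 1) - a / y + (a + c) / (y + 1)\<^sup>2 - c / y\<^sup>2" for y
  define p2 where "p2 y = - a / (y + 1)\<^sup>2 + a / y\<^sup>2 - 2 * (a + c) / (y + 1) ^ 3 + 2 * c / y ^ 3" for y
  have fpos: "f y > 0" if "y > 0" for y
  proof -
    have "1 + 1 / y > 0" using that by (intro add_pos_pos) auto
    then show ?thesis by (simp add: f_def)
  qed
  have fexp: "f y = exp ((a * y - c) * lnq y)" if "y > 0" for y
  proof -
    have "1 + 1 / y = (y + 1) / y" using that by (simp add: field_simps)
    moreover have "ln ((y + 1) / y) = lnq y" using that by (simp add: ln_div)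
    ultimately show ?thesis using that by (simp add: f_def powr_def)
  qed
  have df: "(f has_real_derivative f y * p y) (at y)" if "y > 0" for y
  proof (rule has_field_derivative_transform_within_open[OF _ open_greaterThan[of 0]])
    have l1: "((\<lambda>y. a * y - c) has_real_derivative a) (at y)" by (auto intro!: derivative_eq_intros)
    have l2: "((\<lambda>y. lnq y) has_real_derivative 1 / (y + 1) - 1 / y) (at y)"
      using that by (auto intro!: derivative_eq_intros simp: divide_inverse)
    have "((\<lambda>y. exp ((a * y - c) * lnq y)) has_real_derivative exp ((a * y - c) * lnq y) * (a * lnq y + (a * y - c) * (1 / (y + 1) - 1 / y))) (at y)"
      using DERIV_chain2[OF DERIV_exp DERIV_mult[OF l1 l2]] by (simp add: mult.commute)
    moreover have "a * lnq y + (a * y - c) * (1 / (y + 1) - 1 / y) = p y"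
    proof -
      have "(a * y - c) * (1 / (y + 1) - 1 / y) = - ((a + c) / (y + 1)) + c / y"
        using that by (simp add: divide_simps) (simp add: algebra_simps)
      then show ?thesis by (simp add: p_def)
    qed
    ultimately show "((\<lambda>y. exp ((a * y - c) * lnq y)) has_real_derivative f y * p y) (at y)"
      using fexp[OF that] by simp
  qed (use that fexp in auto)
  have dp: "(p has_real_derivative p1 y) (at y)" if "y > 0" for y
  proof -
    have "(p has_real_derivative a * (1 / (y + 1) - 1 / y) + (a + c) / ((y + 1) * (y + 1)) - c / (y * y)) (at y)"
      unfolding p_def[abs_def] using that by (auto intro!: derivative_eq_intros) (simp only: minus_divide_left minus_diff_eq diff_minus_eq_add add.commute)
    then show ?thesis by (simp add: p1_def power2_eq_square right_diff_distrib)
  qed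
  have dp1: "(p1 has_real_derivative p2 y) (at y)" if "y > 0" for y
  proof -
    have i2: "((\<lambda>y. k / (y + s)\<^sup>2) has_real_derivative - 2 * k / (y + s) ^ 3) (at y)" if "y + s > 0" for k s
    proof -
      have "((\<lambda>y. k / (y + s)\<^sup>2) has_real_derivative - (k * (2 * (y + s))) / ((y + s)\<^sup>2 * (y + s)\<^sup>2)) (at y)"
        using that by (auto intro!: derivative_eq_intros)
      moreover have "- (k * (2 * z)) / (z\<^sup>2 * z\<^sup>2) = - 2 * k / z ^ 3" if "z > 0" for z :: real
        using that by (simp add: power2_eq_square power3_eq_cube) (simp add: mult.commute)
      from this[OF that] have "- (k * (2 * (y + s))) / ((y + s)\<^sup>2 * (y + s)\<^sup>2) = - 2 * k / (y + s) ^ 3" .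
      ultimately show ?thesis by simp
    qed
    have i1: "((\<lambda>y. k / (y + s)) has_real_derivative - k / (y + s)\<^sup>2) (at y)" if "y + s > 0" for k s
      using that by (auto intro!: derivative_eq_intros simp: power2_eq_square)
    have "((\<lambda>y. a / (y + 1) - a / (y + 0) + (a + c) / (y + 1)\<^sup>2 - c / (y + 0)\<^sup>2) has_real_derivative
       - a / (y + 1)\<^sup>2 - - a / (y + 0)\<^sup>2 + - 2 * (a + c) / (y + 1) ^ 3 - - 2 * c / (y + 0) ^ 3) (at y)"
      by (intro DERIV_add DERIV_diff i1 i2) (use that in auto)
    moreover have "- a / (y + 1)\<^sup>2 - - a / (y + 0)\<^sup>2 + - 2 * (a + c) / (y + 1) ^ 3 - - 2 * c / (y + 0) ^ 3 = p2 y"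
      by (simp add: p2_def add_divide_distrib diff_divide_distrib)
    ultimately show ?thesis by (simp add: p1_def[abs_def])
  qed
  have g0: "f y = gder 1 a c 0 y" if "y > 0" for y
    unfolding f_def using scaled_powr_eq[OF that, of a c] by (simp add: gder_def add.commute mult.commute)
  have dg: "(gder 1 a c n has_real_derivative gder 1 a c (Suc n) y) (at y)" if "y > 0" for n y
    by (rule DERIV_gder) (use that in auto)
  have uniq: "E = gder 1 a c (Suc n) y'" if "\<And>y. y > 0 \<Longrightarrow> F1 y = gder 1 a c n y" "(F1 has_real_derivative E) (at y')" "y' > 0" for F1 E n y'
  proof -
    have "(F1 has_real_derivative gder 1 a c (Suc n) y') (at y')"
      by (rule has_field_derivative_transform_within_open[OF dg[OF that(3)] open_greaterThan[of 0]]) (use that in auto)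
    then show ?thesis using that(2) DERIV_unique by blast
  qed
  have g1: "f y * p y = gder 1 a c 1 y" if "y > 0" for y
    using uniq[OF g0 df[OF that] that] by simp
  have d1: "((\<lambda>y. f y * p y) has_real_derivative f y * ((p y)\<^sup>2 + p1 y)) (at y)" if "y > 0" for y
    using DERIV_mult[OF df[OF that] dp[OF that]] by (simp add: power2_eq_square algebra_simps)
  have g2: "f y * ((p y)\<^sup>2 + p1 y) = gder 1 a c 2 y" if "y > 0" for y
    using uniq[OF g1 d1[OF that] that] by (simp add: numeral_2_eq_2)
  have d2: "((\<lambda>y. f y * ((p y)\<^sup>2 + p1 y)) has_real_derivative f y * ((p y) ^ 3 + 3 * p y * p1 y + p2 y)) (at y)" if "y > 0" for y
  proof -
    have "((\<lambda>y. (p y)\<^sup>2 + p1 y) has_real_derivative 2 * p y * p1 y + p2 y) (at y)"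
      using dp[OF that] dp1[OF that] by (auto intro!: derivative_eq_intros)
    from DERIV_mult[OF df[OF that] this] show ?thesis by (simp add: power2_eq_square power3_eq_cube algebra_simps)
  qed
  have g3: "f y * ((p y) ^ 3 + 3 * p y * p1 y + p2 y) = gder 1 a c 3 y" if "y > 0" for y
    using uniq[OF g2 d2[OF that] that] by (simp add: numeral_3_eq_3 numeral_2_eq_2)
  define z where "z = 1 / (y + 1)"
  have z: "0 < z" "z < 1" using y by (auto simp: z_def)
  note pn = psum_nonneg[OF nn z]
  have e1: "gder 1 a c 1 y = exp a * (z ^ 2 * psum a c 1 z)" "gder 1 a c 2 y = - (exp a * (z ^ 3 * psum a c 2 z))"
     "gder 1 a c 3 y = exp a * (z ^ 4 * psum a c 3 z)"
    by (simp_all add: gder_def z_def numeral_2_eq_2 numeral_3_eq_3 eval_nat_numeral)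
  have lc: "(gder 1 a c 2 y)\<^sup>2 \<le> gder 1 a c 1 y * gder 1 a c 3 y"
  proof -
    have "(exp a)\<^sup>2 * z ^ 6 * (psum a c 2 z)\<^sup>2 \<le> (exp a)\<^sup>2 * z ^ 6 * (psum a c 1 z * psum a c 3 z)"
      using psum_log_convex[OF nn z] z by (intro mult_left_mono) auto
    then show ?thesis unfolding e1 by (simp add: power_mult_distrib power2_eq_square eval_nat_numeral mult_ac)
  qed
  have P0: "p y \<ge> 0"
  proof -
    have "f y * p y \<ge> 0" unfolding g1[OF y] e1 using pn z by simp
    then show ?thesis using fpos[OF y] by (simp add: zero_le_mult_iff)
  qed
  have P1: "(p y)\<^sup>2 + p1 y \<le> 0"
  proof -
    have "f y * ((p y)\<^sup>2 + p1 y) \<le> 0" unfolding g2[OF y] e1 using pn z by simp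
    then show ?thesis using fpos[OF y] by (simp add: mult_le_0_iff)
  qed
  have P2: "(p1 y)\<^sup>2 \<le> (p y)\<^sup>2 * p1 y + p y * p2 y"
  proof -
    have "(f y * ((p y)\<^sup>2 + p1 y))\<^sup>2 \<le> (f y * p y) * (f y * ((p y) ^ 3 + 3 * p y * p1 y + p2 y))"
      using lc unfolding g1[OF y] g2[OF y] g3[OF y] .
    then have "(f y)\<^sup>2 * ((p y)\<^sup>2 + p1 y)\<^sup>2 \<le> (f y)\<^sup>2 * (p y * ((p y) ^ 3 + 3 * p y * p1 y + p2 y))"
      by (simp add: power_mult_distrib power2_eq_square mult_ac)
    then have "((p y)\<^sup>2 + p1 y)\<^sup>2 \<le> p y * ((p y) ^ 3 + 3 * p y * p1 y + p2 y)" using fpos[OF y] by simp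
    then show ?thesis by (simp add: power2_eq_square power3_eq_cube algebra_simps)
  qed
  define Y where "Y = y * (y + 1)"
  have Y: "Y > 0" using y by (simp add: Y_def)
  have xp: "x = Y * p y"
    using y unfolding x_def p_def Y_def by (simp add: divide_simps) (simp add: algebra_simps)
  have Bp: "B = - (Y\<^sup>2 * p1 y)"
  proof -
    have "Y\<^sup>2 * p1 y = a * (y * y * (y + 1)) - a * (y * (y + 1) * (y + 1)) + (a + c) * (y * y) - c * ((y + 1) * (y + 1))"
      using y unfolding p1_def Y_def by (simp add: divide_simps power2_eq_square) (simp add: algebra_simps)
    then show ?thesis by (simp add: B_def algebra_simps)
  qed
  have Cp: "C = Y ^ 3 * p2 y"
  proof -
    have "Y ^ 3 * p2 y = - a * (y * y * y * (y + 1)) + a * (y * (y + 1) * (y + 1) * (y + 1)) - 2 * (a + c) * (y * y * y) + 2 * c * ((y + 1) * (y + 1) * (y + 1))"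
      using y unfolding p2_def Y_def by (simp add: divide_simps power2_eq_square power3_eq_cube) (simp add: algebra_simps)
    then show ?thesis by (simp add: C_def power2_eq_square algebra_simps)
  qed
  show "0 \<le> x" unfolding xp using Y P0 by simp
  have "Y\<^sup>2 * ((p y)\<^sup>2 + p1 y) \<le> 0" using P1 Y by (simp add: mult_le_0_iff)
  then show "x\<^sup>2 \<le> B" unfolding xp Bp by (simp add: power_mult_distrib algebra_simps)
  have "Y ^ 4 * (p1 y)\<^sup>2 \<le> Y ^ 4 * ((p y)\<^sup>2 * p1 y + p y * p2 y)" using P2 Y by (intro mult_left_mono) auto
  then show "B * x\<^sup>2 - C * x + B\<^sup>2 \<le> 0"
    unfolding xp Bp Cp by (simp add: power_mult_distrib power2_eq_square power3_eq_cube eval_nat_numeral algebra_simps)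
qed

text \<open>
  Let \<open>y\<close> tend to 0 in \<open>0 \<le> x\<close>.
\<close>

lemma nonneg_imp_c_nonneg:
  assumes nn: "\<And>t. t \<ge> 0 \<Longrightarrow> Dser a c t \<ge> 0" shows "c \<ge> 0"
proof (rule tendsto_lowerbound[of "\<lambda>y. a * (y * ((y + 1) * lnq y - 1)) + c" c "at_right 0"])
  show "((\<lambda>y. a * (y * ((y + 1) * lnq y - 1)) + c) \<longlongrightarrow> c) (at_right 0)" by real_asymp
  show "\<forall>\<^sub>F y in at_right 0. 0 \<le> a * (y * ((y + 1) * lnq y - 1)) + c"
    using eventually_at_right_less[of 0] by (rule eventually_mono) (rule log_derivative_conditions(1)[OF nn])
qed simp

text \<open>
  For \<open>c \<ge> 1\<close> the inequality \<open>x\<^sup>2 \<le> B\<close> fails near \<open>y = 0\<close>: the constant terms satisfy \<open>c\<^sup>2 \<ge> c\<close>, and the term of order \<open>y\<close>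
  on the left carries a logarithm that tends to infinity.
\<close>

lemma nonneg_imp_c_less_1:
  assumes a: "a > 0" and nn: "\<And>t. t \<ge> 0 \<Longrightarrow> Dser a c t \<ge> 0" shows "c < 1"
proof (rule ccontr)
  assume "\<not> c < 1"
  then have c: "c \<ge> 1" by simp
  have "filterlim (\<lambda>y::real. (y + 1) * lnq y - 1) at_top (at_right 0)" by real_asymp
  then have "\<forall>\<^sub>F y in at_right 0. (y + 1) * lnq y - 1 > (a + 2 * c) / (2 * a * c)" by (simp add: filterlim_at_top_dense)
  moreover have "\<forall>\<^sub>F y::real in at_right 0. y > 0" using eventually_at_right_less[of 0] by simp
  ultimately have "\<forall>\<^sub>F y in at_right 0. y > 0 \<and> (y + 1) * lnq y - 1 > (a + 2 * c) / (2 * a * c)"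
    by eventually_elim simp
  then obtain y where y: "y > 0" and ybig: "(y + 1) * lnq y - 1 > (a + 2 * c) / (2 * a * c)"
    using eventually_happens[of _ "at_right (0::real)"] trivial_limit_at_right_real by blast
  define q where "q = (y + 1) * lnq y - 1"
  have q: "q * (2 * a * c) > a + 2 * c" using ybig a c by (simp add: q_def divide_less_eq)
  have "(a * (y * q) + c)\<^sup>2 \<le> (a + 2 * c) * y + c"
    using log_derivative_conditions(2)[OF nn y] by (simp add: q_def)
  moreover have "(a * (y * q) + c)\<^sup>2 = (a * (y * q))\<^sup>2 + y * (q * (2 * a * c)) + c\<^sup>2"
    by (simp add: power2_sum algebra_simps)
  moreover have "y * (q * (2 * a * c)) > y * (a + 2 * c)" using q y by (intro mult_strict_left_mono) auto
  moreover have "c\<^sup>2 \<ge> c" using c by (simp add: power2_eq_square)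
  moreover have "(a + 2 * c) * y = y * (a + 2 * c)" by simp
  ultimately have "(a * (y * q))\<^sup>2 < 0" by linarith
  then show False using zero_le_power2[of "a * (y * q)"] by linarith
qed

lemma ln3_bounds: "1.0984 \<le> ln (3::real)" "ln (3::real) \<le> 1.09876"
proof -
  have "ln (3::real) \<in> {(\<Sum>k<5. 2 * ((3 - 1) / (3 + 1)) ^ (2 * k + 1) / real (2 * k + 1))..
     (\<Sum>k<5. 2 * ((3 - 1) / (3 + 1)) ^ (2 * k + 1) / real (2 * k + 1)) + 2 * (((3 - 1) / (3 + 1)) ^ (2 * 5 + 1) / (1 - ((3 - 1) / (3 + 1))\<^sup>2) / real (2 * 5 + 1))}"
    by (rule ln_approx_bounds) simp
  then show "1.0984 \<le> ln (3::real)" "ln (3::real) \<le> 1.09876"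
    by (simp_all add: eval_nat_numeral field_simps)
qed

lemma K0_bounds: "2.94 < K0" "K0 < 3"
proof -
  define L where "L = 3 * ln (3::real) - 2"
  have L: "1.2952 \<le> L" "L \<le> 1.2963" using ln3_bounds by (auto simp: L_def)
  have K: "K0 = (10 * L - 8) / L\<^sup>2" by (simp add: K0_def L_def)
  have L2: "L\<^sup>2 > 0" using L by simp
  have "L\<^sup>2 \<le> 1.2963\<^sup>2" using L by (intro power_mono) auto
  then have "2.94 * L\<^sup>2 < 10 * L - 8" using L by (simp add: power2_eq_square)
  then show "2.94 < K0" unfolding K using L2 by (simp add: less_divide_eq)
  have "(4 / 3 - L) * (2 - L) > 0" using L by (intro mult_pos_pos) auto
  moreover have "3 * ((4 / 3 - L) * (2 - L)) = 3 * L\<^sup>2 - 10 * L + 8"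
    by (simp add: power2_eq_square algebra_simps diff_divide_distrib add_divide_distrib)
  ultimately have "10 * L - 8 < 3 * L\<^sup>2" by linarith
  then show "K0 < 3" unfolding K using L2 by (simp add: divide_less_eq)
qed

text \<open>
  The third condition at \<open>y = 1/2\<close>, where \<open>ln (1 + 1 / y) = ln 3\<close>. Its left side \<open>P\<close> splits into a multiple of
  \<open>a + c - K0\<close> plus \<open>c Q\<close>, and \<open>Q\<close> is positive when \<open>a + c \<ge> K0\<close>.
\<close>

lemma nonneg_imp_K0_bound:
  assumes a: "a > 0" and nn: "\<And>t. t \<ge> 0 \<Longrightarrow> Dser a c t \<ge> 0"
  shows "a + c \<le> K0" "c > 0 \<Longrightarrow> a + c < K0"
proof -
  have c: "0 \<le> c" "c < 1" using nonneg_imp_c_nonneg[OF nn] nonneg_imp_c_less_1[OF a nn] by auto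
  define L where "L = 3 * ln (3::real) - 2"
  have L: "1.2952 \<le> L" "L \<le> 1.2963" using ln3_bounds by (auto simp: L_def)
  have L2: "L\<^sup>2 > 0" using L by simp
  have K: "K0 * L\<^sup>2 = 10 * L - 8" using L2 by (simp add: K0_def L_def)
  define x where "x = a * L / 4 + c"
  define P where "P = (a / 2 + 2 * c) * x\<^sup>2 - (5 / 4 * a + 13 / 2 * c) * x + (a / 2 + 2 * c)\<^sup>2"
  have "P \<le> 0"
  proof -
    have l: "ln (1 / 2 + 1 :: real) - ln (1 / 2) = ln 3"
      using ln_div[of "3 / 2" "1 / 2 :: real"] by simp
    have "a * (1 / 2 * ((1 / 2 + 1) * (ln (1 / 2 + 1) - ln (1 / 2)) - 1)) + c = x"
      unfolding l x_def L_def by simp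
    then show ?thesis using log_derivative_conditions(3)[OF nn, of "1 / 2"]
      by (simp add: P_def power2_eq_square algebra_simps)
  qed
  define Q where "Q = a\<^sup>2 * (L / 4 + 3 * L\<^sup>2 / 32) + a * (3 / 4 - 13 / 8 * L) + c * (a * (1 / 2 + L) - 5 / 2) + 2 * c\<^sup>2"
  have PQ: "P = a\<^sup>2 * L\<^sup>2 / 32 * (a + c - K0) + c * Q"
  proof -
    have "a\<^sup>2 * L\<^sup>2 / 32 * (a + c - K0) = a\<^sup>2 / 32 * (a * L\<^sup>2 + c * L\<^sup>2 - K0 * L\<^sup>2)"
      by (simp add: algebra_simps diff_divide_distrib add_divide_distrib)
    also have "\<dots> = a\<^sup>2 / 32 * (a * L\<^sup>2 + c * L\<^sup>2 - (10 * L - 8))" unfolding K ..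
    finally show ?thesis unfolding P_def Q_def x_def
      by (simp add: power2_eq_square algebra_simps diff_divide_distrib add_divide_distrib)
  qed
  have Qpos: "Q > 0" if ge: "a + c \<ge> K0"
  proof -
    \<comment> \<open>\<open>2.94\<close> is a lower bound of \<open>K0\<close>, so \<open>u\<close> is nonnegative and the bound for \<open>Q\<close> has positive coefficients in \<open>c\<close> and \<open>u\<close>\<close>
    define u where "u = a + c - 2.94"
    have u: "u \<ge> 0" and au: "a = 2.94 - c + u" using ge K0_bounds by (auto simp: u_def)
    have L2b: "L\<^sup>2 \<ge> 1.2952\<^sup>2" using L by (intro power_mono) auto
    have "a\<^sup>2 * (L / 4 + 3 * L\<^sup>2 / 32) \<ge> a\<^sup>2 * 0.481" using L L2b by (intro mult_left_mono) (auto simp: power2_eq_square)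
    moreover have "a * (3 / 4 - 13 / 8 * L) \<ge> a * (- 1.357)" using L a by (intro mult_left_mono) auto
    moreover have "c * (a * (1 / 2 + L) - 5 / 2) \<ge> c * (a * 1.795 - 2.5)" using L a c by (intro mult_left_mono diff_mono) auto
    ultimately have le: "Q \<ge> a\<^sup>2 * 0.481 + a * (- 1.357) + c * (a * 1.795 - 2.5) + 2 * c\<^sup>2" unfolding Q_def by linarith
    have eq: "a\<^sup>2 * 0.481 + a * (- 1.357) + c * (a * 1.795 - 2.5) + 2 * c\<^sup>2
      = 0.1679916 + c * 1.30602 + c * c * 0.686 + u * (1.47128 + 0.833 * c) + u * u * 0.481"
      unfolding au by (simp add: power2_eq_square algebra_simps diff_divide_distrib add_divide_distrib)
    have "0 < 0.1679916 + c * 1.30602 + c * c * 0.686 + u * (1.47128 + 0.833 * c) + u * u * 0.481"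
      using c u by (intro add_pos_nonneg mult_nonneg_nonneg add_nonneg_nonneg) auto
    then show ?thesis using le unfolding eq by (rule less_le_trans)
  qed
  have aL: "a\<^sup>2 * L\<^sup>2 / 32 > 0" using a L2 by simp
  show "c > 0 \<Longrightarrow> a + c < K0"
  proof (rule ccontr)
    assume "c > 0" "\<not> a + c < K0"
    then have "P > 0" unfolding PQ using Qpos aL by (intro add_nonneg_pos mult_nonneg_nonneg mult_pos_pos) auto
    then show False using \<open>P \<le> 0\<close> by simp
  qed
  show "a + c \<le> K0"
  proof (rule ccontr)
    assume n: "\<not> a + c \<le> K0"
    then have "P > 0" unfolding PQ using Qpos aL c by (intro add_pos_nonneg mult_nonneg_nonneg mult_pos_pos) (auto intro: less_imp_le)
    then show False using \<open>P \<le> 0\<close> by simp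
  qed
qed

text \<open>
  The third condition is a quadratic inequality in \<open>x\<close>; at \<open>y = 2 d / 3\<close> its discriminant is negative, because
  \<open>1 + d < (1 + d / 3) ^ 3\<close>. So nonnegativity fails, with \<open>d = sqrt (1 + b)\<close> giving the second term of \<open>U\<close>.
\<close>

lemma not_nonneg_at_U:
  assumes d: "0 < d" "d \<le> 1"
  shows "\<not> (\<forall>t\<ge>0. Dser (2 * d\<^sup>2 + 2 * d) (1 - d\<^sup>2) t \<ge> 0)"
proof
  assume nn: "\<forall>t\<ge>0. Dser (2 * d\<^sup>2 + 2 * d) (1 - d\<^sup>2) t \<ge> 0"
  \<comment> \<open>chosen so that \<open>B\<close> and \<open>C\<close> factor and the discriminant can be compared\<close>
  define y where "y = 2 * d / 3"
  define a where "a = 2 * d\<^sup>2 + 2 * d"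
  define c where "c = 1 - d\<^sup>2"
  define B where "B = (1 + d) * (1 + d / 3)"
  define C where "C = 2 * (1 + d)\<^sup>2"
  have y: "y > 0" using d by (simp add: y_def)
  have eB: "(a + 2 * c) * y + c = B" by (simp add: a_def c_def y_def B_def power2_eq_square field_simps)
  have eC: "3 * (a + 2 * c) * y\<^sup>2 + (a + 6 * c) * y + 2 * c = C"
    by (simp add: a_def c_def y_def C_def power2_eq_square field_simps)
  obtain x where x: "B * x\<^sup>2 - C * x + B\<^sup>2 \<le> 0"
    using log_derivative_conditions(3)[of a c y] nn y unfolding eB eC by (auto simp: a_def c_def)
  have Bp: "B > 0" using d by (simp add: B_def add_pos_pos)
  have "4 * B * (B * x\<^sup>2 - C * x + B\<^sup>2) = (2 * B * x - C)\<^sup>2 + (4 * B ^ 3 - C\<^sup>2)"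
    by (simp add: power2_eq_square power3_eq_cube algebra_simps)
  moreover have "4 * B * (B * x\<^sup>2 - C * x + B\<^sup>2) \<le> 0" using x Bp by (simp add: mult_le_0_iff)
  moreover have "C\<^sup>2 < 4 * B ^ 3"
  proof -
    have "(1 + d / 3) ^ 3 = 1 + d + (d * d / 3 + d * d * d / 27)" by (simp add: power3_eq_cube field_simps)
    moreover have "d * d / 3 + d * d * d / 27 > 0" using d by (intro add_pos_pos) auto
    ultimately have "1 + d < (1 + d / 3) ^ 3" by linarith
    then have "4 * (1 + d) ^ 3 * (1 + d) < 4 * (1 + d) ^ 3 * (1 + d / 3) ^ 3" using d by (intro mult_strict_left_mono) auto
    moreover have "(2 * g\<^sup>2)\<^sup>2 = 4 * g ^ 3 * g" for g :: real by (simp add: power2_eq_square power3_eq_cube)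
    moreover have "4 * B ^ 3 = 4 * (1 + d) ^ 3 * (1 + d / 3) ^ 3" by (simp add: B_def power_mult_distrib)
    ultimately show ?thesis unfolding C_def by simp
  qed
  ultimately show False using zero_le_power2[of "2 * B * x - C"] by linarith
qed

section \<open>The critical parameter\<close>

definition good :: "real \<Rightarrow> real \<Rightarrow> bool" where "good a c \<longleftrightarrow> a > 0 \<and> (\<forall>t\<ge>0. Dser a c t \<ge> 0)"

lemma good_admissible: "good a c \<Longrightarrow> admissible a c"
  using nonneg_imp_K0_bound(1)[of a c] nonneg_imp_c_nonneg[of a c] nonneg_imp_c_less_1[of a c] K0_bounds
  unfolding good_def admissible_def by force

lemma good_down: "good a c \<Longrightarrow> 0 < a' \<Longrightarrow> a' \<le> a \<Longrightarrow> 0 \<le> c' \<Longrightarrow> c' \<le> c \<Longrightarrow> (a', c') \<noteq> (a, c) \<Longrightarrow> t \<ge> 0 \<Longrightarrow> Dser a' c' t > 0"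
  using down_closed[OF good_admissible] unfolding good_def by blast

lemma good_downI: "good a c \<Longrightarrow> 0 < a' \<Longrightarrow> a' \<le> a \<Longrightarrow> 0 \<le> c' \<Longrightarrow> c' \<le> c \<Longrightarrow> good a' c'"
  using good_down[of a c a' c'] unfolding good_def by (cases "(a', c') = (a, c)") (auto intro: less_imp_le)

text \<open>
  On the line \<open>a + c = 1\<close> the argument of the sine in \<open>w\<close> stays in \<open>[0, pi]\<close>, so the weight and all coefficients are nonnegative.
  This shows that the supremum below is over a nonempty set.
\<close>

lemma good_diagonal:
  assumes "0 \<le> c" "c < 1" shows "good (1 - c) c"
proof -
  have pos: "dens (1 - c) c n \<ge> 0" for n
  proof (cases "n \<ge> 2")
    case True
    have "0 \<le> (LINT s:{0<..<1}|lborel. w (1 - c) c s * (1 - s) ^ n)"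
      unfolding set_lebesgue_integral_def
    proof (rule integral_nonneg_AE, rule AE_I2)
      fix s :: real
      show "0 \<le> indicator {0<..<1} s *\<^sub>R (w (1 - c) c s * (1 - s) ^ n)"
      proof (cases "s \<in> {0<..<1}")
        case s: True
        have "(1 - c) * s \<le> 1 - c" using mult_left_mono[of s 1 "1 - c"] s assms by simp
        then have "(1 - c) * s + c \<le> 1" by (simp only: le_diff_eq)
        moreover have "0 \<le> (1 - c) * s + c" using s assms by (intro add_nonneg_nonneg mult_nonneg_nonneg) auto
        ultimately have "sin (pi * ((1 - c) * s + c)) \<ge> 0"
          by (intro sin_ge_zero) (auto simp: mult_le_cancel_left1)
        then have "w (1 - c) c s \<ge> 0" unfolding w_def by (intro mult_nonneg_nonneg) auto
        then show ?thesis using s by simp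
      qed simp
    qed
    then have "0 \<le> exp (1 - c) * dens (1 - c) c n" using dens_integral(2)[of "1 - c" c n] assms True by simp
    then show ?thesis by (simp add: zero_le_mult_iff)
  next
    case False
    then consider "n = 0" | "n = 1" by linarith
    then show ?thesis
    proof cases
      case 1
      show ?thesis using assms unfolding 1 dens_0 q1_def by simp
    next
      case 2
      have "q1 (1 - c) c - q2 (1 - c) c = (1 - c) * (1 + 3 * c) / 24"
        by (simp add: q1_def q2_def power2_eq_square field_simps)
      moreover have "(1 - c) * (1 + 3 * c) / 24 \<ge> 0" using assms by (intro divide_nonneg_nonneg mult_nonneg_nonneg) auto
      ultimately show ?thesis unfolding 2 dens_1 by (simp only:)
    qed
  qed
  have "Dser (1 - c) c t \<ge> 0" if "t \<ge> 0" for t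
    using Dser_ge_taylor[of 0 "1 - c" c t] pos that by simp
  then show ?thesis using assms by (simp add: good_def)
qed

definition Acrit :: "real \<Rightarrow> real" where "Acrit c = Sup {a. good a c}"

lemma Acrit_props:
  assumes c: "0 \<le> c" "c < 1"
  shows good_Acrit: "good (Acrit c) c" and le_Acrit: "good a c \<Longrightarrow> a \<le> Acrit c"
proof -
  have ne: "{a. good a c} \<noteq> {}" using good_diagonal[OF c] by blast
  have bdd: "bdd_above {a. good a c}"
    by (rule bdd_aboveI[of _ 3]) (use good_admissible c in \<open>force simp: admissible_def\<close>)
  show le: "good a c \<Longrightarrow> a \<le> Acrit c" for a unfolding Acrit_def by (rule cSup_upper) (use bdd in auto)
  have A0: "Acrit c > 0" using le[OF good_diagonal[OF c]] c by simp
  have below: "good a c" if a: "0 < a" "a < Acrit c" for a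
  proof -
    obtain a' where "good a' c" "a < a'" using less_cSupE[OF a(2)[unfolded Acrit_def] ne] by blast
    then show ?thesis using good_downI[of a' c a c] a c by simp
  qed
  define p where "p n = Acrit c * (1 - inverse (real (Suc (Suc n))))" for n
  have "(\<lambda>n. Acrit c * (1 - inverse (real (Suc (Suc n))))) \<longlonglongrightarrow> Acrit c * (1 - 0)"
    by (intro tendsto_intros LIMSEQ_Suc[OF LIMSEQ_inverse_real_of_nat])
  then have pl: "p \<longlonglongrightarrow> Acrit c" by (simp add: p_def[abs_def])
  have "0 < p n" "p n < Acrit c" for n using A0 by (auto simp: p_def mult_less_cancel_left2 inverse_less_1_iff)
  then have gp: "good (p n) c" for n using below by blast
  have "Dser (Acrit c) c t \<ge> 0" if "t \<ge> 0" for t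
    by (rule Dser_nonneg_closed[OF pl tendsto_const[of c]]) (use gp that in \<open>auto simp: good_def\<close>)
  then show "good (Acrit c) c" using A0 by (simp add: good_def)
qed

lemma good_iff_le_Acrit:
  assumes c: "0 \<le> c" "c < 1" and a: "a > 0" shows "good a c \<longleftrightarrow> a \<le> Acrit c"
  using good_downI[OF good_Acrit[OF c], of a c] le_Acrit[OF c, of a] a c by auto

lemma positive_below_Acrit:
  assumes c: "0 \<le> c" "c < 1" and a: "0 < a" "a < Acrit c" "t \<ge> 0" shows "Dser a c t > 0"
  using good_down[OF good_Acrit[OF c], of a c t] a c by simp

text \<open>
  Otherwise positivity would persist for slightly larger \<open>a\<close> by \<open>positive_open\<close>.
\<close>

lemma Acrit_zero:
  assumes c: "0 \<le> c" "c < 1" shows "\<exists>t>0. Dser (Acrit c) c t = 0"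
proof (rule ccontr)
  assume neg: "\<not> ?thesis"
  have adm: "admissible (Acrit c) c" by (rule good_admissible[OF good_Acrit[OF c]])
  have "Dser (Acrit c) c t > 0" if t: "t \<ge> 0" for t
  proof (cases "t = 0")
    case True
    then show ?thesis using adm by (simp add: Dser_0 admissible_def add_pos_nonneg)
  next
    case False
    then have "Dser (Acrit c) c t \<noteq> 0" "Dser (Acrit c) c t \<ge> 0" using neg good_Acrit[OF c] t by (auto simp: good_def)
    then show ?thesis by simp
  qed
  then obtain e where e: "e > 0" "\<And>a' c'. admissible a' c' \<Longrightarrow> \<bar>a' - Acrit c\<bar> < e \<Longrightarrow> \<bar>c' - c\<bar> < e \<Longrightarrow> (\<forall>t\<ge>0. Dser a' c' t > 0)"
    using positive_open[OF adm] by blast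
  define v where "v = min (e / 2) ((3 - Acrit c - c) / 2)"
  have v: "v > 0" "v < e" "Acrit c + v + c < 3"
  proof -
    have "v \<le> (3 - Acrit c - c) / 2" unfolding v_def by (rule min.cobounded2)
    then show "Acrit c + v + c < 3" using adm by (simp add: admissible_def field_simps)
    show "v > 0" using e(1) adm by (simp add: v_def admissible_def)
    have "v \<le> e / 2" unfolding v_def by (rule min.cobounded1)
    then show "v < e" using e(1) by (simp add: field_simps)
  qed
  have "\<forall>t\<ge>0. Dser (Acrit c + v) c t > 0"
    by (rule e(2)) (use adm v e(1) in \<open>auto simp: admissible_def\<close>)
  then have "good (Acrit c + v) c" using v adm by (auto simp: good_def admissible_def intro: less_imp_le)
  then show False using le_Acrit[OF c] v(1) by force
qed

text \<open>
  Lowering only \<open>c\<close> at a critical pair makes the density positive, whereas at the critical parameter for the smaller \<open>c\<close>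
  it has a zero.
\<close>

lemma Acrit_strict_antimono:
  assumes "0 \<le> c'" "c' < c" "c < 1" shows "Acrit c < Acrit c'"
proof -
  have c: "0 \<le> c" "c' < 1" using assms by auto
  have A: "good (Acrit c) c" using good_Acrit assms c by simp
  have pos: "Dser (Acrit c) c' t > 0" if "t \<ge> 0" for t
    using good_down[OF A, of "Acrit c" c' t] A assms that by (auto simp: good_def)
  then have "good (Acrit c) c'" using A by (auto simp: good_def intro: less_imp_le)
  then have "Acrit c \<le> Acrit c'" using le_Acrit assms c by blast
  moreover have "Acrit c \<noteq> Acrit c'"
  proof
    assume eq: "Acrit c = Acrit c'"
    obtain t where "t > 0" "Dser (Acrit c') c' t = 0" using Acrit_zero[OF assms(1) c(2)] by blast
    then show False using pos[of t] eq by simp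
  qed
  ultimately show ?thesis by simp
qed

text \<open>
  Lower semicontinuity is openness of positivity, upper semicontinuity is closedness of nonnegativity.
\<close>

lemma continuous_on_Acrit: "continuous_on {0..<1} Acrit"
  unfolding continuous_on_sequentially
proof (intro allI ballI impI, elim conjE)
  fix q :: "nat \<Rightarrow> real" and c :: real assume c: "c \<in> {0..<1}" and q: "\<forall>n. q n \<in> {0..<1}" "q \<longlonglongrightarrow> c"
  have c': "0 \<le> c" "c < 1" and q': "0 \<le> q n" "q n < 1" for n using c q by auto
  have A: "good (Acrit c) c" by (rule good_Acrit[OF c'])
  have A0: "Acrit c > 0" using A by (simp add: good_def)
  show "(Acrit \<circ> q) \<longlonglongrightarrow> Acrit c" unfolding comp_def
  proof (rule order_tendstoI)
    fix l assume l: "l < Acrit c"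
    define a where "a = max ((l + Acrit c) / 2) (Acrit c / 2)"
    have a: "0 < a" "a < Acrit c" "l < a" using l A0 by (auto simp: a_def max_def)
    have adm: "admissible a c" by (rule good_admissible) (use good_iff_le_Acrit[OF c' a(1)] a in simp)
    obtain e where e: "e > 0" "\<And>a' c'. admissible a' c' \<Longrightarrow> \<bar>a' - a\<bar> < e \<Longrightarrow> \<bar>c' - c\<bar> < e \<Longrightarrow> (\<forall>t\<ge>0. Dser a' c' t > 0)"
      using positive_open[OF adm positive_below_Acrit[OF c' a(1,2)]] by blast
    have ev1: "\<forall>\<^sub>F n in sequentially. \<bar>q n - c\<bar> < e" using tendstoD[OF q(2) e(1)] by (simp add: dist_real_def)
    have ev2: "\<forall>\<^sub>F n in sequentially. q n < 3 - a" using adm by (intro order_tendstoD(2)[OF q(2)]) (simp add: admissible_def)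
    show "\<forall>\<^sub>F n in sequentially. l < Acrit (q n)"
      using ev1 ev2
    proof eventually_elim
      case (elim n)
      have "\<forall>t\<ge>0. Dser a (q n) t > 0" by (rule e(2)) (use elim q' a e(1) in \<open>auto simp: admissible_def\<close>)
      then have "good a (q n)" using a by (auto simp: good_def intro: less_imp_le)
      then show ?case using le_Acrit[OF q'] a by force
    qed
  next
    fix u assume u: "u > Acrit c"
    show "\<forall>\<^sub>F n in sequentially. u > Acrit (q n)"
    proof (rule ccontr)
      assume "\<not> ?thesis"
      then have "\<exists>\<^sub>F n in sequentially. u \<le> Acrit (q n)" by (simp add: frequently_def not_le)
      then have "\<forall>N. \<exists>n\<ge>N. u \<le> Acrit (q n)" by (simp add: frequently_sequentially)
      then have inf: "infinite {n. u \<le> Acrit (q n)}" unfolding infinite_nat_iff_unbounded_le by simp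
      from infinite_enumerate[OF inf] obtain r :: "nat \<Rightarrow> nat" where r': "strict_mono r \<and> (\<forall>n. r n \<in> {n. u \<le> Acrit (q n)})"
        by blast
      then have r: "strict_mono r" "\<And>n. u \<le> Acrit (q (r n))" by simp_all
      have g: "good u (q (r n))" for n using good_iff_le_Acrit[OF q', of u] r(2) u A0 by auto
      have "Dser u c t \<ge> 0" if "t \<ge> 0" for t
        by (rule Dser_nonneg_closed[OF tendsto_const[of u] LIMSEQ_subseq_LIMSEQ[OF q(2) r(1)]]) (use g that in \<open>auto simp: good_def\<close>)
      then have "good u c" using u A0 by (simp add: good_def)
      then show False using le_Acrit[OF c'] u by force
    qed
  qed
qed

lemma bernstein_F_iff_good: "a > 0 \<Longrightarrow> bernstein_function (F a b) \<longleftrightarrow> good a (- b)"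
  using bernstein_F_iff_Dser[of a b] by (simp add: good_def)

lemma alpha_star_eq: "alpha_star = Acrit 0"
  unfolding alpha_star_def Acrit_def good_def bernstein_h_iff_Dser ..

lemma Acrit_less_U:
  assumes c: "0 < c" "c < 1" shows "Acrit c < U (- c)"
proof -
  have g: "good (Acrit c) c" using good_Acrit c by simp
  have 1: "Acrit c + c < K0" using nonneg_imp_K0_bound(2)[of "Acrit c" c] g c by (simp add: good_def)
  define d where "d = sqrt (1 - c)"
  have d: "0 < d" "d \<le> 1" "d\<^sup>2 = 1 - c" using c by (auto simp: d_def)
  have "\<not> good (2 * d\<^sup>2 + 2 * d) (1 - d\<^sup>2)" using not_nonneg_at_U[OF d(1,2)] by (simp add: good_def)
  then have "\<not> good (2 * (1 - c) + 2 * d) c" by (simp add: d(3))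
  then have "Acrit c < 2 * (1 - c) + 2 * d"
    using good_iff_le_Acrit[of c "2 * (1 - c) + 2 * d"] c d by (force simp: add_pos_pos not_le)
  then show ?thesis using 1 by (simp add: U_def d_def)
qed

text \<open>
  The zeros lie in a compact interval by \<open>local_tail_positive\<close>; infinitely many of them would accumulate, and
  the density, an entire function, would vanish identically although it is positive at 0.
\<close>

lemma finite_zeros:
  assumes adm: "admissible a c" shows "finite {t. t > 0 \<and> Dser a c t = 0}"
proof (rule ccontr)
  assume inf: "infinite {t. t > 0 \<and> Dser a c t = 0}"
  obtain e T where eT: "e > 0" "\<And>a' c' t. admissible a' c' \<Longrightarrow> \<bar>a' - a\<bar> < e \<Longrightarrow> \<bar>c' - c\<bar> < e \<Longrightarrow> t \<ge> T \<Longrightarrow> Dser a' c' t > 0"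
    using local_tail_positive[OF adm] by blast
  define Z where "Z = {t. t > 0 \<and> Dser a c t = 0}"
  have sub: "Z \<subseteq> {0..T}"
  proof
    fix t assume t: "t \<in> Z"
    have "\<not> t \<ge> T" using eT(2)[OF adm, of t] eT(1) t by (auto simp: Z_def)
    then show "t \<in> {0..T}" using t by (simp add: Z_def)
  qed
  define E where "E z = (\<Sum>n. of_real (dens a c n / fact n) * z ^ n)" for z :: complex
  have sm: "summable (\<lambda>n. of_real (dens a c n / fact n) * z ^ n)" for z :: complex
  proof (rule summable_norm_cancel)
    have "summable (\<lambda>n. \<bar>dens a c n * norm z ^ n / fact n\<bar>)" by (rule summable_abs_borel[OF geom_bounded_dens])
    then show "summable (\<lambda>n. norm (of_real (dens a c n / fact n) * z ^ n))"
      by (simp add: norm_mult norm_power norm_divide abs_mult)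
  qed
  have hol: "E holomorphic_on UNIV"
  proof -
    have "(E has_field_derivative (\<Sum>n. diffs (\<lambda>n. of_real (dens a c n / fact n)) n * z ^ n)) (at z)" for z
      unfolding E_def[abs_def] by (rule termdiffs_strong_converges_everywhere[OF sm])
    then show ?thesis by (auto simp: holomorphic_on_open)
  qed
  have Er: "E (of_real t) = of_real (Dser a c t)" for t
  proof -
    have "(\<lambda>n. of_real (dens a c n * t ^ n / fact n)) sums (of_real (Dser a c t) :: complex)"
      using Dser_sums[of a c t] by (rule sums_of_real)
    then show ?thesis unfolding E_def by (simp add: sums_iff)
  qed
  define W where "W = complex_of_real ` Z"
  have "infinite W" unfolding W_def using inf by (subst finite_image_iff) (auto simp: Z_def inj_on_def)
  moreover have "W \<subseteq> complex_of_real ` {0..T}" unfolding W_def using sub by blast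
  moreover have "compact (complex_of_real ` {0..T})" by (intro compact_continuous_image continuous_intros) simp
  ultimately obtain \<xi> where "\<xi> islimpt W"
    using Heine_Borel_imp_Bolzano_Weierstrass by blast
  then have "E 0 = 0"
    by (rule analytic_continuation[OF hol open_UNIV connected_UNIV, rotated 2]) (auto simp: W_def Z_def Er)
  then have "Dser a c 0 = 0" using Er[of 0] by simp
  then show False using adm by (simp add: Dser_0 admissible_def)
qed

section \<open>Certified positivity of the density\<close>

text \<open>
  The quadratic changes sign exactly where the sine does.
\<close>

lemma sin_pi_times_quadratic_nonneg:
  assumes "0 \<le> z" "z < (3 :: real)" shows "sin (pi * z) * ((1 - z) * (2 - z)) \<ge> 0"
proof -
  consider "z \<le> 1" | "1 \<le> z" "z < 2" | "2 \<le> z" by linarith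
  then show ?thesis
  proof cases
    case 1
    then show ?thesis using assms by (intro mult_nonneg_nonneg sin_ge_zero) (auto simp: mult_le_cancel_left1)
  next
    case 2
    have "sin (pi * z) \<le> 0" by (rule sin_le_zero) (use 2 in \<open>auto simp: mult_le_cancel_left1 mult.commute\<close>)
    moreover have "(1 - z) * (2 - z) \<le> 0" using 2 by (intro mult_nonpos_nonneg) auto
    ultimately show ?thesis by (rule mult_nonpos_nonpos)
  next
    case 3
    have "sin (pi * z) = sin (pi * (z - 2))" using sin_periodic[of "pi * (z - 2)"] by (simp add: algebra_simps)
    moreover have "sin (pi * (z - 2)) \<ge> 0" using 3 assms by (intro sin_ge_zero) (auto simp: mult_le_cancel_left1)
    ultimately show ?thesis using 3 by (simp add: mult_nonpos_nonpos)
  qed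
qed

lemma w_sign:
  assumes adm: "admissible a c" and s: "0 < s" "s < 1"
  shows "w a c s * (((1 - c) / a - s) * ((2 - c) / a - s)) \<ge> 0"
    and "a + c \<le> 2 \<Longrightarrow> w a c s * ((1 - c) / a - s) \<ge> 0"
proof -
  define z where "z = a * s + c"
  have a: "a > 0" "0 \<le> c" "a + c < 3" using adm by (auto simp: admissible_def)
  have as: "a * s < a" using a s by simp
  have z: "0 \<le> z" "z < 3" using a s as unfolding z_def by (simp, linarith)
  have f: "(1 - c) / a - s = (1 - z) / a" "(2 - c) / a - s = (2 - z) / a"
    using a by (auto simp: z_def field_simps)
  have w: "w a c s = 1 / pi * (s / (1 - s)) powr z * sin (pi * z)" by (simp add: w_def z_def)
  have "w a c s * (((1 - c) / a - s) * ((2 - c) / a - s))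
      = 1 / pi * (s / (1 - s)) powr z / (a * a) * (sin (pi * z) * ((1 - z) * (2 - z)))"
    unfolding w f using a by simp
  also have "\<dots> \<ge> 0" by (rule mult_nonneg_nonneg[OF _ sin_pi_times_quadratic_nonneg[OF z]]) simp
  finally show "w a c s * (((1 - c) / a - s) * ((2 - c) / a - s)) \<ge> 0" .
  assume 2: "a + c \<le> 2"
  have "sin (pi * z) * (1 - z) \<ge> 0"
  proof (cases "z \<le> 1")
    case True
    then show ?thesis using z by (intro mult_nonneg_nonneg sin_ge_zero) (auto simp: mult_le_cancel_left1)
  next
    case False
    have "sin (pi * z) \<le> 0" by (rule sin_le_zero) (use False as 2 in \<open>auto simp: mult_le_cancel_left1 mult.commute z_def\<close>)
    then show ?thesis using False by (simp add: mult_nonpos_nonpos)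
  qed
  moreover have "w a c s * ((1 - c) / a - s) = 1 / pi * (s / (1 - s)) powr z / a * (sin (pi * z) * (1 - z))"
    unfolding w f by simp
  ultimately show "w a c s * ((1 - c) / a - s) \<ge> 0" using a by simp
qed

text \<open>
  Multiplying the weight by \<open>(1 - c) / a - s\<close> removes its first sign change and by \<open>(2 - c) / a - s\<close> the second one. On
  the moments these factors act as first-order difference operators.
\<close>

lemma dens_differences:
  assumes adm: "admissible a c" and n: "n \<ge> 2"
  defines "\<gamma> \<equiv> 1 - (1 - c) / a" and "\<delta> \<equiv> 1 - (2 - c) / a"
  shows "dens a c (n + 2) - \<gamma> * dens a c (n + 1) \<ge> \<delta> * (dens a c (n + 1) - \<gamma> * dens a c n)"
    and "a + c \<le> 2 \<Longrightarrow> dens a c (n + 1) \<ge> \<gamma> * dens a c n"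
proof -
  have a: "a > 0" "0 \<le> c" "a + c < 3" using adm by (auto simp: admissible_def)
  have i: "((\<lambda>x. w a c (1 - x) * x ^ m) has_integral (exp a * dens a c m)) {0<..<1}" if "m \<ge> 2" for m
    by (rule dens_has_integral) (use a that in auto)
  have "((\<lambda>x. w a c (1 - x) * x ^ (n + 2) - (\<gamma> + \<delta>) * (w a c (1 - x) * x ^ (n + 1)) + \<gamma> * \<delta> * (w a c (1 - x) * x ^ n))
     has_integral (exp a * dens a c (n + 2) - (\<gamma> + \<delta>) * (exp a * dens a c (n + 1)) + \<gamma> * \<delta> * (exp a * dens a c n))) {0<..<1}"
    by (intro has_integral_add has_integral_diff has_integral_mult_right i) (use n in auto)
  then have "0 \<le> exp a * dens a c (n + 2) - (\<gamma> + \<delta>) * (exp a * dens a c (n + 1)) + \<gamma> * \<delta> * (exp a * dens a c n)"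
  proof (rule has_integral_nonneg)
    fix x :: real assume x: "x \<in> {0<..<1}"
    have eq: "(1 - c) / a - (1 - x) = x - \<gamma>" "(2 - c) / a - (1 - x) = x - \<delta>" by (auto simp: \<gamma>_def \<delta>_def)
    have "0 \<le> w a c (1 - x) * ((x - \<gamma>) * (x - \<delta>)) * x ^ n"
      using w_sign(1)[OF adm, of "1 - x"] x unfolding eq by (intro mult_nonneg_nonneg[of _ "x ^ n"]) auto
    then show "0 \<le> w a c (1 - x) * x ^ (n + 2) - (\<gamma> + \<delta>) * (w a c (1 - x) * x ^ (n + 1)) + \<gamma> * \<delta> * (w a c (1 - x) * x ^ n)"
      by (simp add: algebra_simps power2_eq_square)
  qed
  also have "\<dots> = exp a * (dens a c (n + 2) - \<gamma> * dens a c (n + 1) - \<delta> * (dens a c (n + 1) - \<gamma> * dens a c n))"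
    by (simp add: algebra_simps)
  finally show "dens a c (n + 2) - \<gamma> * dens a c (n + 1) \<ge> \<delta> * (dens a c (n + 1) - \<gamma> * dens a c n)"
    by (simp add: zero_le_mult_iff)
  assume 2: "a + c \<le> 2"
  have "((\<lambda>x. w a c (1 - x) * x ^ (n + 1) - \<gamma> * (w a c (1 - x) * x ^ n))
     has_integral (exp a * dens a c (n + 1) - \<gamma> * (exp a * dens a c n))) {0<..<1}"
    by (intro has_integral_diff has_integral_mult_right i) (use n in auto)
  then have "0 \<le> exp a * dens a c (n + 1) - \<gamma> * (exp a * dens a c n)"
  proof (rule has_integral_nonneg)
    fix x :: real assume x: "x \<in> {0<..<1}"
    have eq: "(1 - c) / a - (1 - x) = x - \<gamma>" by (auto simp: \<gamma>_def)
    have "0 \<le> w a c (1 - x) * (x - \<gamma>) * x ^ n"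
      using w_sign(2)[OF adm _ _ 2, of "1 - x"] x unfolding eq by (intro mult_nonneg_nonneg[of _ "x ^ n"]) auto
    then show "0 \<le> w a c (1 - x) * x ^ (n + 1) - \<gamma> * (w a c (1 - x) * x ^ n)"
      by (simp add: algebra_simps)
  qed
  also have "\<dots> = exp a * (dens a c (n + 1) - \<gamma> * dens a c n)" by (simp add: algebra_simps)
  finally show "dens a c (n + 1) \<ge> \<gamma> * dens a c n" by (simp add: zero_le_mult_iff)
qed

text \<open>
  The inequality \<open>\<gamma> dens n \<le> dens (n + 1)\<close>, with \<open>\<gamma> = 1 - (1 - c) / a\<close> and denominators cleared, propagates from one index
  to the next. If \<open>a + c \<le> 2\<close> it even holds outright.
\<close>

lemma dens_growth:
  assumes adm: "admissible a c" and k: "k \<ge> 2" and g: "1 - c \<le> a"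
    and start: "(a - 1 + c) * dens a c k \<le> a * dens a c (Suc k)" and reg: "a + c \<le> 2 \<or> 2 - c \<le> a" and n: "n \<ge> k"
  shows "(a - 1 + c) * dens a c n \<le> a * dens a c (Suc n)"
proof -
  have a: "a > 0" using adm by (simp add: admissible_def)
  have eq: "(a - 1 + c) * dens a c n \<le> a * dens a c (Suc n) \<longleftrightarrow> (1 - (1 - c) / a) * dens a c n \<le> dens a c (Suc n)" for n
    using a by (simp add: field_simps)
  show ?thesis
  proof (cases "a + c \<le> 2")
    case True
    then show ?thesis unfolding eq using dens_differences(2)[OF adm, of n] k n by simp
  next
    case False
    then have \<delta>: "1 - (2 - c) / a \<ge> 0" using reg a by (simp add: divide_le_eq)
    show ?thesis using n
    proof (induction n rule: dec_induct)
      case (step n)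
      have "0 \<le> (1 - (2 - c) / a) * (dens a c (n + 1) - (1 - (1 - c) / a) * dens a c n)"
        using step(3) \<delta> unfolding eq by (intro mult_nonneg_nonneg) auto
      also have "\<dots> \<le> dens a c (n + 2) - (1 - (1 - c) / a) * dens a c (n + 1)"
        using dens_differences(1)[OF adm, of n] k step by simp
      finally show ?case unfolding eq by simp
    qed (rule start)
  qed
qed

lemma dens_nonneg_from:
  assumes adm: "admissible a c" and k: "k \<ge> 2" and g: "1 - c \<le> a"
    and start: "(a - 1 + c) * dens a c k \<le> a * dens a c (Suc k)" "dens a c k \<ge> 0" and reg: "a + c \<le> 2 \<or> 2 - c \<le> a" and n: "n \<ge> k"
  shows "dens a c n \<ge> 0"
  using n
proof (induction n rule: dec_induct)
  case (step n)
  have "0 \<le> (a - 1 + c) * dens a c n" using step g by (intro mult_nonneg_nonneg) auto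
  also have "\<dots> \<le> a * dens a c (Suc n)" by (rule dens_growth[OF adm k g start(1) reg]) (use step in auto)
  finally show ?case using adm by (simp add: admissible_def zero_le_mult_iff)
qed (rule start(2))

text \<open>
  Evaluates the convolution in the recursion on a reversed list of coefficients; the running index \<open>k\<close> is a real
  number so that rewriting computes with real numerals only.
\<close>

fun weighted_sum :: "real \<Rightarrow> real \<Rightarrow> real \<Rightarrow> real list \<Rightarrow> real" where
  "weighted_sum a c k [] = 0"
| "weighted_sum a c k (x # xs) = (c + a / k) * x + weighted_sum a c (k + 1) xs"

text \<open>
  The numbers in the list satisfy the recursion of \<open>dens\<close> up to an error \<open>\<rho>\<close> in each step.
\<close>

fun residuals_le :: "real \<Rightarrow> real \<Rightarrow> real \<Rightarrow> real \<Rightarrow> real list \<Rightarrow> real list \<Rightarrow> bool" where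
  "residuals_le a c \<rho> k prev [] \<longleftrightarrow> True"
| "residuals_le a c \<rho> k prev (x # xs) \<longleftrightarrow>
     \<bar>k * x - (c + a / (k + 1)) + weighted_sum a c 2 prev\<bar> \<le> \<rho> \<and> residuals_le a c \<rho> (k + 1) (x # prev) xs"

lemma weighted_sum_eq: "weighted_sum a c (real p + 2) ys = (\<Sum>i<length ys. mom a c (p + i) * ys ! i)"
proof (induction ys arbitrary: p)
  case (Cons y ys)
  have "weighted_sum a c (real (Suc p) + 2) ys = (\<Sum>i<length ys. mom a c (Suc p + i) * ys ! i)" by (rule Cons)
  then have "weighted_sum a c (real p + 2 + 1) ys = (\<Sum>i<length ys. mom a c (p + Suc i) * (y # ys) ! Suc i)" by (simp add: add_ac)
  then show ?case by (simp only: weighted_sum.simps length_Cons sum.lessThan_Suc_shift) (simp add: mom_def)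
qed simp

lemma residuals_leD:
  assumes "residuals_le a c \<rho> (real (length prev) + 1) prev xs" "length prev \<le> n" "n < length prev + length xs"
  shows "\<bar>(real n + 1) * (rev prev @ xs) ! n - mom a c n + seq_conv (mom a c) (\<lambda>j. (rev prev @ xs) ! j) n\<bar> \<le> \<rho>"
  using assms
proof (induction xs arbitrary: prev)
  case (Cons x xs)
  show ?case
  proof (cases "n = length prev")
    case True
    let ?z = "rev prev @ x # xs"
    have "weighted_sum a c (real 0 + 2) prev = (\<Sum>i<n. mom a c i * prev ! i)" unfolding weighted_sum_eq True by simp
    also have "\<dots> = (\<Sum>j<n. mom a c (n - Suc j) * prev ! (n - Suc j))" by (rule sum.nat_diff_reindex[symmetric])
    also have "\<dots> = (\<Sum>j<n. mom a c (n - 1 - j) * ?z ! j)"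
      by (intro sum.cong) (auto simp: True nth_append rev_nth)
    finally have "weighted_sum a c 2 prev = seq_conv (mom a c) (\<lambda>j. ?z ! j) n" by (simp add: seq_conv_def)
    moreover have "?z ! n = x" by (simp add: True nth_append)
    moreover have "mom a c n = c + a / (real n + 1 + 1)" by (simp add: mom_def add_ac)
    ultimately show ?thesis using Cons.prems(1) by (simp add: True)
  next
    case False
    have "\<bar>(real n + 1) * (rev (x # prev) @ xs) ! n - mom a c n + seq_conv (mom a c) (\<lambda>j. (rev (x # prev) @ xs) ! j) n\<bar> \<le> \<rho>"
      by (rule Cons.IH) (use Cons.prems False in \<open>auto simp: add_ac\<close>)
    then show ?thesis by simp
  qed
qed simp

lemma abs_mom_le_2: "0 \<le> a \<Longrightarrow> 0 \<le> c \<Longrightarrow> a / 2 + c \<le> 2 \<Longrightarrow> \<bar>mom a c n\<bar> \<le> 2"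
  using abs_mom_le[of a c n] by simp

text \<open>
  The recursion is stable: with \<open>|mom| \<le> 2\<close> errors of size \<open>\<rho>\<close> in each step grow only linearly, since
  \<open>1 + \<Sum>j<n. (j + 2) = (n + 1) (n + 2) / 2\<close>.
\<close>

lemma dens_approx:
  assumes ac: "0 \<le> a" "0 \<le> c" "a / 2 + c \<le> 2" and res: "residuals_le a c \<rho> 1 [] xs" and n: "n < length xs"
  shows "\<bar>dens a c n - xs ! n\<bar> \<le> \<rho> * (real n + 2) / 2"
  using n
proof (induction n rule: less_induct)
  case (less n)
  have r: "\<bar>(real n + 1) * xs ! n - mom a c n + seq_conv (mom a c) (\<lambda>j. xs ! j) n\<bar> \<le> \<rho>"
    using residuals_leD[of a c \<rho> "[]" xs n] res less by simp
  have "(real n + 1) * (dens a c n - xs ! n)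
      = - ((real n + 1) * xs ! n - mom a c n + seq_conv (mom a c) (\<lambda>j. xs ! j) n)
        - (\<Sum>j<n. mom a c (n - 1 - j) * (dens a c j - xs ! j))"
    using dens_rec[of n a c] by (simp add: seq_conv_def algebra_simps sum_subtractf)
  also have "\<bar>\<dots>\<bar> \<le> \<bar>(real n + 1) * xs ! n - mom a c n + seq_conv (mom a c) (\<lambda>j. xs ! j) n\<bar>
      + \<bar>\<Sum>j<n. mom a c (n - 1 - j) * (dens a c j - xs ! j)\<bar>" by (simp only: abs_minus_cancel order_trans[OF abs_triangle_ineq4])
  also have "\<dots> \<le> \<rho> + (\<Sum>j<n. 2 * (\<rho> * (real j + 2) / 2))"
  proof (rule add_mono[OF r])
    have "\<bar>\<Sum>j<n. mom a c (n - 1 - j) * (dens a c j - xs ! j)\<bar> \<le> (\<Sum>j<n. \<bar>mom a c (n - 1 - j)\<bar> * \<bar>dens a c j - xs ! j\<bar>)"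
      by (rule order_trans[OF sum_abs]) (simp add: abs_mult)
    also have "\<dots> \<le> (\<Sum>j<n. 2 * (\<rho> * (real j + 2) / 2))"
      using less abs_mom_le_2[OF ac] by (intro sum_mono mult_mono) auto
    finally show "\<bar>\<Sum>j<n. mom a c (n - 1 - j) * (dens a c j - xs ! j)\<bar> \<le> (\<Sum>j<n. 2 * (\<rho> * (real j + 2) / 2))" .
  qed
  also have "\<dots> = (real n + 1) * (\<rho> * (real n + 2) / 2)"
    by (induction n) (auto simp: field_simps)
  finally show ?case by (simp add: abs_mult)
qed

text \<open>
  Horner evaluation of an exponential generating function; with \<open>k = 1\<close> it is \<open>\<Sum>n. xs ! n s ^ n / n!\<close>.
\<close>

fun horner :: "real \<Rightarrow> real \<Rightarrow> real list \<Rightarrow> real" where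
  "horner s k [] = 0"
| "horner s k (x # xs) = x + s / k * horner s (k + 1) xs"

lemma horner_eq: "horner s (real k + 1) xs = (\<Sum>i<length xs. xs ! i * (s ^ i * fact k / fact (k + i)))"
proof (induction xs arbitrary: k)
  case (Cons x xs)
  have "horner s (real k + 1 + 1) xs = (\<Sum>i<length xs. xs ! i * (s ^ i * fact (Suc k) / fact (Suc k + i)))"
    using Cons[of "Suc k"] by (simp only: of_nat_Suc add_ac)
  then have "s / (real k + 1) * horner s (real k + 1 + 1) xs
      = (\<Sum>i<length xs. xs ! i * (s ^ Suc i * fact k / fact (k + Suc i)))"
  proof (simp only: sum_distrib_left, intro sum.cong refl)
    fix i
    have f: "fact (Suc k) = (real k + 1) * (fact k :: real)" "fact (Suc k + i) = (fact (k + Suc i) :: real)" by simp_all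
    have "s / r * (y * (p * (r * f) / G)) = y * (s * p * f / G)" if "r \<noteq> 0" for r y p f G :: real
      using that by (cases "G = 0") (auto simp: field_simps)
    then show "s / (real k + 1) * (xs ! i * (s ^ i * fact (Suc k) / fact (Suc k + i))) = xs ! i * (s ^ Suc i * fact k / fact (k + Suc i))"
      unfolding f power_Suc by simp
  qed
  then show ?case by (simp only: horner.simps length_Cons sum.lessThan_Suc_shift) simp
qed simp

lemma horner_sum: "horner s 1 xs = (\<Sum>i<length xs. xs ! i * s ^ i / fact i)"
  using horner_eq[of s 0 xs] by simp

lemma power_ge_tangent:
  assumes "s > 0" "t \<ge> 0" shows "t ^ n \<ge> s ^ n + real n * s ^ (n - 1) * (t - s :: real)"
proof -
  have "s ^ n * (1 + real n * (t / s - 1)) \<le> s ^ n * (1 + (t / s - 1)) ^ n"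
    using assms by (intro mult_left_mono Bernoulli_inequality) auto
  also have "\<dots> = t ^ n" using assms by (simp add: power_divide)
  also have "s ^ n * (1 + real n * (t / s - 1)) = s ^ n + real n * s ^ (n - 1) * (t - s)"
    using assms by (cases n) (auto simp: field_simps)
  finally show ?thesis .
qed

text \<open>
  Each monomial of degree at least 2 has a nonnegative coefficient and lies above its tangent at \<open>s\<close>. So the density lies above
  the tangent of the polynomial at \<open>s\<close>, which is positive on \<open>[0, \<infinity>)\<close> when its slope and its value at 0 are.
\<close>

lemma Dser_pos_by_tangent:
  assumes low: "\<And>n. n < length ls \<Longrightarrow> ls ! n \<le> dens a c n" "\<And>n. 2 \<le> n \<Longrightarrow> n < length ls \<Longrightarrow> 0 \<le> ls ! n"
    and tail: "\<And>n. n \<ge> length ls \<Longrightarrow> dens a c n \<ge> 0"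
    and s: "s > 0" "0 \<le> horner s 1 (tl ls)" "s * horner s 1 (tl ls) < horner s 1 ls" and t: "t \<ge> 0"
  shows "Dser a c t > 0"
proof -
  have d: "horner s 1 (tl ls) = (\<Sum>i<length ls. ls ! i * (real i * s ^ (i - 1)) / fact i)"
  proof (cases ls)
    case (Cons x xs)
    have "horner s 1 (tl ls) = (\<Sum>i<length xs. xs ! i * s ^ i / fact i)" by (simp add: Cons horner_sum)
    also have "\<dots> = (\<Sum>i<length xs. ls ! Suc i * (real (Suc i) * s ^ (Suc i - 1)) / fact (Suc i))"
      by (intro sum.cong) (auto simp: Cons simp del: of_nat_Suc)
    also have "\<dots> = (\<Sum>i<length ls. ls ! i * (real i * s ^ (i - 1)) / fact i)"
      unfolding Cons length_Cons sum.lessThan_Suc_shift by simp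
    finally show ?thesis .
  qed simp
  have "0 < horner s 1 ls + (t - s) * horner s 1 (tl ls)"
    using s(3) mult_nonneg_nonneg[OF t s(2)] by (simp add: algebra_simps)
  also have "\<dots> = (\<Sum>i<length ls. ls ! i * (s ^ i + real i * s ^ (i - 1) * (t - s)) / fact i)"
    unfolding d horner_sum[of s ls] sum_distrib_left sum.distrib[symmetric] by (intro sum.cong) (auto simp: field_simps)
  also have "\<dots> \<le> (\<Sum>i<length ls. ls ! i * t ^ i / fact i)"
  proof (rule sum_mono)
    fix i assume i: "i \<in> {..<length ls}"
    consider "i = 0" | "i = 1" | "i \<ge> 2" by linarith
    then show "ls ! i * (s ^ i + real i * s ^ (i - 1) * (t - s)) / fact i \<le> ls ! i * t ^ i / fact i"
    proof cases
      case 3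
      then show ?thesis using power_ge_tangent[OF s(1) t, of i] low(2)[of i] i
        by (intro divide_right_mono mult_left_mono) auto
    qed auto
  qed
  also have "\<dots> \<le> (\<Sum>i<length ls. dens a c i * t ^ i / fact i)"
    using low(1) t by (intro sum_mono divide_right_mono mult_right_mono) auto
  also have "\<dots> \<le> Dser a c t" by (rule Dser_ge_taylor[OF tail t])
  finally show ?thesis .
qed

text \<open>
  A finite certificate: approximate values of ten coefficients bound them from below up to \<open>6 \<rho>\<close>, the remaining ones are
  nonnegative by \<open>dens_nonneg_from\<close>, started at index 3, and the tangent criterion finishes.
\<close>

lemma good_by_approximation:
  assumes ac: "0 < a" "0 \<le> c" "c < 1" "a + c < 3" "a / 2 + c \<le> 2" "2 - c \<le> a"
    and res: "residuals_le a c \<rho> 1 [] xs" and len: "length xs = 10" and rho: "\<rho> \<ge> 0"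
    and e4: "(a - 1 + c) * (xs ! 3 + 6 * \<rho>) \<le> a * (xs ! 4 - 6 * \<rho>)" and x4: "list_all (\<lambda>x. x \<ge> 6 * \<rho>) (drop 2 xs)"
    and ls: "ls = map (\<lambda>x. x - 6 * \<rho>) xs"
    and s: "s > 0" "0 \<le> horner s 1 (tl ls)" "s * horner s 1 (tl ls) < horner s 1 ls"
  shows "good a c"
proof -
  have adm: "admissible a c" using ac by (simp add: admissible_def)
  have ap: "\<bar>dens a c n - xs ! n\<bar> \<le> 6 * \<rho>" if "n < 10" for n
  proof -
    have "\<bar>dens a c n - xs ! n\<bar> \<le> \<rho> * (real n + 2) / 2" using dens_approx[OF _ _ _ res, of n] ac len that by simp
    also have "\<dots> \<le> \<rho> * 12 / 2" using that rho by (intro divide_right_mono mult_left_mono) auto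
    finally show ?thesis by simp
  qed
  have nn: "0 \<le> ls ! n" if "2 \<le> n" "n < 10" for n
  proof -
    have "(drop 2 xs) ! (n - 2) \<ge> 6 * \<rho>" using x4 that len by (auto simp: list_all_length)
    moreover have "(drop 2 xs) ! (n - 2) = xs ! n"
    proof -
      have "2 \<le> length xs" using len by simp
      from nth_drop[OF this, of "n - 2"] show ?thesis using that(1) by (simp only: le_add_diff_inverse)
    qed
    ultimately show ?thesis using that len by (simp add: ls)
  qed
  have low: "ls ! n \<le> dens a c n" if "n < 10" for n
    using ap[OF that] that len by (simp add: ls abs_le_iff)
  have "(a - 1 + c) * dens a c 3 \<le> (a - 1 + c) * (xs ! 3 + 6 * \<rho>)"
    using ap[of 3] ac by (intro mult_left_mono) auto
  also have "\<dots> \<le> a * (xs ! 4 - 6 * \<rho>)" by (rule e4)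
  also have "\<dots> \<le> a * dens a c 4" using ap[of 4] ac by (intro mult_left_mono) auto
  finally have e: "(a - 1 + c) * dens a c 3 \<le> a * dens a c (Suc 3)" by simp
  have tail: "dens a c n \<ge> 0" if "n \<ge> 10" for n
    by (rule dens_nonneg_from[OF adm, of 3]) (use e order_trans[OF nn low, of 3] ac that in auto)
  have "Dser a c t > 0" if "t \<ge> 0" for t
    by (rule Dser_pos_by_tangent[of ls a c s]) (use low nn tail s that len ls in auto)
  then show ?thesis using ac by (auto simp: good_def intro: less_imp_le)
qed

text \<open>
  Seven pairs slightly below the graph of \<open>Acrit\<close>, chosen so that the rectangles below them cover the segment from
  \<open>(2.31 * 0.8, 0.2)\<close> to \<open>(2.31 * 0.974, 0.026)\<close>. The tangent point \<open>s\<close> is just to the right of the minimum of the density.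
\<close>

lemma good_points:
  shows "good (197 / 100) (1 / 5)"
    and "good (103 / 50) (37 / 250)"
    and "good (17 / 8) (109 / 1000)"
    and "good (217 / 100) (81 / 1000)"
    and "good (11 / 5) (61 / 1000)"
    and "good (223 / 100) (6 / 125)"
    and "good (9 / 4) (7 / 200)"
proof -
  show "good (197 / 100) (1 / 5)"
    by (rule good_by_approximation[where \<rho> = "1 / 5000000" and s = "101 / 20" and xs = "[118500000 / 10 ^ 8, - 27377917 / 10 ^ 8, 59277 / 10 ^ 8, 180564 / 10 ^ 8, 227758 / 10 ^ 8, 222036 / 10 ^ 8, 203129 / 10 ^ 8, 182695 / 10 ^ 8, 163952 / 10 ^ 8, 147583 / 10 ^ 8]", OF _ _ _ _ _ _ _ _ _ _ _ refl]) simp_all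
  show "good (103 / 50) (37 / 250)"
    by (rule good_by_approximation[where \<rho> = "1 / 5000000" and s = "507 / 100" and xs = "[117800000 / 10 ^ 8, - 27650867 / 10 ^ 8, 182996 / 10 ^ 8, 190572 / 10 ^ 8, 224125 / 10 ^ 8, 214930 / 10 ^ 8, 195064 / 10 ^ 8, 174521 / 10 ^ 8, 155993 / 10 ^ 8, 139965 / 10 ^ 8]", OF _ _ _ _ _ _ _ _ _ _ _ refl]) simp_all
  show "good (17 / 8) (109 / 1000)"
    by (rule good_by_approximation[where \<rho> = "1 / 5000000" and s = "51 / 10" and xs = "[117150000 / 10 ^ 8, - 27753946 / 10 ^ 8, 262716 / 10 ^ 8, 192791 / 10 ^ 8, 217490 / 10 ^ 8, 206201 / 10 ^ 8, 185915 / 10 ^ 8, 165508 / 10 ^ 8, 147318 / 10 ^ 8, 131696 / 10 ^ 8]", OF _ _ _ _ _ _ _ _ _ _ _ refl]) simp_all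
  show "good (217 / 100) (81 / 1000)"
    by (rule good_by_approximation[where \<rho> = "1 / 5000000" and s = "513 / 100" and xs = "[116600000 / 10 ^ 8, - 27761133 / 10 ^ 8, 311405 / 10 ^ 8, 191502 / 10 ^ 8, 210594 / 10 ^ 8, 198051 / 10 ^ 8, 177605 / 10 ^ 8, 157400 / 10 ^ 8, 139539 / 10 ^ 8, 124281 / 10 ^ 8]", OF _ _ _ _ _ _ _ _ _ _ _ refl]) simp_all
  show "good (11 / 5) (61 / 1000)"
    by (rule good_by_approximation[where \<rho> = "1 / 5000000" and s = "129 / 25" and xs = "[116100000 / 10 ^ 8, - 27679383 / 10 ^ 8, 337888 / 10 ^ 8, 189317 / 10 ^ 8, 204895 / 10 ^ 8, 191521 / 10 ^ 8, 170973 / 10 ^ 8, 150918 / 10 ^ 8, 133301 / 10 ^ 8, 118315 / 10 ^ 8]", OF _ _ _ _ _ _ _ _ _ _ _ refl]) simp_all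
  show "good (223 / 100) (6 / 125)"
    by (rule good_by_approximation[where \<rho> = "1 / 5000000" and s = "521 / 100" and xs = "[116300000 / 10 ^ 8, - 28061783 / 10 ^ 8, 384596 / 10 ^ 8, 184822 / 10 ^ 8, 197317 / 10 ^ 8, 183970 / 10 ^ 8, 163905 / 10 ^ 8, 144377 / 10 ^ 8, 127245 / 10 ^ 8, 112689 / 10 ^ 8]", OF _ _ _ _ _ _ _ _ _ _ _ refl]) simp_all
  show "good (9 / 4) (7 / 200)"
    by (rule good_by_approximation[where \<rho> = "1 / 5000000" and s = "131 / 25" and xs = "[116000000 / 10 ^ 8, - 28030000 / 10 ^ 8, 401600 / 10 ^ 8, 181924 / 10 ^ 8, 192328 / 10 ^ 8, 178590 / 10 ^ 8, 158567 / 10 ^ 8, 139220 / 10 ^ 8, 122311 / 10 ^ 8, 107986 / 10 ^ 8]", OF _ _ _ _ _ _ _ _ _ _ _ refl]) simp_all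
qed

lemma fact_tail: "(real n + 22) * (21 / 4) ^ (n + 20) / fact (n + 20) \<le> 1 / 400 * (3 / 10 :: real) ^ n"
proof (induction n)
  case 0
  show ?case by (simp add: fact_numeral power_divide)
next
  case (Suc n)
  have f: "fact (Suc n + 20) = (real n + 21) * (fact (n + 20) :: real)" using fact_Suc[of "n + 20", where 'a = real] by simp
  have p: "(21 / 4 :: real) ^ (Suc n + 20) = 21 / 4 * (21 / 4) ^ (n + 20)" by (simp only: add_Suc power_Suc)
  have r: "real (Suc n) + 22 = real n + 23" by simp
  have "(r + 23) * (T * P) / ((r + 21) * G) = (r + 22) * P / G * ((r + 23) / (r + 22) * (T / (r + 21)))" if "r \<ge> 0" "G \<noteq> 0" for r T P G :: real
    using that by (simp add: divide_simps)
  from this[of "real n" "fact (n + 20)" "21 / 4" "(21 / 4) ^ (n + 20)"]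
  have "(real (Suc n) + 22) * (21 / 4) ^ (Suc n + 20) / fact (Suc n + 20)
      = (real n + 22) * (21 / 4) ^ (n + 20) / fact (n + 20) * ((real n + 23) / (real n + 22) * (21 / 4 / (real n + 21)))"
    unfolding f p r by simp
  also have "\<dots> \<le> 1 / 400 * (3 / 10) ^ n * (3 / 10)"
  proof (rule mult_mono[OF Suc])
    have "(real n + 23) / (real n + 22) * (21 / 4 / (real n + 21)) \<le> 23 / 22 * (21 / 4 / 21)"
      by (intro mult_mono divide_left_mono) (auto simp: field_simps)
    then show "(real n + 23) / (real n + 22) * (21 / 4 / (real n + 21)) \<le> 3 / 10" by (rule order_trans) simp
  qed auto
  finally show ?case by simp
qed

lemma majorant_2: "majorant 2 n = real n + 2"
  by (induction n) (auto simp: field_simps)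

text \<open>
  At \<open>t = 21 / 4\<close>, close to the minimum, twenty terms of the series add up to about \<open>- 0.0157\<close>, while the remainder is below
  \<open>0.004\<close> by the majorant for \<open>M = 2\<close>.
\<close>

lemma not_good_at_231: "\<not> good (231 / 100) 0"
proof -
  define xs :: "real list" where "xs = [115500000 / 10 ^ 8, - 28201250 / 10 ^ 8, 462481 / 10 ^ 8, 169887 / 10 ^ 8, 174578 / 10 ^ 8, 160324 / 10 ^ 8, 140872 / 10 ^ 8, 122367 / 10 ^ 8, 106338 / 10 ^ 8, 92854 / 10 ^ 8, 81593 / 10 ^ 8, 72173 / 10 ^ 8, 64252 / 10 ^ 8, 57547 / 10 ^ 8, 51832 / 10 ^ 8, 46926 / 10 ^ 8, 42685 / 10 ^ 8, 38997 / 10 ^ 8, 35769 / 10 ^ 8, 32930 / 10 ^ 8]"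
  define \<rho> :: real where "\<rho> = 1 / 5000000"
  let ?t = "21 / 4 :: real" and ?d = "dens (231 / 100) 0"
  have len: "length xs = 20" by (simp add: xs_def)
  have res: "residuals_le (231 / 100) 0 \<rho> 1 [] xs" by (simp add: xs_def \<rho>_def)
  have "(\<Sum>n<20. ?d n * ?t ^ n / fact n) \<le> (\<Sum>n<20. map (\<lambda>x. x + 11 * \<rho>) xs ! n * ?t ^ n / fact n)"
  proof (intro sum_mono divide_right_mono mult_right_mono)
    fix n :: nat assume n: "n \<in> {..<20}"
    have "\<bar>?d n - xs ! n\<bar> \<le> \<rho> * (real n + 2) / 2" using dens_approx[OF _ _ _ res, of n] n len by simp
    also have "\<dots> \<le> \<rho> * 22 / 2" using n by (intro divide_right_mono mult_left_mono) (auto simp: \<rho>_def)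
    finally show "?d n \<le> map (\<lambda>x. x + 11 * \<rho>) xs ! n" using n len by simp
  qed auto
  also have "\<dots> = horner ?t 1 (map (\<lambda>x. x + 11 * \<rho>) xs)" by (simp add: horner_sum len)
  also have "\<dots> < - 15 / 1000" by (simp add: xs_def \<rho>_def)
  finally have head: "(\<Sum>n<20. ?d n * ?t ^ n / fact n) < - 15 / 1000" .
  have tl: "?d (n + 20) * ?t ^ (n + 20) / fact (n + 20) \<le> 1 / 400 * (3 / 10) ^ n" for n
  proof -
    have "?d (n + 20) \<le> majorant 2 (n + 20)" using abs_dens_le_majorant[OF abs_mom_le_2[of "231 / 100" 0], of "n + 20"] by simp
    then have "?d (n + 20) * ?t ^ (n + 20) / fact (n + 20) \<le> (real n + 22) * ?t ^ (n + 20) / fact (n + 20)"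
      unfolding majorant_2 by (intro divide_right_mono mult_right_mono) auto
    then show ?thesis using fact_tail[of n] by (rule order_trans)
  qed
  have g: "(\<lambda>n. 1 / 400 * (3 / 10 :: real) ^ n) sums (1 / 400 * (1 / (1 - 3 / 10)))" by (intro sums_mult geometric_sums) simp
  have "(\<lambda>n. ?d (n + 20) * ?t ^ (n + 20) / fact (n + 20)) sums (Dser (231 / 100) 0 ?t - (\<Sum>n<20. ?d n * ?t ^ n / fact n))"
    by (rule sums_iff_shift[THEN iffD2]) (use Dser_sums[of "231 / 100" 0 ?t] in simp)
  from sums_le[OF tl this g] have "Dser (231 / 100) 0 ?t < 0" using head by simp
  moreover have "Dser (231 / 100) 0 ?t \<ge> 0" if "good (231 / 100) 0" using that by (simp add: good_def)
  ultimately show ?thesis by linarith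
qed

lemma alpha_star_less: "alpha_star < 231 / 100"
  using good_iff_le_Acrit[of 0 "231 / 100"] not_good_at_231 by (simp add: alpha_star_eq)

section \<open>The chord bound away from zero\<close>

lemma dens_recs:
  "2 * dens a c 1 = mom a c 1 - mom a c 0 * dens a c 0"
  "3 * dens a c 2 = mom a c 2 - (mom a c 1 * dens a c 0 + mom a c 0 * dens a c 1)"
  "4 * dens a c 3 = mom a c 3 - (mom a c 2 * dens a c 0 + mom a c 1 * dens a c 1 + mom a c 0 * dens a c 2)"
  "5 * dens a c 4 = mom a c 4 - (mom a c 3 * dens a c 0 + mom a c 2 * dens a c 1 + mom a c 1 * dens a c 2 + mom a c 0 * dens a c 3)"
  "6 * dens a c 5 = mom a c 5 - (mom a c 4 * dens a c 0 + mom a c 3 * dens a c 1 + mom a c 2 * dens a c 2 + mom a c 1 * dens a c 3 + mom a c 0 * dens a c 4)"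
  using dens_rec[of 1 a c] dens_rec[of 2 a c] dens_rec[of 3 a c] dens_rec[of 4 a c] dens_rec[of 5 a c]
  by (simp_all add: seq_conv_def eval_nat_numeral)

text \<open>
  On the segment \<open>a = 2.31 \<theta>\<close>, \<open>c = 1 - \<theta>\<close> all coefficients after the first are divisible by \<open>\<theta>\<close>. The expansion is about the
  right end \<open>\<theta> = 4 / 5\<close> because there the signs of the coefficients make termwise estimates sharp enough.
\<close>

lemma segment_coefficients:
  fixes u :: real
  defines "\<theta> \<equiv> 4 / 5 - u"
  defines "d \<equiv> dens (231 / 100 * \<theta>) (1 - \<theta>)"
  shows "d 0 = 1 + 31 / 200 * \<theta>"
    and "d 1 = \<theta> * (- 27961 / 100000 + 961 / 80000 * u)"
    and "d 2 = \<theta> * (- 39153 / 25000000 - 231229 / 7500000 * u + 29791 / 48000000 * u * u)"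
    and "d 3 = \<theta> * (73825493 / 25000000000 + 351470563 / 60000000000 * u - 98870563 / 48000000000 * u * u + 923521 / 38400000000 * u * u * u)"
    and "d 4 = \<theta> * (111078623467 / 31250000000000 + 346382817323 / 37500000000000 * u + 3549359291 / 3750000000000 * u * u - 2347441427 / 24000000000000 * u * u * u + 28629151 / 38400000000000 * u * u * u * u)"
    and "d 5 = \<theta> * (157481932965773 / 46875000000000000 + 67554833627627 / 7500000000000000 * u + 10280486836919 / 9000000000000000 * u * u + 538262943281 / 7200000000000000 * u * u * u - 41337723481 / 11520000000000000 * u * u * u * u + 887503681 / 46080000000000000 * u * u * u * u * u)"
proof -
  have m: "mom (231 / 100 * \<theta>) (1 - \<theta>) n = 1 - \<theta> + 231 / 100 * \<theta> / (real n + 2)" for n by (simp add: mom_def)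
  show d0: "d 0 = 1 + 31 / 200 * \<theta>" by (simp add: d_def dens_0 q1_def)
  show d1: "d 1 = \<theta> * (- 27961 / 100000 + 961 / 80000 * u)"
    using dens_recs(1)[of "231 / 100 * \<theta>" "1 - \<theta>", folded d_def] unfolding m d0 by (simp add: \<theta>_def algebra_simps add_divide_distrib diff_divide_distrib)
  show d2: "d 2 = \<theta> * (- 39153 / 25000000 - 231229 / 7500000 * u + 29791 / 48000000 * u * u)"
    using dens_recs(2)[of "231 / 100 * \<theta>" "1 - \<theta>", folded d_def] unfolding m d0 d1 by (simp add: \<theta>_def algebra_simps add_divide_distrib diff_divide_distrib)
  show d3: "d 3 = \<theta> * (73825493 / 25000000000 + 351470563 / 60000000000 * u - 98870563 / 48000000000 * u * u + 923521 / 38400000000 * u * u * u)"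
    using dens_recs(3)[of "231 / 100 * \<theta>" "1 - \<theta>", folded d_def] unfolding m d0 d1 d2 by (simp add: \<theta>_def algebra_simps add_divide_distrib diff_divide_distrib)
  show d4: "d 4 = \<theta> * (111078623467 / 31250000000000 + 346382817323 / 37500000000000 * u + 3549359291 / 3750000000000 * u * u - 2347441427 / 24000000000000 * u * u * u + 28629151 / 38400000000000 * u * u * u * u)"
    using dens_recs(4)[of "231 / 100 * \<theta>" "1 - \<theta>", folded d_def] unfolding m d0 d1 d2 d3 by (simp add: \<theta>_def algebra_simps add_divide_distrib diff_divide_distrib)
  show d5: "d 5 = \<theta> * (157481932965773 / 46875000000000000 + 67554833627627 / 7500000000000000 * u + 10280486836919 / 9000000000000000 * u * u + 538262943281 / 7200000000000000 * u * u * u - 41337723481 / 11520000000000000 * u * u * u * u + 887503681 / 46080000000000000 * u * u * u * u * u)"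
    using dens_recs(5)[of "231 / 100 * \<theta>" "1 - \<theta>", folded d_def] unfolding m d0 d1 d2 d3 d4 by (simp add: \<theta>_def algebra_simps add_divide_distrib diff_divide_distrib)
qed

text \<open>
  Here \<open>(1 - c) / a = 1 / 2.31\<close> is constant, and either \<open>a + c \<le> 2\<close> or \<open>2 - c \<le> a\<close> holds, so \<open>dens_growth\<close> makes all coefficients
  from index 3 on nonnegative. The Taylor polynomial of degree 5 is \<open>1 + \<theta> q\<close> with a polynomial \<open>q\<close> in \<open>t\<close> that is at least \<open>-2\<close> if \<open>\<theta> \<le> 1 / 2\<close>, and at least
  \<open>- 5 / 4\<close> otherwise; the latter suffices because \<open>\<theta> \<le> 4 / 5\<close>.
\<close>

lemma good_segment:
  assumes "0 < \<theta>" "\<theta> \<le> 4 / 5" shows "good (231 / 100 * \<theta>) (1 - \<theta>)"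
proof -
  define a c u where "a = 231 / 100 * \<theta>" and "c = 1 - \<theta>" and "u = 4 / 5 - \<theta>"
  have u: "0 \<le> u" "u < 4 / 5" "\<theta> = 4 / 5 - u" using assms by (auto simp: u_def)
  have adm: "admissible a c" using assms by (auto simp: admissible_def a_def c_def)
  note d = segment_coefficients[of u, folded u(3), folded a_def c_def]
  have u2: "0 \<le> u * u" "u * u \<le> 4 / 5 * u" using u mult_right_mono[of u "4 / 5" u] by auto
  have u3: "0 \<le> u * u * u" "u * u * u \<le> 4 / 5 * (u * u)" using u mult_right_mono[of u "4 / 5" "u * u"] by (auto simp: mult.assoc)
  have u4: "0 \<le> u * u * u * u" "u * u * u * u \<le> 4 / 5 * (u * u * u)" using u mult_right_mono[of u "4 / 5" "u * u * u"] by (auto simp: mult.assoc)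
  have u5: "0 \<le> u * u * u * u * u" using u by auto
  define x where "x n = dens a c n / \<theta>" for n
  have dx: "dens a c n = \<theta> * x n" for n using assms by (simp add: x_def)
  have \<theta>0: "\<theta> \<noteq> 0" using assms by simp
  note xe = d(2-6)[unfolded dx, THEN mult_left_cancel[OF \<theta>0, THEN iffD1]]
  have x1: "x 1 \<ge> - 2797 / 10000" and x2: "x 2 \<ge> - 16 / 10000 - 309 / 10000 * u" and x3: "x 3 \<ge> 29 / 10000 + 4 / 1000 * u" and x4: "x 4 \<ge> 35 / 10000 + 9 / 1000 * u"
    and x5: "x 5 \<ge> 33 / 10000" and x34: "57 / 100 * x 3 \<le> x 4" and x23: "131 / 100 * x 2 \<le> 231 / 100 * x 3"
    using xe u(1,2) u2 u3 u4 u5 by - linarith+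
  have e: "(a - 1 + c) * dens a c 2 \<le> a * dens a c (Suc 2)"
  proof -
    have "\<theta> * \<theta> * (131 / 100 * x 2) \<le> \<theta> * \<theta> * (231 / 100 * x 3)" using x23 assms by (intro mult_left_mono) auto
    moreover have "a - 1 + c = 131 / 100 * \<theta>" by (simp add: a_def c_def)
    moreover have "a * (\<theta> * y) = \<theta> * \<theta> * (231 / 100 * y)" for y by (simp add: a_def)
    moreover have "131 / 100 * \<theta> * (\<theta> * y) = \<theta> * \<theta> * (131 / 100 * y)" for y by simp
    moreover have "Suc 2 = 3" by simp
    ultimately show ?thesis by (simp only: dx)
  qed
  have reg: "a + c \<le> 2 \<or> 2 - c \<le> a" by (auto simp: a_def c_def)
  have "dens a c 3 \<ge> 0" using x3 u assms by (simp add: dx)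
  moreover have "(a - 1 + c) * dens a c 3 \<le> a * dens a c (Suc 3)"
    by (rule dens_growth[OF adm _ _ e reg]) (use assms in \<open>auto simp: a_def c_def\<close>)
  ultimately have tail: "dens a c n \<ge> 0" if "n \<ge> 3" for n
    by (intro dens_nonneg_from[OF adm _ _ _ _ reg that]) (use assms in \<open>auto simp: a_def c_def\<close>)
  have "Dser a c t \<ge> 0" if t: "t \<ge> 0" for t
  proof -
    have "Dser a c t \<ge> (\<Sum>n<6. dens a c n * t ^ n / fact n)" by (rule Dser_ge_taylor) (use tail t in auto)
    also have "(\<Sum>n<6. dens a c n * t ^ n / fact n)
       = 1 + \<theta> * (31 / 200 + x 1 * t + x 2 * (t ^ 2 / 2) + x 3 * (t ^ 3 / 6) + x 4 * (t ^ 4 / 24) + x 5 * (t ^ 5 / 120))"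
    proof -
      have s: "(\<Sum>n<6. g n) = g 0 + g 1 + g 2 + g 3 + g 4 + g 5" for g :: "nat \<Rightarrow> real" by (simp add: eval_nat_numeral)
      show ?thesis unfolding s d(1) dx[of 1] dx[of 2] dx[of 3] dx[of 4] dx[of 5]
        by (simp add: algebra_simps fact_numeral)
    qed
    finally have D: "Dser a c t \<ge> 1 + \<theta> * (31 / 200 + x 1 * t + x 2 * (t ^ 2 / 2) + x 3 * (t ^ 3 / 6) + x 4 * (t ^ 4 / 24) + x 5 * (t ^ 5 / 120))" .
    have lw: "y * (T / k) \<ge> l / k * T" if "y \<ge> l" "T \<ge> 0" "k > 0" for y l T k :: real
      using mult_right_mono[OF that(1), of "T / k"] that by simp
    show ?thesis
    proof (cases "\<theta> \<le> 1 / 2")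
      case True
      then have u: "u \<ge> 3 / 10" by (simp add: u(3))
      have c: "x 1 \<ge> - 2797 / 10000" "x 2 \<ge> - 264 / 10000" "x 3 \<ge> 41 / 10000" "x 4 \<ge> 62 / 10000" "x 5 \<ge> 0"
        using x1 x2 x3 x4 x5 u \<open>u < 4 / 5\<close> by - linarith+
      have lower: "x 1 * t \<ge> - 2797 / 10000 * t" "x 2 * (t ^ 2 / 2) \<ge> - 33 / 2500 * t ^ 2" "x 3 * (t ^ 3 / 6) \<ge> 41 / 60000 * t ^ 3"
        "x 4 * (t ^ 4 / 24) \<ge> 31 / 120000 * t ^ 4" "x 5 * (t ^ 5 / 120) \<ge> 0"
        using lw[OF c(1), of t 1] lw[OF c(2), of "t ^ 2" 2] lw[OF c(3), of "t ^ 3" 6] lw[OF c(4), of "t ^ 4" 24] lw[OF c(5), of "t ^ 5" 120] t by simp_all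
      \<comment> \<open>tangents at \<open>t = 7.1\<close>, near the minimum of the lower bound, make this a linear problem in the monomials \<open>T2, T3, T4\<close>\<close>
      have comb: "31 / 200 + A1 + A2 + A3 + A4 + A5 \<ge> - 2" if
        "A1 \<ge> - 2797 / 10000 * t" "A2 \<ge> - 33 / 2500 * T2" "A3 \<ge> 41 / 60000 * T3" "A4 \<ge> 31 / 120000 * T4" "A5 \<ge> 0" "T3 \<ge> 71 / 5 * T2 - 5041 / 100 * t" "T3 \<ge> 15123 / 100 * t - 357911 / 500" "T4 \<ge> 15123 / 100 * T2 - 357911 / 500 * t" "T4 \<ge> 357911 / 250 * t - 76235043 / 10000" for A1 A2 A3 A4 A5 T2 T3 T4 :: real
        using that t by linarith
      have "31 / 200 + x 1 * t + x 2 * (t ^ 2 / 2) + x 3 * (t ^ 3 / 6) + x 4 * (t ^ 4 / 24) + x 5 * (t ^ 5 / 120) \<ge> - 2"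
      proof (rule comb[OF lower])
        have "t * (t - 71 / 10)\<^sup>2 = t ^ 3 - (71 / 5 * t ^ 2 - 5041 / 100 * t)" by (simp add: power2_eq_square power3_eq_cube algebra_simps)
        moreover have "t * (t - 71 / 10)\<^sup>2 \<ge> 0" using t by simp
        ultimately show "t ^ 3 \<ge> 71 / 5 * t ^ 2 - 5041 / 100 * t" by (simp only: diff_ge_0_iff_ge)
        have "t * (t - r)\<^sup>2 * (t + 2 * r) = t ^ 4 - (3 * r\<^sup>2 * t ^ 2 - 2 * r ^ 3 * t)" for r
          by (simp add: eval_nat_numeral algebra_simps)
        moreover have "t * (t - 71 / 10)\<^sup>2 * (t + 2 * (71 / 10)) \<ge> 0" using t by simp
        ultimately have "3 * (71 / 10)\<^sup>2 * t ^ 2 - 2 * (71 / 10) ^ 3 * t \<le> t ^ 4" by (simp only: diff_ge_0_iff_ge)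
        then show "t ^ 4 \<ge> 15123 / 100 * t ^ 2 - 357911 / 500 * t" by (simp add: power_divide)
      qed (use power_ge_tangent[of "71 / 10" t 3] power_ge_tangent[of "71 / 10" t 4] power_ge_tangent[of "71 / 10" t 5] t in \<open>simp_all add: power_divide diff_divide_distrib\<close>)
      then have "\<theta> * (31 / 200 + x 1 * t + x 2 * (t ^ 2 / 2) + x 3 * (t ^ 3 / 6) + x 4 * (t ^ 4 / 24) + x 5 * (t ^ 5 / 120)) \<ge> \<theta> * (- 2)"
        using assms by (intro mult_left_mono) auto
      then show ?thesis using D True by linarith
    next
      case False
      then have u: "u \<le> 3 / 10" by (simp add: u(3))
      have c: "x 1 \<ge> - 2797 / 10000" "x 2 \<ge> - 1087 / 100000" "x 3 \<ge> 29 / 10000" "x 4 \<ge> 35 / 10000" "x 5 \<ge> 33 / 10000"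
        using x1 x2 x3 x4 x5 u \<open>0 \<le> u\<close> by - linarith+
      have lower: "x 1 * t \<ge> - 2797 / 10000 * t" "x 2 * (t ^ 2 / 2) \<ge> - 1087 / 200000 * t ^ 2" "x 3 * (t ^ 3 / 6) \<ge> 29 / 60000 * t ^ 3"
        "x 4 * (t ^ 4 / 24) \<ge> 7 / 48000 * t ^ 4" "x 5 * (t ^ 5 / 120) \<ge> 11 / 400000 * t ^ 5"
        using lw[OF c(1), of t 1] lw[OF c(2), of "t ^ 2" 2] lw[OF c(3), of "t ^ 3" 6] lw[OF c(4), of "t ^ 4" 24] lw[OF c(5), of "t ^ 5" 120] t by simp_all
      \<comment> \<open>as above, with the minimum near \<open>t = 5.94\<close>\<close>
      have comb: "31 / 200 + A1 + A2 + A3 + A4 + A5 \<ge> - 5 / 4" if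
        "A1 \<ge> - 2797 / 10000 * t" "A2 \<ge> - 1087 / 200000 * T2" "A3 \<ge> 29 / 60000 * T3" "A4 \<ge> 7 / 48000 * T4" "A5 \<ge> 11 / 400000 * T5" "T3 \<ge> 297 / 25 * T2 - 88209 / 2500 * t" "T3 \<ge> 264627 / 2500 * t - 26198073 / 62500" "T4 \<ge> 26198073 / 31250 * t - 23342483043 / 6250000" "T5 \<ge> 7780827681 / 1250000 * t - 2310905821257 / 78125000" for A1 A2 A3 A4 A5 T2 T3 T4 T5 :: real
        using that t by linarith
      have "31 / 200 + x 1 * t + x 2 * (t ^ 2 / 2) + x 3 * (t ^ 3 / 6) + x 4 * (t ^ 4 / 24) + x 5 * (t ^ 5 / 120) \<ge> - 5 / 4"
      proof (rule comb[OF lower])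
        have "t * (t - 297 / 50)\<^sup>2 = t ^ 3 - (297 / 25 * t ^ 2 - 88209 / 2500 * t)" by (simp add: power2_eq_square power3_eq_cube algebra_simps)
        moreover have "t * (t - 297 / 50)\<^sup>2 \<ge> 0" using t by simp
        ultimately show "t ^ 3 \<ge> 297 / 25 * t ^ 2 - 88209 / 2500 * t" by (simp only: diff_ge_0_iff_ge)
      qed (use power_ge_tangent[of "297 / 50" t 3] power_ge_tangent[of "297 / 50" t 4] power_ge_tangent[of "297 / 50" t 5] t in \<open>simp_all add: power_divide diff_divide_distrib\<close>)
      then have "\<theta> * (31 / 200 + x 1 * t + x 2 * (t ^ 2 / 2) + x 3 * (t ^ 3 / 6) + x 4 * (t ^ 4 / 24) + x 5 * (t ^ 5 / 120)) \<ge> \<theta> * (- 5 / 4)"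
        using assms by (intro mult_left_mono) auto
      then show ?thesis using D assms by linarith
    qed
  qed
  then show ?thesis using assms by (simp add: good_def a_def c_def)
qed

text \<open>
  A point of the segment lies below one of the certified pairs, hence has nonnegative density by downward closure.
\<close>

lemma Acrit_ge_chord_away_from_0:
  assumes c: "13 / 500 \<le> c" "c < 1" shows "231 / 100 * (1 - c) \<le> Acrit c"
proof (cases "c \<ge> 1 / 5")
  case True
  then show ?thesis using good_segment[of "1 - c"] le_Acrit[of c "231 / 100 * (1 - c)"] c by simp
next
  case False
  have *: "231 / 100 * (1 - c) \<le> Acrit c" if "good a' c'" "c \<le> c'" "231 / 100 * (1 - c) \<le> a'" for a' c'
    using le_Acrit[OF _ _ good_downI[OF that(1), of "231 / 100 * (1 - c)" c]] that c by simp
  show ?thesis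
  proof -
    consider "c \<le> 7 / 200" | "7 / 200 \<le> c" "c \<le> 6 / 125" | "6 / 125 \<le> c" "c \<le> 61 / 1000" | "61 / 1000 \<le> c" "c \<le> 81 / 1000"
      | "81 / 1000 \<le> c" "c \<le> 109 / 1000" | "109 / 1000 \<le> c" "c \<le> 37 / 250" | "37 / 250 \<le> c" "c \<le> 1 / 5" using False by linarith
    then show ?thesis
      by cases (rule *[OF good_points(7)] *[OF good_points(6)] *[OF good_points(5)] *[OF good_points(4)]
        *[OF good_points(3)] *[OF good_points(2)] *[OF good_points(1)]; use c in simp)+
  qed
qed

section \<open>The chord bound near zero\<close>

lemma touching_imp_critical:
  assumes "\<And>u. u \<ge> 0 \<Longrightarrow> Dser a c u \<ge> 0" "t > 0" "Dser a c t = 0" shows "dDser a c t = 0"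
  by (rule DERIV_local_min[OF DERIV_Dser assms(2)]) (use assms in auto)

lemma DERIV_vker: "(vker a c has_real_derivative vker' a c t) (at t)"
  unfolding vker_def[abs_def] vker'_def using DERIV_borel_series[OF geom_bounded_vker, of a c t] by simp

text \<open>
  In the direction of the chord the infinitesimal kernel is a combination of the two Volterra kernels and of \<open>1\<close> and \<open>e\<^sup>t\<close>.
\<close>

lemma lker_star:
  assumes a: "a > 0"
  shows "lker (- a) (1 - c) t = vker' a c t - (a + c - 1) / a * vker a c t
    - ((a + c) * (a + c - 1) + c * (1 - c) * exp t) / a"
proof (cases "t = 0")
  case True
  have "vker' a c 0 = c + a / 2" unfolding vker'_def borel_series_0 by (simp add: mom_def)
  then show ?thesis using a by (simp add: True lker_0 vker_0 field_simps)
next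
  case False
  define X where "X = (exp t - 1) / t"
  have E: "exp t = 1 + t * X" using False by (simp add: X_def)
  have "t * lker (- a) (1 - c) t = (1 - c) * (exp t - 1) - a * (X - 1)"
    using vker_eq_lker[of "- a" "1 - c" t] vker_closed[OF False, of "- a" "1 - c"] by (simp add: X_def)
  also have "\<dots> = (c * t * exp t + a * (exp t - X)) - (a + c - 1) / a * (t * (c * (exp t - 1) + a * (X - 1)))
    - t * (((a + c) * (a + c - 1) + c * (1 - c) * exp t) / a)"
    unfolding E using a by (simp add: field_simps)
  also have "\<dots> = t * vker' a c t - (a + c - 1) / a * (t * vker a c t) - t * (((a + c) * (a + c - 1) + c * (1 - c) * exp t) / a)"
    using vker'_closed[OF False, of a c] vker_closed[OF False, of c a] by (simp add: X_def vker_closed[OF False])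
  also have "\<dots> = t * (vker' a c t - (a + c - 1) / a * vker a c t - ((a + c) * (a + c - 1) + c * (1 - c) * exp t) / a)"
    by (simp only: right_diff_distrib mult.left_commute)
  finally show ?thesis using False by (simp only: mult_cancel_left) simp
qed

text \<open>
  At a double zero both Volterra equations have vanishing left side, so only the elementary kernel \<open>\<nu>\<close> of \<open>lker_star\<close> remains in
  the directional derivative.
\<close>

lemma dirder_star:
  assumes a: "a > 0" and t: "t \<ge> 0" and D: "Dser a c t = 0" "dDser a c t = 0"
  defines "\<nu> \<equiv> \<lambda>r. (a + c) * (a + c - 1) + c * (1 - c) * exp r"
  shows "a * dirder a c (- a) (1 - c) t = integral {0..t} (\<lambda>u. \<nu> (t - u) * Dser a c u) - \<nu> t"
proof -
  let ?I = "\<lambda>f. integral {0..t} (\<lambda>u. f (t - u) * Dser a c u)"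
  have cv': "continuous_on UNIV (vker' a c)"
    unfolding vker'_def[abs_def] by (rule continuous_on_borel_series[OF geom_bounded_mom])
  have int: "(\<lambda>u. f (t - u) * Dser a c u) integrable_on {0..t}" if "continuous_on UNIV f" for f
    by (intro integrable_continuous_real continuous_intros continuous_on_Dser continuous_on_compose2[OF that]) auto
  have i1: "(\<lambda>u. vker' a c (t - u) * Dser a c u) integrable_on {0..t}" by (rule int[OF cv'])
  have i2: "(\<lambda>u. vker a c (t - u) * Dser a c u) integrable_on {0..t}" by (rule int[OF continuous_on_vker])
  have i3: "(\<lambda>u. \<nu> (t - u) * Dser a c u) integrable_on {0..t}"
    by (rule int) (auto simp: \<nu>_def intro!: continuous_intros)
  have l: "lker (- a) (1 - c) r = vker' a c r - (a + c - 1) / a * vker a c r - \<nu> r / a" for r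
    unfolding \<nu>_def by (rule lker_star[OF a])
  have "?I (lker (- a) (1 - c)) = integral {0..t} (\<lambda>u. vker' a c (t - u) * Dser a c u
      - (a + c - 1) / a * (vker a c (t - u) * Dser a c u) - (\<nu> (t - u) * Dser a c u) / a)"
    unfolding l by (intro integral_cong) (simp add: left_diff_distrib)
  also have "\<dots> = ?I (vker' a c) - (a + c - 1) / a * ?I (vker a c) - ?I \<nu> / a"
    by (intro integral_unique has_integral_diff has_integral_mult_right has_integral_divide integrable_integral i1 i2 i3)
  finally have "dirder a c (- a) (1 - c) t = (vker' a c t - ?I (vker' a c)) - (a + c - 1) / a * (vker a c t - ?I (vker a c)) - (\<nu> t - ?I \<nu>) / a"
    unfolding dirder_def l by (simp add: algebra_simps diff_divide_distrib)
  also have "\<dots> = - ((\<nu> t - ?I \<nu>) / a)"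
    using volterra[OF t, of a c] volterra'[OF t, of a c] D by simp
  also have "\<dots> = (?I \<nu> - \<nu> t) / a" by (simp only: minus_divide_left minus_diff_eq)
  finally show ?thesis using a by simp
qed

text \<open>
  For \<open>r \<le> 1\<close> the left side is nonpositive. On \<open>[1, 6.3]\<close> the exponential lies below its chord, whose slope times \<open>B\<close> is at
  most \<open>S\<close>; this is the point where \<open>B\<close> has to be small.
\<close>

lemma exp_chord_bound:
  fixes r S B :: real
  assumes r: "0 < r" "r \<le> 63 / 10" and S: "S \<ge> 14 / 5" and B: "0 \<le> B" "B \<le> 13 / 500"
  shows "B * (exp r - 1 - r - r\<^sup>2) < S * (r - 1 + exp (- r))"
proof (cases "r \<le> 1")
  case True
  have "exp r \<le> 1 + r + r\<^sup>2" using exp_bound[of r] r True by simp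
  then have "B * (exp r - 1 - r - r\<^sup>2) \<le> 0" using B by (intro mult_nonneg_nonpos) auto
  also have "0 < S * (r - 1 + exp (- r))"
  proof (rule mult_pos_pos)
    have "(1 - r / 2)\<^sup>2 \<le> (exp (- r / 2))\<^sup>2" using exp_ge_add_one_self[of "- r / 2"] True by (intro power_mono) auto
    also have "\<dots> = exp (- r)" by (simp add: exp_double[symmetric])
    finally have "1 - r + r\<^sup>2 / 4 \<le> exp (- r)" by (simp add: power2_eq_square algebra_simps)
    moreover have "r\<^sup>2 > 0" using r by simp
    ultimately show "0 < r - 1 + exp (- r)" by linarith
  qed (use S in simp)
  finally show ?thesis .
next
  case False
  define \<mu> where "\<mu> = (r - 1) / (53 / 10)"
  have mu: "0 \<le> \<mu>" "\<mu> \<le> 1" using False r by (auto simp: \<mu>_def)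
  have "exp (63 / 10 :: real) = exp 1 ^ 6 * exp (3 / 10)" by (simp flip: exp_of_nat_mult exp_add)
  also have "\<dots> \<le> (272 / 100) ^ 6 * (1 + 3 / 10 + (3 / 10)\<^sup>2)"
    using e_less_272 exp_bound[of "3 / 10"] by (intro mult_mono power_mono) auto
  also have "\<dots> \<le> 563" by (simp add: power2_eq_square eval_nat_numeral)
  finally have e63: "exp (63 / 10 :: real) \<le> 563" .
  have "exp ((1 - \<mu>) *\<^sub>R 1 + \<mu> *\<^sub>R (63 / 10)) \<le> (1 - \<mu>) * exp 1 + \<mu> * exp (63 / 10 :: real)"
    by (rule convex_onD[OF exp_convex]) (use mu in auto)
  moreover have "(1 - \<mu>) *\<^sub>R 1 + \<mu> *\<^sub>R (63 / 10) = r" by (simp add: \<mu>_def field_simps)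
  moreover have "(1 - \<mu>) * exp 1 \<le> (1 - \<mu>) * 3" using mu e_less_272 by (intro mult_left_mono) auto
  moreover have "\<mu> * exp (63 / 10) \<le> \<mu> * 563" using mu e63 by (intro mult_left_mono) auto
  ultimately have "exp r \<le> 3 + \<mu> * 563" using mu by simp
  moreover have "r\<^sup>2 \<ge> 1" "r \<ge> 1" using False by auto
  ultimately have "exp r - 1 - r - r\<^sup>2 \<le> \<mu> * 563" by linarith
  then have "B * (exp r - 1 - r - r\<^sup>2) \<le> B * (\<mu> * 563)" using B by (intro mult_left_mono) auto
  also have "\<dots> \<le> 13 / 500 * (\<mu> * 563)" using B mu by (intro mult_right_mono) auto
  also have "\<dots> \<le> 14 / 5 * (r - 1)" using False by (simp add: \<mu>_def)
  also have "\<dots> \<le> S * (r - 1)" using S False by (intro mult_right_mono) auto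
  also have "\<dots> < S * (r - 1 + exp (- r))" using S by (intro mult_strict_left_mono) auto
  finally show ?thesis .
qed

text \<open>
  The quotient \<open>vker / \<nu>\<close> is increasing. After clearing denominators the sign of its derivative is that of the difference
  estimated in \<open>exp_chord_bound\<close>, up to nonnegative terms with a factor \<open>c\<close>.
\<close>

lemma star_kernel_ratio:
  assumes a: "9 / 4 \<le> a" and c: "0 \<le> c" "c \<le> 13 / 500" and t: "t \<le> 63 / 10" and r: "0 \<le> r" "r < t"
  defines "\<nu> \<equiv> \<lambda>r. (a + c) * (a + c - 1) + c * (1 - c) * exp r"
  shows "\<nu> t * vker a c r < \<nu> r * vker a c t"
proof -
  define S B where "S = (a + c) * (a + c - 1)" and "B = c * (1 - c)"
  have "S \<ge> 9 / 4 * (5 / 4)" unfolding S_def using a c by (intro mult_mono) auto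
  then have S: "S \<ge> 14 / 5" by simp
  have B: "0 \<le> B" "B \<le> 13 / 500" using c mult_left_mono[of "1 - c" 1 c] by (auto simp: B_def)
  have nu: "\<nu> s = S + B * exp s" for s by (simp add: \<nu>_def S_def B_def)
  have npos: "\<nu> s > 0" for s unfolding nu using S B by (intro add_pos_nonneg) auto
  have dq: "((\<lambda>s. vker a c s / \<nu> s) has_real_derivative (vker' a c s * \<nu> s - vker a c s * (B * exp s)) / (\<nu> s * \<nu> s)) (at s)" for s
  proof (rule DERIV_divide[OF DERIV_vker])
    show "(\<nu> has_real_derivative B * exp s) (at s)" unfolding nu[abs_def] by (auto intro!: derivative_eq_intros)
  qed (use npos[of s] in simp)
  have pos: "(vker' a c s * \<nu> s - vker a c s * (B * exp s)) / (\<nu> s * \<nu> s) > 0" if s: "0 < s" "s < t" for s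
  proof -
    define X where "X = (exp s - 1) / s"
    have E: "exp s = 1 + s * X" using s by (simp add: X_def)
    have V': "s * vker' a c s = c * s * exp s + a * (exp s - X)" using vker'_closed[of s a c] s by (simp add: X_def)
    have V: "vker a c s = c * (exp s - 1) + a * (X - 1)" using vker_closed[of s a c] s by (simp add: X_def)
    have "s * (s * (vker' a c s * \<nu> s - vker a c s * (B * exp s)))
        = s * (s * vker' a c s) * (S + B * exp s) - s * s * vker a c s * (B * exp s)"
      by (simp add: nu algebra_simps)
    also have "\<dots> = a * (exp s * (S * (s - 1 + exp (- s)) - B * (exp s - 1 - s - s\<^sup>2))) + c * s\<^sup>2 * exp s * S + B * exp s * (c * s\<^sup>2)"
    proof -
      have sX: "s * X = exp s - 1" using E by simp
      have ee: "exp s * exp (- s) = 1" by (simp flip: exp_add)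
      have "s * (c * s * exp s + a * (exp s - X)) = c * s\<^sup>2 * exp s + a * (s * exp s - s * X)"
        by (simp add: power2_eq_square algebra_simps)
      then have P: "s * (s * vker' a c s) = c * s\<^sup>2 * exp s + a * (s * exp s - (exp s - 1))" unfolding V' sX .
      have "s * s * (c * (exp s - 1) + a * (X - 1)) = c * s\<^sup>2 * (exp s - 1) + a * (s * (s * X) - s\<^sup>2)"
        by (simp add: power2_eq_square algebra_simps)
      then have Q: "s * s * vker a c s = c * s\<^sup>2 * (exp s - 1) + a * (s * (exp s - 1) - s\<^sup>2)" unfolding V sX .
      have "exp s * (S * (s - 1 + exp (- s)) - B * (exp s - 1 - s - s\<^sup>2)) = S * (s * exp s - exp s + exp s * exp (- s)) - B * exp s * (exp s - 1 - s - s\<^sup>2)"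
        by (simp add: algebra_simps)
      then have R: "exp s * (S * (s - 1 + exp (- s)) - B * (exp s - 1 - s - s\<^sup>2)) = S * (s * exp s - exp s + 1) - B * exp s * (exp s - 1 - s - s\<^sup>2)"
        unfolding ee .
      show ?thesis unfolding P Q R by (simp add: algebra_simps power2_eq_square)
    qed
    also have "\<dots> > 0"
    proof -
      have "0 < S * (s - 1 + exp (- s)) - B * (exp s - 1 - s - s\<^sup>2)" using exp_chord_bound[OF _ _ S B, of s] s t by simp
      then have "0 < a * (exp s * (S * (s - 1 + exp (- s)) - B * (exp s - 1 - s - s\<^sup>2)))" using a by (intro mult_pos_pos) auto
      then show ?thesis using c S B by (intro add_pos_nonneg mult_nonneg_nonneg) auto
    qed
    finally have "0 < vker' a c s * \<nu> s - vker a c s * (B * exp s)" using s by (simp add: zero_less_mult_iff)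
    then show ?thesis using npos[of s] by simp
  qed
  have "vker a c r / \<nu> r < vker a c t / \<nu> t"
  proof (rule DERIV_pos_imp_increasing_open[OF r(2)])
    show "continuous_on {r..t} (\<lambda>s. vker a c s / \<nu> s)"
      by (intro continuous_at_imp_continuous_on ballI DERIV_isCont[OF dq])
    show "\<exists>y. ((\<lambda>s. vker a c s / \<nu> s) has_real_derivative y) (at s) \<and> y > 0" if "r < s" "s < t" for s
      using dq[of s] pos[of s] that r(1) by (intro exI conjI) auto
  qed
  then show ?thesis using npos[of r] npos[of t] by (simp add: divide_less_eq less_divide_eq pos_divide_less_eq field_simps)
qed

text \<open>
  On the small parameter box each quantity is a polynomial in the distances \<open>x\<close> and \<open>y\<close> from the corner \<open>(9 / 4, 0)\<close>. Terms with
  positive coefficients are dropped, and those with negative coefficients are estimated by their values at the opposite corner.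
\<close>

lemma box_coefficients:
  fixes x y :: real
  assumes x: "0 \<le> x" "x \<le> 3 / 50" and y: "0 \<le> y" "y \<le> 13 / 500"
  defines "a \<equiv> 9 / 4 + x"
  defines "\<epsilon> \<equiv> \<lambda>n. a * dens a y (Suc n) - (a - 1 + y) * dens a y n"
  shows "\<epsilon> 1 \<ge> 0" and "\<epsilon> 0 + 63 / 10 * \<epsilon> 1 \<ge> 8 / 100" and "\<epsilon> 2 \<ge> - 36 / 10000" and "\<epsilon> 3 \<ge> 176 / 100000"
    and "dens a y 3 \<ge> 0"
proof -
  have m: "mom a y n = y + (9 / 4 + x) / (real n + 2)" for n by (simp add: mom_def a_def)
  have d0: "dens a y 0 = 9 / 8 + 1 / 2 * x + y" by (simp add: a_def dens_0 q1_def)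
  have d1: "dens a y 1 = - 33 / 128 - 19 / 48 * x - 5 / 8 * y - 1 / 8 * x ^ 2 - 1 / 2 * x * y - 1 / 2 * y ^ 2"
    using dens_recs(1)[of a y] unfolding m d0 by (simp add: eval_nat_numeral algebra_simps add_divide_distrib diff_divide_distrib)
  have d2: "dens a y 2 = 3 / 1024 + 19 / 768 * x + 11 / 384 * y + 11 / 192 * x ^ 2 + 7 / 48 * x * y + 1 / 16 * y ^ 2 + 1 / 48 * x ^ 3 + 1 / 8 * x ^ 2 * y + 1 / 4 * x * y ^ 2 + 1 / 6 * y ^ 3"
    using dens_recs(2)[of a y] unfolding m d0 d1 by (simp add: eval_nat_numeral algebra_simps add_divide_distrib diff_divide_distrib)
  have d3: "dens a y 3 = 297 / 163840 - 23 / 10240 * x + 1 / 1024 * y + 55 / 9216 * x ^ 2 + 5 / 768 * x * y - 19 / 768 * y ^ 2 - 1 / 384 * x ^ 3 + 1 / 192 * x ^ 2 * y + 5 / 96 * x * y ^ 2 + 1 / 16 * y ^ 3 - 1 / 384 * x ^ 4 - 1 / 48 * x ^ 3 * y - 1 / 16 * x ^ 2 * y ^ 2 - 1 / 12 * x * y ^ 3 - 1 / 24 * y ^ 4"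
    using dens_recs(3)[of a y] unfolding m d0 d1 d2 by (simp add: eval_nat_numeral algebra_simps add_divide_distrib diff_divide_distrib)
  have d4: "dens a y 4 = 2499 / 1310720 - 2779 / 983040 * x + 231 / 163840 * y + 919 / 368640 * x ^ 2 - 293 / 92160 * x * y - 175 / 6144 * y ^ 2 - 13 / 18432 * x ^ 3 + 65 / 9216 * x ^ 2 * y + 67 / 1536 * x * y ^ 2 + 41 / 768 * y ^ 3 - 5 / 9216 * x ^ 4 - 1 / 128 * x ^ 3 * y - 13 / 384 * x ^ 2 * y ^ 2 - 17 / 288 * x * y ^ 3 - 7 / 192 * y ^ 4 + 1 / 3840 * x ^ 5 + 1 / 384 * x ^ 4 * y + 1 / 96 * x ^ 3 * y ^ 2 + 1 / 48 * x ^ 2 * y ^ 3 + 1 / 48 * x * y ^ 4 + 1 / 120 * y ^ 5"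
    using dens_recs(4)[of a y] unfolding m d0 d1 d2 d3 by (simp add: eval_nat_numeral algebra_simps add_divide_distrib diff_divide_distrib)
  have bd: "0 \<le> x ^ i * y ^ j" "x ^ i * y ^ j \<le> (3 / 50) ^ i * (13 / 500) ^ j" for i j
    using x y by (auto intro!: mult_mono power_mono)
  have add_sub_ge: "b \<le> k + P - N" if "0 \<le> P" "N \<le> V" "b \<le> k - V" for b k P N V :: real using that by linarith
  have sub_ge: "b \<le> k - N" if "N \<le> V" "b \<le> k - V" for b k N V :: real using that by linarith
  have add_ge: "b \<le> k + P" if "0 \<le> P" "b \<le> k" for b k P :: real using that by linarith
  have p01: "0 \<le> y" using x y by simp
  have p02: "0 \<le> y ^ 2" using x y by simp
  have p03: "0 \<le> y ^ 3" using x y by simp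
  have p05: "0 \<le> y ^ 5" using x y by simp
  have p10: "0 \<le> x" using x y by simp
  have p11: "0 \<le> x * y" using x y by simp
  have p12: "0 \<le> x * y ^ 2" using x y by simp
  have p13: "0 \<le> x * y ^ 3" using x y by simp
  have p14: "0 \<le> x * y ^ 4" using x y by simp
  have p15: "0 \<le> x * y ^ 5" using x y by simp
  have p20: "0 \<le> x ^ 2" using x y by simp
  have p21: "0 \<le> x ^ 2 * y" using x y by simp
  have p22: "0 \<le> x ^ 2 * y ^ 2" using x y by simp
  have p23: "0 \<le> x ^ 2 * y ^ 3" using x y by simp
  have p24: "0 \<le> x ^ 2 * y ^ 4" using x y by simp
  have p30: "0 \<le> x ^ 3" using x y by simp
  have p31: "0 \<le> x ^ 3 * y" using x y by simp
  have p32: "0 \<le> x ^ 3 * y ^ 2" using x y by simp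
  have p33: "0 \<le> x ^ 3 * y ^ 3" using x y by simp
  have p40: "0 \<le> x ^ 4" using x y by simp
  have p41: "0 \<le> x ^ 4 * y" using x y by simp
  have p42: "0 \<le> x ^ 4 * y ^ 2" using x y by simp
  have p50: "0 \<le> x ^ 5" using x y by simp
  have p51: "0 \<le> x ^ 5 * y" using x y by simp
  have p60: "0 \<le> x ^ 6" using x y by simp
  have u01: "y \<le> 13 / 500" using bd(2)[of 0 1] by (simp add: power_divide)
  have u02: "y ^ 2 \<le> 169 / 250000" using bd(2)[of 0 2] by (simp add: power_divide)
  have u03: "y ^ 3 \<le> 2197 / 125000000" using bd(2)[of 0 3] by (simp add: power_divide)
  have u04: "y ^ 4 \<le> 28561 / 62500000000" using bd(2)[of 0 4] by (simp add: power_divide)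
  have u10: "x \<le> 3 / 50" using bd(2)[of 1 0] by (simp add: power_divide)
  have u11: "x * y \<le> 39 / 25000" using bd(2)[of 1 1] by (simp add: power_divide)
  have u12: "x * y ^ 2 \<le> 507 / 12500000" using bd(2)[of 1 2] by (simp add: power_divide)
  have u13: "x * y ^ 3 \<le> 6591 / 6250000000" using bd(2)[of 1 3] by (simp add: power_divide)
  have u14: "x * y ^ 4 \<le> 85683 / 3125000000000" using bd(2)[of 1 4] by (simp add: power_divide)
  have u20: "x ^ 2 \<le> 9 / 2500" using bd(2)[of 2 0] by (simp add: power_divide)
  have u21: "x ^ 2 * y \<le> 117 / 1250000" using bd(2)[of 2 1] by (simp add: power_divide)
  have u22: "x ^ 2 * y ^ 2 \<le> 1521 / 625000000" using bd(2)[of 2 2] by (simp add: power_divide)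
  have u23: "x ^ 2 * y ^ 3 \<le> 19773 / 312500000000" using bd(2)[of 2 3] by (simp add: power_divide)
  have u30: "x ^ 3 \<le> 27 / 125000" using bd(2)[of 3 0] by (simp add: power_divide)
  have u31: "x ^ 3 * y \<le> 351 / 62500000" using bd(2)[of 3 1] by (simp add: power_divide)
  have u32: "x ^ 3 * y ^ 2 \<le> 4563 / 31250000000" using bd(2)[of 3 2] by (simp add: power_divide)
  have u40: "x ^ 4 \<le> 81 / 6250000" using bd(2)[of 4 0] by (simp add: power_divide)
  have u41: "x ^ 4 * y \<le> 1053 / 3125000000" using bd(2)[of 4 1] by (simp add: power_divide)
  have u50: "x ^ 5 \<le> 243 / 312500000" using bd(2)[of 5 0] by (simp add: power_divide)
  have SUC0: "Suc 0 = 1" and SUC1: "Suc 1 = 2" and SUC2: "Suc 2 = 3" and SUC3: "Suc 3 = 4" by simp_all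
  have e1: "\<epsilon> 1 = 1347 / 4096 + (623 / 768 * (x) + 565 / 512 * (y) + 271 / 384 * (x ^ 2) + 769 / 384 * (x * y) + 89 / 64 * (y ^ 2) + 11 / 48 * (x ^ 3) + 101 / 96 * (x ^ 2 * y) + 13 / 8 * (x * y ^ 2) + 7 / 8 * (y ^ 3) + 1 / 48 * (x ^ 4) + 1 / 8 * (x ^ 3 * y) + 1 / 4 * (x ^ 2 * y ^ 2) + 1 / 6 * (x * y ^ 3))"
    unfolding \<epsilon>_def SUC1 d1 d2 unfolding a_def by (simp add: eval_nat_numeral algebra_simps add_divide_distrib diff_divide_distrib)
  have e1p: "623 / 768 * (x) + 565 / 512 * (y) + 271 / 384 * (x ^ 2) + 769 / 384 * (x * y) + 89 / 64 * (y ^ 2) + 11 / 48 * (x ^ 3) + 101 / 96 * (x ^ 2 * y) + 13 / 8 * (x * y ^ 2) + 7 / 8 * (y ^ 3) + 1 / 48 * (x ^ 4) + 1 / 8 * (x ^ 3 * y) + 1 / 4 * (x ^ 2 * y ^ 2) + 1 / 6 * (x * y ^ 3) \<ge> 0"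
    by (intro add_nonneg_nonneg mult_nonneg_nonneg p10 p01 p20 p11 p02 p30 p21 p12 p03 p40 p31 p22 p13; simp)
  show "\<epsilon> 1 \<ge> 0" unfolding e1 by (rule add_ge[OF e1p]) simp
  have e2: "\<epsilon> 2 = 273 / 655360 - (18233 / 491520 * (x) + 449 / 12288 * (y) + 5233 / 61440 * (x ^ 2) + 169 / 768 * (x * y) + 499 / 3072 * (y ^ 2) + 767 / 9216 * (x ^ 3) + 131 / 384 * (x ^ 2 * y) + 329 / 768 * (x * y ^ 2) + 25 / 192 * (y ^ 3) + 15 / 512 * (x ^ 4) + 3 / 16 * (x ^ 3 * y) + 89 / 192 * (x ^ 2 * y ^ 2) + 13 / 24 * (x * y ^ 3) + 25 / 96 * (y ^ 4) + 1 / 384 * (x ^ 5) + 1 / 48 * (x ^ 4 * y) + 1 / 16 * (x ^ 3 * y ^ 2) + 1 / 12 * (x ^ 2 * y ^ 3) + 1 / 24 * (x * y ^ 4))"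
    unfolding \<epsilon>_def SUC2 d2 d3 unfolding a_def by (simp add: eval_nat_numeral algebra_simps add_divide_distrib diff_divide_distrib)
  have e2n: "18233 / 491520 * (x) + 449 / 12288 * (y) + 5233 / 61440 * (x ^ 2) + 169 / 768 * (x * y) + 499 / 3072 * (y ^ 2) + 767 / 9216 * (x ^ 3) + 131 / 384 * (x ^ 2 * y) + 329 / 768 * (x * y ^ 2) + 25 / 192 * (y ^ 3) + 15 / 512 * (x ^ 4) + 3 / 16 * (x ^ 3 * y) + 89 / 192 * (x ^ 2 * y ^ 2) + 13 / 24 * (x * y ^ 3) + 25 / 96 * (y ^ 4) + 1 / 384 * (x ^ 5) + 1 / 48 * (x ^ 4 * y) + 1 / 16 * (x ^ 3 * y ^ 2) + 1 / 12 * (x ^ 2 * y ^ 3) + 1 / 24 * (x * y ^ 4) \<le> 18233 / 491520 * (3 / 50) + 449 / 12288 * (13 / 500) + 5233 / 61440 * (9 / 2500) + 169 / 768 * (39 / 25000) + 499 / 3072 * (169 / 250000) + 767 / 9216 * (27 / 125000) + 131 / 384 * (117 / 1250000) + 329 / 768 * (507 / 12500000) + 25 / 192 * (2197 / 125000000) + 15 / 512 * (81 / 6250000) + 3 / 16 * (351 / 62500000) + 89 / 192 * (1521 / 625000000) + 13 / 24 * (6591 / 6250000000) + 25 / 96 * (28561 / 62500000000) + 1 / 384 * (243 / 312500000) + 1 / 48 * (1053 / 3125000000) + 1 / 16 * (4563 / 31250000000) + 1 / 12 * (19773 / 312500000000) + 1 / 24 * (85683 / 3125000000000)"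
    by (intro add_mono mult_left_mono u10 u01 u20 u11 u02 u30 u21 u12 u03 u40 u31 u22 u13 u04 u50 u41 u32 u23 u14; simp)
  show "\<epsilon> 2 \<ge> - 36 / 10000" unfolding e2 by (rule sub_ge[OF e2n]) simp
  have e3: "\<epsilon> 3 = 10611 / 5242880 + (91 / 655360 * (y) + 35 / 1536 * (x * y ^ 2) + 205 / 3072 * (y ^ 3) + 145 / 36864 * (x ^ 4) + 119 / 9216 * (x ^ 3 * y) + 61 / 23040 * (x ^ 5) + 11 / 512 * (x ^ 4 * y) + 7 / 96 * (x ^ 3 * y ^ 2) + 77 / 576 * (x ^ 2 * y ^ 3) + 13 / 96 * (x * y ^ 4) + 29 / 480 * (y ^ 5) + 1 / 3840 * (x ^ 6) + 1 / 384 * (x ^ 5 * y) + 1 / 96 * (x ^ 4 * y ^ 2) + 1 / 48 * (x ^ 3 * y ^ 3) + 1 / 48 * (x ^ 2 * y ^ 4) + 1 / 120 * (x * y ^ 5)) - (2267 / 655360 * (x) + 7171 / 2949120 * (x ^ 2) + 6199 / 491520 * (x * y) + 839 / 24576 * (y ^ 2) + 37 / 20480 * (x ^ 3) + 129 / 20480 * (x ^ 2 * y) + 3 / 256 * (x ^ 2 * y ^ 2) + 23 / 256 * (x * y ^ 3) + 71 / 768 * (y ^ 4))"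
    unfolding \<epsilon>_def SUC3 d3 d4 unfolding a_def by (simp add: eval_nat_numeral algebra_simps add_divide_distrib diff_divide_distrib)
  have e3p: "91 / 655360 * (y) + 35 / 1536 * (x * y ^ 2) + 205 / 3072 * (y ^ 3) + 145 / 36864 * (x ^ 4) + 119 / 9216 * (x ^ 3 * y) + 61 / 23040 * (x ^ 5) + 11 / 512 * (x ^ 4 * y) + 7 / 96 * (x ^ 3 * y ^ 2) + 77 / 576 * (x ^ 2 * y ^ 3) + 13 / 96 * (x * y ^ 4) + 29 / 480 * (y ^ 5) + 1 / 3840 * (x ^ 6) + 1 / 384 * (x ^ 5 * y) + 1 / 96 * (x ^ 4 * y ^ 2) + 1 / 48 * (x ^ 3 * y ^ 3) + 1 / 48 * (x ^ 2 * y ^ 4) + 1 / 120 * (x * y ^ 5) \<ge> 0"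
    by (intro add_nonneg_nonneg mult_nonneg_nonneg p01 p12 p03 p40 p31 p50 p41 p32 p23 p14 p05 p60 p51 p42 p33 p24 p15; simp)
  have e3n: "2267 / 655360 * (x) + 7171 / 2949120 * (x ^ 2) + 6199 / 491520 * (x * y) + 839 / 24576 * (y ^ 2) + 37 / 20480 * (x ^ 3) + 129 / 20480 * (x ^ 2 * y) + 3 / 256 * (x ^ 2 * y ^ 2) + 23 / 256 * (x * y ^ 3) + 71 / 768 * (y ^ 4) \<le> 2267 / 655360 * (3 / 50) + 7171 / 2949120 * (9 / 2500) + 6199 / 491520 * (39 / 25000) + 839 / 24576 * (169 / 250000) + 37 / 20480 * (27 / 125000) + 129 / 20480 * (117 / 1250000) + 3 / 256 * (1521 / 625000000) + 23 / 256 * (6591 / 6250000000) + 71 / 768 * (28561 / 62500000000)"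
    by (intro add_mono mult_left_mono u10 u20 u11 u02 u30 u21 u22 u13 u04; simp)
  show "\<epsilon> 3 \<ge> 176 / 100000" unfolding e3 by (rule add_sub_ge[OF e3p e3n]) simp
  have e01: "\<epsilon> 0 + 63 / 10 * \<epsilon> 1 = 3501 / 40960 + (5663 / 2560 * (x) + 3247 / 1024 * (y) + 12553 / 3840 * (x ^ 2) + 11989 / 1280 * (x * y) + 4247 / 640 * (y ^ 2) + 211 / 160 * (x ^ 3) + 1961 / 320 * (x ^ 2 * y) + 779 / 80 * (x * y ^ 2) + 441 / 80 * (y ^ 3) + 21 / 160 * (x ^ 4) + 63 / 80 * (x ^ 3 * y) + 63 / 40 * (x ^ 2 * y ^ 2) + 21 / 20 * (x * y ^ 3))"
    unfolding \<epsilon>_def SUC0 SUC1 d0 d1 d2 unfolding a_def by (simp add: eval_nat_numeral algebra_simps add_divide_distrib diff_divide_distrib)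
  have e01p: "5663 / 2560 * (x) + 3247 / 1024 * (y) + 12553 / 3840 * (x ^ 2) + 11989 / 1280 * (x * y) + 4247 / 640 * (y ^ 2) + 211 / 160 * (x ^ 3) + 1961 / 320 * (x ^ 2 * y) + 779 / 80 * (x * y ^ 2) + 441 / 80 * (y ^ 3) + 21 / 160 * (x ^ 4) + 63 / 80 * (x ^ 3 * y) + 63 / 40 * (x ^ 2 * y ^ 2) + 21 / 20 * (x * y ^ 3) \<ge> 0"
    by (intro add_nonneg_nonneg mult_nonneg_nonneg p10 p01 p20 p11 p02 p30 p21 p12 p03 p40 p31 p22 p13; simp)
  show "\<epsilon> 0 + 63 / 10 * \<epsilon> 1 \<ge> 8 / 100" unfolding e01 by (rule add_ge[OF e01p]) simp
  have e33: "dens a y 3 = 297 / 163840 + (1 / 1024 * (y) + 55 / 9216 * (x ^ 2) + 5 / 768 * (x * y) + 1 / 192 * (x ^ 2 * y) + 5 / 96 * (x * y ^ 2) + 1 / 16 * (y ^ 3)) - (23 / 10240 * (x) + 19 / 768 * (y ^ 2) + 1 / 384 * (x ^ 3) + 1 / 384 * (x ^ 4) + 1 / 48 * (x ^ 3 * y) + 1 / 16 * (x ^ 2 * y ^ 2) + 1 / 12 * (x * y ^ 3) + 1 / 24 * (y ^ 4))"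
    unfolding d3 by (simp add: eval_nat_numeral algebra_simps add_divide_distrib diff_divide_distrib)
  have e33p: "1 / 1024 * (y) + 55 / 9216 * (x ^ 2) + 5 / 768 * (x * y) + 1 / 192 * (x ^ 2 * y) + 5 / 96 * (x * y ^ 2) + 1 / 16 * (y ^ 3) \<ge> 0"
    by (intro add_nonneg_nonneg mult_nonneg_nonneg p01 p20 p11 p21 p12 p03; simp)
  have e33n: "23 / 10240 * (x) + 19 / 768 * (y ^ 2) + 1 / 384 * (x ^ 3) + 1 / 384 * (x ^ 4) + 1 / 48 * (x ^ 3 * y) + 1 / 16 * (x ^ 2 * y ^ 2) + 1 / 12 * (x * y ^ 3) + 1 / 24 * (y ^ 4) \<le> 23 / 10240 * (3 / 50) + 19 / 768 * (169 / 250000) + 1 / 384 * (27 / 125000) + 1 / 384 * (81 / 6250000) + 1 / 48 * (351 / 62500000) + 1 / 16 * (1521 / 625000000) + 1 / 12 * (6591 / 6250000000) + 1 / 24 * (28561 / 62500000000)"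
    by (intro add_mono mult_left_mono u10 u02 u30 u40 u31 u22 u13 u04; simp)
  show "dens a y 3 \<ge> 0" unfolding e33 by (rule add_sub_ge[OF e33p e33n]) simp
qed

text \<open>
  At a double zero the combination \<open>a D' - (a - 1 + c) D\<close> vanishes, and by \<open>dens_growth\<close> its Taylor coefficients are nonnegative
  from index 3 on. The first four terms alone are positive for \<open>t \<ge> 6.3\<close>: the linear part by the second estimate of
  \<open>box_coefficients\<close>, and the cubic term outweighs the possibly negative quadratic one.
\<close>

lemma touching_location:
  assumes a: "9 / 4 \<le> a" "a \<le> 231 / 100" and c: "0 \<le> c" "c \<le> 13 / 500"
    and t: "t > 0" and D: "Dser a c t = 0" "dDser a c t = 0"
  shows "t < 63 / 10"
proof (rule ccontr)
  assume "\<not> ?thesis"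
  then have t63: "t \<ge> 63 / 10" by simp
  define \<epsilon> where "\<epsilon> n = a * dens a c (Suc n) - (a - 1 + c) * dens a c n" for n
  have b: "\<epsilon> 1 \<ge> 0" "\<epsilon> 0 + 63 / 10 * \<epsilon> 1 \<ge> 8 / 100" "\<epsilon> 2 \<ge> - 36 / 10000" "\<epsilon> 3 \<ge> 176 / 100000" "dens a c 3 \<ge> 0"
    using box_coefficients[of "a - 9 / 4" c] a c by (simp_all add: \<epsilon>_def)
  have adm: "admissible a c" using a c by (simp add: admissible_def)
  have nn: "\<epsilon> n \<ge> 0" if "n \<ge> 3" for n
    using dens_growth[OF adm _ _ _ _ that] b(4) a c by (simp add: \<epsilon>_def)
  have "(\<lambda>n. a * (dens a c (Suc n) * t ^ n / fact n) - (a - 1 + c) * (dens a c n * t ^ n / fact n)) sums (a * dDser a c t - (a - 1 + c) * Dser a c t)"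
    unfolding dDser_def by (intro sums_diff sums_mult Dser_sums borel_series_sums geom_bounded_Suc geom_bounded_dens)
  then have s: "(\<lambda>n. \<epsilon> n * t ^ n / fact n) sums 0"
    by (simp add: D \<epsilon>_def left_diff_distrib diff_divide_distrib mult.assoc)
  have "(\<Sum>n<4. \<epsilon> n * t ^ n / fact n) \<le> 0"
    using sum_le_suminf[OF sums_summable[OF s], of "{..<4}"] nn t s by (force simp: sums_iff)
  then have "\<epsilon> 0 + \<epsilon> 1 * t + \<epsilon> 2 * (t\<^sup>2 / 2) + \<epsilon> 3 * (t ^ 3 / 6) \<le> 0"
    by (simp add: eval_nat_numeral)
  moreover have "\<epsilon> 1 * t \<ge> \<epsilon> 1 * (63 / 10)" using b t63 by (intro mult_left_mono) auto
  moreover have "\<epsilon> 2 * (t\<^sup>2 / 2) \<ge> - 18 / 10000 * t\<^sup>2" "\<epsilon> 3 * (t ^ 3 / 6) \<ge> 88 / 300000 * t ^ 3"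
    using mult_right_mono[OF b(3), of "t\<^sup>2 / 2"] mult_right_mono[OF b(4), of "t ^ 3 / 6"] t by simp_all
  moreover have "t ^ 3 \<ge> 63 / 10 * t\<^sup>2" using mult_right_mono[OF t63, of "t\<^sup>2"] by (simp add: power2_eq_square power3_eq_cube)
  moreover have "t\<^sup>2 \<ge> 0" by simp
  moreover have False if "e0 + E1 + E2 + E3 \<le> 0" "e1 * (63 / 10) \<le> E1" "- 18 / 10000 * T2 \<le> E2" "88 / 300000 * T3 \<le> E3"
    "63 / 10 * T2 \<le> T3" "0 \<le> T2" "8 / 100 \<le> e0 + 63 / 10 * e1" for e0 e1 E1 E2 E3 T2 T3 :: real
    using that by linarith
  ultimately show False using b(2) by blast
qed

text \<open>
  Move from \<open>(alpha_star, 0)\<close> along the chord towards \<open>(0, 1)\<close>. Where the density has a zero, \<open>a \<ge> 9 / 4\<close>, since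
  smaller pairs lie below the last certified point, and the zero lies in the interval where \<open>star_kernel_ratio\<close> applies. So
  every zero lifts off, and the density at the end of the path is positive, which forces strict inequality.
\<close>

lemma Acrit_chord_near_0:
  assumes c: "0 < c" "c \<le> 13 / 500" shows "alpha_star * (1 - c) < Acrit c"
proof -
  have c1: "0 \<le> c" "c < 1" using c by auto
  have al: "0 < alpha_star" "alpha_star < 231 / 100"
    using alpha_star_less good_Acrit[of 0] by (auto simp: alpha_star_eq good_def)
  have pos: "Dser (alpha_star + 1 * (- alpha_star * c)) (0 + 1 * c) t > 0" if "t \<ge> 0" for t
  proof (rule path_positive[OF _ _ _ _ _ that])
    fix \<tau> :: real assume tau: "0 \<le> \<tau>" "\<tau> \<le> 1"
    define a' c' where "a' = alpha_star + \<tau> * (- alpha_star * c)" and "c' = 0 + \<tau> * c"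
    have a': "a' = alpha_star * (1 - c')" by (simp add: a'_def c'_def algebra_simps)
    have "\<tau> * c \<le> 1 * c" using tau c by (intro mult_right_mono) auto
    then have c': "0 \<le> c'" "c' \<le> 13 / 500" using tau c unfolding c'_def by (simp, linarith)
    have "alpha_star * (1 - c') \<le> alpha_star * 1" using al c' by (intro mult_left_mono) auto
    then have a'1: "a' < 231 / 100" using al(2) unfolding a' mult_1_right by (rule le_less_trans)
    have a'0: "0 < a'" unfolding a' using al c' by (intro mult_pos_pos) auto
    show "admissible (alpha_star + \<tau> * (- alpha_star * c)) (0 + \<tau> * c)"
      unfolding a'_def[symmetric] c'_def[symmetric] using a'0 a'1 c' by (simp add: admissible_def)
    fix s :: real assume s: "s > 0"
    assume "\<And>u. u \<ge> 0 \<Longrightarrow> Dser (alpha_star + \<tau> * (- alpha_star * c)) (0 + \<tau> * c) u \<ge> 0"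
      and "Dser (alpha_star + \<tau> * (- alpha_star * c)) (0 + \<tau> * c) s = 0"
    then have nn: "\<And>u. u \<ge> 0 \<Longrightarrow> Dser a' c' u \<ge> 0" and z: "Dser a' c' s = 0"
      unfolding a'_def[symmetric] c'_def[symmetric] by blast+
    have a'2: "9 / 4 \<le> a'"
    proof (rule ccontr)
      assume "\<not> ?thesis"
      then have "Dser a' c' s > 0" using good_down[OF good_points(7), of a' c' s] a'0 c' s by simp
      then show False using z by simp
    qed
    have d: "dDser a' c' s = 0" by (rule touching_imp_critical[OF nn s z])
    have s63: "s < 63 / 10" by (rule touching_location[OF a'2 _ c' s z d]) (use a'1 in simp)
    define \<nu> where "\<nu> = (\<lambda>r. (a' + c') * (a' + c' - 1) + c' * (1 - c') * exp r)"
    have "\<nu> s < integral {0..s} (\<lambda>u. \<nu> (s - u) * Dser a' c' u)"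
    proof (rule chebyshev_touching[OF s nn _ z])
      show "Dser a' c' 0 > 0" using a'0 c' by (simp add: Dser_0 add_pos_nonneg)
      show "continuous_on {0..s} \<nu>" unfolding \<nu>_def by (intro continuous_intros)
      show "vker a' c' s > 0" using vker_pos a'0 c' s by simp
      show "\<nu> s * vker a' c' r < \<nu> r * vker a' c' s" if "0 \<le> r" "r < s" for r
        unfolding \<nu>_def by (rule star_kernel_ratio) (use a'2 c' s63 that in auto)
    qed
    then have "a' * dirder a' c' (- a') (1 - c') s > 0"
      using dirder_star[OF a'0 _ z d] s by (simp add: \<nu>_def)
    then have dd: "dirder a' c' (- a') (1 - c') s > 0" using a'0 by (simp add: zero_less_mult_iff)
    \<comment> \<open>the velocity of the path is this multiple of the direction in \<open>dirder_star\<close>\<close>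
    define k where "k = c / (1 - c')"
    have k: "k > 0" using c c' by (simp add: k_def)
    have kk: "- alpha_star * c = k * (- a')" "c = k * (1 - c')" using c' by (auto simp: k_def a')
    have lk: "lker (- alpha_star * c) c r = k * lker (- a') (1 - c') r" for r
      using lker_scale[of k "- a'" "1 - c'" r] unfolding kk(1) kk(2)[symmetric] .
    have "dirder a' c' (- alpha_star * c) c s = k * dirder a' c' (- a') (1 - c') s"
      unfolding dirder_def lk by (simp add: right_diff_distrib mult.assoc)
    then show "dirder (alpha_star + \<tau> * (- alpha_star * c)) (0 + \<tau> * c) (- alpha_star * c) c s > 0"
      unfolding a'_def[symmetric] c'_def[symmetric] using dd k by simp
  next
    show "Dser alpha_star 0 u \<ge> 0" if "u \<ge> 0" for u using good_Acrit[of 0] that by (simp add: alpha_star_eq good_def)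
  qed auto
  have eq: "alpha_star + 1 * (- alpha_star * c) = alpha_star * (1 - c)" by (simp add: algebra_simps)
  have p: "Dser (alpha_star * (1 - c)) c t > 0" if "t \<ge> 0" for t using pos[OF that] unfolding eq by simp
  have "alpha_star * (1 - c) > 0" using al c by simp
  then have "alpha_star * (1 - c) \<le> Acrit c"
    by (intro le_Acrit[OF c1]) (use p in \<open>auto simp: good_def intro: less_imp_le\<close>)
  moreover obtain t where "t > 0" "Dser (Acrit c) c t = 0" using Acrit_zero[OF c1] by blast
  ultimately show ?thesis using p[of t] by (cases "alpha_star * (1 - c) = Acrit c") auto
qed

theorem Acrit_gt_chord:
  assumes c: "0 < c" "c < 1" shows "alpha_star * (1 - c) < Acrit c"
proof (cases "c \<le> 13 / 500")
  case False
  have "alpha_star * (1 - c) < 231 / 100 * (1 - c)" using alpha_star_less c by (intro mult_strict_right_mono) auto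
  also have "\<dots> \<le> Acrit c" by (rule Acrit_ge_chord_away_from_0) (use False c in auto)
  finally show ?thesis .
qed (use Acrit_chord_near_0 c in simp)

section \<open>The threshold function\<close>

text \<open>
  The value outside the domain is the one demanded of extensional functions.
\<close>

definition threshold :: "real \<Rightarrow> real" where "threshold b = (if -1 < b \<and> b \<le> 0 then Acrit (- b) else undefined)"

lemma threshold_eq: "-1 < b \<Longrightarrow> b \<le> 0 \<Longrightarrow> threshold b = Acrit (- b)" by (simp add: threshold_def)

lemma bernstein_iff_Acrit:
  assumes a: "a > 0" shows "bernstein_function (F a b) \<longleftrightarrow> -1 < b \<and> b \<le> 0 \<and> a \<le> Acrit (- b)"
proof -
  have "0 \<le> - b" "- b < 1" if "good a (- b)" using good_admissible[OF that] by (auto simp: admissible_def)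
  then show ?thesis unfolding bernstein_F_iff_good[OF a] using good_iff_le_Acrit[of "- b" a] a by force
qed

text \<open>
  The Bernstein condition determines the set of positive \<open>a\<close> below \<open>A b\<close>, hence the value \<open>A b > 0\<close>; outside the domain
  extensionality determines \<open>A\<close>.
\<close>

lemma is_threshold_iff: "is_threshold A \<longleftrightarrow> A = threshold"
proof
  assume A: "is_threshold A"
  have Api: "A \<in> {-1<..0} \<rightarrow>\<^sub>E {0<..alpha_star}"
    and bf: "\<And>a b. a > 0 \<Longrightarrow> bernstein_function (F a b) \<longleftrightarrow> (-1 < b \<and> b \<le> 0) \<and> (0 < a \<and> a \<le> A b)"
    using A unfolding is_threshold_def by blast+
  show "A = threshold"
  proof
    fix b
    show "A b = threshold b"
    proof (cases "-1 < b \<and> b \<le> 0")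
      case True
      then have A0: "A b > 0" using PiE_mem[OF Api, of b] by simp
      have C0: "Acrit (- b) > 0" using good_Acrit[of "- b"] True by (simp add: good_def)
      have "a \<le> A b \<longleftrightarrow> a \<le> Acrit (- b)" if "a > 0" for a
        using bf[OF that, of b] bernstein_iff_Acrit[OF that, of b] True that by simp
      from this[OF A0] this[OF C0] show ?thesis using True by (simp add: threshold_eq)
    next
      case False
      then show ?thesis using PiE_arb[OF Api, of b] by (auto simp: threshold_def)
    qed
  qed
next
  assume A: "A = threshold"
  have "threshold b \<in> {0<..alpha_star}" if b: "b \<in> {-1<..0}" for b
  proof -
    have "Acrit (- b) > 0" using good_Acrit[of "- b"] b by (simp add: good_def)
    moreover have "Acrit (- b) \<le> Acrit 0"
      using Acrit_strict_antimono[of 0 "- b"] b by (cases "b = 0") auto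
    ultimately show ?thesis using b by (simp add: threshold_eq alpha_star_eq)
  qed
  moreover have "continuous_on {-1<..0} threshold"
  proof -
    have "continuous_on {-1<..0} (\<lambda>b. Acrit (- b))"
      by (rule continuous_on_compose2[OF continuous_on_Acrit]) (auto intro!: continuous_intros)
    then show ?thesis by (rule continuous_on_eq) (simp add: threshold_eq)
  qed
  moreover have "strict_mono_on {-1<..0} threshold"
    by (rule strict_mono_onI) (auto simp: threshold_eq intro!: Acrit_strict_antimono)
  moreover have "bernstein_function (F a b) \<longleftrightarrow> (-1 < b \<and> b \<le> 0) \<and> (0 < a \<and> a \<le> threshold b)" if "a > 0" for a b
    using bernstein_iff_Acrit[OF that, of b] that by (auto simp: threshold_eq)
  ultimately show "is_threshold A" unfolding is_threshold_def A by (auto simp: threshold_def)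
qed

lemma threshold_bounds:
  assumes "-1 < b" "b < 0"
  shows "alpha_star * (1 + b) < threshold b" "threshold b < alpha_star" "threshold b < U b"
  using Acrit_gt_chord[of "- b"] Acrit_strict_antimono[of 0 "- b"] Acrit_less_U[of "- b"] assms
  by (simp_all add: threshold_eq alpha_star_eq)

text \<open>
  The second term of \<open>U\<close> tends to 0.
\<close>

lemma threshold_tendsto_0: "(threshold \<longlongrightarrow> 0) (at_right (-1))"
proof (rule tendsto_sandwich)
  have ev: "\<forall>\<^sub>F b in at_right (-1 :: real). -1 < b \<and> b < 0"
    using eventually_at_right[of "-1" 0] by force
  show "\<forall>\<^sub>F b in at_right (-1). 0 \<le> threshold b"
    using ev
  proof eventually_elim
    case (elim b)
    then show ?case using good_Acrit[of "- b"] by (simp add: good_def threshold_eq less_imp_le)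
  qed
  show "\<forall>\<^sub>F b in at_right (-1). threshold b \<le> 2 * (1 + b) + 2 * sqrt (1 + b)"
    using ev by eventually_elim (use threshold_bounds(3) in \<open>force simp: U_def\<close>)
  have "((\<lambda>b. 2 * (1 + b) + 2 * sqrt (1 + b)) \<longlongrightarrow> 2 * (1 + -1) + 2 * sqrt (1 + -1)) (at_right (-1 :: real))"
    by (intro tendsto_intros)
  then show "((\<lambda>b. 2 * (1 + b) + 2 * sqrt (1 + b)) \<longlongrightarrow> 0) (at_right (-1 :: real))" by simp
qed simp

lemma density_at_threshold:
  assumes b: "-1 < b" "b \<le> 0"
  shows "0 < a \<Longrightarrow> a < threshold b \<Longrightarrow> t \<ge> 0 \<Longrightarrow> D a (- b) t > 0"
    and "t \<ge> 0 \<Longrightarrow> D (threshold b) (- b) t \<ge> 0"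
    and "{t. t > 0 \<and> D (threshold b) (- b) t = 0} \<noteq> {}"
    and "finite {t. t > 0 \<and> D (threshold b) (- b) t = 0}"
proof -
  have c: "0 \<le> - b" "- b < 1" using b by auto
  have A: "threshold b = Acrit (- b)" by (rule threshold_eq[OF b])
  have g: "good (Acrit (- b)) (- b)" by (rule good_Acrit[OF c])
  have adm: "admissible (Acrit (- b)) (- b)" by (rule good_admissible[OF g])
  have D: "D a (- b) t = Dser a (- b) t" if "0 < a" "a \<le> threshold b" for a t
    by (rule D_eq_Dser) (use that adm b in \<open>auto simp: A admissible_def\<close>)
  have DA: "D (threshold b) (- b) t = Dser (Acrit (- b)) (- b) t" for t
    using D[of "threshold b" t] g by (simp add: A good_def)
  show "0 < a \<Longrightarrow> a < threshold b \<Longrightarrow> t \<ge> 0 \<Longrightarrow> D a (- b) t > 0"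
    using positive_below_Acrit[OF c, of a t] D[of a t] by (simp add: A)
  show "t \<ge> 0 \<Longrightarrow> D (threshold b) (- b) t \<ge> 0" using g by (simp add: DA good_def)
  show "{t. t > 0 \<and> D (threshold b) (- b) t = 0} \<noteq> {}" using Acrit_zero[OF c] by (auto simp: DA)
  show "finite {t. t > 0 \<and> D (threshold b) (- b) t = 0}" using finite_zeros[OF adm] by (simp add: DA)
qed

theorem theorem17:
  shows "(\<exists>!A. is_threshold A) \<and>
    (\<forall>A. is_threshold A \<longrightarrow>
       A 0 = alpha_star \<and>
       (A \<longlongrightarrow> 0) (at_right (-1)) \<and>
       (\<forall>b. -1 < b \<and> b < 0 \<longrightarrow>
          alpha_star * (1 + b) < A b \<and> A b < min alpha_star (U b)) \<and>
       (\<forall>b. -1 < b \<and> b \<le> 0 \<longrightarrow>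
          (\<forall>a. 0 < a \<and> a < A b \<longrightarrow> (\<forall>t\<ge>0. D a (- b) t > 0)) \<and>
          (\<forall>t\<ge>0. D (A b) (- b) t \<ge> 0) \<and>
          {t. t > 0 \<and> D (A b) (- b) t = 0} \<noteq> {} \<and>
          finite {t. t > 0 \<and> D (A b) (- b) t = 0}))"
proof -
  have "threshold 0 = alpha_star" by (simp add: threshold_eq alpha_star_eq)
  then show ?thesis
    unfolding is_threshold_iff
    using threshold_tendsto_0 threshold_bounds density_at_threshold by simp
qed

end
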